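(* Suppose that $L$ has the interior Hölder property in $\Omega$ with some constants $\mu_0\in(0,1]$, $R_c\in(0,\infty]$, $N_1>0$ (defined in the context), and let $\boldsymbol G(x,y)$ be the Green's matrix of $L$ in $\Omega$. Suppose there exist $R_{max}\in(0,\infty]$ and a constant $C_0$ such that $$|\boldsymbol G(x,y)|\le C_0|x-y|^{2-n}\quad\text{for all }x,y\in\Omega\text{ satisfying }0<|x-y|<R_{max}.$$ Then $L$ has the local boundedness property in $\Omega$ with the same $R_{max}$ and with a constant $N_0$ depending only on $n,m,\nu,C_0$; that is, for all $x\in\Omega$, $R\in(0,R_{max})$ and $\boldsymbol f\in L^\infty(\Omega_R(x))$, if $\boldsymbol u\in W^{1,2}(\Omega_R(x))$ is a weak solution of either $L\boldsymbol u=\boldsymbol f$ or ${}^tL\boldsymbol u=\boldsymbol f$ in $\Omega_R(x)$ and vanishes on $\varSigma_R(x)$, then $$\|\boldsymbol u\|_{L^\infty(\Omega_{R/2}(x))}\le N_0\left(R^{-n/2}\|\boldsymbol u\|_{L^2(\Omega_R(x))}+R^2\|\boldsymbol f\|_{L^\infty(\Omega_R(x))}\right).$$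
   Context: Setting. $n\ge 3$, $m\ge 1$, and $\Omega\subset\mathbb R^n$ is a (possibly unbounded) domain. Repeated indices are summed ($\alpha,\beta$ from $1$ to $n$; $i,j$ from $1$ to $m$). The operator $L$ acts on $\mathbb R^m$-valued functions $\boldsymbol u=(u^1,\dots,u^m)^T$ by $L\boldsymbol u=-D_\alpha(\boldsymbol A^{\alpha\beta}D_\beta\boldsymbol u)$, where $\boldsymbol A^{\alpha\beta}=(A^{\alpha\beta}_{ij})$ are $m\times m$ matrix valued measurable functions on $\mathbb R^n$ such that, for some constant $\nu\in(0,1]$, $A^{\alpha\beta}_{ij}(x)\xi^j_\beta\xi^i_\alpha\ge\nu|\boldsymbol\xi|^2$ for all $\boldsymbol\xi\in\mathbb R^{mn}$, $x\in\mathbb R^n$, and $\sum_{i,j,\alpha,\beta}|A^{\alpha\beta}_{ij}(x)|^2\le\nu^{-2}$ for all $x\in\mathbb R^n$. No symmetry is assumed. The adjoint operator is ${}^tL\boldsymbol u=-D_\alpha({}^t\boldsymbol A^{\alpha\beta}D_\beta\boldsymbol u)$ with ${}^tA^{\alpha\beta}_{ij}=A^{\beta\alpha}_{ji}$. For an open set $U$, $\boldsymbol u$ is a weak solution of $L\boldsymbol u=\boldsymbol f$ in $U$ if $\int_U A^{\alpha\beta}_{ij}D_\beta u^jD_\alpha\phi^i=\int_U f^i\phi^i$ for all $\boldsymbol\phi\in C^\infty_c(U)^m$; similarly for ${}^tL$. Function spaces. For an open set $U\subset\mathbb R^n$, $Y^{1,2}(U)$ is the space of weakly differentiable $u\in L^{2n/(n-2)}(U)$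 with $Du\in L^2(U)$, normed by $\|u\|_{L^{2n/(n-2)}(U)}+\|Du\|_{L^2(U)}$; $Y^{1,2}_0(U)$ is the closure of $C_c^\infty(U)$ in $Y^{1,2}(U)$. For $\varSigma\subset\overline U$, a function $u\in Y^{1,2}(U)$ vanishes on $\varSigma$ if it is a limit in $Y^{1,2}(U)$ of functions in $C_c^\infty(\overline U\setminus\varSigma)$. $L^\infty_c(\Omega)$ is the set of $L^\infty(\Omega)$ functions with compact support in $\overline\Omega$. $\Omega_R(x)=\Omega\cap B_R(x)$, $\varSigma_R(x)=\partial\Omega\cap B_R(x)$, $d_x=\operatorname{dist}(x,\partial\Omega)$, $a\wedge b=\min(a,b)$. All notions are applied componentwise to vector and matrix valued functions. Green's matrix. An $m\times m$ matrix valued function $\boldsymbol G(x,y)=(G_{ij}(x,y))$ on $\{(x,y)\in\Omega\times\Omega:x\ne y\}$ is the Green's matrix of $L$ in $\Omega$ if: (i) for all $y\in\Omega$, $\boldsymbol G(\cdot,y)\in W^{1,1}_{loc}(\Omega)$ and $\int_\Omega A^{\alpha\beta}_{ij}D_\beta G_{jk}(\cdot,y)D_\alpha\phi^i=\phi^k(y)$ for all $\boldsymbol\phi\in C_c^\infty(\Omega)^m$ and all $k$; (ii) for all $y\in\Omega$ and $r>0$, $\boldsymbol G(\cdot,y)\in Y^{1,2}(\Omega\setminus B_r(y))$, and $\boldsymbol G(\cdot,y)$ vanishes on $\partial\Omega$ (away from the pole: $(1-\zeta)\boldsymbol G(\cdot,y)\in Y^{1,2}_0(\Omega)$ whenever $\zeta\in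 C_c^\infty(\Omega)$ equals $1$ near $y$); (iii) for every $\boldsymbol f\in L^\infty_c(\Omega)^m$, the function $\boldsymbol u$ with $u^k(x)=\int_\Omega G_{ik}(y,x)f^i(y)\,dy$ belongs to $Y^{1,2}_0(\Omega)$ and satisfies ${}^tL\boldsymbol u=\boldsymbol f$, i.e. $\int_\Omega A^{\alpha\beta}_{ij}D_\alpha u^iD_\beta\phi^j=\int_\Omega f^j\phi^j$ for all $\boldsymbol\phi\in C_c^\infty(\Omega)^m$. These properties determine the Green's matrix uniquely. Since $\boldsymbol G(\cdot,y)$ is a Sobolev function, pointwise statements refer to its continuous representative on $\Omega\setminus\{y\}$ when there is one, and to a.e. $x$ otherwise. Interior Hölder property with constants $\mu_0\in(0,1]$, $R_c\in(0,\infty]$, $N_1>0$: for all $x\in\Omega$ and $R\in(0,d_x\wedge R_c)$, if $\boldsymbol u\in W^{1,2}(B_R(x))$ is a weak solution of either $L\boldsymbol u=0$ or ${}^tL\boldsymbol u=0$ in $B_R(x)$, then $\int_{B_r(x)}|D\boldsymbol u|^2\le N_1(r/s)^{n-2+2\mu_0}\int_{B_s(x)}|D\boldsymbol u|^2$ for $0<r<s\le R$. *)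

theory Defs
  imports "HOL-Analysis.Analysis" "HOL-Probability.Essential_Supremum"
begin

text \<open>Functions on a set \<open>U\<close> are represented by total functions of which only the values
  on \<open>U\<close> matter; all integrals are Lebesgue integrals over \<open>lebesgue_on U\<close>.\<close>

section \<open>Smooth functions\<close>

definition pderiv_at :: "'n::finite \<Rightarrow> (real^'n \<Rightarrow> real) \<Rightarrow> real^'n \<Rightarrow> real" where
  "pderiv_at \<alpha> f x = frechet_derivative f (at x) (axis \<alpha> 1)"

primrec iter_pderiv :: "'n::finite list \<Rightarrow> (real^'n \<Rightarrow> real) \<Rightarrow> real^'n \<Rightarrow> real" where
  "iter_pderiv [] f = f"
| "iter_pderiv (\<alpha> # \<alpha>s) f = pderiv_at \<alpha> (iter_pderiv \<alpha>s f)"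

text \<open>Meant for open \<open>S\<close>.\<close>

definition smooth_on :: "(real^'n::finite) set \<Rightarrow> (real^'n \<Rightarrow> real) \<Rightarrow> bool" where
  "smooth_on S f \<longleftrightarrow> (\<forall>\<alpha>s. iter_pderiv \<alpha>s f differentiable_on S)"

definition Cc_inf :: "(real^'n::finite) set \<Rightarrow> (real^'n \<Rightarrow> real) set" where
  "Cc_inf U = {\<phi>. smooth_on UNIV \<phi> \<and> compact (closure {x. \<phi> x \<noteq> 0}) \<and>
                  closure {x. \<phi> x \<noteq> 0} \<subseteq> U}"

definition Cc_inf_vec :: "(real^'n::finite) set \<Rightarrow> (real^'n \<Rightarrow> real^'m::finite) set" where
  "Cc_inf_vec U = {\<phi>. \<forall>i. (\<lambda>x. \<phi> x $ i) \<in> Cc_inf U}"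

text \<open>The space $C_c^\infty(\overline U\setminus\varSigma)$ for open \<open>U\<close>: functions
  that are smooth in \<open>U\<close>, all of whose derivatives extend continuously to
  \<open>closure U\<close>, and whose support is a compact subset of \<open>closure U - \<Sigma>\<close>.\<close>

definition Cc_inf_closure ::
    "(real^'n::finite) set \<Rightarrow> (real^'n) set \<Rightarrow> (real^'n \<Rightarrow> real) set" where
  "Cc_inf_closure U \<Sigma> = {\<phi>. smooth_on U \<phi> \<and>
      (\<forall>\<alpha>s. \<exists>g. continuous_on (closure U) g \<and> (\<forall>x\<in>U. g x = iter_pderiv \<alpha>s \<phi> x)) \<and>
      compact (closure {x\<in>U. \<phi> x \<noteq> 0}) \<and> closure {x\<in>U. \<phi> x \<noteq> 0} \<inter> \<Sigma> = {}}"

section \<open>Lebesgue spaces\<close>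

definition Lp :: "real \<Rightarrow> (real^'n::finite) set \<Rightarrow> (real^'n \<Rightarrow> 'b::euclidean_space) set" where
  "Lp p U = {f. f \<in> borel_measurable (lebesgue_on U) \<and>
                integrable (lebesgue_on U) (\<lambda>x. norm (f x) powr p)}"

definition Lp_norm :: "real \<Rightarrow> (real^'n::finite) set \<Rightarrow> (real^'n \<Rightarrow> 'b::euclidean_space) \<Rightarrow> real" where
  "Lp_norm p U f = (LINT x|lebesgue_on U. norm (f x) powr p) powr (1 / p)"

definition Linf_norm :: "(real^'n::finite) set \<Rightarrow> (real^'n \<Rightarrow> 'b::euclidean_space) \<Rightarrow> ereal" where
  "Linf_norm U f = esssup (lebesgue_on U) (\<lambda>x. ereal (norm (f x)))"

definition Linf :: "(real^'n::finite) set \<Rightarrow> (real^'n \<Rightarrow> 'b::euclidean_space) set" where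
  "Linf U = {f. f \<in> borel_measurable (lebesgue_on U) \<and> Linf_norm U f < \<infinity>}"

text \<open>Compact support is meant in the a.e. sense.\<close>

definition Linf_c :: "(real^'n::finite) set \<Rightarrow> (real^'n \<Rightarrow> 'b::euclidean_space) set" where
  "Linf_c U = {f \<in> Linf U. \<exists>K. compact K \<and> K \<subseteq> closure U \<and>
                 (AE x in lebesgue_on U. x \<notin> K \<longrightarrow> f x = 0)}"

definition L1_loc :: "(real^'n::finite) set \<Rightarrow> (real^'n \<Rightarrow> 'b::euclidean_space) set" where
  "L1_loc U = {f. \<forall>K. compact K \<and> K \<subseteq> U \<longrightarrow> f absolutely_integrable_on K}"

section \<open>Weak derivatives and Sobolev spaces\<close>

definition has_weak_grad ::
    "(real^'n::finite) set \<Rightarrow> (real^'n \<Rightarrow> real) \<Rightarrow> (real^'n \<Rightarrow> real^'n) \<Rightarrow> bool" where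
  "has_weak_grad U u g \<longleftrightarrow> u \<in> L1_loc U \<and> g \<in> L1_loc U \<and>
     (\<forall>\<phi>\<in>Cc_inf U. \<forall>\<alpha>. (LINT x|lebesgue_on U. u x * pderiv_at \<alpha> \<phi> x) =
                        - (LINT x|lebesgue_on U. g x $ \<alpha> * \<phi> x))"

definition weakly_differentiable :: "(real^'n::finite) set \<Rightarrow> (real^'n \<Rightarrow> real) \<Rightarrow> bool" where
  "weakly_differentiable U u \<longleftrightarrow> (\<exists>g. has_weak_grad U u g)"

text \<open>Weak gradients are unique up to null sets, and a representative is chosen here.\<close>

definition wgrad :: "(real^'n::finite) set \<Rightarrow> (real^'n \<Rightarrow> real) \<Rightarrow> real^'n \<Rightarrow> real^'n" where
  "wgrad U u = (SOME g. has_weak_grad U u g)"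

text \<open>\<open>wjac U u x $ j $ \<beta>\<close> is $D_\beta u^j(x)$; \<open>norm\<close> of it is the
  Euclidean (Frobenius) norm $|D\boldsymbol u(x)|$.\<close>

definition wjac ::
    "(real^'n::finite) set \<Rightarrow> (real^'n \<Rightarrow> real^'m::finite) \<Rightarrow> real^'n \<Rightarrow> real^'n^'m" where
  "wjac U u x = (\<chi> j. wgrad U (\<lambda>z. u z $ j) x)"

definition W11_loc :: "(real^'n::finite) set \<Rightarrow> (real^'n \<Rightarrow> real) set" where
  "W11_loc U = {u. u \<in> L1_loc U \<and> weakly_differentiable U u \<and> wgrad U u \<in> L1_loc U}"

definition W12 :: "(real^'n::finite) set \<Rightarrow> (real^'n \<Rightarrow> real) set" where
  "W12 U = {u. weakly_differentiable U u \<and> u \<in> Lp 2 U \<and> wgrad U u \<in> Lp 2 U}"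

definition W12_vec :: "(real^'n::finite) set \<Rightarrow> (real^'n \<Rightarrow> real^'m::finite) set" where
  "W12_vec U = {u. \<forall>i. (\<lambda>x. u x $ i) \<in> W12 U}"

definition sobolev_exp :: "'n::finite itself \<Rightarrow> real" where
  "sobolev_exp _ = 2 * real CARD('n) / (real CARD('n) - 2)"

definition Y12 :: "(real^'n::finite) set \<Rightarrow> (real^'n \<Rightarrow> real) set" where
  "Y12 U = {u. weakly_differentiable U u \<and> u \<in> Lp (sobolev_exp TYPE('n)) U \<and> wgrad U u \<in> Lp 2 U}"

definition Y12_norm :: "(real^'n::finite) set \<Rightarrow> (real^'n \<Rightarrow> real) \<Rightarrow> real" where
  "Y12_norm U u = Lp_norm (sobolev_exp TYPE('n)) U u + Lp_norm 2 U (wgrad U u)"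

definition Y12_0 :: "(real^'n::finite) set \<Rightarrow> (real^'n \<Rightarrow> real) set" where
  "Y12_0 U = {u \<in> Y12 U. \<forall>\<epsilon>>0. \<exists>\<phi>\<in>Cc_inf U. Y12_norm U (\<lambda>x. u x - \<phi> x) < \<epsilon>}"

definition Y12_0_vec :: "(real^'n::finite) set \<Rightarrow> (real^'n \<Rightarrow> real^'m::finite) set" where
  "Y12_0_vec U = {u. \<forall>i. (\<lambda>x. u x $ i) \<in> Y12_0 U}"

definition vanishes_on ::
    "(real^'n::finite) set \<Rightarrow> (real^'n) set \<Rightarrow> (real^'n \<Rightarrow> real) \<Rightarrow> bool" where
  "vanishes_on U \<Sigma> u \<longleftrightarrow> u \<in> Y12 U \<and>
     (\<exists>\<phi>. (\<forall>k::nat. \<phi> k \<in> Cc_inf_closure U \<Sigma>) \<and>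
          (\<lambda>k. Y12_norm U (\<lambda>x. u x - \<phi> k x)) \<longlonglongrightarrow> 0)"

definition vanishes_on_vec ::
    "(real^'n::finite) set \<Rightarrow> (real^'n) set \<Rightarrow> (real^'n \<Rightarrow> real^'m::finite) \<Rightarrow> bool" where
  "vanishes_on_vec U \<Sigma> u \<longleftrightarrow> (\<forall>i. vanishes_on U \<Sigma> (\<lambda>x. u x $ i))"

section \<open>Elliptic systems\<close>

text \<open>\<open>A \<alpha> \<beta> x $ i $ j\<close> is $A^{\alpha\beta}_{ij}(x)$.\<close>

type_synonym ('n, 'm) coeff = "'n \<Rightarrow> 'n \<Rightarrow> real^'n \<Rightarrow> real^'m^'m"

definition elliptic_coeff :: "real \<Rightarrow> ('n::finite, 'm::finite) coeff \<Rightarrow> bool" where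
  "elliptic_coeff \<nu> A \<longleftrightarrow>
     (\<forall>\<alpha> \<beta>. A \<alpha> \<beta> \<in> borel_measurable lebesgue) \<and>
     (\<forall>x. \<forall>\<xi>::real^'n^'m.
        (\<Sum>\<alpha>\<in>UNIV. \<Sum>\<beta>\<in>UNIV. \<Sum>i\<in>UNIV. \<Sum>j\<in>UNIV. A \<alpha> \<beta> x $ i $ j * \<xi> $ j $ \<beta> * \<xi> $ i $ \<alpha>)
          \<ge> \<nu> * (norm \<xi>)\<^sup>2) \<and>
     (\<forall>x. (\<Sum>i\<in>UNIV. \<Sum>j\<in>UNIV. \<Sum>\<alpha>\<in>UNIV. \<Sum>\<beta>\<in>UNIV. \<bar>A \<alpha> \<beta> x $ i $ j\<bar>\<^sup>2) \<le> 1 / \<nu>\<^sup>2)"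

definition adj_coeff :: "('n::finite, 'm::finite) coeff \<Rightarrow> ('n, 'm) coeff" where
  "adj_coeff A = (\<lambda>\<alpha> \<beta> x. transpose (A \<beta> \<alpha> x))"

text \<open>$\int_U A^{\alpha\beta}_{ij}D_\beta u^jD_\alpha\phi^i$, with weak derivatives of \<open>u\<close>
  and classical derivatives of the test function \<open>\<phi>\<close>.\<close>

definition sys_form ::
    "('n::finite, 'm::finite) coeff \<Rightarrow> (real^'n) set \<Rightarrow>
     (real^'n \<Rightarrow> real^'m) \<Rightarrow> (real^'n \<Rightarrow> real^'m) \<Rightarrow> real" where
  "sys_form A U u \<phi> = (LINT x|lebesgue_on U.
     (\<Sum>\<alpha>\<in>UNIV. \<Sum>\<beta>\<in>UNIV. \<Sum>i\<in>UNIV. \<Sum>j\<in>UNIV.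
       A \<alpha> \<beta> x $ i $ j * wjac U u x $ j $ \<beta> * pderiv_at \<alpha> (\<lambda>z. \<phi> z $ i) x))"

definition weak_solution ::
    "('n::finite, 'm::finite) coeff \<Rightarrow> (real^'n) set \<Rightarrow>
     (real^'n \<Rightarrow> real^'m) \<Rightarrow> (real^'n \<Rightarrow> real^'m) \<Rightarrow> bool" where
  "weak_solution A U u f \<longleftrightarrow>
     (\<forall>\<phi>\<in>Cc_inf_vec U. sys_form A U u \<phi> = (LINT x|lebesgue_on U. f x \<bullet> \<phi> x))"

section \<open>Green's matrix\<close>

definition is_green_matrix ::
    "('n::finite, 'm::finite) coeff \<Rightarrow> (real^'n) set \<Rightarrow>
     (real^'n \<Rightarrow> real^'n \<Rightarrow> real^'m^'m) \<Rightarrow> bool" where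
  "is_green_matrix A \<Omega> G \<longleftrightarrow>
     (\<forall>y\<in>\<Omega>. (\<forall>j k. (\<lambda>x. G x y $ j $ k) \<in> W11_loc \<Omega>) \<and>
        (\<forall>\<phi>\<in>Cc_inf_vec \<Omega>. \<forall>k. sys_form A \<Omega> (\<lambda>x. column k (G x y)) \<phi> = \<phi> y $ k)) \<and>
     (\<forall>y\<in>\<Omega>. (\<forall>r>0. \<forall>j k. (\<lambda>x. G x y $ j $ k) \<in> Y12 (\<Omega> - cball y r)) \<and>
        (\<forall>\<zeta>\<in>Cc_inf \<Omega>. eventually (\<lambda>x. \<zeta> x = 1) (nhds y) \<longrightarrow>
           (\<forall>j k. (\<lambda>x. (1 - \<zeta> x) * G x y $ j $ k) \<in> Y12_0 \<Omega>))) \<and>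
     (\<forall>f\<in>Linf_c \<Omega>.
        let u = (\<lambda>x. \<chi> k. LINT y|lebesgue_on \<Omega>. (\<Sum>i\<in>UNIV. G y x $ i $ k * f y $ i))
        in u \<in> Y12_0_vec \<Omega> \<and> weak_solution (adj_coeff A) \<Omega> u f)"

text \<open>\<open>P\<close> holds at every point of \<open>U\<close> for the continuous representative of \<open>g\<close>
  when there is one, and almost everywhere in \<open>U\<close> otherwise.\<close>

definition holds_repr ::
    "(real^'n::finite) set \<Rightarrow> (real^'n \<Rightarrow> 'b::topological_space) \<Rightarrow>
     (real^'n \<Rightarrow> 'b \<Rightarrow> bool) \<Rightarrow> bool" where
  "holds_repr U g P \<longleftrightarrow>
     (let C = {h. continuous_on U h \<and> (AE x in lebesgue_on U. h x = g x)}
      in if C \<noteq> {} then (\<forall>h\<in>C. \<forall>x\<in>U. P x (h x)) else (AE x in lebesgue_on U. P x (g x)))"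

definition green_bound ::
    "(real^'n::finite) set \<Rightarrow> (real^'n \<Rightarrow> real^'n \<Rightarrow> real^'m^'m::finite) \<Rightarrow> ereal \<Rightarrow> real \<Rightarrow> bool" where
  "green_bound \<Omega> G Rmax C0 \<longleftrightarrow>
     (\<forall>y\<in>\<Omega>. holds_repr (\<Omega> - {y}) (\<lambda>x. G x y)
        (\<lambda>x v. 0 < dist x y \<and> ereal (dist x y) < Rmax \<longrightarrow>
               norm v \<le> C0 * dist x y powr (2 - real CARD('n))))"

section \<open>Interior Hoelder property and local boundedness\<close>

text \<open>Extended-real valued, so that the distance to an empty boundary is \<open>\<infinity>\<close>
  (\<open>infdist\<close> would give 0).\<close>

definition bdry_dist :: "(real^'n::finite) set \<Rightarrow> real^'n \<Rightarrow> ereal" where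
  "bdry_dist \<Omega> x = (INF z\<in>frontier \<Omega>. ereal (dist x z))"

definition interior_hoelder ::
    "('n::finite, 'm::finite) coeff \<Rightarrow> (real^'n) set \<Rightarrow> real \<Rightarrow> ereal \<Rightarrow> real \<Rightarrow> bool" where
  "interior_hoelder A \<Omega> \<mu>0 Rc N1 \<longleftrightarrow>
     (\<forall>x\<in>\<Omega>. \<forall>R::real. 0 < R \<and> ereal R < min (bdry_dist \<Omega> x) Rc \<longrightarrow>
       (\<forall>u\<in>W12_vec (ball x R).
          weak_solution A (ball x R) u (\<lambda>_. 0) \<or>
          weak_solution (adj_coeff A) (ball x R) u (\<lambda>_. 0) \<longrightarrow>
          (\<forall>r s. 0 < r \<and> r < s \<and> s \<le> R \<longrightarrow>
             (LINT z|lebesgue_on (ball x r). (norm (wjac (ball x R) u z))\<^sup>2)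
               \<le> N1 * (r / s) powr (real CARD('n) - 2 + 2 * \<mu>0) *
                  (LINT z|lebesgue_on (ball x s). (norm (wjac (ball x R) u z))\<^sup>2))))"

definition local_boundedness ::
    "('n::finite, 'm::finite) coeff \<Rightarrow> (real^'n) set \<Rightarrow> ereal \<Rightarrow> real \<Rightarrow> bool" where
  "local_boundedness A \<Omega> Rmax N0 \<longleftrightarrow>
     (\<forall>x\<in>\<Omega>. \<forall>R::real. 0 < R \<and> ereal R < Rmax \<longrightarrow>
       (\<forall>f\<in>Linf (\<Omega> \<inter> ball x R). \<forall>u\<in>W12_vec (\<Omega> \<inter> ball x R).
          (weak_solution A (\<Omega> \<inter> ball x R) u f \<or>
           weak_solution (adj_coeff A) (\<Omega> \<inter> ball x R) u f) \<and>
          vanishes_on_vec (\<Omega> \<inter> ball x R) (frontier \<Omega> \<inter> ball x R) u \<longrightarrow>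
          Linf_norm (\<Omega> \<inter> ball x (R / 2)) u
            \<le> ereal N0 * (ereal (R powr (- real CARD('n) / 2) * Lp_norm 2 (\<Omega> \<inter> ball x R) u)
                          + ereal (R\<^sup>2) * Linf_norm (\<Omega> \<inter> ball x R) f)))"

end

theory Submission
  imports Defs
begin

text \<open>Why the theorem holds. Write \<open>\<Omega>\<^sub>R = \<Omega> \<inter> ball x R\<close>, let \<open>u\<close> vanish on \<open>frontier \<Omega> \<inter> ball x R\<close>, and let
  it solve the transposed equation with right-hand side \<open>f\<close> in \<open>\<Omega>\<^sub>R\<close>. By duality an essential bound
  for \<open>u\<close> near a point \<open>p \<in> ball x (R/2)\<close> follows from
  \<open>\<bar>\<integral>g \<bullet> u\<bar> \<le> C \<parallel>g\<parallel>\<^sub>1\<close> for all bounded \<open>g\<close> supported in \<open>ball p (\<rho>/2)\<close>, where \<open>\<rho> = R/20\<close>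
  (\<open>AE_bound_by_duality\<close>).

  Let \<open>\<phi>\<close> solve the equation with source \<open>g\<close> and zero boundary values, and let \<open>\<zeta>\<close> be a cutoff
  function around \<open>p\<close> at scale \<open>\<rho>\<close>. Testing the equation of \<open>\<phi>\<close> with \<open>\<zeta> u\<close>, and that of \<open>u\<close> with
  \<open>\<zeta> \<phi>\<close>, gives
  \[ \int g \cdot u = \int f \cdot \zeta\phi - \int A(\phi \otimes \nabla\zeta, Du)
     + \int A(D\phi, u \otimes \nabla\zeta). \]
  In the last two terms only the annulus where \<open>\<nabla>\<zeta>\<close> lives matters, at a distance comparable to \<open>\<rho>\<close>
  from the source. There \<open>\<bar>\<phi>\<bar>\<close> is of order \<open>\<rho>\<^bsup>2-n\<^esup> \<parallel>g\<parallel>\<^sub>1\<close> by the bound for the Green's matrix,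
  and Caccioppoli's inequality controls \<open>D\<phi>\<close> by \<open>\<phi>\<close> and \<open>Du\<close> by \<open>u\<close> and \<open>f\<close>. In the first term the
  kernel bound gives \<open>\<parallel>\<phi>\<parallel>\<^sub>1 \<le> C \<rho>\<^sup>2 \<parallel>g\<parallel>\<^sub>1\<close>. Adding up, \<open>\<bar>\<integral>g \<bullet> u\<bar>\<close> is at most a constant times
  \<open>(\<rho>\<^bsup>-n/2\<^esup> \<parallel>u\<parallel>\<^sub>2 + \<rho>\<^sup>2 \<parallel>f\<parallel>\<^sub>\<infinity>) \<parallel>g\<parallel>\<^sub>1\<close>. The lemmas are \<open>approx_solution_estimates\<close> for \<open>\<phi>\<close>,
  \<open>solution_energy\<close> for \<open>u\<close>, \<open>duality_estimate_eps\<close> for the identity and \<open>duality_estimate_scaled\<close>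
  for the powers of \<open>\<rho>\<close>; \<open>local_bound\<close> covers the half ball by countably many small balls.

  Two kinds of solution \<open>\<phi>\<close> are needed, one for \<open>L\<close> and one for its adjoint. For the adjoint the Green's
  matrix provides \<open>\<phi>(x) = \<integral>G(y,x)\<^sup>T g(y) dy\<close>, and the bound for \<open>G\<close> is directly a kernel bound
  for \<open>\<phi>\<close> (\<open>approx_solvable_green\<close>). For \<open>L\<close> the kernel bound is inherited by duality
  in the weak form \<open>\<bar>\<integral>h \<bullet> \<phi>\<^sub>g\<bar> \<le> K \<integral>\<integral> \<bar>h(x)\<bar> \<bar>x - y\<bar>\<^bsup>2-n\<^esup> \<bar>g(y)\<bar>\<close>,
  since \<open>\<integral>h \<bullet> \<phi>\<^sub>g = \<integral>\<phi>\<^sub>h \<bullet> g\<close> when \<open>\<phi>\<^sub>h\<close> solves the transposed problem with source \<open>h\<close>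
  (\<open>approx_solvable_adj\<close>). All estimates of \<open>\<phi>\<close> use this weak form only, so both equations are
  treated alike.

  Throughout, \<open>\<phi>\<close> is a test function solving its equation up to an error \<open>\<epsilon>\<close> measured in the
  dual of the energy norm. For the adjoint they come from the definition of \<open>Y\<^sup>1\<^sup>,\<^sup>2\<^sub>0(\<Omega>)\<close> as
  a closure, and for \<open>L\<close> from a quantitative Lax-Milgram argument in the pre-Hilbert space of test
  functions (\<open>pre_hilbert_form.approximate_solution\<close>). They keep the calculus elementary: products
  of \<open>\<phi>\<close> with cutoff functions are again test functions, with classical derivatives.\<close>

section \<open>Smooth functions\<close>

text \<open>Smoothness by means of total derivatives: \<open>f\<close> is \<open>k\<close> times differentiable on \<open>S\<close>, with no condition
  for \<open>k = 0\<close>. Since the derivative is given by a witness, the closure properties (products,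
  composition) are one-step inductions, whereas iterated partial derivatives do not compose well.
  On open sets, membership for all \<open>k\<close> is \<open>smooth_on\<close>.\<close>

primrec Ck_on :: "nat \<Rightarrow> 'a::euclidean_space set \<Rightarrow> ('a \<Rightarrow> real) \<Rightarrow> bool" where
  "Ck_on 0 S f \<longleftrightarrow> True"
| "Ck_on (Suc k) S f \<longleftrightarrow> (\<exists>f'. (\<forall>x\<in>S. (f has_derivative f' x) (at x)) \<and>
                                 (\<forall>v\<in>Basis. Ck_on k S (\<lambda>x. f' x v)))"

lemma Ck_on_SucE:
  assumes "Ck_on (Suc k) S f"
  obtains f' where "\<And>x. x \<in> S \<Longrightarrow> (f has_derivative f' x) (at x)" "\<And>v. v \<in> Basis \<Longrightarrow> Ck_on k S (\<lambda>x. f' x v)"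
  using assms unfolding Ck_on.simps(2) by blast

lemma Ck_on_SucI:
  assumes "\<And>x. x \<in> S \<Longrightarrow> (f has_derivative f' x) (at x)" "\<And>v. v \<in> Basis \<Longrightarrow> Ck_on k S (\<lambda>x. f' x v)"
  shows "Ck_on (Suc k) S f"
  unfolding Ck_on.simps(2) using assms by blast

declare Ck_on.simps(2) [simp del]

lemma Ck_on_cong_imp:
  assumes "open S" "\<And>x. x \<in> S \<Longrightarrow> f x = g x" "Ck_on k S f"
  shows "Ck_on k S g"
  using assms
proof (induction k arbitrary: f g)
  case (Suc k)
  obtain f' where f': "\<And>x. x \<in> S \<Longrightarrow> (f has_derivative f' x) (at x)" "\<And>v. v \<in> Basis \<Longrightarrow> Ck_on k S (\<lambda>x. f' x v)"
    by (rule Ck_on_SucE[OF Suc.prems(3)]) blast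
  have "(g has_derivative f' x) (at x)" if "x \<in> S" for x
    using has_derivative_transform_within_open[OF f'(1)[OF that] \<open>open S\<close> that] Suc.prems by auto
  then show ?case using f' by (intro Ck_on_SucI)
qed simp

lemma Ck_on_Suc_imp: "Ck_on (Suc k) S f \<Longrightarrow> Ck_on k S f"
proof (induction k arbitrary: f)
  case (Suc k)
  obtain f' where "\<And>x. x \<in> S \<Longrightarrow> (f has_derivative f' x) (at x)" "\<And>v. v \<in> Basis \<Longrightarrow> Ck_on (Suc k) S (\<lambda>x. f' x v)"
    by (rule Ck_on_SucE[OF Suc.prems]) blast
  then show ?case using Suc.IH by (intro Ck_on_SucI[where f' = f']) blast+
qed simp

lemma Ck_on_Un:
  assumes "open S" "open T" "Ck_on k S f" "Ck_on k T f"
  shows "Ck_on k (S \<union> T) f"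
  using assms
proof (induction k arbitrary: f)
  case (Suc k)
  obtain f' where f': "\<And>x. x \<in> S \<Longrightarrow> (f has_derivative f' x) (at x)" "\<And>v. v \<in> Basis \<Longrightarrow> Ck_on k S (\<lambda>x. f' x v)"
    by (rule Ck_on_SucE[OF Suc.prems(3)]) blast
  obtain g' where g': "\<And>x. x \<in> T \<Longrightarrow> (f has_derivative g' x) (at x)" "\<And>v. v \<in> Basis \<Longrightarrow> Ck_on k T (\<lambda>x. g' x v)"
    by (rule Ck_on_SucE[OF Suc.prems(4)]) blast
  define h where "h x = (if x \<in> S then f' x else g' x)" for x
  have hT: "h x = g' x" if "x \<in> T" for x
    using f'(1) g'(1) has_derivative_unique that unfolding h_def by metis
  have "Ck_on k (S \<union> T) (\<lambda>x. h x v)" if "v \<in> Basis" for v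
  proof (rule Suc.IH)
    show "Ck_on k S (\<lambda>x. h x v)" by (rule Ck_on_cong_imp[OF _ _ f'(2)[OF that]]) (use Suc.prems h_def in auto)
    show "Ck_on k T (\<lambda>x. h x v)" by (rule Ck_on_cong_imp[OF _ _ g'(2)[OF that]]) (use Suc.prems hT in auto)
  qed (use Suc.prems in auto)
  moreover have "(f has_derivative h x) (at x)" if "x \<in> S \<union> T" for x
    using that f'(1) g'(1) by (auto simp: h_def)
  ultimately show ?case by (intro Ck_on_SucI)
qed simp

lemma Ck_on_const: "Ck_on k S (\<lambda>x. c)"
proof (induction k arbitrary: c)
  case (Suc k)
  show ?case by (rule Ck_on_SucI[where f' = "\<lambda>x h. 0"]) (auto simp: Suc)
qed simp

lemma Ck_on_inner: "Ck_on k S (\<lambda>x. x \<bullet> a)"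
proof (cases k)
  case (Suc k)
  show ?thesis unfolding Suc
    by (rule Ck_on_SucI[where f' = "\<lambda>x h. h \<bullet> a"]) (auto intro!: Ck_on_const derivative_eq_intros)
qed simp

lemma Ck_on_ident: "Ck_on k S (\<lambda>x::real. x)"
  using Ck_on_inner[of k S "1::real"] by simp

lemma Ck_on_add: "Ck_on k S f \<Longrightarrow> Ck_on k S g \<Longrightarrow> Ck_on k S (\<lambda>x. f x + g x)"
proof (induction k arbitrary: f g)
  case (Suc k)
  obtain f' where f': "\<And>x. x \<in> S \<Longrightarrow> (f has_derivative f' x) (at x)" "\<And>v. v \<in> Basis \<Longrightarrow> Ck_on k S (\<lambda>x. f' x v)"
    by (rule Ck_on_SucE[OF Suc.prems(1)]) blast
  obtain g' where g': "\<And>x. x \<in> S \<Longrightarrow> (g has_derivative g' x) (at x)" "\<And>v. v \<in> Basis \<Longrightarrow> Ck_on k S (\<lambda>x. g' x v)"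
    by (rule Ck_on_SucE[OF Suc.prems(2)]) blast
  show ?case
    by (rule Ck_on_SucI[where f' = "\<lambda>x v. f' x v + g' x v"]) (auto intro!: derivative_intros f' g' Suc.IH)
qed simp

lemma Ck_on_mult: "Ck_on k S f \<Longrightarrow> Ck_on k S g \<Longrightarrow> Ck_on k S (\<lambda>x. f x * g x)"
proof (induction k arbitrary: f g)
  case (Suc k)
  obtain f' where f': "\<And>x. x \<in> S \<Longrightarrow> (f has_derivative f' x) (at x)" "\<And>v. v \<in> Basis \<Longrightarrow> Ck_on k S (\<lambda>x. f' x v)"
    by (rule Ck_on_SucE[OF Suc.prems(1)]) blast
  obtain g' where g': "\<And>x. x \<in> S \<Longrightarrow> (g has_derivative g' x) (at x)" "\<And>v. v \<in> Basis \<Longrightarrow> Ck_on k S (\<lambda>x. g' x v)"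
    by (rule Ck_on_SucE[OF Suc.prems(2)]) blast
  have "Ck_on k S f" "Ck_on k S g" using Suc.prems Ck_on_Suc_imp by auto
  then show ?case
    by (intro Ck_on_SucI[where f' = "\<lambda>x v. f x * g' x v + f' x v * g x"])
       (auto intro!: derivative_intros f' g' Suc.IH Ck_on_add)
qed simp

lemma Ck_on_diff:
  assumes f: "Ck_on k S f" and g: "Ck_on k S g" shows "Ck_on k S (\<lambda>x. f x - g x)"
proof -
  have "Ck_on k S (\<lambda>x. - 1 * g x)" by (rule Ck_on_mult[OF Ck_on_const g])
  from Ck_on_add[OF f this] show ?thesis by simp
qed

lemma Ck_on_sum: "(\<And>i. i \<in> I \<Longrightarrow> Ck_on k S (f i)) \<Longrightarrow> Ck_on k S (\<lambda>x. \<Sum>i\<in>I. f i x)"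
  by (induction I rule: infinite_finite_induct) (auto intro: Ck_on_const Ck_on_add)

lemma Ck_on_prod: "(\<And>i. i \<in> I \<Longrightarrow> Ck_on k S (f i)) \<Longrightarrow> Ck_on k S (\<lambda>x. \<Prod>i\<in>I. f i x)"
  by (induction I rule: infinite_finite_induct) (auto intro: Ck_on_const Ck_on_mult)

lemma Ck_on_compose:
  fixes F :: "real \<Rightarrow> real"
  shows "Ck_on k T F \<Longrightarrow> Ck_on k S q \<Longrightarrow> (\<And>x. x \<in> S \<Longrightarrow> q x \<in> T) \<Longrightarrow> Ck_on k S (\<lambda>x. F (q x))"
proof (induction k arbitrary: F)
  case (Suc k)
  obtain F' where F': "\<And>x. x \<in> T \<Longrightarrow> (F has_derivative F' x) (at x)" "Ck_on k T (\<lambda>x. F' x 1)"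
  proof -
    from Suc.prems(1) show ?thesis by (rule Ck_on_SucE) (rule that, simp_all)
  qed
  obtain q' where q': "\<And>x. x \<in> S \<Longrightarrow> (q has_derivative q' x) (at x)" "\<And>v. v \<in> Basis \<Longrightarrow> Ck_on k S (\<lambda>x. q' x v)"
    by (rule Ck_on_SucE[OF Suc.prems(2)]) blast
  have 1: "((\<lambda>x. F (q x)) has_derivative (\<lambda>v. q' x v * F' (q x) 1)) (at x)" if "x \<in> S" for x
  proof -
    have "linear (F' (q x))" using F'(1)[of "q x"] Suc.prems(3)[OF that] has_derivative_linear by blast
    then have "F' (q x) (q' x v) = q' x v * F' (q x) 1" for v
      using linear_cmul[of "F' (q x)" "q' x v" 1] by simp
    then show ?thesis
      using has_derivative_compose[OF q'(1)[OF that] F'(1)[OF Suc.prems(3)[OF that]]] by simp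
  qed
  have "Ck_on k S (\<lambda>x. F' (q x) 1)"
    using Suc.IH[OF F'(2)] Ck_on_Suc_imp[OF Suc.prems(2)] Suc.prems(3) by blast
  then show ?case
    by (intro Ck_on_SucI[where f' = "\<lambda>x v. q' x v * F' (q x) 1"]) (auto intro!: 1 Ck_on_mult q')
qed simp

lemma Ck_on_inverse: "Ck_on k {0<..} (\<lambda>x::real. inverse x)"
proof (induction k)
  case (Suc k)
  have "\<forall>x\<in>{0<..}. ((\<lambda>x::real. inverse x) has_derivative (\<lambda>v. - 1 * (inverse x * inverse x) * v)) (at x)"
    by (auto intro!: derivative_eq_intros)
  then show ?case
    by (intro Ck_on_SucI[where f' = "\<lambda>x v::real. - 1 * (inverse x * inverse x) * v"])
       (blast, intro Ck_on_mult Suc Ck_on_const)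
qed simp

lemma Ck_on_imp_differentiable: "Ck_on (Suc k) S f \<Longrightarrow> x \<in> S \<Longrightarrow> f differentiable (at x)"
  by (meson Ck_on_SucE differentiableI)

lemma Ck_on_imp_continuous_on: "Ck_on (Suc k) S f \<Longrightarrow> continuous_on S f"
  by (meson continuous_at_imp_continuous_on Ck_on_imp_differentiable differentiable_imp_continuous_within)

subsection \<open>Relation to iterated partial derivatives\<close>

lemma iter_pderiv_append: "iter_pderiv (as @ bs) f = iter_pderiv as (iter_pderiv bs f)"
  by (induction as) auto

lemma smooth_on_differentiable: "smooth_on S f \<Longrightarrow> open S \<Longrightarrow> x \<in> S \<Longrightarrow> f differentiable (at x)"
  unfolding smooth_on_def by (metis at_within_open differentiable_on_def iter_pderiv.simps(1))

lemma smooth_on_pderiv: "smooth_on S f \<Longrightarrow> smooth_on S (pderiv_at \<alpha> f)"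
  unfolding smooth_on_def by (metis iter_pderiv.simps iter_pderiv_append)

lemma smooth_on_imp_Ck_on:
  assumes "open S" "smooth_on S f" shows "Ck_on k S f"
  using assms(2)
proof (induction k arbitrary: f)
  case (Suc k)
  have "(f has_derivative frechet_derivative f (at x)) (at x)" if "x \<in> S" for x
    using smooth_on_differentiable[OF Suc.prems assms(1) that] by (simp add: frechet_derivative_works)
  moreover have "Ck_on k S (\<lambda>x. frechet_derivative f (at x) v)" if v: "v \<in> Basis" for v
  proof -
    obtain \<alpha> where "v = axis \<alpha> 1" using v by (auto simp: Basis_vec_def)
    then show ?thesis using Suc.IH[OF smooth_on_pderiv[OF Suc.prems, of \<alpha>]] by (simp add: pderiv_at_def[abs_def])
  qed
  ultimately show ?case by (intro Ck_on_SucI)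
qed simp

lemma Ck_on_imp_smooth_on:
  assumes "open S" "\<And>k. Ck_on k S f" shows "smooth_on S f"
proof -
  have "\<forall>x\<in>S. iter_pderiv as f differentiable (at x)" for as
    using assms(2)
  proof (induction as arbitrary: f rule: rev_induct)
    case Nil
    then show ?case using Ck_on_imp_differentiable by (metis iter_pderiv.simps(1))
  next
    case (snoc \<alpha> as)
    have "Ck_on k S (pderiv_at \<alpha> f)" for k
    proof -
      obtain f' where f': "\<And>x. x \<in> S \<Longrightarrow> (f has_derivative f' x) (at x)" "\<And>v. v \<in> Basis \<Longrightarrow> Ck_on k S (\<lambda>x. f' x v)"
        by (rule Ck_on_SucE[OF snoc.prems[of "Suc k"]]) blast
      have "f' x (axis \<alpha> 1) = pderiv_at \<alpha> f x" if "x \<in> S" for x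
        using frechet_derivative_at[OF f'(1)[OF that]] by (simp add: pderiv_at_def)
      then show ?thesis
        by (intro Ck_on_cong_imp[OF assms(1) _ f'(2)[of "axis \<alpha> 1"]]) (auto simp: axis_in_Basis_iff)
    qed
    then show ?case using snoc.IH by (simp add: iter_pderiv_append)
  qed
  then show ?thesis
    unfolding smooth_on_def differentiable_on_def using differentiable_at_withinI by blast
qed

lemma smooth_on_subset: "smooth_on T f \<Longrightarrow> S \<subseteq> T \<Longrightarrow> smooth_on S f"
  unfolding smooth_on_def using differentiable_on_subset by blast

lemma smooth_on_continuous: "smooth_on S f \<Longrightarrow> continuous_on S f"
  unfolding smooth_on_def by (metis differentiable_imp_continuous_on iter_pderiv.simps(1))

lemma pderiv_cong:
  assumes "open S" "x \<in> S" "\<And>x. x \<in> S \<Longrightarrow> f x = g x" shows "pderiv_at \<alpha> f x = pderiv_at \<alpha> g x"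
proof (cases "f differentiable at x")
  case True
  then show ?thesis unfolding pderiv_at_def
    using frechet_derivative_transform_within_open[OF True assms(1,2)] assms(3) by simp
next
  case False
  have "(f has_derivative D) (at x) \<longleftrightarrow> (g has_derivative D) (at x)" for D
    using has_derivative_transform_within_open[OF _ assms(1,2)] assms(3) by metis
  then show ?thesis unfolding pderiv_at_def frechet_derivative_def by simp
qed

lemma pderiv_zero: "pderiv_at \<alpha> (\<lambda>x. c) x = 0"
  by (simp add: pderiv_at_def)

lemma pderiv_add:
  assumes "f differentiable at x" "g differentiable at x"
  shows "pderiv_at \<alpha> (\<lambda>x. f x + g x) x = pderiv_at \<alpha> f x + pderiv_at \<alpha> g x"
  unfolding pderiv_at_def
  using frechet_derivative_at[OF has_derivative_add[OF assms[unfolded frechet_derivative_works]]]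
  by metis

lemma pderiv_mult:
  fixes f g :: "real^'n \<Rightarrow> real"
  assumes "f differentiable at x" "g differentiable at x"
  shows "pderiv_at \<alpha> (\<lambda>x. f x * g x) x = f x * pderiv_at \<alpha> g x + pderiv_at \<alpha> f x * g x"
  unfolding pderiv_at_def
  using fun_cong[OF frechet_derivative_at[OF has_derivative_mult[OF assms[unfolded frechet_derivative_works]]], of "axis \<alpha> 1"]
  by (simp add: mult.commute)

lemma pderiv_cmult:
  assumes "g differentiable at x"
  shows "pderiv_at \<alpha> (\<lambda>x. c * g x) x = c * pderiv_at \<alpha> g x"
  using pderiv_mult[of "\<lambda>_. c" x g \<alpha>] assms by (simp add: pderiv_zero)

subsection \<open>Compactly supported smooth functions\<close>

lemma Cc_infI:
  fixes f :: "real^'n \<Rightarrow> real"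
  assumes "smooth_on UNIV f" "compact K" "K \<subseteq> U" "\<And>x. x \<notin> K \<Longrightarrow> f x = 0"
  shows "f \<in> Cc_inf U"
proof -
  have "closure {x. f x \<noteq> 0} \<subseteq> K"
    using assms(2,4) by (intro closure_minimal) (auto simp: compact_imp_closed)
  moreover from this have "compact (closure {x. f x \<noteq> 0})"
    using assms(2) closed_closure compact_closure compact_imp_bounded bounded_subset closure_subset
    by (metis (no_types, lifting))
  ultimately show ?thesis unfolding Cc_inf_def using assms by auto
qed

lemma Cc_infE:
  fixes f :: "real^'n \<Rightarrow> real"
  assumes "f \<in> Cc_inf U"
  obtains K where "compact K" "K \<subseteq> U" "\<And>x. x \<notin> K \<Longrightarrow> f x = 0"
proof
  show "compact (closure {x. f x \<noteq> 0})" "closure {x. f x \<noteq> 0} \<subseteq> U" using assms by (auto simp: Cc_inf_def)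
  show "f x = 0" if "x \<notin> closure {x. f x \<noteq> 0}" for x using closure_subset[of "{x. f x \<noteq> 0}"] that by auto
qed

lemma Cc_inf_smooth: "f \<in> Cc_inf U \<Longrightarrow> smooth_on UNIV f"
  by (auto simp: Cc_inf_def)

lemma Cc_inf_Ck_on: "f \<in> Cc_inf U \<Longrightarrow> Ck_on k UNIV f"
  using Cc_inf_smooth smooth_on_imp_Ck_on open_UNIV by blast

lemma Cc_inf_differentiable: "f \<in> Cc_inf U \<Longrightarrow> f differentiable at x"
  by (meson Cc_inf_smooth UNIV_I open_UNIV smooth_on_differentiable)

lemma Cc_inf_continuous: "f \<in> Cc_inf U \<Longrightarrow> continuous_on S f"
  using Cc_inf_smooth continuous_on_subset smooth_on_continuous by blast

lemma Cc_inf_mono: "U \<subseteq> V \<Longrightarrow> Cc_inf U \<subseteq> Cc_inf V"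
  by (auto simp: Cc_inf_def)

lemma Cc_inf_pderiv: 
  assumes "f \<in> Cc_inf U" shows "pderiv_at \<alpha> f \<in> Cc_inf U"
proof -
  obtain K where K: "compact K" "K \<subseteq> U" "\<And>x. x \<notin> K \<Longrightarrow> f x = 0" by (rule Cc_infE[OF assms]) blast
  show ?thesis
  proof (rule Cc_infI[OF _ K(1,2)])
    fix x assume x: "x \<notin> K"
    have "pderiv_at \<alpha> f x = pderiv_at \<alpha> (\<lambda>x. 0) x"
      using K x by (intro pderiv_cong[of "- K"]) (auto simp: compact_imp_closed)
    then show "pderiv_at \<alpha> f x = 0" by (simp add: pderiv_zero)
  qed (intro smooth_on_pderiv Cc_inf_smooth[OF assms])
qed

lemma Cc_inf_add:
  fixes f g :: "real^'n \<Rightarrow> real"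
  assumes "f \<in> Cc_inf U" "g \<in> Cc_inf U" shows "(\<lambda>x. f x + g x) \<in> Cc_inf U"
proof -
  obtain K where K: "compact K" "K \<subseteq> U" "\<And>x. x \<notin> K \<Longrightarrow> f x = 0" by (rule Cc_infE[OF assms(1)]) blast
  obtain L where L: "compact L" "L \<subseteq> U" "\<And>x. x \<notin> L \<Longrightarrow> g x = 0" by (rule Cc_infE[OF assms(2)]) blast
  show ?thesis
  proof (rule Cc_infI)
    show "smooth_on UNIV (\<lambda>x. f x + g x)"
      using Cc_inf_Ck_on[OF assms(1)] Cc_inf_Ck_on[OF assms(2)] by (auto intro!: Ck_on_imp_smooth_on Ck_on_add)
    show "compact (K \<union> L)" using K L by auto
    show "K \<union> L \<subseteq> U" using K L by auto
  qed (use K L in auto)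
qed

text \<open>Multiplying a function that is smooth only in an open set by a cutoff function produces a
  test function as soon as the supports of both meet in a compact subset of this open set.\<close>

lemma Cc_inf_cutoff:
  fixes f g :: "real^'n \<Rightarrow> real"
  assumes "open U" "smooth_on U f" "smooth_on U g" "compact K" "K \<subseteq> U"
    and "\<And>x. x \<in> U \<Longrightarrow> x \<notin> K \<Longrightarrow> g x * f x = 0"
  shows "(\<lambda>x. if x \<in> U then g x * f x else 0) \<in> Cc_inf U" (is "?h \<in> _")
proof (rule Cc_infI[OF _ assms(4,5)])
  have K: "open (- K)" using assms(4) by (auto simp: compact_imp_closed)
  have "Ck_on k (U \<union> - K) ?h" for k
  proof (rule Ck_on_Un[OF assms(1) K])
    have "Ck_on k U (\<lambda>x. g x * f x)" using assms(1-3) by (intro Ck_on_mult smooth_on_imp_Ck_on)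
    then show "Ck_on k U ?h" by (rule Ck_on_cong_imp[OF assms(1), rotated]) auto
    show "Ck_on k (- K) ?h" by (rule Ck_on_cong_imp[OF K _ Ck_on_const[of _ _ 0]]) (use assms(6) in auto)
  qed
  moreover have "U \<union> - K = UNIV" using assms(5) by auto
  ultimately show "smooth_on UNIV ?h" by (auto intro: Ck_on_imp_smooth_on)
qed (use assms(6) in auto)

lemma Cc_inf_mult:
  fixes f g :: "real^'n \<Rightarrow> real"
  assumes "f \<in> Cc_inf U" "smooth_on UNIV g" shows "(\<lambda>x. g x * f x) \<in> Cc_inf U"
proof -
  obtain K where K: "compact K" "K \<subseteq> U" "\<And>x. x \<notin> K \<Longrightarrow> f x = 0" by (rule Cc_infE[OF assms(1)]) blast
  show ?thesis
  proof (rule Cc_infI[OF _ K(1,2)])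
    show "smooth_on UNIV (\<lambda>x. g x * f x)"
      using Cc_inf_Ck_on[OF assms(1)] smooth_on_imp_Ck_on[OF _ assms(2)] by (auto intro!: Ck_on_imp_smooth_on Ck_on_mult)
  qed (use K in auto)
qed

lemma smooth_on_const: "open S \<Longrightarrow> smooth_on S (\<lambda>x. c)"
  by (simp add: Ck_on_const Ck_on_imp_smooth_on)

lemma Cc_inf_bounded:
  fixes f :: "real^'n \<Rightarrow> real"
  assumes "f \<in> Cc_inf U"
  obtains B where "B > 0" "\<And>x. \<bar>f x\<bar> \<le> B"
proof -
  obtain K where K: "compact K" "K \<subseteq> U" "\<And>x. x \<notin> K \<Longrightarrow> f x = 0" by (rule Cc_infE[OF assms(1)]) blast
  have "bounded (f ` K)" using K(1) Cc_inf_continuous[OF assms] compact_continuous_image compact_imp_bounded by blast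
  then obtain B where "B > 0" "\<And>x. x \<in> K \<Longrightarrow> \<bar>f x\<bar> \<le> B" unfolding bounded_pos by auto
  then show ?thesis using that[of B] K(3) by (metis abs_zero less_imp_le)
qed

subsection \<open>Cutoff functions\<close>

text \<open>The functions \<open>p(1/t) exp(-1/t)\<close>, extended by zero to \<open>t \<le> 0\<close>. Admitting all polynomials \<open>p\<close> makes
  the family closed under differentiation, so that smoothness at the origin is an induction.\<close>

definition flat :: "real poly \<Rightarrow> real \<Rightarrow> real" where
  "flat p t = (if t > 0 then poly p (inverse t) * exp (- inverse t) else 0)"

lemma poly_times_exp_neg_tendsto_0: "((\<lambda>s. poly p s * exp (- s)) \<longlongrightarrow> (0::real)) at_top"
proof -
  have "((\<lambda>s. \<Sum>i\<le>degree p. coeff p i * (s ^ i / exp s)) \<longlongrightarrow> (\<Sum>i\<le>degree p. coeff p i * 0)) at_top"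
    by (intro tendsto_intros tendsto_power_div_exp_0)
  moreover have "(\<Sum>i\<le>degree p. coeff p i * (s ^ i / exp s)) = poly p s * exp (- s)" for s
    by (simp add: poly_altdef sum_distrib_right exp_minus divide_inverse mult.assoc)
  ultimately show ?thesis by simp
qed

lemma flat_tendsto_0: "(flat p \<longlongrightarrow> 0) (at 0)"
proof -
  have "((\<lambda>t. poly p (inverse t) * exp (- inverse t)) \<longlongrightarrow> 0) (at_right 0)"
    using filterlim_compose[OF poly_times_exp_neg_tendsto_0 filterlim_inverse_at_top_right] .
  then have "(flat p \<longlongrightarrow> 0) (at_right 0)"
    by (rule Lim_transform_eventually) (auto simp: flat_def eventually_at_filter)
  moreover have "(flat p \<longlongrightarrow> 0) (at_left 0)"
    by (rule tendsto_eventually) (auto simp: flat_def eventually_at_filter)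
  ultimately show ?thesis by (simp add: filterlim_split_at)
qed

lemma flat_has_derivative:
  "(flat p has_field_derivative flat (monom 1 2 * (p - pderiv p)) t) (at t)"
proof -
  consider "t > 0" | "t < 0" | "t = 0" by linarith
  then show ?thesis
  proof cases
    case 1
    have "((\<lambda>t. poly p (inverse t) * exp (- inverse t)) has_field_derivative
        flat (monom 1 2 * (p - pderiv p)) t) (at t)"
      using 1 by (auto intro!: derivative_eq_intros poly_DERIV simp: flat_def poly_monom power2_eq_square field_simps)
    then show ?thesis
      by (rule has_field_derivative_transform_within_open[of _ _ _ "{0<..}"]) (use 1 in \<open>auto simp: flat_def\<close>)
  next
    case 2
    have "((\<lambda>t. 0) has_field_derivative 0) (at t)" by simp
    then have "(flat p has_field_derivative 0) (at t)"
      by (rule has_field_derivative_transform_within_open[of _ _ _ "{..<0}"]) (use 2 in \<open>auto simp: flat_def\<close>)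
    then show ?thesis using 2 by (simp add: flat_def)
  next
    case 3
    have "((\<lambda>h. flat p h / h) \<longlongrightarrow> 0) (at 0)"
      by (rule Lim_transform_eventually[OF flat_tendsto_0[of "monom 1 1 * p"]])
         (auto simp: flat_def eventually_at_filter poly_monom field_simps)
    then show ?thesis using 3 by (simp add: DERIV_def flat_def)
  qed
qed

lemma Ck_on_flat: "Ck_on k UNIV (flat p)"
proof (induction k arbitrary: p)
  case (Suc k)
  have "(flat p has_derivative (\<lambda>v. flat (monom 1 2 * (p - pderiv p)) x * v)) (at x)" for x
    using flat_has_derivative by (simp add: has_field_derivative_def)
  then show ?case
    by (intro Ck_on_SucI[where f' = "\<lambda>x v. flat (monom 1 2 * (p - pderiv p)) x * v"]) (auto simp: Suc)
qed simp

text \<open>The usual quotient \<open>e(4-t) / (e(4-t) + e(t-1))\<close> with \<open>e(t) = exp(-1/t)\<close> for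
  \<open>t > 0\<close> and zero otherwise; it descends from 1 to 0
  between \<open>t = 1\<close> and \<open>t = 4\<close>, the squares of 1 and 2.\<close>

definition step :: "real \<Rightarrow> real" where
  "step t = flat 1 (4 - t) * inverse (flat 1 (4 - t) + flat 1 (t - 1))"

lemma flat_pos: "t > 0 \<Longrightarrow> flat 1 t > 0"
  by (simp add: flat_def)

lemma flat_0: "t \<le> 0 \<Longrightarrow> flat 1 t = 0"
  by (simp add: flat_def)

lemma flat_nonneg: "flat 1 t \<ge> 0"
  using flat_pos[of t] flat_0[of t] by (cases "t > 0") simp_all

lemma step_denominator_pos: "flat 1 (4 - t) + flat 1 (t - 1) > 0"
proof (cases "t < 4")
  case True
  then show ?thesis by (intro add_pos_nonneg flat_pos flat_nonneg) simp
next
  case False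
  then show ?thesis by (intro add_nonneg_pos flat_pos flat_nonneg) simp
qed

lemma Ck_on_step: "Ck_on k UNIV step"
proof -
  have a: "Ck_on k UNIV (\<lambda>t::real. 4 - t)"
    by (rule Ck_on_diff[OF Ck_on_const Ck_on_ident])
  have a': "Ck_on k UNIV (\<lambda>t::real. t - 1)"
    by (rule Ck_on_diff[OF Ck_on_ident Ck_on_const])
  have b: "Ck_on k UNIV (\<lambda>t. flat 1 (4 - t))"
    by (rule Ck_on_compose[OF Ck_on_flat a]) simp
  have c: "Ck_on k UNIV (\<lambda>t. flat 1 (t - 1))"
    by (rule Ck_on_compose[OF Ck_on_flat a']) simp
  have "Ck_on k UNIV (\<lambda>t. inverse (flat 1 (4 - t) + flat 1 (t - 1)))"
    by (rule Ck_on_compose[OF Ck_on_inverse Ck_on_add[OF b c]]) (simp add: step_denominator_pos)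
  from Ck_on_mult[OF b this] show ?thesis unfolding step_def[abs_def] .
qed

lemma step_le: "t \<le> 1 \<Longrightarrow> step t = 1"
  using flat_0[of "t - 1"] flat_pos[of "4 - t"] by (simp add: step_def)

lemma step_ge: "4 \<le> t \<Longrightarrow> step t = 0"
  using flat_0[of "4 - t"] by (simp add: step_def)

lemma step_bounds: "0 \<le> step t" "step t \<le> 1"
  using step_denominator_pos[of t] flat_nonneg[of "4 - t"] flat_nonneg[of "t - 1"]
  unfolding step_def by (simp_all add: divide_inverse[symmetric])

lemma step_derivative:
  obtains s' C where "\<And>t. (step has_field_derivative s' t) (at t)" "C > 0" "\<And>t. \<bar>s' t\<bar> \<le> C" "\<And>t. t > 4 \<Longrightarrow> s' t = 0"
proof -
  obtain f' where f': "\<And>x. x \<in> UNIV \<Longrightarrow> (step has_derivative f' x) (at x)"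
      "\<And>v. v \<in> Basis \<Longrightarrow> Ck_on (Suc 0) UNIV (\<lambda>x. f' x v)"
    by (rule Ck_on_SucE[OF Ck_on_step[of "Suc (Suc 0)"]]) blast
  define s' where "s' t = f' t 1" for t
  have d: "(step has_field_derivative s' t) (at t)" for t
  proof -
    have "f' t h = f' t 1 * h" for h
      using linear_cmul[OF has_derivative_linear[OF f'(1)[of t, OF UNIV_I]], of h 1] by (simp add: mult.commute)
    then have "f' t = (\<lambda>h. f' t 1 * h)" by (rule ext)
    then show ?thesis using f'(1)[of t, OF UNIV_I] unfolding has_field_derivative_def s'_def by metis
  qed
  have "continuous_on UNIV s'"
    unfolding s'_def[abs_def] by (rule Ck_on_imp_continuous_on[OF f'(2)]) simp
  then have c: "continuous_on {0..4} s'" using continuous_on_subset by blast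
  have 0: "s' t = 0" if "t < 1 \<or> t > 4" for t
  proof -
    have "(step has_field_derivative 0) (at t)"
    proof (cases "t < 1")
      case True
      show ?thesis by (rule has_field_derivative_transform_within_open[of "\<lambda>_. 1" _ _ "{..<1}"])
        (use True step_le in auto)
    next
      case False
      show ?thesis by (rule has_field_derivative_transform_within_open[of "\<lambda>_. 0" _ _ "{4<..}"])
        (use False that step_ge in auto)
    qed
    then show ?thesis using d DERIV_unique by blast
  qed
  have "bounded (s' ` {0..4})" using c compact_continuous_image compact_imp_bounded by blast
  then obtain C where C: "C > 0" "\<And>t. t \<in> {0..4} \<Longrightarrow> \<bar>s' t\<bar> \<le> C" unfolding bounded_pos by auto
  have "\<bar>s' t\<bar> \<le> C" for t using C 0[of t] by (cases "t \<in> {0..4}") auto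
  then show ?thesis using that[of s' C] d C(1) 0 by blast
qed

text \<open>One in the ball of radius \<open>r\<close>, zero outside the ball of radius \<open>2r\<close>. Taking the step function of the
  squared distance avoids differentiating the norm at the centre.\<close>

definition cutoff :: "real^'n::finite \<Rightarrow> real \<Rightarrow> real^'n \<Rightarrow> real" where
  "cutoff p r x = step ((norm (x - p) / r)\<^sup>2)"

definition grad :: "(real^'n::finite \<Rightarrow> real) \<Rightarrow> real^'n \<Rightarrow> real^'n" where
  "grad f x = (\<chi> \<alpha>. pderiv_at \<alpha> f x)"

lemma cutoff_one: "r > 0 \<Longrightarrow> dist x p \<le> r \<Longrightarrow> cutoff p r x = 1"
  unfolding cutoff_def by (intro step_le power_le_one) (simp_all add: dist_norm)

lemma cutoff_zero: "r > 0 \<Longrightarrow> dist x p \<ge> 2 * r \<Longrightarrow> cutoff p r x = 0"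
proof -
  assume "r > 0" "dist x p \<ge> 2 * r"
  then have "2 \<le> norm (x - p) / r" by (simp add: dist_norm field_simps)
  then have "2^2 \<le> (norm (x - p) / r)\<^sup>2" by (rule power_mono) simp
  then show ?thesis unfolding cutoff_def by (intro step_ge) simp
qed

lemma cutoff_bounds: "0 \<le> cutoff p r x" "cutoff p r x \<le> 1"
  by (auto simp: cutoff_def step_bounds)

lemma smooth_cutoff:
  fixes p :: "real^'n" shows "smooth_on UNIV (cutoff p r)"
proof (rule Ck_on_imp_smooth_on)
  fix k
  have *: "(norm (x - p) / r)\<^sup>2 = (\<Sum>b\<in>Basis. (x \<bullet> b - p \<bullet> b) * (x \<bullet> b - p \<bullet> b)) * inverse (r\<^sup>2)" for x :: "real^'n"
    by (simp add: power_divide divide_inverse[symmetric] power2_norm_eq_inner euclidean_inner[of "x - p" "x - p"] flip: inner_diff_left)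
  show "Ck_on k UNIV (cutoff p r)" unfolding cutoff_def[abs_def] *
  proof (rule Ck_on_compose[OF Ck_on_step])
    have "Ck_on k UNIV (\<lambda>x. (x \<bullet> b - p \<bullet> b) * (x \<bullet> b - p \<bullet> b))" for b
      by (rule Ck_on_mult; rule Ck_on_diff[OF Ck_on_inner Ck_on_const])
    then show "Ck_on k UNIV (\<lambda>x. (\<Sum>b\<in>Basis. (x \<bullet> b - p \<bullet> b) * (x \<bullet> b - p \<bullet> b)) * inverse (r\<^sup>2))"
      by (rule Ck_on_mult[OF Ck_on_sum Ck_on_const])
  qed simp
qed simp

lemma cutoff_gradient_bound:
  obtains C where "C > 0"
    "\<And>(p::real^'n) r x. r > 0 \<Longrightarrow> norm (grad (cutoff p r) x) \<le> C / r"
proof -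
  obtain s' C where s': "\<And>t. (step has_field_derivative s' t) (at t)" "C > 0" "\<And>t. \<bar>s' t\<bar> \<le> C" "\<And>t. t > 4 \<Longrightarrow> s' t = 0"
    by (rule step_derivative) blast
  have "norm (grad (cutoff p r) x) \<le> (4 * C) / r" if r: "r > 0" for p x :: "real^'n" and r
  proof -
    define s where "s = (norm (x - p) / r)\<^sup>2"
    have sq: "((\<lambda>x. (norm (x - p) / r)\<^sup>2) has_derivative (\<lambda>v. 2 * ((x - p) \<bullet> v) / r\<^sup>2)) (at x)"
    proof -
      have "((\<lambda>x. ((x - p) \<bullet> (x - p)) * c) has_derivative (\<lambda>v. 2 * ((x - p) \<bullet> v) * c)) (at x)" for c :: real
        by (auto intro!: derivative_eq_intros simp: inner_commute)
      from this[of "inverse (r\<^sup>2)"] show ?thesis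
        by (simp only: power_divide divide_inverse[symmetric] power2_norm_eq_inner)
    qed
    have "(cutoff p r has_derivative (\<lambda>v. s' s * (2 * ((x - p) \<bullet> v) / r\<^sup>2))) (at x)"
      unfolding cutoff_def[abs_def] s_def
      using has_derivative_compose[OF sq s'(1)[unfolded has_field_derivative_def]] by simp
    then have "frechet_derivative (cutoff p r) (at x) = (\<lambda>v. s' s * (2 * ((x - p) \<bullet> v) / r\<^sup>2))"
      using frechet_derivative_at by metis
    then have g: "grad (cutoff p r) x = (s' s * 2 / r\<^sup>2) *\<^sub>R (x - p)"
      by (auto simp: grad_def pderiv_at_def vec_eq_iff inner_axis)
    show ?thesis
    proof (cases "s > 4")
      case True then show ?thesis using g s'(2,4) r by simp
    next
      case False
      then have "(norm (x - p) / r)\<^sup>2 \<le> 2\<^sup>2" by (simp add: s_def)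
      then have "norm (x - p) / r \<le> 2" by (rule power2_le_imp_le) simp
      then have "norm (x - p) \<le> 2 * r" using r by (simp add: field_simps)
      then have "\<bar>s' s\<bar> * norm (x - p) \<le> C * (2 * r)" using s'(2,3) r by (intro mult_mono) auto
      then have "\<bar>s' s\<bar> * 2 / r\<^sup>2 * norm (x - p) \<le> C * (2 * r) * 2 / r\<^sup>2"
        using r by (simp add: divide_simps)
      then show ?thesis using g r by (simp add: power2_eq_square)
    qed
  qed
  then show ?thesis using that[of "4 * C"] s'(2) by simp
qed

text \<open>Smooth Urysohn functions: the complement of a finite union of balls is the zero set of a
  product of functions \<open>1 - cutoff\<close>.\<close>

lemma smooth_urysohn:
  fixes K V :: "(real^'n) set"
  assumes "compact K" "open V" "K \<subseteq> V"
  obtains \<psi> where "\<psi> \<in> Cc_inf V" "\<And>x. 0 \<le> \<psi> x" "\<And>x. \<psi> x \<le> 1" "\<And>x. x \<in> K \<Longrightarrow> \<psi> x = 1"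
proof -
  have "\<exists>r>0. cball p (2 * r) \<subseteq> V" if "p \<in> K" for p
  proof -
    have "p \<in> V" using assms(3) that by blast
    then obtain e where "e > 0" "cball p e \<subseteq> V" using assms(2) unfolding open_contains_cball by blast
    then show ?thesis by (intro exI[of _ "e/2"]) simp
  qed
  then have "\<forall>p\<in>K. \<exists>r>0. cball p (2 * r) \<subseteq> V" by blast
  from bchoice[OF this] obtain r where r: "\<And>p. p \<in> K \<Longrightarrow> r p > 0 \<and> cball p (2 * r p) \<subseteq> V" by blast
  obtain D where D: "finite D" "D \<subseteq> K" "K \<subseteq> (\<Union>p\<in>D. ball p (r p))"
  proof (rule compactE_image[OF assms(1), of K "\<lambda>p. ball p (r p)"])
    show "K \<subseteq> (\<Union>p\<in>K. ball p (r p))" using r centre_in_ball by blast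
  qed auto
  define \<psi> where "\<psi> x = 1 - (\<Prod>p\<in>D. (1 - cutoff p (r p) x))" for x
  have "\<psi> \<in> Cc_inf V"
  proof (rule Cc_infI)
    have "Ck_on k UNIV (\<lambda>x. 1 - cutoff p (r p) x)" for k p
      by (rule Ck_on_diff[OF Ck_on_const smooth_on_imp_Ck_on[OF open_UNIV smooth_cutoff]])
    then have "Ck_on k UNIV \<psi>" for k unfolding \<psi>_def[abs_def]
      by (rule Ck_on_diff[OF Ck_on_const Ck_on_prod])
    then show "smooth_on UNIV \<psi>" by (rule Ck_on_imp_smooth_on[OF open_UNIV])
    show "compact (\<Union>p\<in>D. cball p (2 * r p))" using D(1) by (intro compact_UN) auto
    show "(\<Union>p\<in>D. cball p (2 * r p)) \<subseteq> V" using D(2) r by auto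
    fix x assume "x \<notin> (\<Union>p\<in>D. cball p (2 * r p))"
    then have "cutoff p (r p) x = 0" if "p \<in> D" for p
      using that r D(2) by (intro cutoff_zero) (auto simp: dist_commute)
    then show "\<psi> x = 0" by (simp add: \<psi>_def)
  qed
  moreover have "0 \<le> (\<Prod>p\<in>D. (1 - cutoff p (r p) x))" "(\<Prod>p\<in>D. (1 - cutoff p (r p) x)) \<le> 1" for x
    using cutoff_bounds by (auto intro!: prod_nonneg prod_le_1 simp: )
  moreover have "\<psi> x = 1" if xK: "x \<in> K" for x
  proof -
    obtain p where p: "p \<in> D" "x \<in> ball p (r p)" using xK D(3) by blast
    then have "cutoff p (r p) x = 1" using r D(2) by (intro cutoff_one) (auto simp: dist_commute)
    then have "(\<Prod>p\<in>D. (1 - cutoff p (r p) x)) = 0" using p(1) D(1) by (intro prod_zero) auto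
    then show ?thesis by (simp add: \<psi>_def)
  qed
  ultimately show ?thesis using that[of \<psi>] by (simp add: \<psi>_def)
qed

section \<open>Integration by parts and weak gradients\<close>

lemma integrable_lebesgue_imp_on:
  fixes f :: "'a::euclidean_space \<Rightarrow> 'b::euclidean_space"
  assumes "S \<in> sets lebesgue" "integrable lebesgue f"
  shows "integrable (lebesgue_on S) f"
  using assms integrable_mult_indicator[OF assms] by (simp add: integrable_restrict_space)

lemma lebesgue_on_shrink:
  fixes f :: "'a::euclidean_space \<Rightarrow> 'b::euclidean_space"
  assumes "S \<in> sets lebesgue" "T \<in> sets lebesgue" "S \<subseteq> T" "\<And>x. x \<in> T \<Longrightarrow> x \<notin> S \<Longrightarrow> f x = 0"
  shows "integral\<^sup>L (lebesgue_on T) f = integral\<^sup>L (lebesgue_on S) f"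
    and "integrable (lebesgue_on T) f \<longleftrightarrow> integrable (lebesgue_on S) f"
proof -
  have "(\<lambda>x. indicator T x *\<^sub>R f x) = (\<lambda>x. indicator S x *\<^sub>R f x)"
    using assms(3,4) by (auto simp: indicator_def fun_eq_iff)
  then show "integral\<^sup>L (lebesgue_on T) f = integral\<^sup>L (lebesgue_on S) f"
    "integrable (lebesgue_on T) f \<longleftrightarrow> integrable (lebesgue_on S) f"
    using assms(1,2) by (simp_all add: integrable_restrict_space integral_restrict_space)
qed

lemma compact_sets_lebesgue: "compact K \<Longrightarrow> K \<in> sets lebesgue" for K :: "'a::euclidean_space set"
  by (rule fmeasurableD[OF lmeasurable_compact])

lemma Cc_inf_borel: "f \<in> Cc_inf U \<Longrightarrow> f \<in> borel_measurable borel"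
  using Cc_inf_continuous[of f U UNIV] by (rule borel_measurable_continuous_onI)

lemma Cc_inf_measurable: 
  fixes f :: "real^'n \<Rightarrow> real"
  assumes "f \<in> Cc_inf U" shows "f \<in> borel_measurable (lebesgue_on S)"
proof (rule measurable_restrict_space1)
  show "f \<in> borel_measurable lebesgue"
    using Cc_inf_borel[OF assms] by (intro measurable_completion) simp
qed

lemma Cc_inf_integrable_lborel:
  fixes f :: "real^'n \<Rightarrow> real"
  assumes "f \<in> Cc_inf U" shows "integrable lborel f"
proof -
  obtain K where K: "compact K" "K \<subseteq> U" "\<And>x. x \<notin> K \<Longrightarrow> f x = 0" by (rule Cc_infE[OF assms]) blast
  have "(\<lambda>x. indicator K x *\<^sub>R f x) = f" using K(3) by (auto simp: indicator_def fun_eq_iff)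
  then show ?thesis using borel_integrable_compact[OF K(1) Cc_inf_continuous[OF assms]] by simp
qed

lemma Cc_inf_integrable:
  fixes f :: "real^'n \<Rightarrow> real"
  assumes "f \<in> Cc_inf U" "S \<in> sets lebesgue" shows "integrable (lebesgue_on S) f"
  using Cc_inf_integrable_lborel[OF assms(1)] Cc_inf_borel[OF assms(1)]
  by (intro integrable_lebesgue_imp_on assms) (simp add: integrable_completion)

lemma grad_component: "grad f x $ \<alpha> = pderiv_at \<alpha> f x"
  by (simp add: grad_def)

lemma pderiv_line:
  assumes "f differentiable at (x + t *\<^sub>R axis \<alpha> 1)"
  shows "((\<lambda>s. f (x + s *\<^sub>R axis \<alpha> 1)) has_field_derivative pderiv_at \<alpha> f (x + t *\<^sub>R axis \<alpha> 1)) (at t)"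
proof -
  let ?D = "frechet_derivative f (at (x + t *\<^sub>R axis \<alpha> 1))"
  have D: "(f has_derivative ?D) (at (x + t *\<^sub>R axis \<alpha> 1))" using assms by (simp add: frechet_derivative_works)
  have l: "((\<lambda>s. x + s *\<^sub>R axis \<alpha> 1) has_derivative (\<lambda>s. s *\<^sub>R axis \<alpha> 1)) (at t)"
    by (auto intro!: derivative_eq_intros)
  have eq: "?D (s *\<^sub>R axis \<alpha> 1) = pderiv_at \<alpha> f (x + t *\<^sub>R axis \<alpha> 1) * s" for s
    using linear_cmul[OF has_derivative_linear[OF D]] by (simp add: pderiv_at_def)
  have "(\<lambda>s. ?D (s *\<^sub>R axis \<alpha> 1)) = (*) (pderiv_at \<alpha> f (x + t *\<^sub>R axis \<alpha> 1))"
    using eq by (intro ext)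
  then show ?thesis using has_derivative_compose[OF l D] unfolding has_field_derivative_def by simp
qed

text \<open>Difference quotients of a compactly supported function integrate to zero by translation
  invariance, and they converge boundedly to the derivative.\<close>

lemma integral_pderiv_eq_0:
  fixes w :: "real^'n \<Rightarrow> real"
  assumes w: "w \<in> Cc_inf UNIV"
  shows "(LINT x|lebesgue. pderiv_at \<alpha> w x) = 0"
proof -
  define e where "e = (axis \<alpha> 1 :: real^'n)"
  define h where "h k = inverse (real (Suc k))" for k
  have h: "h k > 0" "h k \<le> 1" for k by (auto simp: h_def field_simps)
  define q where "q k x = (w (x + h k *\<^sub>R e) - w x) / h k" for k x
  obtain B where B: "B > 0" "\<And>x. \<bar>pderiv_at \<alpha> w x\<bar> \<le> B" by (rule Cc_inf_bounded[OF Cc_inf_pderiv[OF w]]) blast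
  obtain K where K: "compact K" "\<And>x. x \<notin> K \<Longrightarrow> w x = 0" by (rule Cc_infE[OF w]) blast
  obtain r where r: "r > 0" "K \<subseteq> cball 0 r" using bounded_subset_ballD[OF compact_imp_bounded[OF K(1)], of 0] ball_subset_cball by (meson subset_trans)
  have int: "integrable lborel w" by (rule Cc_inf_integrable_lborel[OF w])
  have mw: "w \<in> borel_measurable borel" by (rule Cc_inf_borel[OF w])
  have shift: "integrable lborel (\<lambda>x. w (x + c))" "(LINT x|lborel. w (x + c)) = (LINT x|lborel. w x)" for c
  proof -
    have d: "distr lborel borel ((+) c) = (lborel :: (real^'n) measure)" by (rule lborel_distr_plus)
    have "integrable (distr lborel borel ((+) c)) w" using int unfolding d .
    then show "integrable lborel (\<lambda>x. w (x + c))"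
      using mw by (subst (asm) integrable_distr_eq) (auto simp: add.commute)
    have "(LINT x|distr lborel borel ((+) c). w x) = (LINT x|lborel. w (c + x))"
      using mw by (intro integral_distr) auto
    then show "(LINT x|lborel. w (x + c)) = (LINT x|lborel. w x)" unfolding d by (simp add: add.commute)
  qed
  have q0: "(LINT x|lborel. q k x) = 0" for k
    unfolding q_def using shift int by simp
  have qB: "norm (q k x) \<le> B * indicator (cball 0 (r + 1)) x" for k x
  proof (cases "x \<in> cball 0 (r + 1)")
    case True
    have "\<exists>z>0. z < h k \<and> w (x + h k *\<^sub>R e) - w (x + 0 *\<^sub>R e) = (h k - 0) * pderiv_at \<alpha> w (x + z *\<^sub>R e)"
      unfolding e_def by (rule MVT2[OF h(1)]) (intro pderiv_line Cc_inf_differentiable[OF w])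
    then obtain z where "w (x + h k *\<^sub>R e) - w x = h k * pderiv_at \<alpha> w (x + z *\<^sub>R e)" by auto
    then have "q k x = pderiv_at \<alpha> w (x + z *\<^sub>R e)" using h(1)[of k] by (simp add: q_def)
    then show ?thesis using True B by simp
  next
    case False
    have n: "norm x > r + 1" using False by simp
    have "norm x \<le> norm (x + h k *\<^sub>R e) + norm (h k *\<^sub>R e)" by (metis add_diff_cancel_right' norm_triangle_ineq4)
    moreover have "norm (h k *\<^sub>R e) \<le> 1" using h[of k] by (simp add: e_def)
    ultimately have "norm (x + h k *\<^sub>R e) > r" using n by linarith
    then have "x + h k *\<^sub>R e \<notin> K" "x \<notin> K" using r n by (auto simp: subset_iff)
    then have "q k x = 0" by (simp add: q_def K(2))
    then show ?thesis using B by simp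
  qed
  have h0: "h \<longlonglongrightarrow> 0" unfolding h_def[abs_def] by (rule LIMSEQ_inverse_real_of_nat)
  have lim: "(\<lambda>k. q k x) \<longlonglongrightarrow> pderiv_at \<alpha> w x" for x
  proof -
    have "((\<lambda>s. (w (x + (0 + s) *\<^sub>R e) - w (x + 0 *\<^sub>R e)) / s) \<longlongrightarrow> pderiv_at \<alpha> w (x + 0 *\<^sub>R e)) (at 0)"
      using pderiv_line[OF Cc_inf_differentiable[OF w], where x = x and t = 0 and \<alpha> = \<alpha>] unfolding DERIV_def e_def .
    then have "((\<lambda>s. (w (x + s *\<^sub>R e) - w x) / s) \<longlongrightarrow> pderiv_at \<alpha> w x) (at 0)" by simp
    moreover have "filterlim h (at 0) sequentially"
      using h0 h(1) by (auto simp: filterlim_at less_imp_neq[symmetric])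
    ultimately show ?thesis unfolding q_def[abs_def] by (rule filterlim_compose)
  qed
  have "(\<lambda>k. LINT x|lborel. q k x) \<longlonglongrightarrow> (LINT x|lborel. pderiv_at \<alpha> w x)"
  proof (rule integral_dominated_convergence)
    show "pderiv_at \<alpha> w \<in> borel_measurable lborel" using Cc_inf_borel[OF Cc_inf_pderiv[OF w]] by simp
    show "q k \<in> borel_measurable lborel" for k unfolding q_def[abs_def] using mw by measurable
    show "integrable lborel (\<lambda>x::real^'n. B * indicator (cball 0 (r + 1)) x)"
      by (intro integrable_mult_right integrable_real_indicator) (simp_all add: emeasure_bounded_finite[unfolded infinity_ennreal_def])
  qed (use lim qB in auto)
  then have "(LINT x|lborel. pderiv_at \<alpha> w x) = 0" by (simp add: q0 LIMSEQ_const_iff)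
  then show ?thesis
    using Cc_inf_borel[OF Cc_inf_pderiv[OF w]] by (simp add: integral_completion)
qed

text \<open>The product \<open>\<phi> \<psi>\<close>, extended by zero, is a test function on the whole space, whose derivative has
  integral zero.\<close>

lemma integration_by_parts:
  fixes \<phi> \<psi> :: "real^'n \<Rightarrow> real"
  assumes U: "open U" and \<phi>: "smooth_on U \<phi>" and \<psi>: "\<psi> \<in> Cc_inf U"
  shows "(LINT x|lebesgue_on U. \<phi> x * pderiv_at \<alpha> \<psi> x) = - (LINT x|lebesgue_on U. pderiv_at \<alpha> \<phi> x * \<psi> x)"
proof -
  have U': "U \<in> sets lebesgue" using U by auto
  have ext: "(\<lambda>x. if x \<in> U then g x * f x else 0) \<in> Cc_inf U" if g: "smooth_on U g" and f: "f \<in> Cc_inf U" for f g :: "real^'n \<Rightarrow> real"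
  proof -
    obtain K where K: "compact K" "K \<subseteq> U" "\<And>x. x \<notin> K \<Longrightarrow> f x = 0" by (rule Cc_infE[OF f]) blast
    show ?thesis
      by (rule Cc_inf_cutoff[OF U smooth_on_subset[OF Cc_inf_smooth[OF f] subset_UNIV] g K(1,2)]) (simp add: K(3))
  qed
  define w where "w x = (if x \<in> U then \<phi> x * \<psi> x else 0)" for x
  have w: "w \<in> Cc_inf U" unfolding w_def[abs_def] by (rule ext[OF \<phi> \<psi>])
  have on_U: "integrable (lebesgue_on U) (\<lambda>x. g x * f x)" if g: "smooth_on U g" and f: "f \<in> Cc_inf U" for f g :: "real^'n \<Rightarrow> real"
    using Cc_inf_integrable[OF ext[OF g f] U'] by (rule Bochner_Integration.integrable_cong[THEN iffD1, rotated 2]) auto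
  have "(LINT x|lebesgue_on UNIV. pderiv_at \<alpha> w x) = (LINT x|lebesgue_on U. pderiv_at \<alpha> w x)"
  proof (rule lebesgue_on_shrink(1))
    fix x assume "x \<notin> U"
    obtain K where K: "compact K" "K \<subseteq> U" "\<And>x. x \<notin> K \<Longrightarrow> pderiv_at \<alpha> w x = 0" by (rule Cc_infE[OF Cc_inf_pderiv[OF w]]) blast
    then show "pderiv_at \<alpha> w x = 0" using \<open>x \<notin> U\<close> by blast
  qed (use U' in auto)
  moreover have "(LINT x|lebesgue_on UNIV. pderiv_at \<alpha> w x) = 0"
    using integral_pderiv_eq_0[of w \<alpha>] w Cc_inf_mono[of U UNIV] by (auto simp: lebesgue_on_UNIV_eq)
  ultimately have "0 = (LINT x|lebesgue_on U. pderiv_at \<alpha> w x)" by simp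
  also have "\<dots> = (LINT x|lebesgue_on U. \<phi> x * pderiv_at \<alpha> \<psi> x + pderiv_at \<alpha> \<phi> x * \<psi> x)"
  proof (rule Bochner_Integration.integral_cong[OF refl])
    fix x assume "x \<in> space (lebesgue_on U)"
    then have x: "x \<in> U" by simp
    have "pderiv_at \<alpha> w x = pderiv_at \<alpha> (\<lambda>x. \<phi> x * \<psi> x) x"
      by (rule pderiv_cong[OF U x]) (simp add: w_def)
    then show "pderiv_at \<alpha> w x = \<phi> x * pderiv_at \<alpha> \<psi> x + pderiv_at \<alpha> \<phi> x * \<psi> x"
      using pderiv_mult[OF smooth_on_differentiable[OF \<phi> U x] Cc_inf_differentiable[OF \<psi>]] by simp
  qed
  also have "\<dots> = (LINT x|lebesgue_on U. \<phi> x * pderiv_at \<alpha> \<psi> x) + (LINT x|lebesgue_on U. pderiv_at \<alpha> \<phi> x * \<psi> x)"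
    by (rule Bochner_Integration.integral_add[OF on_U[OF \<phi> Cc_inf_pderiv[OF \<psi>]] on_U[OF smooth_on_pderiv[OF \<phi>] \<psi>]])
  finally show ?thesis by simp
qed

lemma L1_loc_mult_integrable:
  fixes u \<psi> :: "real^'n \<Rightarrow> real"
  assumes U: "open U" and u: "u \<in> L1_loc U" and \<psi>: "\<psi> \<in> Cc_inf U"
  shows "integrable (lebesgue_on U) (\<lambda>x. u x * \<psi> x)"
proof -
  obtain K where K: "compact K" "K \<subseteq> U" "\<And>x. x \<notin> K \<Longrightarrow> \<psi> x = 0" by (rule Cc_infE[OF \<psi>]) blast
  obtain B where B: "B > 0" "\<And>x. \<bar>\<psi> x\<bar> \<le> B" by (rule Cc_inf_bounded[OF \<psi>]) blast
  have uK: "integrable lebesgue (\<lambda>x. indicator K x *\<^sub>R u x)"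
    using u K(1,2) unfolding L1_loc_def set_integrable_def by blast
  have "integrable lebesgue (\<lambda>x. indicator K x *\<^sub>R u x * \<psi> x)"
  proof (rule Bochner_Integration.integrable_bound[OF integrable_mult_right[OF integrable_norm[OF uK], of B]])
    show "(\<lambda>x. indicator K x *\<^sub>R u x * \<psi> x) \<in> borel_measurable lebesgue"
      using uK Cc_inf_measurable[OF \<psi>, of UNIV] by (intro borel_measurable_times) (auto simp: lebesgue_on_UNIV_eq)
    show "AE x in lebesgue. norm (indicator K x *\<^sub>R u x * \<psi> x) \<le> norm (B * norm (indicator K x *\<^sub>R u x))"
    proof (rule AE_I2)
      fix x
      have "\<bar>indicator K x * u x\<bar> * \<bar>\<psi> x\<bar> \<le> \<bar>indicator K x * u x\<bar> * B" by (rule mult_left_mono[OF B(2)]) simp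
      then show "norm (indicator K x *\<^sub>R u x * \<psi> x) \<le> norm (B * norm (indicator K x *\<^sub>R u x))"
        using B(1) by (simp add: abs_mult mult_ac)
    qed
  qed
  moreover have "(\<lambda>x. indicator K x *\<^sub>R u x * \<psi> x) = (\<lambda>x. u x * \<psi> x)" using K(3) by (auto simp: indicator_def fun_eq_iff)
  ultimately have "integrable lebesgue (\<lambda>x. u x * \<psi> x)" by simp
  then show ?thesis using U by (intro integrable_lebesgue_imp_on) auto
qed

text \<open>The fundamental lemma of the calculus of variations. Smooth Urysohn functions give
  \<open>\<integral>\<^sub>K q = 0\<close> for every compact \<open>K\<close>, and by inner regularity the sets \<open>{q > 0}\<close> and \<open>{q < 0}\<close>
  cannot have positive measure.\<close>

lemma fundamental_lemma_compact:
  fixes q :: "real^'n \<Rightarrow> real"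
  assumes U: "open U" and q: "q \<in> L1_loc U"
    and 0: "\<And>\<psi>. \<psi> \<in> Cc_inf U \<Longrightarrow> (LINT x|lebesgue_on U. q x * \<psi> x) = 0"
    and K: "compact K" "K \<subseteq> U"
  shows "(LINT x|lebesgue. indicator K x *\<^sub>R q x) = 0"
proof (cases "K = {}")
  case False
  obtain e where e: "e > 0" "{x. infdist x K \<le> e} \<subseteq> U" by (rule compact_in_open_separated[OF False K(1) U K(2)]) blast
  define K' where "K' = {x. infdist x K \<le> e}"
  have K': "compact K'" unfolding K'_def by (rule compact_infdist_le[OF False K(1) e(1)])
  define h where "h k = e * inverse (real (Suc k))" for k
  have h: "h k > 0" "h k \<le> e" for k using e(1) by (auto simp: h_def field_simps)
  define V where "V k = {x. infdist x K < h k}" for k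
  have oV: "open (V k)" for k unfolding V_def by (intro open_Collect_less continuous_intros)
  have KV: "K \<subseteq> V k" for k using h[of k] by (auto simp: V_def)
  have VK': "V k \<subseteq> K'" for k using h[of k] by (auto simp: V_def K'_def)
  have "\<exists>\<psi>. \<psi> \<in> Cc_inf (V k) \<and> (\<forall>x. 0 \<le> \<psi> x) \<and> (\<forall>x. \<psi> x \<le> 1) \<and> (\<forall>x\<in>K. \<psi> x = 1)" for k
    by (rule smooth_urysohn[OF K(1) oV KV]) blast
  then obtain \<psi> where \<psi>: "\<And>k. \<psi> k \<in> Cc_inf (V k)" "\<And>k x. 0 \<le> \<psi> k x" "\<And>k x. \<psi> k x \<le> 1" "\<And>k x. x \<in> K \<Longrightarrow> \<psi> k x = 1"
    by metis
  have \<psi>0: "\<psi> k x = 0" if "x \<notin> V k" for k x by (rule Cc_infE[OF \<psi>(1)[of k]]) (use that in blast)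
  have \<psi>U: "\<psi> k \<in> Cc_inf U" for k using \<psi>(1)[of k] Cc_inf_mono[of "V k" U] VK'[of k] e(2) unfolding K'_def by blast
  have qK': "integrable lebesgue (\<lambda>x. indicator K' x *\<^sub>R q x)"
    using q K' e(2) unfolding L1_loc_def set_integrable_def K'_def by blast
  have eq: "(LINT x|lebesgue. indicator K' x *\<^sub>R q x * \<psi> k x) = 0" for k
  proof -
    have "(LINT x|lebesgue_on U. q x * \<psi> k x) = (LINT x|lebesgue. indicator U x *\<^sub>R (q x * \<psi> k x))"
      using U by (intro integral_restrict_space) auto
    also have "\<dots> = (LINT x|lebesgue. indicator K' x *\<^sub>R q x * \<psi> k x)"
    proof (rule Bochner_Integration.integral_cong[OF refl])
      fix x show "indicator U x *\<^sub>R (q x * \<psi> k x) = indicator K' x *\<^sub>R q x * \<psi> k x"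
        using \<psi>0[of x k] VK'[of k] e(2) unfolding K'_def[symmetric] by (cases "x \<in> V k") (auto simp: indicator_def)
    qed
    finally show ?thesis using 0[OF \<psi>U] by simp
  qed
  have "(\<lambda>k. LINT x|lebesgue. indicator K' x *\<^sub>R q x * \<psi> k x) \<longlonglongrightarrow> (LINT x|lebesgue. indicator K x *\<^sub>R q x)"
  proof (rule integral_dominated_convergence[where w = "\<lambda>x. norm (indicator K' x *\<^sub>R q x)"])
    have KK': "K \<subseteq> K'" using KV[of 0] VK'[of 0] by blast
    have "(\<lambda>x. indicator K x *\<^sub>R (indicator K' x *\<^sub>R q x)) \<in> borel_measurable lebesgue"
      using borel_measurable_integrable[OF qK'] compact_sets_lebesgue[OF K(1)]
      by (rule borel_measurable_scaleR[OF borel_measurable_indicator, rotated])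
    moreover have "(\<lambda>x. indicator K x *\<^sub>R (indicator K' x *\<^sub>R q x)) = (\<lambda>x. indicator K x *\<^sub>R q x)"
      using KK' by (auto simp: indicator_def fun_eq_iff)
    ultimately show "(\<lambda>x. indicator K x *\<^sub>R q x) \<in> borel_measurable lebesgue" by simp
    show "(\<lambda>x. indicator K' x *\<^sub>R q x * \<psi> k x) \<in> borel_measurable lebesgue" for k
      using qK' Cc_inf_measurable[OF \<psi>(1), of k UNIV] by (intro borel_measurable_times) (auto simp: lebesgue_on_UNIV_eq)
    show "integrable lebesgue (\<lambda>x. norm (indicator K' x *\<^sub>R q x))" using qK' by (rule integrable_norm)
    show "AE x in lebesgue. norm (indicator K' x *\<^sub>R q x * \<psi> k x) \<le> norm (indicator K' x *\<^sub>R q x)" for k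
      using \<psi>(2,3) by (intro AE_I2) (auto simp: abs_mult intro: mult_left_le)
    show "AE x in lebesgue. (\<lambda>k. indicator K' x *\<^sub>R q x * \<psi> k x) \<longlonglongrightarrow> indicator K x *\<^sub>R q x"
    proof (rule AE_I2)
      fix x show "(\<lambda>k. indicator K' x *\<^sub>R q x * \<psi> k x) \<longlonglongrightarrow> indicator K x *\<^sub>R q x"
      proof (cases "x \<in> K")
        case True then show ?thesis using KK' \<psi>(4) by auto
      next
        case False
        then have pos: "infdist x K > 0"
          using \<open>K \<noteq> {}\<close> K(1) by (simp add: infdist_pos_not_in_closed compact_imp_closed)
        have "h \<longlonglongrightarrow> e * 0" unfolding h_def[abs_def] by (intro tendsto_intros LIMSEQ_inverse_real_of_nat)
        then have "eventually (\<lambda>k. h k < infdist x K) sequentially" using pos order_tendstoD(2) by fastforce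
        then have "eventually (\<lambda>k. indicator K' x *\<^sub>R q x * \<psi> k x = 0) sequentially"
          by (rule eventually_mono) (use \<psi>0 in \<open>auto simp: V_def\<close>)
        then show ?thesis using False by (simp add: tendsto_eventually)
      qed
    qed
  qed
  then show ?thesis unfolding eq by (simp add: LIMSEQ_const_iff)
qed simp

text \<open>If the set where \<open>q > 0\<close> were not negligible, it would contain a compact set of positive measure, over
  which the integral of \<open>q\<close> is positive.\<close>

lemma fundamental_lemma_positive_part:
  fixes q :: "real^'n \<Rightarrow> real"
  assumes K0: "compact K0" and q: "q absolutely_integrable_on K0"
    and 0: "\<And>K. compact K \<Longrightarrow> K \<subseteq> K0 \<Longrightarrow> (LINT x|lebesgue. indicator K x *\<^sub>R q x) = 0"
  shows "{x\<in>K0. q x > 0} \<in> null_sets lebesgue"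
proof (rule ccontr)
  define P where "P = {x\<in>K0. q x > 0}"
  assume "\<not> ?thesis"
  then have notnull: "P \<notin> null_sets lebesgue" by (simp add: P_def)
  have qK: "integrable lebesgue (\<lambda>x. indicator K0 x *\<^sub>R q x)" using q by (simp add: set_integrable_def)
  have "P = {x \<in> space lebesgue. 0 < indicator K0 x *\<^sub>R q x}" by (auto simp: P_def indicator_def)
  also have "\<dots> \<in> sets lebesgue" using qK by measurable
  finally have P: "P \<in> sets lebesgue" .
  have "emeasure lebesgue P \<le> emeasure lebesgue K0"
    using compact_sets_lebesgue[OF K0] by (intro emeasure_mono) (auto simp: P_def)
  also have "\<dots> < \<infinity>" using lmeasurable_compact[OF K0] by (auto simp: fmeasurable_def)
  finally have fin: "emeasure lebesgue P < \<infinity>" .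
  have pos: "emeasure lebesgue P > 0" using notnull P by (auto simp: null_sets_def zero_less_iff_neq_zero)
  define \<epsilon> where "\<epsilon> = measure lebesgue P"
  have \<epsilon>: "emeasure lebesgue P = ennreal \<epsilon>" using fin by (simp add: \<epsilon>_def emeasure_eq_ennreal_measure top.not_eq_extremum)
  then have "\<epsilon> > 0" using pos by auto
  then obtain T where T: "closed T" "T \<subseteq> P" "P - T \<in> lmeasurable" "emeasure lebesgue (P - T) < ennreal \<epsilon>"
    by (rule sets_lebesgue_inner_closed[OF P]) blast
  have TK: "T \<subseteq> K0" using T(2) by (auto simp: P_def)
  have "compact T" using closed_Int_compact[OF T(1) K0] TK by (simp add: Int_absorb2)
  have "integrable lebesgue (\<lambda>x. indicator T x *\<^sub>R (indicator K0 x *\<^sub>R q x))"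
    by (rule integrable_mult_indicator[OF _ qK]) (use T(1) in auto)
  moreover have "(\<lambda>x. indicator T x *\<^sub>R (indicator K0 x *\<^sub>R q x)) = (\<lambda>x. indicator T x *\<^sub>R q x)"
    using TK by (auto simp: indicator_def fun_eq_iff)
  ultimately have i: "integrable lebesgue (\<lambda>x. indicator T x *\<^sub>R q x)" by simp
  have nn: "AE x in lebesgue. 0 \<le> indicator T x *\<^sub>R q x"
    using T(2) by (intro AE_I2) (auto simp: indicator_def P_def less_imp_le)
  have "AE x in lebesgue. indicator T x *\<^sub>R q x = 0"
    using integral_nonneg_eq_0_iff_AE[OF i nn] 0[OF \<open>compact T\<close> TK] by simp
  then have "AE x in lebesgue. x \<notin> T"
    by (rule AE_mp) (use T(2) in \<open>auto intro!: AE_I2 simp: P_def\<close>)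
  then have "emeasure lebesgue T = 0"
    using T(1) by (subst (asm) AE_iff_measurable[of T]) auto
  moreover have "emeasure lebesgue P \<le> emeasure lebesgue (P - T) + emeasure lebesgue T"
    using T P emeasure_subadditive[of "P - T" lebesgue T] by (simp add: Un_absorb2)
  ultimately show False using T(4) \<epsilon> by (simp add: leD)
qed

lemma fundamental_lemma:
  fixes q :: "real^'n \<Rightarrow> real"
  assumes U: "open U" and q: "q \<in> L1_loc U"
    and 0: "\<And>\<psi>. \<psi> \<in> Cc_inf U \<Longrightarrow> (LINT x|lebesgue_on U. q x * \<psi> x) = 0"
  shows "AE x in lebesgue_on U. q x = 0"
proof -
  have N: "{x\<in>K. q x \<noteq> 0} \<in> null_sets lebesgue" if K: "compact K" "K \<subseteq> U" for K
  proof -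
    have qK: "q absolutely_integrable_on K" using q K by (auto simp: L1_loc_def)
    have z: "(LINT x|lebesgue. indicator K' x *\<^sub>R q x) = 0" if "compact K'" "K' \<subseteq> K" for K'
      using fundamental_lemma_compact[OF U q 0 that(1)] that K(2) by blast
    have p: "{x\<in>K. q x > 0} \<in> null_sets lebesgue" by (rule fundamental_lemma_positive_part[OF K(1) qK z])
    have "(\<lambda>x. - q x) absolutely_integrable_on K" using qK integrable_minus by (simp add: set_integrable_def)
    then have "{x\<in>K. - q x > 0} \<in> null_sets lebesgue"
      by (rule fundamental_lemma_positive_part[OF K(1)]) (use z in auto)
    then have "{x\<in>K. q x > 0} \<union> {x\<in>K. - q x > 0} \<in> null_sets lebesgue" using p by blast
    moreover have "{x\<in>K. q x > 0} \<union> {x\<in>K. - q x > 0} = {x\<in>K. q x \<noteq> 0}" by auto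
    ultimately show ?thesis by simp
  qed
  obtain C where C: "\<And>n::nat. compact (C n)" "\<And>n. C n \<subseteq> U" "\<Union>(range C) = U"
    using open_Union_compact_subsets[OF U] by metis
  have "(\<Union>n. {x\<in>C n. q x \<noteq> 0}) \<in> null_sets lebesgue" using N C(1,2) by (intro null_sets_UN) auto
  moreover have "(\<Union>n. {x\<in>C n. q x \<noteq> 0}) = {x\<in>U. q x \<noteq> 0}" using C(3) by auto
  ultimately have "{x\<in>U. q x \<noteq> 0} \<in> null_sets lebesgue" by simp
  then have "AE x in lebesgue. x \<in> U \<longrightarrow> q x = 0" by (rule AE_mp[OF AE_not_in]) (auto intro: AE_I2)
  then show ?thesis using U by (subst AE_restrict_space_iff) auto
qed

lemma L1_loc_continuous:
  fixes f :: "real^'n \<Rightarrow> 'b::euclidean_space"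
  assumes "continuous_on U f" shows "f \<in> L1_loc U"
  unfolding L1_loc_def
proof safe
  fix K assume K: "compact K" "K \<subseteq> U"
  have "integrable lborel (\<lambda>x. indicator K x *\<^sub>R f x)"
    using K assms by (intro borel_integrable_compact) (auto intro: continuous_on_subset)
  then show "f absolutely_integrable_on K"
    unfolding set_integrable_def by (subst integrable_completion) auto
qed

lemma L1_loc_component: "g \<in> L1_loc U \<Longrightarrow> (\<lambda>x. g x $ \<alpha>) \<in> L1_loc U"
  for g :: "real^'n \<Rightarrow> real^'k"
  using absolutely_integrable_component[where b = "axis \<alpha> 1" and f = g] unfolding L1_loc_def by (simp add: inner_axis)

lemma L1_loc_diff: "f \<in> L1_loc U \<Longrightarrow> g \<in> L1_loc U \<Longrightarrow> (\<lambda>x. f x - g x) \<in> L1_loc U"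
  by (auto simp: L1_loc_def intro: set_integral_diff(1))

text \<open>The representative picked by \<open>wgrad\<close> is not explicit; uniqueness is what allows any other weak gradient
  to replace it under an integral.\<close>

lemma weak_grad_unique:
  fixes u :: "real^'n \<Rightarrow> real"
  assumes U: "open U" and g: "has_weak_grad U u g" "has_weak_grad U u h"
  shows "AE x in lebesgue_on U. g x = h x"
proof -
  have L: "g \<in> L1_loc U" "h \<in> L1_loc U" using g by (auto simp: has_weak_grad_def)
  have "AE x in lebesgue_on U. g x $ \<alpha> - h x $ \<alpha> = 0" for \<alpha>
  proof (rule fundamental_lemma[OF U])
    show "(\<lambda>x. g x $ \<alpha> - h x $ \<alpha>) \<in> L1_loc U" using L by (intro L1_loc_diff L1_loc_component)
    fix \<psi> assume \<psi>: "\<psi> \<in> Cc_inf U"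
    have wg: "(LINT x|lebesgue_on U. u x * pderiv_at \<alpha> \<psi> x) = - (LINT x|lebesgue_on U. k x $ \<alpha> * \<psi> x)"
      if "has_weak_grad U u k" for k using that \<psi> unfolding has_weak_grad_def by blast
    have "(LINT x|lebesgue_on U. g x $ \<alpha> * \<psi> x) = (LINT x|lebesgue_on U. h x $ \<alpha> * \<psi> x)"
      using wg[OF g(1)] wg[OF g(2)] by simp
    then show "(LINT x|lebesgue_on U. (g x $ \<alpha> - h x $ \<alpha>) * \<psi> x) = 0"
      using L1_loc_mult_integrable[OF U L1_loc_component[OF L(1)] \<psi>] L1_loc_mult_integrable[OF U L1_loc_component[OF L(2)] \<psi>]
      by (simp add: left_diff_distrib)
  qed
  then have "AE x in lebesgue_on U. \<forall>\<alpha>. g x $ \<alpha> - h x $ \<alpha> = 0" by (subst AE_all_countable) auto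
  then show ?thesis by (rule AE_mp) (auto intro!: AE_I2 simp: vec_eq_iff)
qed

lemma grad_continuous_on: "smooth_on U \<phi> \<Longrightarrow> continuous_on U (grad \<phi>)"
  unfolding grad_def[abs_def] by (intro continuous_on_vec_lambda smooth_on_continuous smooth_on_pderiv)

lemma has_weak_grad_smooth:
  fixes \<phi> :: "real^'n \<Rightarrow> real"
  assumes "open U" "smooth_on U \<phi>" shows "has_weak_grad U \<phi> (grad \<phi>)"
  unfolding has_weak_grad_def grad_component
  by (intro conjI ballI allI integration_by_parts[OF assms] L1_loc_continuous grad_continuous_on[OF assms(2)] smooth_on_continuous[OF assms(2)])

lemma has_weak_grad_diff:
  fixes u v :: "real^'n \<Rightarrow> real"
  assumes U: "open U" and u: "has_weak_grad U u g" and v: "has_weak_grad U v h"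
  shows "has_weak_grad U (\<lambda>x. u x - v x) (\<lambda>x. g x - h x)"
proof -
  have L: "u \<in> L1_loc U" "v \<in> L1_loc U" "g \<in> L1_loc U" "h \<in> L1_loc U" using u v by (auto simp: has_weak_grad_def)
  have "(LINT x|lebesgue_on U. (u x - v x) * pderiv_at \<alpha> \<psi> x) = - (LINT x|lebesgue_on U. (g x - h x) $ \<alpha> * \<psi> x)"
    if \<psi>: "\<psi> \<in> Cc_inf U" for \<psi> \<alpha>
  proof -
    note D = Cc_inf_pderiv[OF \<psi>, of \<alpha>]
    have "(LINT x|lebesgue_on U. (u x - v x) * pderiv_at \<alpha> \<psi> x) =
      (LINT x|lebesgue_on U. u x * pderiv_at \<alpha> \<psi> x) - (LINT x|lebesgue_on U. v x * pderiv_at \<alpha> \<psi> x)"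
      using L1_loc_mult_integrable[OF U L(1) D] L1_loc_mult_integrable[OF U L(2) D] by (simp add: left_diff_distrib)
    also have "\<dots> = - (LINT x|lebesgue_on U. g x $ \<alpha> * \<psi> x) + (LINT x|lebesgue_on U. h x $ \<alpha> * \<psi> x)"
      using u v \<psi> by (simp add: has_weak_grad_def)
    also have "\<dots> = - (LINT x|lebesgue_on U. (g x - h x) $ \<alpha> * \<psi> x)"
      using L1_loc_mult_integrable[OF U L1_loc_component[OF L(3)] \<psi>] L1_loc_mult_integrable[OF U L1_loc_component[OF L(4)] \<psi>]
      by (simp add: left_diff_distrib)
    finally show ?thesis .
  qed
  then show ?thesis unfolding has_weak_grad_def by (intro conjI L1_loc_diff L ballI allI)
qed

lemma has_weak_grad_wgrad: "weakly_differentiable U u \<Longrightarrow> has_weak_grad U u (wgrad U u)"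
  unfolding weakly_differentiable_def wgrad_def by (elim exE) (erule someI[of "has_weak_grad U u"])

lemma wgrad_diff_smooth:
  fixes u \<phi> :: "real^'n \<Rightarrow> real"
  assumes U: "open U" and u: "weakly_differentiable U u" and \<phi>: "smooth_on U \<phi>"
  shows "AE x in lebesgue_on U. wgrad U (\<lambda>x. u x - \<phi> x) x = wgrad U u x - grad \<phi> x"
proof -
  have d: "has_weak_grad U (\<lambda>x. u x - \<phi> x) (\<lambda>x. wgrad U u x - grad \<phi> x)"
    by (rule has_weak_grad_diff[OF U has_weak_grad_wgrad[OF u] has_weak_grad_smooth[OF U \<phi>]])
  then have "weakly_differentiable U (\<lambda>x. u x - \<phi> x)" unfolding weakly_differentiable_def by blast
  then show ?thesis by (rule weak_grad_unique[OF U has_weak_grad_wgrad d])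
qed

section \<open>Square integrable functions\<close>

definition sqint :: "'a measure \<Rightarrow> ('a \<Rightarrow> 'b::euclidean_space) \<Rightarrow> bool" where
  "sqint M F \<longleftrightarrow> F \<in> borel_measurable M \<and> integrable M (\<lambda>x. (norm (F x))\<^sup>2)"

definition l2 :: "'a measure \<Rightarrow> ('a \<Rightarrow> 'b::euclidean_space) \<Rightarrow> real" where
  "l2 M F = sqrt (LINT x|M. (norm (F x))\<^sup>2)"

lemma sqint_measurable [measurable_dest]: "sqint M F \<Longrightarrow> F \<in> borel_measurable M"
  by (simp add: sqint_def)

lemma l2_nonneg: "l2 M F \<ge> 0"
  by (simp add: l2_def)

lemma l2_square: "(l2 M F)\<^sup>2 = (LINT x|M. (norm (F x))\<^sup>2)"
  by (simp add: l2_def)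

lemma l2_minus_commute: "l2 M (\<lambda>x. F x - G x) = l2 M (\<lambda>x. G x - F x)"
  by (simp add: l2_def norm_minus_commute)

lemma sqint_dominated:
  assumes F: "sqint M F" and G: "G \<in> borel_measurable M"
    and le: "AE x in M. norm (G x) \<le> c * norm (F x)" and c: "c \<ge> 0"
  shows "sqint M G" "l2 M G \<le> c * l2 M F"
proof -
  have i: "integrable M (\<lambda>x. c\<^sup>2 * (norm (F x))\<^sup>2)" using F by (simp add: sqint_def)
  have le2: "AE x in M. (norm (G x))\<^sup>2 \<le> c\<^sup>2 * (norm (F x))\<^sup>2"
  proof (rule AE_mp[OF le], rule AE_I2, rule impI)
    fix x assume "norm (G x) \<le> c * norm (F x)"
    from power_mono[OF this norm_ge_zero, of 2] show "(norm (G x))\<^sup>2 \<le> c\<^sup>2 * (norm (F x))\<^sup>2"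
      by (simp add: power_mult_distrib)
  qed
  have iG: "integrable M (\<lambda>x. (norm (G x))\<^sup>2)"
    by (rule Bochner_Integration.integrable_bound[OF i]) (use G le2 in auto)
  then show "sqint M G" using G by (simp add: sqint_def)
  have "(LINT x|M. (norm (G x))\<^sup>2) \<le> (LINT x|M. c\<^sup>2 * (norm (F x))\<^sup>2)"
    by (rule integral_mono_AE[OF iG i le2])
  then have "(l2 M G)\<^sup>2 \<le> (c * l2 M F)\<^sup>2" by (simp add: l2_square power_mult_distrib)
  then show "l2 M G \<le> c * l2 M F" by (rule power2_le_imp_le) (simp add: c l2_nonneg)
qed

lemma product_integrable:
  assumes F: "sqint M F" and G: "sqint M G"
  shows "integrable M (\<lambda>x. norm (F x) * norm (G x))" "(LINT x|M. norm (F x) * norm (G x)) \<le> l2 M F * l2 M G"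
proof -
  have m: "F \<in> borel_measurable M" "G \<in> borel_measurable M" using F G by (auto simp: sqint_def)
  have i: "integrable M (\<lambda>x. (norm (F x))\<^sup>2)" "integrable M (\<lambda>x. (norm (G x))\<^sup>2)" using F G by (auto simp: sqint_def)
  have ineq: "a * b \<le> (t * a\<^sup>2 + b\<^sup>2 / t) / 2" if "t > 0" for a b t :: real
  proof -
    have "0 \<le> (t * a - b)\<^sup>2" by simp
    then have "2 * a * b * t \<le> t * t * a\<^sup>2 + b\<^sup>2" by (simp add: power2_eq_square algebra_simps)
    then show ?thesis using that by (simp add: field_simps power2_eq_square)
  qed
  show int: "integrable M (\<lambda>x. norm (F x) * norm (G x))"
  proof (rule Bochner_Integration.integrable_bound[OF Bochner_Integration.integrable_add[OF i]])
    show "(\<lambda>x. norm (F x) * norm (G x)) \<in> borel_measurable M" using m by measurable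
    have "a * b \<le> a\<^sup>2 + b\<^sup>2" if "a \<ge> 0" "b \<ge> 0" for a b :: real
      using ineq[of 1 a b] mult_nonneg_nonneg[OF that] by simp
    then show "AE x in M. norm (norm (F x) * norm (G x)) \<le> norm ((norm (F x))\<^sup>2 + (norm (G x))\<^sup>2)"
      by (intro AE_I2) simp
  qed
  let ?A = "l2 M F" and ?B = "l2 M G" and ?I = "LINT x|M. norm (F x) * norm (G x)"
  have le: "?I \<le> (t * ?A\<^sup>2 + ?B\<^sup>2 / t) / 2" if "t > 0" for t
  proof -
    have "?I \<le> (LINT x|M. (t * (norm (F x))\<^sup>2 + (norm (G x))\<^sup>2 / t) / 2)"
      by (rule integral_mono[OF int]) (use i ineq[OF that] in auto)
    also have "\<dots> = (t * ?A\<^sup>2 + ?B\<^sup>2 / t) / 2" using i by (simp add: l2_square)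
    finally show ?thesis .
  qed
  have A0: "?I \<le> ?A * ?B + s" if "s > 0" for s
  proof -
    \<comment> \<open>The optimal weight is \<open>B / A\<close>; both numbers are enlarged to keep it positive.\<close>
    have nn: "?A \<ge> 0" "?B \<ge> 0" by (auto simp: l2_nonneg)
    define d where "d = min 1 (s / (?A + ?B + 1))"
    have d: "d > 0" "d \<le> 1" "d * (?A + ?B + 1) \<le> s" proof -
      have c: "?A + ?B + 1 > 0" using nn by simp
      then show "d > 0" "d \<le> 1" using that by (auto simp: d_def)
      have "d \<le> s / (?A + ?B + 1)" by (simp add: d_def)
      then show "d * (?A + ?B + 1) \<le> s" using c by (simp add: pos_le_divide_eq)
    qed
    define t where "t = (?B + d) / (?A + d)"
    have t: "t > 0" using nn d by (auto simp: t_def intro!: divide_pos_pos add_nonneg_pos)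
    have "t * ?A\<^sup>2 \<le> t * (?A + d)\<^sup>2" using t nn d by (intro mult_left_mono power_mono) auto
    also have "\<dots> = (?B + d) * (?A + d)" using nn d by (simp add: t_def power2_eq_square field_simps)
    finally have 1: "t * ?A\<^sup>2 \<le> (?B + d) * (?A + d)" .
    have "?B\<^sup>2 / t \<le> (?B + d)\<^sup>2 / t" using t nn d by (intro divide_right_mono power_mono) auto
    also have "\<dots> = (?B + d) * (?A + d)" using nn d by (simp add: t_def power2_eq_square field_simps)
    finally have 2: "?B\<^sup>2 / t \<le> (?B + d) * (?A + d)" .
    have "?I \<le> (?B + d) * (?A + d)" using le[OF t] 1 2 by simp
    also have "\<dots> = ?A * ?B + d * (?A + ?B + d)" by (simp add: algebra_simps)
    also have "\<dots> \<le> ?A * ?B + d * (?A + ?B + 1)" using d nn by (intro add_left_mono mult_left_mono) auto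
    finally show ?thesis using d by linarith
  qed
  then show "?I \<le> ?A * ?B" by (rule field_le_epsilon)
qed

lemma sqint_add:
  assumes F: "sqint M F" and G: "sqint M G"
  shows "sqint M (\<lambda>x. F x + G x)" "l2 M (\<lambda>x. F x + G x) \<le> l2 M F + l2 M G"
proof -
  have m: "F \<in> borel_measurable M" "G \<in> borel_measurable M" using F G by (auto simp: sqint_def)
  have i: "integrable M (\<lambda>x. (norm (F x))\<^sup>2)" "integrable M (\<lambda>x. (norm (G x))\<^sup>2)" using F G by (auto simp: sqint_def)
  note p = product_integrable[OF F G]
  have I: "integrable M (\<lambda>x. (norm (F x))\<^sup>2 + 2 * (norm (F x) * norm (G x)) + (norm (G x))\<^sup>2)"
    using i p by simp
  have pw: "(norm (F x + G x))\<^sup>2 \<le> (norm (F x))\<^sup>2 + 2 * (norm (F x) * norm (G x)) + (norm (G x))\<^sup>2" for x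
    using power_mono[OF norm_triangle_ineq[of "F x" "G x"] norm_ge_zero, of 2] by (simp add: power2_sum)
  have J: "integrable M (\<lambda>x. (norm (F x + G x))\<^sup>2)"
  proof (rule Bochner_Integration.integrable_bound[OF I])
    show "AE x in M. norm ((norm (F x + G x))\<^sup>2) \<le> norm ((norm (F x))\<^sup>2 + 2 * (norm (F x) * norm (G x)) + (norm (G x))\<^sup>2)"
      using pw by (intro AE_I2) auto
  qed (use m in measurable)
  then show "sqint M (\<lambda>x. F x + G x)" using m by (simp add: sqint_def)
  have "(l2 M (\<lambda>x. F x + G x))\<^sup>2 \<le> (LINT x|M. (norm (F x))\<^sup>2 + 2 * (norm (F x) * norm (G x)) + (norm (G x))\<^sup>2)"
    unfolding l2_square by (rule integral_mono[OF J I pw])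
  also have "\<dots> = (l2 M F)\<^sup>2 + 2 * (LINT x|M. norm (F x) * norm (G x)) + (l2 M G)\<^sup>2"
    using i p by (simp add: l2_square)
  also have "\<dots> \<le> (l2 M F + l2 M G)\<^sup>2" using p(2) by (simp add: power2_sum)
  finally show "l2 M (\<lambda>x. F x + G x) \<le> l2 M F + l2 M G"
    by (rule power2_le_imp_le) (simp add: l2_nonneg)
qed

lemma sqint_mult:
  assumes F: "sqint M F" and m: "m \<in> borel_measurable M" and B: "\<And>x. x \<in> space M \<Longrightarrow> \<bar>m x\<bar> \<le> B" "B \<ge> 0"
  shows "sqint M (\<lambda>x. m x *\<^sub>R F x)" "l2 M (\<lambda>x. m x *\<^sub>R F x) \<le> B * l2 M F"
proof -
  have "(\<lambda>x. m x *\<^sub>R F x) \<in> borel_measurable M" using m F by (auto simp: sqint_def)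
  moreover have "AE x in M. norm (m x *\<^sub>R F x) \<le> B * norm (F x)"
    using B by (intro AE_I2) (auto intro: mult_right_mono)
  ultimately show "sqint M (\<lambda>x. m x *\<^sub>R F x)" "l2 M (\<lambda>x. m x *\<^sub>R F x) \<le> B * l2 M F"
    using sqint_dominated[OF F] B(2) by blast+
qed

lemma sqint_scale: "sqint M F \<Longrightarrow> sqint M (\<lambda>x. c *\<^sub>R F x)"
  using sqint_mult(1)[of M F "\<lambda>_. c" "\<bar>c\<bar>"] by simp

lemma l2_scale: "l2 M (\<lambda>x. c *\<^sub>R F x) = \<bar>c\<bar> * l2 M F"
  by (simp add: l2_def power_mult_distrib real_sqrt_mult)

lemma sqint_diff:
  assumes F: "sqint M F" and G: "sqint M G"
  shows "sqint M (\<lambda>x. F x - G x)" "l2 M (\<lambda>x. F x - G x) \<le> l2 M F + l2 M G"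
  using sqint_add[OF F sqint_scale[OF G, of "-1"]] l2_scale[of M "-1" G] by simp_all

lemma l2_diff_abs_le:
  assumes F: "sqint M F" and G: "sqint M G"
  shows "\<bar>l2 M F - l2 M G\<bar> \<le> l2 M (\<lambda>x. F x - G x)"
  using sqint_add(2)[OF sqint_diff(1)[OF F G] G] sqint_add(2)[OF sqint_diff(1)[OF G F] F] l2_minus_commute[of M F G]
  by simp

lemma bilinear_integrable:
  assumes F: "sqint M F" and G: "sqint M G" and b: "b \<in> borel_measurable M"
    and le: "AE x in M. \<bar>b x\<bar> \<le> c * (norm (F x) * norm (G x))" and c: "c \<ge> 0"
  shows "integrable M b" "\<bar>LINT x|M. b x\<bar> \<le> c * (l2 M F * l2 M G)"
proof -
  note p = product_integrable[OF F G]
  have i: "integrable M (\<lambda>x. c * (norm (F x) * norm (G x)))" using p(1) by simp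
  show ib: "integrable M b"
    by (rule Bochner_Integration.integrable_bound[OF i b]) (use le c in auto)
  have "\<bar>LINT x|M. b x\<bar> \<le> (LINT x|M. \<bar>b x\<bar>)" by (rule integral_abs_bound)
  also have "\<dots> \<le> (LINT x|M. c * (norm (F x) * norm (G x)))"
    by (rule integral_mono_AE[OF integrable_abs[OF ib] i le])
  also have "\<dots> \<le> c * (l2 M F * l2 M G)" using p(2) c by (simp add: mult_left_mono)
  finally show "\<bar>LINT x|M. b x\<bar> \<le> c * (l2 M F * l2 M G)" .
qed

lemma inner_integrable:
  assumes F: "sqint M F" and G: "sqint M G"
  shows "integrable M (\<lambda>x. F x \<bullet> G x)" "\<bar>LINT x|M. F x \<bullet> G x\<bar> \<le> l2 M F * l2 M G"
  using bilinear_integrable[OF F G, of "\<lambda>x. F x \<bullet> G x" 1] F G Cauchy_Schwarz_ineq2 by (auto simp: sqint_def)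

lemma norm_le_l2_finite:
  assumes "finite_measure M" and F: "sqint M F"
  shows "integrable M (\<lambda>x. norm (F x))" "(LINT x|M. norm (F x)) \<le> sqrt (measure M (space M)) * l2 M F"
proof -
  interpret finite_measure M by fact
  have 1: "sqint M (\<lambda>x. 1::real)" by (simp add: sqint_def)
  have "l2 M (\<lambda>x. 1::real) = sqrt (measure M (space M))" by (simp add: l2_def)
  then show "integrable M (\<lambda>x. norm (F x))" "(LINT x|M. norm (F x)) \<le> sqrt (measure M (space M)) * l2 M F"
    using product_integrable[OF 1 F] by simp_all
qed

lemma norm_vec_square: "(norm x)\<^sup>2 = (\<Sum>i\<in>UNIV. (norm (x $ i))\<^sup>2)" for x :: "'b::real_normed_vector ^ 'k"
  by (simp add: norm_vec_def L2_set_def sum_nonneg)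

lemma measurable_vec_nth:
  fixes F :: "'a \<Rightarrow> 'b::euclidean_space ^ 'k"
  assumes "F \<in> borel_measurable M" shows "(\<lambda>x. F x $ i) \<in> borel_measurable M"
proof -
  have "(\<lambda>v :: 'b ^ 'k. v $ i) \<in> borel_measurable borel"
    by (intro borel_measurable_continuous_onI continuous_intros)
  then show ?thesis using assms by (rule measurable_compose[rotated])
qed

lemma measurable_vec:
  fixes F :: "'a \<Rightarrow> 'b::euclidean_space ^ 'k"
  assumes m: "\<And>i. (\<lambda>x. F x $ i) \<in> borel_measurable M" shows "F \<in> borel_measurable M"
proof -
  have "(\<lambda>x. F x \<bullet> b) \<in> borel_measurable M" if b: "b \<in> Basis" for b
  proof -
    obtain i c where "b = axis i c" using b by (auto simp: Basis_vec_def)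
    then have "(\<lambda>x. F x \<bullet> b) = (\<lambda>x. F x $ i \<bullet> c)" by (simp add: inner_axis)
    then show ?thesis using m[of i] by simp
  qed
  then show ?thesis by (subst borel_measurable_euclidean_space) auto
qed

lemma sqint_vec:
  fixes F :: "'a \<Rightarrow> 'b::euclidean_space ^ 'k"
  assumes "\<And>i. sqint M (\<lambda>x. F x $ i)"
  shows "sqint M F" "(l2 M F)\<^sup>2 = (\<Sum>i\<in>UNIV. (l2 M (\<lambda>x. F x $ i))\<^sup>2)"
proof -
  have i: "integrable M (\<lambda>x. (norm (F x $ i))\<^sup>2)" for i using assms by (simp add: sqint_def)
  have m: "(\<lambda>x. F x $ i) \<in> borel_measurable M" for i using assms by (simp add: sqint_def)
  have "F \<in> borel_measurable M" by (rule measurable_vec[OF m])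
  then show "sqint M F" unfolding sqint_def norm_vec_square[where x = "F _"] using i by simp
  show "(l2 M F)\<^sup>2 = (\<Sum>i\<in>UNIV. (l2 M (\<lambda>x. F x $ i))\<^sup>2)"
    unfolding l2_square unfolding norm_vec_square[where x = "F _"] using i by simp
qed

lemma l2_vec_tendsto_0:
  fixes F :: "nat \<Rightarrow> 'a \<Rightarrow> 'b::euclidean_space ^ 'k"
  assumes "\<And>i k. sqint M (\<lambda>x. F k x $ i)" "\<And>i. (\<lambda>k. l2 M (\<lambda>x. F k x $ i)) \<longlonglongrightarrow> 0"
  shows "(\<lambda>k. l2 M (F k)) \<longlonglongrightarrow> 0"
proof -
  have eq: "l2 M (F k) = sqrt (\<Sum>i\<in>UNIV. (l2 M (\<lambda>x. F k x $ i))\<^sup>2)" for k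
    using sqint_vec(2)[of M "F k", OF assms(1)] l2_nonneg[of M "F k"] by (metis real_sqrt_unique)
  have "(\<lambda>k. sqrt (\<Sum>i\<in>UNIV. (l2 M (\<lambda>x. F k x $ i))\<^sup>2)) \<longlonglongrightarrow> sqrt (\<Sum>i\<in>(UNIV :: 'k set). 0\<^sup>2)"
    by (intro tendsto_intros assms(2))
  then show ?thesis by (simp add: eq)
qed

lemma tendsto_if_abs_diff_le:
  fixes a e :: "nat \<Rightarrow> real"
  assumes "\<And>k. \<bar>a k - L\<bar> \<le> e k" "e \<longlonglongrightarrow> 0"
  shows "a \<longlonglongrightarrow> L"
  by (rule LIM_zero_cancel, rule Lim_null_comparison[OF _ assms(2)]) (simp add: assms(1))

lemma inner_tendsto:
  assumes F: "sqint M F" and G: "sqint M G" "\<And>k. sqint M (H k)" and lim: "(\<lambda>k. l2 M (\<lambda>x. H k x - G x)) \<longlonglongrightarrow> 0"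
  shows "(\<lambda>k. LINT x|M. F x \<bullet> H k x) \<longlonglongrightarrow> (LINT x|M. F x \<bullet> G x)"
proof (rule tendsto_if_abs_diff_le)
  fix k
  have "(LINT x|M. F x \<bullet> H k x) - (LINT x|M. F x \<bullet> G x) = (LINT x|M. F x \<bullet> (H k x - G x))"
    using inner_integrable(1)[OF F G(1)] inner_integrable(1)[OF F G(2)] by (simp add: inner_diff_right)
  then show "\<bar>(LINT x|M. F x \<bullet> H k x) - (LINT x|M. F x \<bullet> G x)\<bar> \<le> l2 M F * l2 M (\<lambda>x. H k x - G x)"
    using inner_integrable(2)[OF F sqint_diff(1)[OF G(2) G(1)]] by simp
next
  show "(\<lambda>k. l2 M F * l2 M (\<lambda>x. H k x - G x)) \<longlonglongrightarrow> 0" using tendsto_mult_right_zero[OF lim] .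
qed

section \<open>Approximation in the Sobolev spaces\<close>

lemma integrable_on_subset:
  fixes f :: "'a::euclidean_space \<Rightarrow> 'b::euclidean_space"
  assumes "S \<in> sets lebesgue" "T \<in> sets lebesgue" "S \<subseteq> T" "integrable (lebesgue_on T) f"
  shows "integrable (lebesgue_on S) f"
proof -
  have "integrable lebesgue (\<lambda>x. indicator T x *\<^sub>R f x)" using assms(2,4) by (simp add: integrable_restrict_space)
  then have "integrable lebesgue (\<lambda>x. indicator S x *\<^sub>R (indicator T x *\<^sub>R f x))"
    by (rule integrable_mult_indicator[OF assms(1)])
  moreover have "(\<lambda>x. indicator S x *\<^sub>R (indicator T x *\<^sub>R f x)) = (\<lambda>x. indicator S x *\<^sub>R f x)"
    using assms(3) by (auto simp: indicator_def fun_eq_iff)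
  ultimately show ?thesis using assms(1) by (simp add: integrable_restrict_space)
qed

lemma integral_on_subset_le:
  fixes f :: "'a::euclidean_space \<Rightarrow> real"
  assumes "S \<in> sets lebesgue" "T \<in> sets lebesgue" "S \<subseteq> T" "integrable (lebesgue_on T) f" "\<And>x. x \<in> T \<Longrightarrow> f x \<ge> 0"
  shows "(LINT x|lebesgue_on S. f x) \<le> (LINT x|lebesgue_on T. f x)"
proof -
  have i: "integrable lebesgue (\<lambda>x. indicator T x *\<^sub>R f x)" "integrable lebesgue (\<lambda>x. indicator S x *\<^sub>R f x)"
    using assms integrable_on_subset[OF assms(1-4)] by (simp_all add: integrable_restrict_space)
  have "(LINT x|lebesgue. indicator S x *\<^sub>R f x) \<le> (LINT x|lebesgue. indicator T x *\<^sub>R f x)"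
    by (rule integral_mono[OF i(2,1)]) (use assms(3,5) in \<open>auto simp: indicator_def\<close>)
  then show ?thesis using assms(1,2) by (simp add: integral_restrict_space)
qed

lemma sqint_on_subset:
  fixes F :: "'a::euclidean_space \<Rightarrow> 'b::euclidean_space"
  assumes "S \<in> sets lebesgue" "T \<in> sets lebesgue" "S \<subseteq> T" "sqint (lebesgue_on T) F"
  shows "sqint (lebesgue_on S) F" "l2 (lebesgue_on S) F \<le> l2 (lebesgue_on T) F"
proof -
  have "F \<in> borel_measurable (lebesgue_on S)" using assms(3,4) measurable_restrict_mono by (auto simp: sqint_def)
  then show "sqint (lebesgue_on S) F"
    using assms(4) integrable_on_subset[OF assms(1-3)] by (auto simp: sqint_def)
  show "l2 (lebesgue_on S) F \<le> l2 (lebesgue_on T) F"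
    unfolding l2_def using assms(4) by (intro real_sqrt_le_mono integral_on_subset_le assms(1-3)) (auto simp: sqint_def)
qed

lemma norm_powr_2: "norm x powr 2 = (norm x)\<^sup>2"
  by (cases "norm x = 0") (auto simp: powr_numeral)

lemma Lp_2_iff: "f \<in> Lp 2 U \<longleftrightarrow> sqint (lebesgue_on U) f"
  by (simp add: Lp_def sqint_def norm_powr_2)

lemma Lp_norm_2: "Lp_norm 2 U f = l2 (lebesgue_on U) f"
  by (simp add: Lp_norm_def l2_def norm_powr_2 powr_half_sqrt)

lemma Lp_diff:
  fixes f g :: "real^'n \<Rightarrow> real"
  assumes p: "p \<ge> 0" and f: "f \<in> Lp p U" and g: "g \<in> Lp p U"
  shows "(\<lambda>x. f x - g x) \<in> Lp p U"
proof -
  have m: "f \<in> borel_measurable (lebesgue_on U)" "g \<in> borel_measurable (lebesgue_on U)" using f g by (auto simp: Lp_def)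
  have le: "\<bar>a - b\<bar> powr p \<le> 2 powr p * (\<bar>a\<bar> powr p + \<bar>b\<bar> powr p)" for a b :: real
  proof -
    have "\<bar>a - b\<bar> powr p \<le> (2 * max \<bar>a\<bar> \<bar>b\<bar>) powr p" using p by (intro powr_mono2) auto
    also have "\<dots> = 2 powr p * max \<bar>a\<bar> \<bar>b\<bar> powr p" by (simp add: powr_mult)
    also have "\<dots> \<le> 2 powr p * (\<bar>a\<bar> powr p + \<bar>b\<bar> powr p)"
      by (intro mult_left_mono) (auto simp: max_def)
    finally show ?thesis .
  qed
  have i: "integrable (lebesgue_on U) (\<lambda>x. 2 powr p * (norm (f x) powr p + norm (g x) powr p))"
    using f g by (auto simp: Lp_def)
  have "integrable (lebesgue_on U) (\<lambda>x. norm (f x - g x) powr p)"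
    by (rule Bochner_Integration.integrable_bound[OF i]) (use m le in \<open>auto intro!: AE_I2\<close>)
  then show ?thesis using m by (simp add: Lp_def)
qed

text \<open>On sets of finite measure, the \<open>L\<^sup>p\<close> norm with \<open>p \<ge> 2\<close> controls the \<open>L\<^sup>2\<close> norm: where \<open>\<bar>f\<bar> \<le> d\<close> use
  this bound, and elsewhere \<open>\<bar>f\<bar>\<^sup>2 \<le> d\<^bsup>2-p\<^esup> \<bar>f\<bar>\<^sup>p\<close>. The free parameter \<open>d\<close> replaces Hoelder's
  inequality.\<close>

lemma Lp_imp_L2:
  fixes f :: "real^'n \<Rightarrow> real"
  assumes p: "p \<ge> 2" and f: "f \<in> Lp p U" and S: "S \<in> lmeasurable" "S \<subseteq> U" and U: "U \<in> sets lebesgue" and d: "d > 0"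
  shows "sqint (lebesgue_on S) f"
    "(l2 (lebesgue_on S) f)\<^sup>2 \<le> d\<^sup>2 * measure lebesgue S + d powr (2 - p) * Lp_norm p U f powr p"
proof -
  have Sm: "S \<in> sets lebesgue" using S by auto
  have le: "a\<^sup>2 \<le> d\<^sup>2 + d powr (2 - p) * \<bar>a\<bar> powr p" for a :: real
  proof (cases "\<bar>a\<bar> \<le> d")
    case True
    then have "\<bar>a\<bar>\<^sup>2 \<le> d\<^sup>2" by (intro power_mono) auto
    then show ?thesis by (simp add: add_increasing2)
  next
    case False
    then have a: "\<bar>a\<bar> > 0" using d by linarith
    have "a\<^sup>2 = \<bar>a\<bar> powr (2 - p) * \<bar>a\<bar> powr p"
      using a by (simp flip: powr_add)
    also have "\<dots> \<le> d powr (2 - p) * \<bar>a\<bar> powr p"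
      using False d p by (intro mult_right_mono powr_mono2') auto
    finally show ?thesis by (simp add: add_increasing)
  qed
  have fm: "f \<in> borel_measurable (lebesgue_on S)" using f S(2) measurable_restrict_mono by (auto simp: Lp_def)
  have iU: "integrable (lebesgue_on U) (\<lambda>x. norm (f x) powr p)" using f by (simp add: Lp_def)
  then have iS: "integrable (lebesgue_on S) (\<lambda>x. norm (f x) powr p)" by (rule integrable_on_subset[OF Sm U S(2)])
  interpret finite_measure "lebesgue_on S" by (rule finite_measure_lebesgue_on[OF S(1)])
  have I: "integrable (lebesgue_on S) (\<lambda>x. d\<^sup>2 + d powr (2 - p) * norm (f x) powr p)" using iS by simp
  have J: "integrable (lebesgue_on S) (\<lambda>x. (norm (f x))\<^sup>2)"
    by (rule Bochner_Integration.integrable_bound[OF I]) (use fm le in \<open>auto intro!: AE_I2\<close>)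
  then show "sqint (lebesgue_on S) f" using fm by (simp add: sqint_def)
  have "(l2 (lebesgue_on S) f)\<^sup>2 \<le> (LINT x|lebesgue_on S. d\<^sup>2 + d powr (2 - p) * norm (f x) powr p)"
    unfolding l2_square by (rule integral_mono[OF J I]) (use le in auto)
  also have "\<dots> = d\<^sup>2 * measure lebesgue S + d powr (2 - p) * (LINT x|lebesgue_on S. norm (f x) powr p)"
    using iS Sm by (simp add: measure_restrict_space)
  also have "(LINT x|lebesgue_on S. norm (f x) powr p) \<le> (LINT x|lebesgue_on U. norm (f x) powr p)"
    by (rule integral_on_subset_le[OF Sm U S(2) iU]) simp
  also have "(LINT x|lebesgue_on U. norm (f x) powr p) = Lp_norm p U f powr p"
    using p by (simp add: Lp_norm_def powr_powr integral_nonneg_AE)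
  finally show "(l2 (lebesgue_on S) f)\<^sup>2 \<le> d\<^sup>2 * measure lebesgue S + d powr (2 - p) * Lp_norm p U f powr p"
    by (simp add: mult_left_mono)
qed

lemma small_Lp_imp_small_L2:
  fixes S U :: "(real^'n) set"
  assumes p: "p \<ge> 2" and S: "S \<in> lmeasurable" "S \<subseteq> U" and U: "U \<in> sets lebesgue" and e: "e > 0"
  shows "\<exists>\<eta>>0. \<forall>f::real^'n \<Rightarrow> real. f \<in> Lp p U \<longrightarrow> Lp_norm p U f < \<eta> \<longrightarrow> l2 (lebesgue_on S) f < e"
proof -
  define \<mu> where "\<mu> = measure lebesgue S"
  have \<mu>: "\<mu> \<ge> 0" by (simp add: \<mu>_def)
  define d where "d = e / sqrt (2 * (\<mu> + 1))"
  have d: "d > 0" using e \<mu> by (simp add: d_def)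
  have "d\<^sup>2 * (2 * (\<mu> + 1)) = e\<^sup>2" using \<mu> by (simp add: d_def power_divide)
  then have "e\<^sup>2 = 2 * d\<^sup>2 + 2 * (d\<^sup>2 * \<mu>)" by (simp add: algebra_simps)
  then have d2: "d\<^sup>2 * \<mu> \<le> e\<^sup>2 / 2" using zero_le_power2[of d] by linarith
  define c where "c = d powr (2 - p)"
  have c: "c > 0" using d by (simp add: c_def)
  define \<eta> where "\<eta> = (e\<^sup>2 / 2 / c) powr (1 / p)"
  have \<eta>: "\<eta> > 0" using e c by (simp add: \<eta>_def)
  have "l2 (lebesgue_on S) f < e" if f: "f \<in> Lp p U" "Lp_norm p U f < \<eta>" for f :: "real^'n \<Rightarrow> real"
  proof -
    have "Lp_norm p U f powr p < \<eta> powr p" using f(2) p by (intro powr_less_mono2) (auto simp: Lp_norm_def)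
    also have "\<eta> powr p = e\<^sup>2 / 2 / c" using p e c by (simp add: \<eta>_def powr_powr)
    finally have "c * Lp_norm p U f powr p < e\<^sup>2 / 2" using c by (simp add: field_simps)
    then have "(l2 (lebesgue_on S) f)\<^sup>2 < e\<^sup>2"
      using Lp_imp_L2(2)[OF p f(1) S U d] d2 unfolding c_def[symmetric] \<mu>_def[symmetric] by linarith
    then show ?thesis using e by (simp add: power_less_imp_less_base)
  qed
  then show ?thesis using \<eta> by blast
qed

lemma sobolev_exp_ge_2: "CARD('n::finite) \<ge> 3 \<Longrightarrow> sobolev_exp TYPE('n) \<ge> 2"
  by (simp add: sobolev_exp_def field_simps)

lemma L1_loc_measurable:
  fixes f :: "real^'n \<Rightarrow> 'b::euclidean_space"
  assumes U: "open U" and f: "f \<in> L1_loc U"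
  shows "f \<in> borel_measurable (lebesgue_on U)"
proof -
  obtain C where C: "\<And>n::nat. compact (C n)" "\<And>n. C n \<subseteq> U" "\<Union>(range C) = U"
    using open_Union_compact_subsets[OF U] by metis
  show ?thesis
  proof (rule measurable_piecewise_restrict[where C = "range C"])
    show "A \<inter> space (lebesgue_on U) \<in> sets (lebesgue_on U)" if A: "A \<in> range C" for A
    proof -
      have "A \<in> sets lebesgue" "A \<subseteq> U" using A C compact_sets_lebesgue by auto
      then show ?thesis using U by (simp add: sets_restrict_space_iff Int_absorb2)
    qed
    show "f \<in> borel_measurable (restrict_space (lebesgue_on U) A)" if A: "A \<in> range C" for A
    proof -
      have AU: "A \<in> sets lebesgue" "A \<subseteq> U" "compact A" using A C compact_sets_lebesgue by auto
      have "restrict_space (lebesgue_on U) A = lebesgue_on A"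
        using AU U by (subst restrict_restrict_space) (auto simp: Int_absorb1)
      moreover have "integrable (lebesgue_on A) f"
        using f AU unfolding L1_loc_def set_integrable_def by (subst integrable_restrict_space) auto
      ultimately show ?thesis by auto
    qed
  qed (use C(3) in auto)
qed

lemma wgrad_diff_sqint:
  fixes u \<phi> :: "real^'n \<Rightarrow> real"
  assumes U: "open U" and u: "weakly_differentiable U u" "wgrad U u \<in> Lp 2 U" and \<phi>: "smooth_on U \<phi>" "grad \<phi> \<in> Lp 2 U"
  shows "l2 (lebesgue_on U) (\<lambda>x. grad \<phi> x - wgrad U u x) = Lp_norm 2 U (wgrad U (\<lambda>x. u x - \<phi> x))"
proof -
  have d: "has_weak_grad U (\<lambda>x. u x - \<phi> x) (\<lambda>x. wgrad U u x - grad \<phi> x)"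
    by (rule has_weak_grad_diff[OF U has_weak_grad_wgrad[OF u(1)] has_weak_grad_smooth[OF U \<phi>(1)]])
  have "has_weak_grad U (\<lambda>x. u x - \<phi> x) (wgrad U (\<lambda>x. u x - \<phi> x))"
    by (rule has_weak_grad_wgrad) (use d in \<open>auto simp: weakly_differentiable_def\<close>)
  then have "wgrad U (\<lambda>x. u x - \<phi> x) \<in> borel_measurable (lebesgue_on U)"
    by (intro L1_loc_measurable[OF U]) (simp add: has_weak_grad_def)
  moreover have "wgrad U u \<in> borel_measurable (lebesgue_on U)" "grad \<phi> \<in> borel_measurable (lebesgue_on U)"
    using u \<phi> by (auto simp: Lp_def)
  moreover have "AE x in lebesgue_on U. wgrad U (\<lambda>x. u x - \<phi> x) x = wgrad U u x - grad \<phi> x"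
    by (rule wgrad_diff_smooth[OF U u(1) \<phi>(1)])
  ultimately show ?thesis
    unfolding Lp_norm_2 l2_minus_commute[of _ "grad \<phi>"] unfolding l2_def
    by (intro arg_cong[where f = sqrt] integral_cong_AE) auto
qed

definition cjac :: "(real^'n::finite \<Rightarrow> real^'m::finite) \<Rightarrow> real^'n \<Rightarrow> real^'n^'m" where
  "cjac \<phi> x = (\<chi> j. grad (\<lambda>z. \<phi> z $ j) x)"

text \<open>Approximation in the \<open>Y\<^sup>1\<^sup>,\<^sup>2\<close> norm, componentwise and by functions from a class \<open>C\<close>, becomes one
  sequence of vector-valued functions that converges in \<open>L\<^sup>2\<close> together with its derivatives. The
  members of \<open>C\<close> have to be integrable to the relevant powers, because the norm is defined by a
  Bochner integral, which is zero for non-integrable functions: a small norm of the difference says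
  nothing unless the difference lies in the space. In applications \<open>C\<close> consists of the test functions
  in \<open>U\<close> or of the functions vanishing near a part of the boundary.\<close>

lemma Y12_approximation:
  fixes v :: "real^'n \<Rightarrow> real^'m"
  assumes n: "CARD('n) \<ge> 3" and U: "open U" and S: "S \<in> lmeasurable" "S \<subseteq> U"
    and v: "\<And>i. (\<lambda>x. v x $ i) \<in> Y12 U"
    and C: "\<And>\<phi>. \<phi> \<in> C \<Longrightarrow> smooth_on U \<phi>" "\<And>\<phi>. \<phi> \<in> C \<Longrightarrow> \<phi> \<in> Lp (sobolev_exp TYPE('n)) U" "\<And>\<phi>. \<phi> \<in> C \<Longrightarrow> grad \<phi> \<in> Lp 2 U"
    and approx: "\<And>i \<epsilon>. \<epsilon> > 0 \<Longrightarrow> \<exists>\<phi>\<in>C. Y12_norm U (\<lambda>x. v x $ i - \<phi> x) < \<epsilon>"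
  obtains \<psi> where "\<And>k i. (\<lambda>x. \<psi> k x $ i) \<in> C"
    "\<And>k. sqint (lebesgue_on U) (cjac (\<psi> k))" "\<And>k. sqint (lebesgue_on S) (\<psi> k)"
    "sqint (lebesgue_on U) (wjac U v)" "sqint (lebesgue_on S) v"
    "(\<lambda>k. l2 (lebesgue_on S) (\<lambda>x. \<psi> k x - v x)) \<longlonglongrightarrow> 0"
    "(\<lambda>k. l2 (lebesgue_on U) (\<lambda>x. cjac (\<psi> k) x - wjac U v x)) \<longlonglongrightarrow> 0"
proof -
  let ?p = "sobolev_exp TYPE('n)"
  have p: "?p \<ge> 2" by (rule sobolev_exp_ge_2[OF n])
  have Um: "U \<in> sets lebesgue" using U by auto
  have v': "weakly_differentiable U (\<lambda>x. v x $ i)" "(\<lambda>x. v x $ i) \<in> Lp ?p U" "wgrad U (\<lambda>x. v x $ i) \<in> Lp 2 U" for i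
    using v[of i] by (auto simp: Y12_def)
  have "\<exists>\<phi>\<in>C. l2 (lebesgue_on S) (\<lambda>x. \<phi> x - v x $ i) < inverse (real (Suc k)) \<and>
      l2 (lebesgue_on U) (\<lambda>x. grad \<phi> x - wgrad U (\<lambda>z. v z $ i) x) < inverse (real (Suc k))" for k i
  proof -
    have e: "inverse (real (Suc k)) > 0" by simp
    obtain \<eta> where \<eta>: "\<eta> > 0" "\<And>f::real^'n \<Rightarrow> real. f \<in> Lp ?p U \<Longrightarrow> Lp_norm ?p U f < \<eta> \<Longrightarrow> l2 (lebesgue_on S) f < inverse (real (Suc k))"
      using small_Lp_imp_small_L2[OF p S Um e] by blast
    obtain \<phi> where \<phi>: "\<phi> \<in> C" "Y12_norm U (\<lambda>x. v x $ i - \<phi> x) < min \<eta> (inverse (real (Suc k)))"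
      using approx[of "min \<eta> (inverse (real (Suc k)))" i] \<eta>(1) e by auto
    have nn: "Lp_norm ?p U (\<lambda>x. v x $ i - \<phi> x) \<ge> 0" "Lp_norm 2 U (wgrad U (\<lambda>x. v x $ i - \<phi> x)) \<ge> 0"
      by (auto simp: Lp_norm_def)
    have "(\<lambda>x. v x $ i - \<phi> x) \<in> Lp ?p U" using p by (intro Lp_diff v' C \<phi>(1)) simp
    moreover have "Lp_norm ?p U (\<lambda>x. v x $ i - \<phi> x) < \<eta>" using \<phi>(2) nn by (simp add: Y12_norm_def)
    ultimately have "l2 (lebesgue_on S) (\<lambda>x. v x $ i - \<phi> x) < inverse (real (Suc k))" by (rule \<eta>(2))
    then have 1: "l2 (lebesgue_on S) (\<lambda>x. \<phi> x - v x $ i) < inverse (real (Suc k))" by (subst l2_minus_commute)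
    have "Lp_norm 2 U (wgrad U (\<lambda>x. v x $ i - \<phi> x)) < inverse (real (Suc k))" using \<phi>(2) nn by (simp add: Y12_norm_def)
    then have "l2 (lebesgue_on U) (\<lambda>x. grad \<phi> x - wgrad U (\<lambda>z. v z $ i) x) < inverse (real (Suc k))"
      using wgrad_diff_sqint[OF U v'(1,3) C(1,3)[OF \<phi>(1)], of i] by simp
    then show ?thesis using 1 \<phi>(1) by blast
  qed
  then have "\<forall>k i. \<exists>\<phi>. \<phi> \<in> C \<and> l2 (lebesgue_on S) (\<lambda>x. \<phi> x - v x $ i) < inverse (real (Suc k)) \<and>
      l2 (lebesgue_on U) (\<lambda>x. grad \<phi> x - wgrad U (\<lambda>z. v z $ i) x) < inverse (real (Suc k))" by blast
  then have "\<forall>k. \<exists>F. \<forall>i. F i \<in> C \<and> l2 (lebesgue_on S) (\<lambda>x. F i x - v x $ i) < inverse (real (Suc k)) \<and>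
      l2 (lebesgue_on U) (\<lambda>x. grad (F i) x - wgrad U (\<lambda>z. v z $ i) x) < inverse (real (Suc k))"
    by (intro allI choice) blast
  from choice[OF this] obtain \<Phi> where
    \<Phi>: "\<And>k i. \<Phi> k i \<in> C" "\<And>k i. l2 (lebesgue_on S) (\<lambda>x. \<Phi> k i x - v x $ i) < inverse (real (Suc k))"
      "\<And>k i. l2 (lebesgue_on U) (\<lambda>x. grad (\<Phi> k i) x - wgrad U (\<lambda>z. v z $ i) x) < inverse (real (Suc k))" by blast
  define \<psi> where "\<psi> k x = (\<chi> i. \<Phi> k i x)" for k x
  have comp: "(\<lambda>x. \<psi> k x $ i) = \<Phi> k i" for k i by (simp add: \<psi>_def)
  have lim: "(\<lambda>k. inverse (real (Suc k))) \<longlonglongrightarrow> 0" by (rule LIMSEQ_inverse_real_of_nat)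
  have sqD: "sqint (lebesgue_on U) (\<lambda>x. cjac (\<psi> k) x $ i)" for k i
    using C(3)[OF \<Phi>(1)] by (simp add: cjac_def comp Lp_2_iff)
  have sqW: "sqint (lebesgue_on U) (\<lambda>x. wjac U v x $ i)" for i
    using v'(3)[of i] by (simp add: wjac_def Lp_2_iff)
  have sqS: "sqint (lebesgue_on S) (\<lambda>x. \<psi> k x $ i)" for k i
    using Lp_imp_L2(1)[OF p C(2)[OF \<Phi>(1)] S Um, of 1] by (simp add: comp)
  have sqv: "sqint (lebesgue_on S) (\<lambda>x. v x $ i)" for i
    using Lp_imp_L2(1)[OF p v'(2) S Um, of 1] by simp
  show ?thesis
  proof (rule that)
    show "(\<lambda>x. \<psi> k x $ i) \<in> C" for k i using \<Phi>(1) by (simp add: comp)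
    show "sqint (lebesgue_on U) (cjac (\<psi> k))" for k by (rule sqint_vec(1)[OF sqD])
    show "sqint (lebesgue_on U) (wjac U v)" by (rule sqint_vec(1)[OF sqW])
    show "sqint (lebesgue_on S) (\<psi> k)" for k by (rule sqint_vec(1)[OF sqS])
    show "sqint (lebesgue_on S) v" by (rule sqint_vec(1)[OF sqv])
    show "(\<lambda>k. l2 (lebesgue_on S) (\<lambda>x. \<psi> k x - v x)) \<longlonglongrightarrow> 0"
    proof (rule l2_vec_tendsto_0)
      show "sqint (lebesgue_on S) (\<lambda>x. (\<psi> k x - v x) $ i)" for i k
        using sqint_diff(1)[OF sqS sqv] by simp
      show "(\<lambda>k. l2 (lebesgue_on S) (\<lambda>x. (\<psi> k x - v x) $ i)) \<longlonglongrightarrow> 0" for i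
        by (rule tendsto_if_abs_diff_le[OF _ lim]) (use \<Phi>(2) in \<open>auto simp: comp l2_nonneg less_imp_le \<psi>_def\<close>)
    qed
    show "(\<lambda>k. l2 (lebesgue_on U) (\<lambda>x. cjac (\<psi> k) x - wjac U v x)) \<longlonglongrightarrow> 0"
    proof (rule l2_vec_tendsto_0)
      show "sqint (lebesgue_on U) (\<lambda>x. (cjac (\<psi> k) x - wjac U v x) $ i)" for i k
        using sqint_diff(1)[OF sqD sqW] by simp
      show "(\<lambda>k. l2 (lebesgue_on U) (\<lambda>x. (cjac (\<psi> k) x - wjac U v x) $ i)) \<longlonglongrightarrow> 0" for i
        by (rule tendsto_if_abs_diff_le[OF _ lim]) (use \<Phi>(3) in \<open>auto simp: comp cjac_def wjac_def l2_nonneg less_imp_le\<close>)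
    qed
  qed
qed

lemma bounded_supp_integrable:
  fixes f :: "real^'n \<Rightarrow> real"
  assumes f: "f \<in> borel_measurable (lebesgue_on U)" and K: "K \<in> lmeasurable" and U: "U \<in> sets lebesgue"
    and B: "\<And>x. x \<in> U \<Longrightarrow> \<bar>f x\<bar> \<le> B" and 0: "\<And>x. x \<in> U \<Longrightarrow> x \<notin> K \<Longrightarrow> f x = 0"
  shows "integrable (lebesgue_on U) f"
proof (rule Bochner_Integration.integrable_bound[OF _ f])
  have "integrable lebesgue (\<lambda>x. \<bar>B\<bar> * indicator K x :: real)"
    using K by (intro integrable_mult_right integrable_real_indicator) (auto simp: fmeasurable_def)
  then show "integrable (lebesgue_on U) (\<lambda>x. \<bar>B\<bar> * indicator K x :: real)" by (rule integrable_lebesgue_imp_on[OF U])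
  show "AE x in lebesgue_on U. norm (f x) \<le> norm (\<bar>B\<bar> * indicator K x :: real)"
  proof (rule AE_I2)
    fix x assume "x \<in> space (lebesgue_on U)"
    then show "norm (f x) \<le> norm (\<bar>B\<bar> * indicator K x :: real)"
      using B[of x] 0[of x] by (cases "x \<in> K") auto
  qed
qed

lemma bounded_supp_Lp:
  fixes f :: "real^'n \<Rightarrow> 'b::euclidean_space"
  assumes p: "p > 0" and f: "f \<in> borel_measurable (lebesgue_on U)" and K: "K \<in> lmeasurable" and U: "U \<in> sets lebesgue"
    and B: "\<And>x. x \<in> U \<Longrightarrow> norm (f x) \<le> B" and 0: "\<And>x. x \<in> U \<Longrightarrow> x \<notin> K \<Longrightarrow> f x = 0"
  shows "f \<in> Lp p U"
proof -
  have "integrable (lebesgue_on U) (\<lambda>x. norm (f x) powr p)"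
  proof (rule bounded_supp_integrable[OF _ K U, where B = "\<bar>B\<bar> powr p"])
    show "(\<lambda>x. norm (f x) powr p) \<in> borel_measurable (lebesgue_on U)" using f by measurable
    show "\<bar>norm (f x) powr p\<bar> \<le> \<bar>B\<bar> powr p" if "x \<in> U" for x
      using B[OF that] p by (auto intro!: powr_mono2)
  qed (use 0 p in auto)
  then show ?thesis using f by (simp add: Lp_def)
qed

lemma grad_norm_le:
  fixes f :: "real^'n \<Rightarrow> real"
  shows "norm (grad f x) \<le> (\<Sum>\<alpha>\<in>UNIV. \<bar>pderiv_at \<alpha> f x\<bar>)"
  using norm_le_l1_cart[of "grad f x"] by (simp add: grad_component)

lemma continuous_on_open_measurable:
  fixes f :: "real^'n \<Rightarrow> 'b::euclidean_space"
  assumes "open U" "continuous_on U f" shows "f \<in> borel_measurable (lebesgue_on U)"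
  using assms by (intro continuous_imp_measurable_on_sets_lebesgue) auto

lemma Cc_inf_grad_zero:
  assumes "\<phi> \<in> Cc_inf U" obtains K where "compact K" "K \<subseteq> U" "\<And>x. x \<notin> K \<Longrightarrow> \<phi> x = 0" "\<And>x. x \<notin> K \<Longrightarrow> grad \<phi> x = 0"
proof -
  obtain K where K: "compact K" "K \<subseteq> U" "\<And>x. x \<notin> K \<Longrightarrow> \<phi> x = 0" by (rule Cc_infE[OF assms]) blast
  have "grad \<phi> x = 0" if "x \<notin> K" for x
  proof -
    have "pderiv_at \<alpha> \<phi> x = pderiv_at \<alpha> (\<lambda>x. 0) x" for \<alpha>
      using K that by (intro pderiv_cong[of "- K"]) (auto simp: compact_imp_closed)
    then show ?thesis by (simp add: grad_def pderiv_zero vec_eq_iff)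
  qed
  then show ?thesis using that K by blast
qed

lemma Cc_inf_grad_bounded:
  fixes \<phi> :: "real^'n \<Rightarrow> real"
  assumes "\<phi> \<in> Cc_inf U" shows "\<exists>B. \<forall>x. norm (grad \<phi> x) \<le> B"
proof -
  have "\<exists>B. \<forall>x. \<bar>pderiv_at \<alpha> \<phi> x\<bar> \<le> B" for \<alpha>
    by (rule Cc_inf_bounded[OF Cc_inf_pderiv[OF assms, of \<alpha>]]) blast
  then obtain B where B: "\<And>\<alpha> x. \<bar>pderiv_at \<alpha> \<phi> x\<bar> \<le> B \<alpha>" by metis
  have "norm (grad \<phi> x) \<le> (\<Sum>\<alpha>\<in>UNIV. B \<alpha>)" for x
    using grad_norm_le[of \<phi> x] sum_mono[of UNIV "\<lambda>\<alpha>. \<bar>pderiv_at \<alpha> \<phi> x\<bar>" B] B by force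
  then show ?thesis by blast
qed

lemma Cc_inf_class:
  fixes \<phi> :: "real^'n \<Rightarrow> real"
  assumes U: "open U" and \<phi>: "\<phi> \<in> Cc_inf U" and p: "p > 0"
  shows "smooth_on U \<phi>" "\<phi> \<in> Lp p U" "grad \<phi> \<in> Lp 2 U"
proof -
  show s: "smooth_on U \<phi>" using Cc_inf_smooth[OF \<phi>] smooth_on_subset by blast
  obtain K where K: "compact K" "K \<subseteq> U" "\<And>x. x \<notin> K \<Longrightarrow> \<phi> x = 0" "\<And>x. x \<notin> K \<Longrightarrow> grad \<phi> x = 0" by (rule Cc_inf_grad_zero[OF \<phi>]) blast
  obtain B where B: "\<And>x. \<bar>\<phi> x\<bar> \<le> B" by (rule Cc_inf_bounded[OF \<phi>]) blast
  obtain B' where B': "\<And>x. norm (grad \<phi> x) \<le> B'" using Cc_inf_grad_bounded[OF \<phi>] by blast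
  have Um: "U \<in> sets lebesgue" using U by auto
  show "\<phi> \<in> Lp p U"
    using continuous_on_open_measurable[OF U smooth_on_continuous[OF s]] K(3) B
    by (intro bounded_supp_Lp[OF p _ lmeasurable_compact[OF K(1)] Um, of _ B]) auto
  show "grad \<phi> \<in> Lp 2 U"
    using continuous_on_open_measurable[OF U grad_continuous_on[OF s]] K(4) B'
    by (intro bounded_supp_Lp[OF _ _ lmeasurable_compact[OF K(1)] Um, of _ _ B']) auto
qed

text \<open>All derivatives extend continuously to the closure of \<open>U\<close>, which is compact as \<open>U\<close> is bounded; hence
  they are bounded in \<open>U\<close>, a set of finite measure.\<close>

lemma Cc_inf_closure_class:
  fixes \<phi> :: "real^'n \<Rightarrow> real"
  assumes U: "open U" "bounded U" and \<phi>: "\<phi> \<in> Cc_inf_closure U \<Sigma>" and p: "p > 0"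
  shows "smooth_on U \<phi>" "\<phi> \<in> Lp p U" "grad \<phi> \<in> Lp 2 U"
proof -
  show s: "smooth_on U \<phi>" using \<phi> by (simp add: Cc_inf_closure_def)
  have bd: "\<exists>B. \<forall>x\<in>U. \<bar>iter_pderiv as \<phi> x\<bar> \<le> B" for as
  proof -
    obtain g where g: "continuous_on (closure U) g" "\<And>x. x \<in> U \<Longrightarrow> g x = iter_pderiv as \<phi> x"
      using \<phi> unfolding Cc_inf_closure_def by blast
    have "compact (closure U)" using U(2) by simp
    then have "bounded (g ` closure U)" using compact_continuous_image[OF g(1)] compact_imp_bounded by blast
    then obtain B where "\<And>x. x \<in> closure U \<Longrightarrow> \<bar>g x\<bar> \<le> B" unfolding bounded_iff by auto
    then show ?thesis using g(2) closure_subset by (metis subsetD)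
  qed
  obtain B where B: "\<And>x. x \<in> U \<Longrightarrow> \<bar>\<phi> x\<bar> \<le> B" using bd[of "[]"] by auto
  have "\<forall>\<alpha>. \<exists>B. \<forall>x\<in>U. \<bar>pderiv_at \<alpha> \<phi> x\<bar> \<le> B" using bd[of "[\<alpha>]" for \<alpha>] by simp
  from choice[OF this] obtain B' where B': "\<And>\<alpha> x. x \<in> U \<Longrightarrow> \<bar>pderiv_at \<alpha> \<phi> x\<bar> \<le> B' \<alpha>" by blast
  have B'': "norm (grad \<phi> x) \<le> (\<Sum>\<alpha>\<in>UNIV. B' \<alpha>)" if "x \<in> U" for x
    using grad_norm_le[of \<phi> x] sum_mono[of UNIV "\<lambda>\<alpha>. \<bar>pderiv_at \<alpha> \<phi> x\<bar>" B'] B'[OF that] by force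
  have Um: "U \<in> sets lebesgue" "U \<in> lmeasurable" using U by (auto simp: bounded_set_imp_lmeasurable)
  show "\<phi> \<in> Lp p U"
    using continuous_on_open_measurable[OF U(1) smooth_on_continuous[OF s]] B
    by (intro bounded_supp_Lp[OF p _ Um(2,1), of _ B]) auto
  show "grad \<phi> \<in> Lp 2 U"
    using continuous_on_open_measurable[OF U(1) grad_continuous_on[OF s]] B''
    by (intro bounded_supp_Lp[OF _ _ Um(2,1), of _ _ "\<Sum>\<alpha>\<in>UNIV. B' \<alpha>"]) auto
qed

section \<open>The bilinear form of an elliptic system\<close>

text \<open>The integrand \<open>A\<^sup>\<alpha>\<^sup>\<beta>\<^sub>i\<^sub>j D\<^sub>\<beta>u\<^sup>j D\<^sub>\<alpha>\<phi>\<^sup>i\<close> of the weak formulation as a bilinear form in the two derivative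
  matrices. Transposing the coefficients swaps the arguments.\<close>

definition aform :: "('n::finite, 'm::finite) coeff \<Rightarrow> real^'n \<Rightarrow> real^'n^'m \<Rightarrow> real^'n^'m \<Rightarrow> real" where
  "aform A x P Q = (\<Sum>\<alpha>\<in>UNIV. \<Sum>\<beta>\<in>UNIV. \<Sum>i\<in>UNIV. \<Sum>j\<in>UNIV. A \<alpha> \<beta> x $ i $ j * P $ j $ \<beta> * Q $ i $ \<alpha>)"

lemma sys_form_aform: "sys_form A U u \<phi> = (LINT x|lebesgue_on U. aform A x (wjac U u x) (cjac \<phi> x))"
  by (simp add: sys_form_def aform_def cjac_def grad_component)

lemma aform_adj: "aform (adj_coeff A) x P Q = aform A x Q P"
proof -
  have "aform (adj_coeff A) x P Q = (\<Sum>\<alpha>\<in>UNIV. \<Sum>\<beta>\<in>UNIV. \<Sum>i\<in>UNIV. \<Sum>j\<in>UNIV. A \<beta> \<alpha> x $ j $ i * P $ j $ \<beta> * Q $ i $ \<alpha>)"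
    by (simp add: aform_def adj_coeff_def transpose_def)
  also have "\<dots> = (\<Sum>\<beta>\<in>UNIV. \<Sum>\<alpha>\<in>UNIV. \<Sum>i\<in>UNIV. \<Sum>j\<in>UNIV. A \<beta> \<alpha> x $ j $ i * P $ j $ \<beta> * Q $ i $ \<alpha>)"
    by (rule sum.swap)
  also have "\<dots> = (\<Sum>\<beta>\<in>UNIV. \<Sum>\<alpha>\<in>UNIV. \<Sum>j\<in>UNIV. \<Sum>i\<in>UNIV. A \<beta> \<alpha> x $ j $ i * P $ j $ \<beta> * Q $ i $ \<alpha>)"
    by (intro sum.cong refl sum.swap)
  finally show ?thesis by (simp add: aform_def mult_ac)
qed

lemma adj_adj: "adj_coeff (adj_coeff A) = A"
  by (simp add: adj_coeff_def transpose_transpose)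

text \<open>What the estimates use of ellipticity, in a form that passes to the adjoint operator with the same
  constants.\<close>

definition bounded_coercive :: "real \<Rightarrow> real \<Rightarrow> ('n::finite, 'm::finite) coeff \<Rightarrow> bool" where
  "bounded_coercive \<nu> M A \<longleftrightarrow> (\<forall>\<alpha> \<beta>. A \<alpha> \<beta> \<in> borel_measurable lebesgue) \<and>
     (\<forall>x P. aform A x P P \<ge> \<nu> * (norm P)\<^sup>2) \<and>
     (\<forall>x P Q. \<bar>aform A x P Q\<bar> \<le> M * (norm P * norm Q))"

lemma component_le_norm2: "\<bar>P $ j $ \<beta>\<bar> \<le> norm P" for P :: "real^'n^'m"
  using component_le_norm_cart[of "P $ j" \<beta>] Finite_Cartesian_Product.norm_nth_le[of P j] by linarith

lemma bounded_coercive_adj: "bounded_coercive \<nu> M A \<Longrightarrow> bounded_coercive \<nu> M (adj_coeff A)"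
  unfolding bounded_coercive_def aform_adj
proof (intro conjI allI)
  assume A: "(\<forall>\<alpha> \<beta>. A \<alpha> \<beta> \<in> borel_measurable lebesgue) \<and>
     (\<forall>x P. aform A x P P \<ge> \<nu> * (norm P)\<^sup>2) \<and>
     (\<forall>x P Q. \<bar>aform A x P Q\<bar> \<le> M * (norm P * norm Q))"
  show "\<nu> * (norm P)\<^sup>2 \<le> aform A x P P" for x P using A by blast
  show "\<bar>aform A x Q P\<bar> \<le> M * (norm P * norm Q)" for x P Q using A by (metis mult.commute)
  show "adj_coeff A \<alpha> \<beta> \<in> borel_measurable lebesgue" for \<alpha> \<beta>
  proof -
    have m: "A \<beta> \<alpha> \<in> borel_measurable lebesgue" using A by blast
    have "(\<lambda>x. adj_coeff A \<alpha> \<beta> x \<bullet> b) \<in> borel_measurable lebesgue" if b: "b \<in> Basis" for b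
    proof -
      obtain i j where "b = axis i (axis j 1)" using b by (auto simp: Basis_vec_def)
      then have "(\<lambda>x. adj_coeff A \<alpha> \<beta> x \<bullet> b) = (\<lambda>x. A \<beta> \<alpha> x $ j $ i)"
        by (simp add: inner_axis adj_coeff_def transpose_def)
      then show ?thesis using measurable_vec_nth[OF measurable_vec_nth[OF m]] by simp
    qed
    then show ?thesis by (subst borel_measurable_euclidean_space) blast
  qed
qed

text \<open>The bound on the square sum of the coefficients is applied to single entries: each of the
  \<open>n\<^sup>2 m\<^sup>2\<close> entries is at most \<open>1/\<nu>\<close>.\<close>

lemma elliptic_imp_bounded_coercive:
  fixes A :: "('n::finite, 'm::finite) coeff"
  assumes A: "elliptic_coeff \<nu> A" and \<nu>: "\<nu> > 0"
  shows "bounded_coercive \<nu> ((real CARD('n))\<^sup>2 * (real CARD('m))\<^sup>2 / \<nu>) A"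
  unfolding bounded_coercive_def
proof (intro conjI allI)
  show "A \<alpha> \<beta> \<in> borel_measurable lebesgue" for \<alpha> \<beta> using A by (auto simp: elliptic_coeff_def)
  show "\<nu> * (norm P)\<^sup>2 \<le> aform A x P P" for x P using A by (auto simp: elliptic_coeff_def aform_def)
  have entry: "\<bar>A \<alpha> \<beta> x $ i $ j\<bar> \<le> 1 / \<nu>" for \<alpha> \<beta> x i j
  proof -
    have S: "(\<Sum>i\<in>UNIV. \<Sum>j\<in>UNIV. \<Sum>\<alpha>\<in>UNIV. \<Sum>\<beta>\<in>UNIV. \<bar>A \<alpha> \<beta> x $ i $ j\<bar>\<^sup>2) \<le> 1 / \<nu>\<^sup>2"
      using A unfolding elliptic_coeff_def by blast
    have "\<bar>A \<alpha> \<beta> x $ i $ j\<bar>\<^sup>2 \<le> (\<Sum>\<beta>\<in>UNIV. \<bar>A \<alpha> \<beta> x $ i $ j\<bar>\<^sup>2)" by (rule member_le_sum) auto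
    also have "\<dots> \<le> (\<Sum>\<alpha>\<in>UNIV. \<Sum>\<beta>\<in>UNIV. \<bar>A \<alpha> \<beta> x $ i $ j\<bar>\<^sup>2)"
      by (rule member_le_sum[where f = "\<lambda>\<alpha>. \<Sum>\<beta>\<in>UNIV. \<bar>A \<alpha> \<beta> x $ i $ j\<bar>\<^sup>2"]) (auto intro: sum_nonneg)
    also have "\<dots> \<le> (\<Sum>j\<in>UNIV. \<Sum>\<alpha>\<in>UNIV. \<Sum>\<beta>\<in>UNIV. \<bar>A \<alpha> \<beta> x $ i $ j\<bar>\<^sup>2)"
      by (rule member_le_sum[where f = "\<lambda>j. \<Sum>\<alpha>\<in>UNIV. \<Sum>\<beta>\<in>UNIV. \<bar>A \<alpha> \<beta> x $ i $ j\<bar>\<^sup>2"]) (auto intro!: sum_nonneg)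
    also have "\<dots> \<le> (\<Sum>i\<in>UNIV. \<Sum>j\<in>UNIV. \<Sum>\<alpha>\<in>UNIV. \<Sum>\<beta>\<in>UNIV. \<bar>A \<alpha> \<beta> x $ i $ j\<bar>\<^sup>2)"
      by (rule member_le_sum[where f = "\<lambda>i. \<Sum>j\<in>UNIV. \<Sum>\<alpha>\<in>UNIV. \<Sum>\<beta>\<in>UNIV. \<bar>A \<alpha> \<beta> x $ i $ j\<bar>\<^sup>2"]) (auto intro!: sum_nonneg)
    also have "\<dots> \<le> (1 / \<nu>)\<^sup>2" using S by (simp add: power_divide)
    finally show ?thesis by (rule power2_le_imp_le) (use \<nu> in simp)
  qed
  show "\<bar>aform A x P Q\<bar> \<le> (real CARD('n))\<^sup>2 * (real CARD('m))\<^sup>2 / \<nu> * (norm P * norm Q)" for x P Q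
  proof -
    have t: "\<bar>A \<alpha> \<beta> x $ i $ j * P $ j $ \<beta> * Q $ i $ \<alpha>\<bar> \<le> 1 / \<nu> * norm P * norm Q" for \<alpha> \<beta> i j
      unfolding abs_mult using \<nu> by (intro mult_mono entry component_le_norm2) auto
    have "\<bar>aform A x P Q\<bar> \<le> (\<Sum>\<alpha>\<in>(UNIV::'n set). \<Sum>\<beta>\<in>(UNIV::'n set). \<Sum>i\<in>(UNIV::'m set). \<Sum>j\<in>(UNIV::'m set). 1 / \<nu> * norm P * norm Q)"
      unfolding aform_def
      by (intro order_trans[OF sum_abs] sum_mono t)
    then show ?thesis by (simp add: power2_eq_square mult_ac)
  qed
qed

lemma aform_bilinear:
  assumes "bounded_coercive \<nu> M A" shows "bounded_bilinear (aform A x)"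
proof
  show "aform A x (P + P') Q = aform A x P Q + aform A x P' Q" for P P' Q
    by (simp add: aform_def algebra_simps sum.distrib)
  show "aform A x P (Q + Q') = aform A x P Q + aform A x P Q'" for P Q Q'
    by (simp add: aform_def algebra_simps sum.distrib)
  show "aform A x (r *\<^sub>R P) Q = r *\<^sub>R aform A x P Q" for r P Q
    by (simp add: aform_def sum_distrib_left mult_ac)
  show "aform A x P (r *\<^sub>R Q) = r *\<^sub>R aform A x P Q" for r P Q
    by (simp add: aform_def sum_distrib_left mult_ac)
  show "\<exists>K. \<forall>P Q. norm (aform A x P Q) \<le> norm P * norm Q * K"
    using assms unfolding bounded_coercive_def by (intro exI[of _ M]) (auto simp: mult.commute)
qed

lemma bounded_coercive_bound: "bounded_coercive \<nu> M A \<Longrightarrow> \<bar>aform A x P Q\<bar> \<le> M * (norm P * norm Q)"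
  by (simp add: bounded_coercive_def)

lemma bounded_coercive_coercive: "bounded_coercive \<nu> M A \<Longrightarrow> \<nu> * (norm P)\<^sup>2 \<le> aform A x P P"
  by (simp add: bounded_coercive_def)

lemma bounded_coercive_constants:
  fixes A :: "('n::finite, 'm::finite) coeff"
  assumes A: "bounded_coercive \<nu> M A" shows "M \<ge> \<nu>"
proof -
  define P :: "real^'n^'m" where "P = axis undefined (axis undefined 1)"
  have "norm P = 1" by (simp add: P_def)
  then show ?thesis using bounded_coercive_bound[OF A, of undefined P P] bounded_coercive_coercive[OF A, of P undefined] by simp
qed

lemma aform_measurable:
  fixes A :: "('n::finite, 'm::finite) coeff"
  assumes A: "bounded_coercive \<nu> M A" and F: "F \<in> borel_measurable (lebesgue_on U)" and G: "G \<in> borel_measurable (lebesgue_on U)"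
  shows "(\<lambda>x. aform A x (F x) (G x)) \<in> borel_measurable (lebesgue_on U)"
proof -
  have m: "A \<alpha> \<beta> \<in> borel_measurable (lebesgue_on U)" for \<alpha> \<beta>
    using A unfolding bounded_coercive_def by (intro measurable_restrict_space1) blast
  show ?thesis unfolding aform_def
    by (intro borel_measurable_sum borel_measurable_times measurable_vec_nth F G m)
qed

lemma aform_integrable:
  assumes A: "bounded_coercive \<nu> M A" "\<nu> > 0" and F: "sqint (lebesgue_on U) F" and G: "sqint (lebesgue_on U) G"
  shows "integrable (lebesgue_on U) (\<lambda>x. aform A x (F x) (G x))"
    "\<bar>LINT x|lebesgue_on U. aform A x (F x) (G x)\<bar> \<le> M * (l2 (lebesgue_on U) F * l2 (lebesgue_on U) G)"
proof -
  have m: "(\<lambda>x. aform A x (F x) (G x)) \<in> borel_measurable (lebesgue_on U)"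
    using F G by (intro aform_measurable[OF A(1)]) (auto simp: sqint_def)
  have M: "M \<ge> 0" using bounded_coercive_constants[OF A(1)] A(2) by simp
  show "integrable (lebesgue_on U) (\<lambda>x. aform A x (F x) (G x))"
    "\<bar>LINT x|lebesgue_on U. aform A x (F x) (G x)\<bar> \<le> M * (l2 (lebesgue_on U) F * l2 (lebesgue_on U) G)"
    using bilinear_integrable[OF F G m AE_I2 M] bounded_coercive_bound[OF A(1)] by blast+
qed

lemma aform_tendsto:
  assumes A: "bounded_coercive \<nu> M A" "\<nu> > 0" and F: "sqint (lebesgue_on U) F" and G: "sqint (lebesgue_on U) G"
    and H: "\<And>k. sqint (lebesgue_on U) (H k)" and lim: "(\<lambda>k. l2 (lebesgue_on U) (\<lambda>x. H k x - G x)) \<longlonglongrightarrow> 0"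
  shows "(\<lambda>k. LINT x|lebesgue_on U. aform A x (F x) (H k x)) \<longlonglongrightarrow> (LINT x|lebesgue_on U. aform A x (F x) (G x))"
proof (rule tendsto_if_abs_diff_le)
  fix k
  have "(LINT x|lebesgue_on U. aform A x (F x) (H k x)) - (LINT x|lebesgue_on U. aform A x (F x) (G x))
      = (LINT x|lebesgue_on U. aform A x (F x) (H k x - G x))"
    using aform_integrable(1)[OF A F G] aform_integrable(1)[OF A F H]
    by (simp add: bounded_bilinear.diff_right[OF aform_bilinear[OF A(1)]])
  then show "\<bar>(LINT x|lebesgue_on U. aform A x (F x) (H k x)) - (LINT x|lebesgue_on U. aform A x (F x) (G x))\<bar>
      \<le> M * (l2 (lebesgue_on U) F * l2 (lebesgue_on U) (\<lambda>x. H k x - G x))"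
    using aform_integrable(2)[OF A F sqint_diff(1)[OF H G]] by simp
next
  show "(\<lambda>k. M * (l2 (lebesgue_on U) F * l2 (lebesgue_on U) (\<lambda>x. H k x - G x))) \<longlonglongrightarrow> 0"
    by (intro tendsto_mult_right_zero lim)
qed

text \<open>The part of the derivative of \<open>\<zeta> v\<close> that contains the derivative \<open>q = \<nabla>\<zeta>\<close> of the scalar factor.\<close>

definition outer :: "real^'m::finite \<Rightarrow> real^'n::finite \<Rightarrow> real^'n^'m" where
  "outer v q = (\<chi> j. v $ j *\<^sub>R q)"

lemma norm_outer: "norm (outer v q) = norm v * norm q"
proof -
  have "(norm (outer v q))\<^sup>2 = (\<Sum>j\<in>UNIV. (v $ j)\<^sup>2 * (norm q)\<^sup>2)"
    unfolding norm_vec_square[of "outer v q"] by (simp add: outer_def power_mult_distrib)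
  also have "\<dots> = (norm v * norm q)\<^sup>2"
    by (simp add: power_mult_distrib norm_vec_square[of v] flip: sum_distrib_right)
  finally show ?thesis by (simp add: power2_eq_iff_nonneg)
qed

lemma outer_diff: "outer (v - w) q = outer v q - outer w q"
  by (simp add: outer_def vec_eq_iff algebra_simps)

lemma outer_scale: "outer (c *\<^sub>R v) q = c *\<^sub>R outer v q" "outer v (c *\<^sub>R q) = c *\<^sub>R outer v q"
  by (simp_all add: outer_def vec_eq_iff)

lemma grad_add_scale:
  fixes f g :: "real^'n \<Rightarrow> real"
  assumes "f differentiable at x" "g differentiable at x"
  shows "grad (\<lambda>x. f x + c * g x) x = grad f x + c *\<^sub>R grad g x"
proof -
  have "(\<lambda>x. c * g x) differentiable at x" using assms(2) by (intro differentiable_mult) auto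
  then show ?thesis using assms by (simp add: grad_def vec_eq_iff pderiv_add pderiv_cmult)
qed

lemma grad_mult:
  fixes f g :: "real^'n \<Rightarrow> real"
  assumes "f differentiable at x" "g differentiable at x"
  shows "grad (\<lambda>x. f x * g x) x = f x *\<^sub>R grad g x + g x *\<^sub>R grad f x"
  using pderiv_mult[OF assms] by (simp add: grad_def vec_eq_iff mult.commute)

lemma grad_cong:
  assumes "open S" "x \<in> S" "\<And>x. x \<in> S \<Longrightarrow> f x = g x" shows "grad f x = grad g x"
  using pderiv_cong[OF assms] by (simp add: grad_def)

lemma cjac_add_scale:
  assumes "\<And>j. (\<lambda>z. \<phi> z $ j) differentiable at x" "\<And>j. (\<lambda>z. \<psi> z $ j) differentiable at x"
  shows "cjac (\<lambda>x. \<phi> x + c *\<^sub>R \<psi> x) x = cjac \<phi> x + c *\<^sub>R cjac \<psi> x"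
  using grad_add_scale[OF assms] by (simp add: cjac_def vec_eq_iff)

lemma cjac_mult:
  assumes "\<eta> differentiable at x" "\<And>j. (\<lambda>z. \<phi> z $ j) differentiable at x"
  shows "cjac (\<lambda>x. \<eta> x *\<^sub>R \<phi> x) x = \<eta> x *\<^sub>R cjac \<phi> x + outer (\<phi> x) (grad \<eta> x)"
  using grad_mult[OF assms] by (simp add: cjac_def outer_def vec_eq_iff)

lemma cjac_cong:
  assumes "open S" "x \<in> S" "\<And>x. x \<in> S \<Longrightarrow> \<phi> x = \<psi> x" shows "cjac \<phi> x = cjac \<psi> x"
  using grad_cong[OF assms(1,2), of "\<lambda>z. \<phi> z $ j" "\<lambda>z. \<psi> z $ j" for j] assms(3) by (simp add: cjac_def)

lemma Cc_inf_vec_component: "\<phi> \<in> Cc_inf_vec U \<Longrightarrow> (\<lambda>x. \<phi> x $ i) \<in> Cc_inf U"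
  by (simp add: Cc_inf_vec_def)

lemma Cc_inf_vec_differentiable: "\<phi> \<in> Cc_inf_vec U \<Longrightarrow> (\<lambda>x. \<phi> x $ i) differentiable at x"
  by (rule Cc_inf_differentiable[OF Cc_inf_vec_component])

lemma Cc_inf_vec_mono: "U \<subseteq> V \<Longrightarrow> \<phi> \<in> Cc_inf_vec U \<Longrightarrow> \<phi> \<in> Cc_inf_vec V"
  unfolding Cc_inf_vec_def using Cc_inf_mono by blast

lemma Cc_inf_vec_sqint:
  fixes \<phi> :: "real^'n \<Rightarrow> real^'m"
  assumes "open U" "\<phi> \<in> Cc_inf_vec U"
  shows "sqint (lebesgue_on U) \<phi>" "sqint (lebesgue_on U) (cjac \<phi>)"
proof -
  note c = Cc_inf_class[OF assms(1) Cc_inf_vec_component[OF assms(2)], of 2]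
  show "sqint (lebesgue_on U) \<phi>" by (rule sqint_vec(1)) (use c(2) in \<open>simp add: Lp_2_iff\<close>)
  show "sqint (lebesgue_on U) (cjac \<phi>)" by (rule sqint_vec(1)) (use c(3) in \<open>simp add: Lp_2_iff cjac_def\<close>)
qed

lemma Cc_inf_vec_support:
  fixes \<phi> :: "real^'n \<Rightarrow> real^'m"
  assumes "\<phi> \<in> Cc_inf_vec U" "x \<notin> U" shows "\<phi> x = 0" "cjac \<phi> x = 0"
proof -
  have "\<phi> x $ i = 0 \<and> grad (\<lambda>x. \<phi> x $ i) x = 0" for i
    by (rule Cc_inf_grad_zero[OF Cc_inf_vec_component[OF assms(1), of i]]) (use assms(2) in blast)
  then show "\<phi> x = 0" "cjac \<phi> x = 0" by (simp_all add: vec_eq_iff cjac_def)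
qed

lemma Cc_inf_vec_add_scale:
  assumes "\<phi> \<in> Cc_inf_vec U" "\<psi> \<in> Cc_inf_vec U" shows "(\<lambda>x. \<phi> x + c *\<^sub>R \<psi> x) \<in> Cc_inf_vec U"
proof -
  have "(\<lambda>x. \<phi> x $ i + c * \<psi> x $ i) \<in> Cc_inf U" for i
    using Cc_inf_vec_component[OF assms(1)] Cc_inf_vec_component[OF assms(2)]
    by (intro Cc_inf_add Cc_inf_mult smooth_on_const) auto
  then show ?thesis by (simp add: Cc_inf_vec_def)
qed

lemma Cc_inf_vec_mult:
  assumes "\<phi> \<in> Cc_inf_vec U" "smooth_on UNIV \<eta>" shows "(\<lambda>x. \<eta> x *\<^sub>R \<phi> x) \<in> Cc_inf_vec U"
  using Cc_inf_mult[OF Cc_inf_vec_component[OF assms(1)] assms(2)] by (simp add: Cc_inf_vec_def)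

text \<open>Classical derivatives in both arguments, so that passing to the adjoint swaps them; \<open>sys_form\<close> has weak
  derivatives in its first argument only.\<close>

definition bform :: "('n::finite, 'm::finite) coeff \<Rightarrow> (real^'n) set \<Rightarrow> (real^'n \<Rightarrow> real^'m) \<Rightarrow> (real^'n \<Rightarrow> real^'m) \<Rightarrow> real" where
  "bform A U \<phi> \<psi> = (LINT x|lebesgue_on U. aform A x (cjac \<phi> x) (cjac \<psi> x))"

lemma bform_adj: "bform (adj_coeff A) U \<phi> \<psi> = bform A U \<psi> \<phi>"
  by (simp add: bform_def aform_adj)

section \<open>The Riesz kernel\<close>

definition riesz :: "real^'n::finite \<Rightarrow> real^'n \<Rightarrow> real" where
  "riesz x y = dist x y powr (2 - real CARD('n))"

lemma riesz_nonneg: "riesz x y \<ge> 0"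
  by (simp add: riesz_def)

lemma riesz_commute: "riesz x y = riesz y x"
  by (simp add: riesz_def dist_commute)

lemma dyadic_annulus:
  fixes r d :: real
  assumes "0 < d" "d < r" shows "\<exists>k. r / 2 ^ Suc k \<le> d \<and> d < r / 2 ^ k"
proof -
  obtain N where N: "r / d < 2 ^ N" using real_arch_pow[of 2 "r / d"] by auto
  define k where "k = (LEAST k. r / 2 ^ Suc k \<le> d)"
  have "r / 2 ^ Suc N \<le> d" 
  proof -
    have "r < d * 2 ^ N" using N assms by (simp add: field_simps)
    also have "\<dots> \<le> d * 2 ^ Suc N" using assms by simp
    finally show ?thesis by (simp add: field_simps)
  qed
  then have k: "r / 2 ^ Suc k \<le> d" unfolding k_def by (rule LeastI)
  moreover have "d < r / 2 ^ k"
  proof (cases k)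
    case 0 then show ?thesis using assms by simp
  next
    case (Suc j)
    then have "\<not> r / 2 ^ Suc j \<le> d" using not_less_Least[of j "\<lambda>k. r / 2 ^ Suc k \<le> d"] by (simp add: k_def)
    then show ?thesis using Suc by simp
  qed
  ultimately show ?thesis by blast
qed

text \<open>Decompose the ball into dyadic annuli; the contribution of the annulus of radius
  $r 2^{-k}$ is of order $(r 2^{-k})^{2-n} (r 2^{-k})^n$.\<close>

lemma riesz_ball_integral:
  obtains Kc where "Kc > 0"
    "\<And>(x::real^'n) r. CARD('n) \<ge> 3 \<Longrightarrow> r > 0 \<Longrightarrow>
       (\<integral>\<^sup>+y. ennreal (riesz x y * indicator (ball x r) y) \<partial>lebesgue) \<le> ennreal (Kc * r\<^sup>2)"
proof -
  define n where "n = real CARD('n)"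
  define \<omega> where "\<omega> = unit_ball_vol n"
  have \<omega>: "\<omega> > 0" by (simp add: \<omega>_def n_def)
  define c where "c = \<omega> * 2 powr (n - 2)"
  have c: "c > 0" using \<omega> by (simp add: c_def)
  have "(\<integral>\<^sup>+y. ennreal (riesz x y * indicator (ball x r) y) \<partial>lebesgue) \<le> ennreal (c * (4 / 3) * r\<^sup>2)"
    if n3: "CARD('n) \<ge> 3" and r: "r > 0" for x :: "real^'n" and r
  proof -
    define a where "a k = (r / 2 ^ Suc k) powr (2 - n)" for k :: nat
    have a: "a k \<ge> 0" for k by (simp add: a_def)
    have pw: "ennreal (riesz x y * indicator (ball x r) y) \<le> (\<Sum>k. ennreal (a k * indicator (ball x (r / 2 ^ k)) y))" for y
    proof (cases "y \<in> ball x r \<and> y \<noteq> x")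
      case True
      then obtain k where k: "r / 2 ^ Suc k \<le> dist x y" "dist x y < r / 2 ^ k"
        using dyadic_annulus[of "dist x y" r] by auto
      have "riesz x y \<le> a k" unfolding riesz_def a_def n_def[symmetric]
        using k r n3 by (intro powr_mono2') (auto simp: n_def)
      then have "ennreal (riesz x y * indicator (ball x r) y) \<le> ennreal (a k * indicator (ball x (r / 2 ^ k)) y)"
        using True k by (intro ennreal_leI) simp
      also have "\<dots> \<le> (\<Sum>k. ennreal (a k * indicator (ball x (r / 2 ^ k)) y))"
        using ennreal_suminf_lessD leI by blast
      finally show ?thesis .
    next
      case False
      then have z: "riesz x y * indicator (ball x r) y = 0" by (auto simp: riesz_def)
      show ?thesis unfolding z by simp
    qed
    have "(\<integral>\<^sup>+y. ennreal (riesz x y * indicator (ball x r) y) \<partial>lebesgue)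
        \<le> (\<integral>\<^sup>+y. (\<Sum>k. ennreal (a k * indicator (ball x (r / 2 ^ k)) y)) \<partial>lebesgue)"
      by (rule nn_integral_mono) (rule pw)
    also have "\<dots> = (\<integral>\<^sup>+y. (\<Sum>k. ennreal (a k * indicator (ball x (r / 2 ^ k)) y)) \<partial>lborel)"
      by (rule nn_integral_completion)
    also have "\<dots> = (\<Sum>k. \<integral>\<^sup>+y. ennreal (a k * indicator (ball x (r / 2 ^ k)) y) \<partial>lborel)"
      by (rule nn_integral_suminf) (intro measurable_compose[OF _ measurable_ennreal] borel_measurable_times borel_measurable_const borel_measurable_indicator; simp)
    also have "\<dots> = (\<Sum>k. ennreal (c * r\<^sup>2 * (1 / 4) ^ k))"
    proof (rule suminf_cong)
      fix k
      have rk: "r / 2 ^ k > 0" using r by simp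
      have "(\<integral>\<^sup>+y. ennreal (a k * indicator (ball x (r / 2 ^ k)) y) \<partial>lborel)
         = (\<integral>\<^sup>+y. ennreal (a k) * indicator (ball x (r / 2 ^ k)) y \<partial>lborel)"
        by (intro nn_integral_cong) (simp add: indicator_def)
      also have "\<dots> = ennreal (a k) * emeasure lborel (ball x (r / 2 ^ k))"
        by (rule nn_integral_cmult_indicator) simp
      also have "emeasure lborel (ball x (r / 2 ^ k)) = ennreal (\<omega> * (r / 2 ^ k) powr n)"
        using rk by (simp add: emeasure_ball less_imp_le \<omega>_def n_def powr_realpow)
      also have "ennreal (a k) * \<dots> = ennreal (a k * (\<omega> * (r / 2 ^ k) powr n))"
        using a by (simp add: ennreal_mult')
      also have "a k * (\<omega> * (r / 2 ^ k) powr n) = c * r\<^sup>2 * (1 / 4) ^ k"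
      proof -
        have half: "(t / 2) powr (2 - n) = t powr (2 - n) / 2 powr (2 - n)" if "t > 0" for t :: real
          using that by (simp add: powr_divide)
        have "r / 2 ^ Suc k = (r / 2 ^ k) / 2" by simp
        then have "a k = (r / 2 ^ k) powr (2 - n) / 2 powr (2 - n)" unfolding a_def using half[OF rk] by (simp add: mult.commute)
        also have "\<dots> = (r / 2 ^ k) powr (2 - n) * 2 powr (n - 2)"
          using powr_minus[of 2 "2 - n"] by (simp add: field_simps)
        finally have "a k * (\<omega> * (r / 2 ^ k) powr n) = c * ((r / 2 ^ k) powr (2 - n) * (r / 2 ^ k) powr n)"
          by (simp add: c_def)
        also have "(r / 2 ^ k) powr (2 - n) * (r / 2 ^ k) powr n = (r / 2 ^ k)\<^sup>2"
          using rk by (simp flip: powr_add)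
        also have "(r / 2 ^ k)\<^sup>2 = r\<^sup>2 * (1 / 4) ^ k"
          by (simp add: power_divide power_mult[symmetric] mult.commute[of k 2]) (simp add: power_mult)
        finally show ?thesis by simp
      qed
      finally show "(\<integral>\<^sup>+y. ennreal (a k * indicator (ball x (r / 2 ^ k)) y) \<partial>lborel) = ennreal (c * r\<^sup>2 * (1 / 4) ^ k)" .
    qed
    also have "\<dots> = ennreal (c * r\<^sup>2 * (1 / (1 - 1 / 4)))"
      using c by (intro suminf_ennreal_eq sums_mult geometric_sums) auto
    finally show ?thesis by (simp add: mult_ac)
  qed
  then show ?thesis using that[of "c * (4 / 3)"] c by simp
qed

lemma sigma_finite_lebesgue: "sigma_finite_measure (lebesgue :: 'a::euclidean_space measure)"
proof
  show "\<exists>A. countable A \<and> A \<subseteq> sets (lebesgue :: 'a measure) \<and> \<Union>A = space lebesgue \<and> (\<forall>a\<in>A. emeasure lebesgue a \<noteq> \<infinity>)"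
  proof (intro exI[of _ "range (\<lambda>n::nat. cball 0 (real n))"] conjI)
    have "x \<in> \<Union>(range (\<lambda>n::nat. cball 0 (real n)))" for x :: 'a using real_arch_simple[of "norm x"] by auto
    then show "\<Union>(range (\<lambda>n::nat. cball (0::'a) (real n))) = space lebesgue" by auto
    show "\<forall>a\<in>range (\<lambda>n::nat. cball (0::'a) (real n)). emeasure lebesgue a \<noteq> \<infinity>"
      using emeasure_bounded_finite[OF bounded_cball] by (auto simp: less_top[symmetric])
  qed auto
qed

text \<open>The double integral of \<open>a(x) \<bar>x - y\<bar>\<^bsup>2-n\<^esup> b(y)\<close>. With values in the extended nonnegative reals,
  Tonelli's theorem applies without integrability conditions.\<close>

definition riesz_energy :: "(real^'n::finite \<Rightarrow> real) \<Rightarrow> (real^'n \<Rightarrow> real) \<Rightarrow> ennreal" where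
  "riesz_energy a b = (\<integral>\<^sup>+x. \<integral>\<^sup>+y. ennreal (a x * riesz x y * b y) \<partial>lebesgue \<partial>lebesgue)"

lemma riesz_energy_measurable:
  fixes a b :: "real^'n \<Rightarrow> real"
  assumes [measurable]: "a \<in> borel_measurable lebesgue" "b \<in> borel_measurable lebesgue"
  shows "(\<lambda>(x, y). ennreal (a x * riesz x y * b y)) \<in> borel_measurable (lebesgue \<Otimes>\<^sub>M lebesgue)"
proof -
  have id: "(\<lambda>x::real^'n. x) \<in> measurable lebesgue borel" by (intro measurable_completion) simp
  have 1: "(\<lambda>z. fst z) \<in> measurable (lebesgue \<Otimes>\<^sub>M lebesgue) (borel :: (real^'n) measure)"
    by (rule measurable_compose[OF measurable_fst id])
  have 2: "(\<lambda>z. snd z) \<in> measurable (lebesgue \<Otimes>\<^sub>M lebesgue) (borel :: (real^'n) measure)"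
    by (rule measurable_compose[OF measurable_snd id])
  have a: "(\<lambda>z. a (fst z)) \<in> borel_measurable (lebesgue \<Otimes>\<^sub>M (lebesgue :: (real^'n) measure))"
    by (rule measurable_compose[OF measurable_fst assms(1)])
  have b: "(\<lambda>z. b (snd z)) \<in> borel_measurable ((lebesgue :: (real^'n) measure) \<Otimes>\<^sub>M lebesgue)"
    by (rule measurable_compose[OF measurable_snd assms(2)])
  have "(\<lambda>z. dist (fst z) (snd z)) \<in> borel_measurable (lebesgue \<Otimes>\<^sub>M (lebesgue :: (real^'n) measure))"
    by (rule borel_measurable_dist[OF 1 2])
  then have "(\<lambda>z. a (fst z) * (dist (fst z) (snd z) powr (2 - real CARD('n))) * b (snd z)) \<in> borel_measurable (lebesgue \<Otimes>\<^sub>M lebesgue)"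
    using a b by measurable
  then show ?thesis unfolding riesz_def case_prod_unfold by measurable
qed

lemma riesz_energy_commute:
  fixes a b :: "real^'n \<Rightarrow> real"
  assumes "a \<in> borel_measurable lebesgue" "b \<in> borel_measurable lebesgue"
  shows "riesz_energy a b = riesz_energy b a"
proof -
  interpret pair_sigma_finite "lebesgue :: (real^'n) measure" "lebesgue :: (real^'n) measure"
    using sigma_finite_lebesgue by (simp add: pair_sigma_finite_def)
  have "riesz_energy a b = (\<integral>\<^sup>+y. \<integral>\<^sup>+x. ennreal (a x * riesz x y * b y) \<partial>lebesgue \<partial>lebesgue)"
    unfolding riesz_energy_def by (rule Fubini'[OF riesz_energy_measurable[OF assms], symmetric])
  also have "\<dots> = riesz_energy b a" unfolding riesz_energy_def by (simp add: riesz_commute mult_ac)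
  finally show ?thesis .
qed

section \<open>Energy of bounded functions with respect to the Riesz kernel\<close>

definition riesz_ball_bound :: "'n::finite itself \<Rightarrow> real \<Rightarrow> bool" where
  "riesz_ball_bound _ Kc \<longleftrightarrow> Kc > 0 \<and> (\<forall>(x::real^'n) r. r > 0 \<longrightarrow>
     (\<integral>\<^sup>+y. ennreal (riesz x y * indicator (ball x r) y) \<partial>lebesgue) \<le> ennreal (Kc * r\<^sup>2))"

lemma riesz_measurable: "(\<lambda>y. riesz x y) \<in> borel_measurable lebesgue" for x :: "real^'n"
proof -
  have "(\<lambda>y. riesz x y) \<in> borel_measurable borel" unfolding riesz_def by measurable
  then show ?thesis by (intro measurable_completion) simp
qed

text \<open>For fixed \<open>x\<close> the inner integral is at most \<open>B\<close> times the integral of the kernel over the ball of radius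
  \<open>2r\<close> about \<open>x\<close>, which contains \<open>ball p r\<close>.\<close>

lemma riesz_energy_le:
  fixes a b :: "real^'n \<Rightarrow> real"
  assumes Kc: "riesz_ball_bound TYPE('n) Kc" and r: "r > 0"
    and a: "a \<in> borel_measurable lebesgue" "\<And>x. a x \<ge> 0" "\<And>x. x \<notin> ball p r \<Longrightarrow> a x = 0"
    and b: "\<And>x. 0 \<le> b x" "\<And>x. b x \<le> B" "\<And>x. x \<notin> ball p r \<Longrightarrow> b x = 0"
  shows "riesz_energy a b \<le> ennreal (B * Kc * (2 * r)\<^sup>2) * (\<integral>\<^sup>+x. ennreal (a x) \<partial>lebesgue)"
proof -
  have B: "B \<ge> 0" using b(1,2)[of p] by linarith
  have K: "Kc > 0" using Kc by (simp add: riesz_ball_bound_def)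
  have inner: "(\<integral>\<^sup>+y. ennreal (a x * riesz x y * b y) \<partial>lebesgue) \<le> ennreal (B * Kc * (2 * r)\<^sup>2) * ennreal (a x)" for x
  proof (cases "x \<in> ball p r")
    case True
    have "(\<integral>\<^sup>+y. ennreal (a x * riesz x y * b y) \<partial>lebesgue)
        \<le> (\<integral>\<^sup>+y. ennreal (a x * B) * ennreal (riesz x y * indicator (ball x (2 * r)) y) \<partial>lebesgue)"
    proof (rule nn_integral_mono)
      fix y
      have "a x * riesz x y * b y \<le> a x * B * (riesz x y * indicator (ball x (2 * r)) y)"
      proof (cases "y \<in> ball p r")
        case y: True
        have "dist x y \<le> dist x p + dist p y" by (rule dist_triangle)
        then have "y \<in> ball x (2 * r)" using True y by (simp add: dist_commute)
        then show ?thesis using a(2)[of x] b(2)[of y] riesz_nonneg[of x y]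
          by (simp add: mult.assoc mult.commute[of B] mult_left_mono)
      next
        case False
        then show ?thesis using b(3) B a(2)[of x] riesz_nonneg[of x y] by simp
      qed
      then show "ennreal (a x * riesz x y * b y) \<le> ennreal (a x * B) * ennreal (riesz x y * indicator (ball x (2 * r)) y)"
        using a(2)[of x] B riesz_nonneg[of x y] by (subst ennreal_mult[symmetric]) (auto intro: ennreal_leI)
    qed
    also have "\<dots> = ennreal (a x * B) * (\<integral>\<^sup>+y. ennreal (riesz x y * indicator (ball x (2 * r)) y) \<partial>lebesgue)"
      by (intro nn_integral_cmult measurable_compose[OF _ measurable_ennreal] borel_measurable_times riesz_measurable borel_measurable_indicator) simp
    also have "\<dots> \<le> ennreal (a x * B) * ennreal (Kc * (2 * r)\<^sup>2)"
      using Kc[unfolded riesz_ball_bound_def, THEN conjunct2, rule_format, of "2 * r" x] r by (intro mult_left_mono) simp_all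
    also have "\<dots> = ennreal (B * Kc * (2 * r)\<^sup>2) * ennreal (a x)"
      using a(2)[of x] B K by (simp add: ennreal_mult'[symmetric] mult_ac)
    finally show ?thesis .
  next
    case False
    then show ?thesis using a(3) by simp
  qed
  have "riesz_energy a b \<le> (\<integral>\<^sup>+x. ennreal (B * Kc * (2 * r)\<^sup>2) * ennreal (a x) \<partial>lebesgue)"
    unfolding riesz_energy_def by (rule nn_integral_mono) (rule inner)
  also have "\<dots> = ennreal (B * Kc * (2 * r)\<^sup>2) * (\<integral>\<^sup>+x. ennreal (a x) \<partial>lebesgue)"
    using a(1) by (intro nn_integral_cmult) simp
  finally show ?thesis .
qed

text \<open>At distance at least \<open>\<rho>\<close> the kernel is at most \<open>\<rho>\<^bsup>2-n\<^esup>\<close>, its exponent being negative.\<close>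

lemma riesz_energy_separated:
  fixes a b :: "real^'n \<Rightarrow> real"
  assumes n: "CARD('n) \<ge> 3" and \<rho>: "\<rho> > 0"
    and a: "a \<in> borel_measurable lebesgue" "\<And>x. a x \<ge> 0" and b: "b \<in> borel_measurable lebesgue" "\<And>x. b x \<ge> 0"
    and sep: "\<And>x y. a x \<noteq> 0 \<Longrightarrow> b y \<noteq> 0 \<Longrightarrow> dist x y \<ge> \<rho>"
  shows "riesz_energy a b \<le> ennreal (\<rho> powr (2 - real CARD('n))) * ((\<integral>\<^sup>+x. ennreal (a x) \<partial>lebesgue) * (\<integral>\<^sup>+x. ennreal (b x) \<partial>lebesgue))"
proof -
  let ?c = "\<rho> powr (2 - real CARD('n))"
  have "riesz_energy a b \<le> (\<integral>\<^sup>+x. \<integral>\<^sup>+y. ennreal ?c * ennreal (a x) * ennreal (b y) \<partial>lebesgue \<partial>lebesgue)"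
    unfolding riesz_energy_def
  proof (intro nn_integral_mono)
    fix x y
    have "a x * riesz x y * b y \<le> ?c * a x * b y"
    proof (cases "a x \<noteq> 0 \<and> b y \<noteq> 0")
      case True
      have "riesz x y \<le> ?c" unfolding riesz_def using sep[of x y] True n \<rho> by (intro powr_mono2') auto
      then have "riesz x y * (a x * b y) \<le> ?c * (a x * b y)" using a(2)[of x] b(2)[of y] by (intro mult_right_mono) auto
      then show ?thesis by (simp add: mult_ac)
    qed auto
    then show "ennreal (a x * riesz x y * b y) \<le> ennreal ?c * ennreal (a x) * ennreal (b y)"
      using a(2)[of x] b(2)[of y] by (simp add: ennreal_mult[symmetric] ennreal_leI)
  qed
  also have "\<dots> = (\<integral>\<^sup>+x. ennreal ?c * (ennreal (a x) * (\<integral>\<^sup>+y. ennreal (b y) \<partial>lebesgue)) \<partial>lebesgue)"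
    using b(1) by (simp add: nn_integral_cmult mult.assoc)
  also have "\<dots> = ennreal ?c * ((\<integral>\<^sup>+x. ennreal (a x) \<partial>lebesgue) * (\<integral>\<^sup>+x. ennreal (b x) \<partial>lebesgue))"
    using a(1) by (simp add: nn_integral_cmult nn_integral_multc)
  finally show ?thesis .
qed

text \<open>Schur's test: \<open>a(x) a(y) \<le> (a(x)\<^sup>2 + a(y)\<^sup>2)/2\<close>, and each of the two parts is the pairing of \<open>a\<^sup>2/2\<close>
  with the indicator function of the ball.\<close>

lemma riesz_energy_self:
  fixes a :: "real^'n \<Rightarrow> real"
  assumes Kc: "riesz_ball_bound TYPE('n) Kc" and r: "r > 0"
    and a: "a \<in> borel_measurable lebesgue" "\<And>x. a x \<ge> 0" "\<And>x. x \<notin> ball p r \<Longrightarrow> a x = 0"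
  shows "riesz_energy a a \<le> ennreal (Kc * (2 * r)\<^sup>2) * (\<integral>\<^sup>+x. ennreal ((a x)\<^sup>2) \<partial>lebesgue)"
proof -
  interpret sigma_finite_measure "lebesgue :: (real^'n) measure" by (rule sigma_finite_lebesgue)
  define c where "c x = (a x)\<^sup>2 / 2" for x
  define d :: "real^'n \<Rightarrow> real" where "d x = indicator (ball p r) x" for x
  have cm: "c \<in> borel_measurable lebesgue" unfolding c_def[abs_def] using a(1) by measurable
  have dm: "d \<in> borel_measurable lebesgue" unfolding d_def[abs_def] by (intro borel_measurable_indicator) simp
  have le: "a x * riesz x y * a y \<le> c x * riesz x y * d y + d x * riesz x y * c y" for x y
  proof (cases "x \<in> ball p r \<and> y \<in> ball p r")
    case True
    have "0 \<le> (a x - a y)\<^sup>2" by simp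
    then have "a x * a y \<le> c x + c y" by (simp add: c_def power2_eq_square algebra_simps)
    then have "riesz x y * (a x * a y) \<le> riesz x y * (c x + c y)" using riesz_nonneg by (rule mult_left_mono)
    then show ?thesis using True by (simp add: d_def algebra_simps)
  next
    case False
    then have z: "a x * riesz x y * a y = 0" using a(3) by auto
    show ?thesis unfolding z using riesz_nonneg[of x y] by (simp add: c_def d_def)
  qed
  have m1: "(\<lambda>(x, y). ennreal (c x * riesz x y * d y)) \<in> borel_measurable (lebesgue \<Otimes>\<^sub>M lebesgue)" by (rule riesz_energy_measurable[OF cm dm])
  have m2: "(\<lambda>(x, y). ennreal (d x * riesz x y * c y)) \<in> borel_measurable (lebesgue \<Otimes>\<^sub>M lebesgue)" by (rule riesz_energy_measurable[OF dm cm])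
  have s1: "(\<lambda>y. ennreal (c x * riesz x y * d y)) \<in> borel_measurable lebesgue" for x
    using dm riesz_measurable by measurable
  have s2: "(\<lambda>y. ennreal (d x * riesz x y * c y)) \<in> borel_measurable lebesgue" for x
    using cm riesz_measurable by measurable
  have "riesz_energy a a \<le> (\<integral>\<^sup>+x. \<integral>\<^sup>+y. ennreal (c x * riesz x y * d y) + ennreal (d x * riesz x y * c y) \<partial>lebesgue \<partial>lebesgue)"
    unfolding riesz_energy_def
  proof (intro nn_integral_mono)
    fix x y
    have "c x * riesz x y * d y \<ge> 0" "d x * riesz x y * c y \<ge> 0" using riesz_nonneg[of x y] by (simp_all add: c_def d_def)
    then show "ennreal (a x * riesz x y * a y) \<le> ennreal (c x * riesz x y * d y) + ennreal (d x * riesz x y * c y)"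
      using ennreal_leI[OF le[of x y]] by (simp add: ennreal_plus)
  qed
  also have "\<dots> = riesz_energy c d + riesz_energy d c"
    unfolding riesz_energy_def using borel_measurable_nn_integral[OF m1] borel_measurable_nn_integral[OF m2]
    by (simp add: nn_integral_add[OF s1 s2] nn_integral_add)
  also have "\<dots> = riesz_energy c d + riesz_energy c d" using riesz_energy_commute[OF cm dm] by simp
  also have "riesz_energy c d \<le> ennreal (1 * Kc * (2 * r)\<^sup>2) * (\<integral>\<^sup>+x. ennreal (c x) \<partial>lebesgue)"
    by (rule riesz_energy_le[OF Kc r cm, where p = p]) (auto simp: c_def d_def a(3))
  finally have "riesz_energy a a \<le> ennreal (Kc * (2 * r)\<^sup>2) * ((\<integral>\<^sup>+x. ennreal (c x) \<partial>lebesgue) + (\<integral>\<^sup>+x. ennreal (c x) \<partial>lebesgue))"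
    by (simp add: distrib_left add_mono)
  also have "(\<integral>\<^sup>+x. ennreal (c x) \<partial>lebesgue) + (\<integral>\<^sup>+x. ennreal (c x) \<partial>lebesgue) = (\<integral>\<^sup>+x. ennreal ((a x)\<^sup>2) \<partial>lebesgue)"
    using cm a(1) by (subst nn_integral_add[symmetric]) (auto simp: c_def simp flip: ennreal_plus)
  finally show ?thesis .
qed

definition bounded_supported :: "(real^'n::finite) set \<Rightarrow> (real^'n \<Rightarrow> real^'m::finite) \<Rightarrow> bool" where
  "bounded_supported D h \<longleftrightarrow> h \<in> borel_measurable lebesgue \<and> (\<exists>B. \<forall>x. norm (h x) \<le> B) \<and> (\<forall>x. x \<notin> D \<longrightarrow> h x = 0)"

definition riesz_pairing :: "(real^'n::finite \<Rightarrow> real^'m::finite) \<Rightarrow> (real^'n \<Rightarrow> real^'m) \<Rightarrow> real" where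
  "riesz_pairing h g = enn2real (riesz_energy (\<lambda>x. norm (h x)) (\<lambda>x. norm (g x)))"

lemma bounded_supported_measurable: "bounded_supported D h \<Longrightarrow> h \<in> borel_measurable lebesgue"
  by (simp add: bounded_supported_def)

lemma bounded_supported_mono: "bounded_supported D h \<Longrightarrow> D \<subseteq> E \<Longrightarrow> bounded_supported E h"
  by (auto simp: bounded_supported_def)

lemma bounded_supported_integrable:
  fixes h :: "real^'n \<Rightarrow> real^'m"
  assumes h: "bounded_supported D h" and D: "D \<subseteq> ball p r"
  shows "integrable lebesgue (\<lambda>x. norm (h x))" "sqint lebesgue h"
proof -
  obtain B where B: "\<And>x. norm (h x) \<le> B" using h by (auto simp: bounded_supported_def)
  have z: "h x = 0" if "x \<notin> ball p r" for x using h D that by (auto simp: bounded_supported_def)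
  have m: "h \<in> borel_measurable (lebesgue_on UNIV)" using h by (simp add: bounded_supported_def lebesgue_on_UNIV_eq)
  have L: "h \<in> Lp q UNIV" if "q > 0" for q
    by (rule bounded_supp_Lp[OF that m lmeasurable_ball[of p r]]) (use B z in auto)
  show "integrable lebesgue (\<lambda>x. norm (h x))" using L[of 1] by (simp add: Lp_def lebesgue_on_UNIV_eq)
  show "sqint lebesgue h" using L[of 2] by (simp add: Lp_2_iff lebesgue_on_UNIV_eq)
qed

lemma riesz_pairing_finite:
  fixes h g :: "real^'n \<Rightarrow> real^'m"
  assumes Kc: "riesz_ball_bound TYPE('n) Kc" and r: "r > 0" and h: "bounded_supported (ball p r) h" and g: "bounded_supported (ball p r) g"
  shows "riesz_energy (\<lambda>x. norm (h x)) (\<lambda>x. norm (g x)) = ennreal (riesz_pairing h g)" "riesz_pairing h g \<ge> 0"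
    "\<And>B. (\<And>x. norm (g x) \<le> B) \<Longrightarrow> riesz_pairing h g \<le> B * Kc * (2 * r)\<^sup>2 * (LINT x|lebesgue. norm (h x))"
proof -
  have le: "riesz_energy (\<lambda>x. norm (h x)) (\<lambda>x. norm (g x)) \<le> ennreal (B * Kc * (2 * r)\<^sup>2 * (LINT x|lebesgue. norm (h x)))"
    if B: "\<And>x. norm (g x) \<le> B" for B
  proof -
    have B0: "B \<ge> 0" using B[of p] norm_ge_zero order_trans by blast
    have "riesz_energy (\<lambda>x. norm (h x)) (\<lambda>x. norm (g x)) \<le> ennreal (B * Kc * (2 * r)\<^sup>2) * (\<integral>\<^sup>+x. ennreal (norm (h x)) \<partial>lebesgue)"
      by (rule riesz_energy_le[OF Kc r, where p = p]) (use h g B in \<open>auto simp: bounded_supported_def\<close>)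
    also have "(\<integral>\<^sup>+x. ennreal (norm (h x)) \<partial>lebesgue) = ennreal (LINT x|lebesgue. norm (h x))"
      using bounded_supported_integrable(1)[OF h] by (intro nn_integral_eq_integral) auto
    finally show ?thesis using B0 Kc by (simp add: ennreal_mult' riesz_ball_bound_def)
  qed
  obtain B where B: "\<And>x. norm (g x) \<le> B" using g by (auto simp: bounded_supported_def)
  have "riesz_energy (\<lambda>x. norm (h x)) (\<lambda>x. norm (g x)) < top" using le[OF B] by (rule le_less_trans) simp
  then show eq: "riesz_energy (\<lambda>x. norm (h x)) (\<lambda>x. norm (g x)) = ennreal (riesz_pairing h g)" by (simp add: riesz_pairing_def)
  show "riesz_pairing h g \<ge> 0" by (simp add: riesz_pairing_def)
  fix B assume B: "\<And>x. norm (g x) \<le> B"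
  have B0: "B \<ge> 0" using B[of p] norm_ge_zero order_trans by blast
  have "B * Kc * (2 * r)\<^sup>2 * (LINT x|lebesgue. norm (h x)) \<ge> 0"
    using B0 Kc by (intro mult_nonneg_nonneg) (auto simp: riesz_ball_bound_def)
  then show "riesz_pairing h g \<le> B * Kc * (2 * r)\<^sup>2 * (LINT x|lebesgue. norm (h x))"
    using le[OF B] unfolding eq by (simp add: ennreal_le_iff)
qed

lemma riesz_pairing_commute:
  assumes "bounded_supported D h" "bounded_supported E g" shows "riesz_pairing h g = riesz_pairing g h"
  unfolding riesz_pairing_def using assms by (subst riesz_energy_commute) (auto simp: bounded_supported_def)

lemma riesz_pairing_separated:
  fixes h g :: "real^'n \<Rightarrow> real^'m"
  assumes n: "CARD('n) \<ge> 3" and \<rho>: "\<rho> > 0" and h: "bounded_supported (ball p r) h" and g: "bounded_supported (ball p r) g"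
    and sep: "\<And>x y. h x \<noteq> 0 \<Longrightarrow> g y \<noteq> 0 \<Longrightarrow> dist x y \<ge> \<rho>"
  shows "riesz_pairing h g \<le> \<rho> powr (2 - real CARD('n)) * ((LINT x|lebesgue. norm (h x)) * (LINT x|lebesgue. norm (g x)))"
proof -
  have "riesz_energy (\<lambda>x. norm (h x)) (\<lambda>x. norm (g x)) \<le> ennreal (\<rho> powr (2 - real CARD('n))) *
      ((\<integral>\<^sup>+x. ennreal (norm (h x)) \<partial>lebesgue) * (\<integral>\<^sup>+x. ennreal (norm (g x)) \<partial>lebesgue))"
    by (rule riesz_energy_separated[OF n \<rho>]) (use h g sep in \<open>auto simp: bounded_supported_def\<close>)
  also have "(\<integral>\<^sup>+x. ennreal (norm (h x)) \<partial>lebesgue) = ennreal (LINT x|lebesgue. norm (h x))"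
    using bounded_supported_integrable(1)[OF h] by (intro nn_integral_eq_integral) auto
  also have "(\<integral>\<^sup>+x. ennreal (norm (g x)) \<partial>lebesgue) = ennreal (LINT x|lebesgue. norm (g x))"
    using bounded_supported_integrable(1)[OF g] by (intro nn_integral_eq_integral) auto
  finally have "riesz_energy (\<lambda>x. norm (h x)) (\<lambda>x. norm (g x)) \<le>
     ennreal (\<rho> powr (2 - real CARD('n)) * ((LINT x|lebesgue. norm (h x)) * (LINT x|lebesgue. norm (g x))))"
    by (simp add: ennreal_mult' integral_nonneg_AE)
  then show ?thesis unfolding riesz_pairing_def by (intro enn2real_leI) (auto intro!: mult_nonneg_nonneg integral_nonneg_AE)
qed

lemma riesz_pairing_self:
  fixes h :: "real^'n \<Rightarrow> real^'m"
  assumes Kc: "riesz_ball_bound TYPE('n) Kc" and r: "r > 0" and h: "bounded_supported (ball p r) h"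
  shows "riesz_pairing h h \<le> Kc * (2 * r)\<^sup>2 * (l2 lebesgue h)\<^sup>2"
proof -
  have "riesz_energy (\<lambda>x. norm (h x)) (\<lambda>x. norm (h x)) \<le> ennreal (Kc * (2 * r)\<^sup>2) * (\<integral>\<^sup>+x. ennreal ((norm (h x))\<^sup>2) \<partial>lebesgue)"
    by (rule riesz_energy_self[OF Kc r]) (use h in \<open>auto simp: bounded_supported_def\<close>)
  also have "(\<integral>\<^sup>+x. ennreal ((norm (h x))\<^sup>2) \<partial>lebesgue) = ennreal ((l2 lebesgue h)\<^sup>2)"
    unfolding l2_square using bounded_supported_integrable(2)[OF h] by (intro nn_integral_eq_integral) (auto simp: sqint_def)
  finally have "riesz_energy (\<lambda>x. norm (h x)) (\<lambda>x. norm (h x)) \<le> ennreal (Kc * (2 * r)\<^sup>2 * (l2 lebesgue h)\<^sup>2)"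
    using Kc by (simp add: ennreal_mult' riesz_ball_bound_def)
  then show ?thesis unfolding riesz_pairing_def using Kc by (intro enn2real_leI) (auto simp: riesz_ball_bound_def)
qed

section \<open>An approximate Lax-Milgram theorem\<close>

text \<open>Bessel's inequality in two dimensions: a functional with values \<open>a\<close>, \<open>b\<close> on orthogonal vectors of
  lengths \<open>E\<close>, \<open>P\<close>. The bound is used at the vector that represents the functional.\<close>

lemma bessel_two:
  fixes E P \<rho> a b :: real
  assumes E: "E > 0" and P: "P > 0" and a: "a \<noteq> 0" and \<rho>: "\<rho> \<ge> 0"
    and le: "\<And>t. \<bar>a + t * b\<bar> \<le> \<rho> * sqrt (E\<^sup>2 + t\<^sup>2 * P\<^sup>2)"
  shows "a\<^sup>2 / E\<^sup>2 + b\<^sup>2 / P\<^sup>2 \<le> \<rho>\<^sup>2"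
proof -
  define Q where "Q = a\<^sup>2 / E\<^sup>2 + b\<^sup>2 / P\<^sup>2"
  have Q: "Q > 0" using E a by (auto simp: Q_def intro!: add_pos_nonneg)
  \<comment> \<open>The representing vector has coordinates \<open>a/E\<^sup>2\<close> and \<open>b/P\<^sup>2\<close>; here its first coordinate is scaled to 1.\<close>
  define t where "t = b * E\<^sup>2 / (P\<^sup>2 * a)"
  have 1: "a + t * b = E\<^sup>2 / a * Q" using E P a by (simp add: t_def Q_def field_simps power2_eq_square)
  have 2: "E\<^sup>2 + t\<^sup>2 * P\<^sup>2 = (E\<^sup>2 / a)\<^sup>2 * Q" using E P a by (simp add: t_def Q_def field_simps power2_eq_square)
  have "\<bar>E\<^sup>2 / a * Q\<bar>\<^sup>2 \<le> (\<rho> * sqrt ((E\<^sup>2 / a)\<^sup>2 * Q))\<^sup>2"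
    using power_mono[OF le[of t], of 2] unfolding 1 2 by simp
  also have "\<dots> = \<rho>\<^sup>2 * ((E\<^sup>2 / a)\<^sup>2 * Q)" using Q by (simp add: power_mult_distrib)
  finally have "(E\<^sup>2 / a)\<^sup>2 * (Q * Q) \<le> (E\<^sup>2 / a)\<^sup>2 * (\<rho>\<^sup>2 * Q)" by (simp add: power_mult_distrib power2_eq_square mult_ac)
  then have "Q * Q \<le> \<rho>\<^sup>2 * Q" using E a by (simp add: mult_le_cancel_left_pos)
  then show ?thesis using Q unfolding Q_def[symmetric] by (simp add: mult_le_cancel_right_pos)
qed

lemma two_dim_Cauchy_Schwarz: "a * u + b * v \<le> sqrt (a\<^sup>2 + b\<^sup>2) * sqrt (u\<^sup>2 + v\<^sup>2)" for a b u v :: real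
proof -
  have "(a * u + b * v)\<^sup>2 + (a * v - b * u)\<^sup>2 = (a\<^sup>2 + b\<^sup>2) * (u\<^sup>2 + v\<^sup>2)" by (simp add: power2_eq_square algebra_simps)
  then have "(a * u + b * v)\<^sup>2 \<le> (a\<^sup>2 + b\<^sup>2) * (u\<^sup>2 + v\<^sup>2)" using zero_le_power2[of "a * v - b * u"] by linarith
  from real_sqrt_le_mono[OF this] have "\<bar>a * u + b * v\<bar> \<le> sqrt ((a\<^sup>2 + b\<^sup>2) * (u\<^sup>2 + v\<^sup>2))"
    by simp
  then show ?thesis by (simp add: real_sqrt_mult)
qed

text \<open>A bounded coercive form \<open>B\<close> and a bounded functional \<open>lin\<close> on a real vector space with a positive
  semidefinite inner product \<open>ip\<close>. The operation \<open>comb f c g\<close> stands for \<open>f + c g\<close>, so that carriers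
  consisting of functions need no vector space type of their own. As the space may be incomplete,
  the equation \<open>B \<phi> \<psi> = lin \<psi>\<close> is solvable only up to an arbitrarily small residual.\<close>

locale pre_hilbert_form =
  fixes V :: "'v set" and comb :: "'v \<Rightarrow> real \<Rightarrow> 'v \<Rightarrow> 'v" and ip B :: "'v \<Rightarrow> 'v \<Rightarrow> real" and lin :: "'v \<Rightarrow> real"
    and \<nu> M L :: real and v0 :: 'v
  assumes v0: "v0 \<in> V"
    and comb: "f \<in> V \<Longrightarrow> g \<in> V \<Longrightarrow> comb f c g \<in> V"
    and ip_commute: "ip f g = ip g f"
    and ip_nonneg: "ip f f \<ge> 0"
    and ip_comb: "f \<in> V \<Longrightarrow> g \<in> V \<Longrightarrow> h \<in> V \<Longrightarrow> ip (comb f c g) h = ip f h + c * ip g h"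
    and B_left: "f \<in> V \<Longrightarrow> g \<in> V \<Longrightarrow> h \<in> V \<Longrightarrow> B (comb f c g) h = B f h + c * B g h"
    and B_right: "f \<in> V \<Longrightarrow> g \<in> V \<Longrightarrow> h \<in> V \<Longrightarrow> B h (comb f c g) = B h f + c * B h g"
    and B_bound: "f \<in> V \<Longrightarrow> g \<in> V \<Longrightarrow> \<bar>B f g\<bar> \<le> M * (sqrt (ip f f) * sqrt (ip g g))"
    and B_coercive: "f \<in> V \<Longrightarrow> B f f \<ge> \<nu> * ip f f"
    and l_comb: "f \<in> V \<Longrightarrow> g \<in> V \<Longrightarrow> lin (comb f c g) = lin f + c * lin g"
    and l_bound: "f \<in> V \<Longrightarrow> \<bar>lin f\<bar> \<le> L * sqrt (ip f f)"
    and \<nu>: "\<nu> > 0" and M: "M > 0"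
begin

abbreviation "nrm f \<equiv> sqrt (ip f f)"

text \<open>A residual of dual norm at most \<open>\<rho>\<close>.\<close>

definition attainable :: "real \<Rightarrow> bool" where
  "attainable \<rho> \<longleftrightarrow> (\<exists>\<phi>\<in>V. \<forall>\<psi>\<in>V. \<bar>lin \<psi> - B \<phi> \<psi>\<bar> \<le> \<rho> * nrm \<psi>)"

lemma nrm_comb:
  assumes "f \<in> V" "g \<in> V" shows "(nrm (comb f c g))\<^sup>2 = ip f f + 2 * c * ip f g + c\<^sup>2 * ip g g"
proof -
  have "ip (comb f c g) (comb f c g) = ip f f + 2 * c * ip f g + c\<^sup>2 * ip g g"
    using assms comb[OF assms, of c] ip_comb[OF assms comb[OF assms]] ip_comb[OF assms assms(1)] ip_comb[OF assms assms(2)]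
      ip_commute[of f "comb f c g"] ip_commute[of g "comb f c g"] ip_commute[of g f]
    by (simp add: power2_eq_square algebra_simps)
  then show ?thesis using ip_nonneg[of "comb f c g"] by (metis real_sqrt_pow2)
qed

text \<open>One step of the iteration. Let \<open>r\<close> be the residual of \<open>\<phi>\<close>, of dual norm at most \<open>\<rho>\<close>. If its
  dual norm is at most \<open>(1 - \<delta>) \<rho>\<close>, nothing is to be done. Otherwise it is almost attained at some
  \<open>e\<close>; by Bessel's inequality \<open>r\<close> is then small on the orthogonal complement of \<open>e\<close>, namely at most
  \<open>\<rho> \<surd>(2\<delta>)\<close>. A step of length \<open>\<rho> s1\<close> along \<open>e\<close> lowers the residual in the direction \<open>e\<close> to
  \<open>\<rho> (1 - s1 \<nu>)\<close> by coercivity, and adds at most \<open>\<rho> s1 M\<close> on the complement by boundedness. The choice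
  \<open>\<delta> = (s1 M)\<^sup>2/2\<close> makes both contributions on the complement equal, and \<open>s1\<close> minimises
  \<open>(1 - s1 \<nu>)\<^sup>2 + (2 s1 M)\<^sup>2\<close>.\<close>

lemma residual_contraction:
  fixes \<rho> :: real
  defines "s1 \<equiv> \<nu> / (\<nu>\<^sup>2 + 4 * M\<^sup>2)"
  defines "\<delta> \<equiv> (s1 * M)\<^sup>2 / 2"
  assumes g: "attainable \<rho>" and \<rho>: "\<rho> > 0"
  shows "attainable (max (1 - \<delta>) (sqrt (1 - \<nu>\<^sup>2 / (\<nu>\<^sup>2 + 4 * M\<^sup>2))) * \<rho>)"
proof -
  let ?q = "max (1 - \<delta>) (sqrt (1 - \<nu>\<^sup>2 / (\<nu>\<^sup>2 + 4 * M\<^sup>2)))"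
  have den: "\<nu>\<^sup>2 + 4 * M\<^sup>2 > 0" using \<nu> by (simp add: add_pos_nonneg)
  have s1: "s1 > 0" using \<nu> den by (simp add: s1_def)
  have "0 \<le> (\<nu> - 2 * M)\<^sup>2" by simp
  then have "4 * (\<nu> * M) \<le> \<nu>\<^sup>2 + 4 * M\<^sup>2" by (simp add: power2_eq_square algebra_simps)
  then have s1M: "s1 * M \<le> 1 / 4" using den by (simp add: s1_def field_simps)
  have s1M0: "s1 * M > 0" using s1 M by simp
  have "(s1 * M)\<^sup>2 \<le> (1 / 4)\<^sup>2" using s1M s1M0 by (intro power_mono) auto
  then have "(s1 * M)\<^sup>2 \<le> 1 / 16" by (simp add: power_divide)
  then have \<delta>: "0 < \<delta>" "\<delta> \<le> 1 / 4" using zero_less_power[OF s1M0, of 2] unfolding \<delta>_def by linarith+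
  obtain \<phi> where \<phi>: "\<phi> \<in> V" "\<And>\<psi>. \<psi> \<in> V \<Longrightarrow> \<bar>lin \<psi> - B \<phi> \<psi>\<bar> \<le> \<rho> * nrm \<psi>"
    using g unfolding attainable_def by blast
  define r where "r \<psi> = lin \<psi> - B \<phi> \<psi>" for \<psi>
  have r_bound: "\<bar>r \<psi>\<bar> \<le> \<rho> * nrm \<psi>" if "\<psi> \<in> V" for \<psi> using \<phi>(2)[OF that] by (simp add: r_def)
  have r_comb: "r (comb f c h) = r f + c * r h" if "f \<in> V" "h \<in> V" for f h c
    using that \<phi>(1) by (simp add: r_def l_comb B_right algebra_simps)
  have nn: "nrm f \<ge> 0" for f by (simp add: ip_nonneg)
  show ?thesis
  proof (cases "\<forall>\<psi>\<in>V. \<bar>r \<psi>\<bar> \<le> (1 - \<delta>) * \<rho> * nrm \<psi>")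
    case True
    have "\<bar>lin \<psi> - B \<phi> \<psi>\<bar> \<le> ?q * \<rho> * nrm \<psi>" if "\<psi> \<in> V" for \<psi>
    proof -
      have "\<bar>lin \<psi> - B \<phi> \<psi>\<bar> \<le> (1 - \<delta>) * \<rho> * nrm \<psi>" using True that by (simp add: r_def)
      also have "\<dots> \<le> ?q * \<rho> * nrm \<psi>" using \<rho> nn by (intro mult_right_mono) auto
      finally show ?thesis .
    qed
    then show ?thesis unfolding attainable_def using \<phi>(1) by blast
  next
    case False
    then obtain e where e: "e \<in> V" "\<bar>r e\<bar> > (1 - \<delta>) * \<rho> * nrm e" by (auto simp: not_le)
    define E where "E = nrm e"
    have "0 \<le> (1 - \<delta>) * \<rho> * nrm e" using \<delta> \<rho> nn[of e] by (intro mult_nonneg_nonneg) auto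
    then have re: "\<bar>r e\<bar> > 0" using e(2) by linarith
    then have E: "E > 0" using r_bound[OF e(1)] \<rho> nn[of e] unfolding E_def by (smt (verit) mult_eq_0_iff)
    have ipe: "ip e e = E\<^sup>2" by (simp add: E_def ip_nonneg)
    define s where "s = \<rho> * s1"
    have s: "s > 0" using \<rho> s1 by (simp add: s_def)
    define \<sigma> where "\<sigma> = sgn (r e) * s / E"
    have \<sigma>: "\<bar>\<sigma>\<bar> = s / E" using re s E by (simp add: \<sigma>_def abs_mult abs_sgn_eq)
    define r' where "r' \<psi> = r \<psi> - \<sigma> * B e \<psi>" for \<psi>
    have r'_comb: "r' (comb f c h) = r' f + c * r' h" if "f \<in> V" "h \<in> V" for f h c
      using that e(1) by (simp add: r'_def r_comb B_right algebra_simps)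
    have r'e: "\<bar>r' e\<bar> \<le> (\<rho> - s * \<nu>) * E"
    proof -
      have "r' e = sgn (r e) * (\<bar>r e\<bar> - s / E * B e e)"
        by (simp add: r'_def \<sigma>_def algebra_simps) (simp add: abs_sgn mult.commute)
      then have 1: "\<bar>r' e\<bar> = \<bar>\<bar>r e\<bar> - s / E * B e e\<bar>" using re by (simp add: abs_mult abs_sgn_eq)
      have "s / E * B e e \<ge> s / E * (\<nu> * E\<^sup>2)" using B_coercive[OF e(1)] ipe s E by (intro mult_left_mono) auto
      then have lo: "s / E * B e e \<ge> s * \<nu> * E" using E by (simp add: power2_eq_square)
      have "B e e \<le> M * (E * E)" using B_bound[OF e(1) e(1)] by (simp add: E_def)
      then have "s / E * B e e \<le> s / E * (M * (E * E))" using s E by (intro mult_left_mono) auto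
      also have "\<dots> = \<rho> * (s1 * M) * E" using E by (simp add: s_def)
      also have "\<dots> \<le> \<rho> * (1 - \<delta>) * E" using s1M \<delta> \<rho> E by (intro mult_right_mono mult_left_mono) auto
      also have "\<dots> < \<bar>r e\<bar>" using e(2) by (simp add: E_def mult_ac)
      finally have hi: "s / E * B e e < \<bar>r e\<bar>" .
      have "\<bar>r e\<bar> \<le> \<rho> * E" using r_bound[OF e(1)] by (simp add: E_def)
      then show ?thesis using 1 lo hi by (simp add: algebra_simps)
    qed
    have r'_bound: "\<bar>r' \<psi>\<bar> \<le> ?q * \<rho> * nrm \<psi>" if \<psi>: "\<psi> \<in> V" for \<psi>
    proof -
      define c where "c = ip e \<psi> / E\<^sup>2"
      define w where "w = comb \<psi> (- c) e"
      have w: "w \<in> V" unfolding w_def by (rule comb[OF \<psi> e(1)])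
      have ew: "ip e w = 0"
      proof -
        have "ip w e = ip \<psi> e - c * ip e e" unfolding w_def using ip_comb[OF \<psi> e(1) e(1), of "-c"] by simp
        then show ?thesis using ip_commute[of e \<psi>] ip_commute[of e w] E by (simp add: c_def ipe)
      qed
      define P where "P = nrm w"
      have P: "P \<ge> 0" unfolding P_def by (rule nn)
      have ipw: "ip w w = P\<^sup>2" by (simp add: P_def ip_nonneg)
      have r'\<psi>: "r' \<psi> = r' w + c * r' e" using r'_comb[OF \<psi> e(1), of "-c"] by (simp add: w_def)
      have nrm\<psi>: "(nrm \<psi>)\<^sup>2 = (\<bar>c\<bar> * E)\<^sup>2 + P\<^sup>2"
      proof -
        have "P\<^sup>2 = (nrm w)\<^sup>2" by (simp add: P_def)
        also have "\<dots> = ip \<psi> \<psi> - 2 * c * ip \<psi> e + c\<^sup>2 * E\<^sup>2"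
          unfolding w_def using nrm_comb[OF \<psi> e(1), of "-c"] by (simp add: ipe)
        also have "ip \<psi> e = c * E\<^sup>2" using ip_commute[of e \<psi>] E by (simp add: c_def)
        finally show ?thesis by (simp add: ip_nonneg power_mult_distrib power2_eq_square algebra_simps)
      qed
      have rw: "\<bar>r w\<bar> \<le> \<rho> * (s1 * M) * P"
      proof (cases "P = 0")
        case True then show ?thesis using r_bound[OF w] by (simp add: P_def)
      next
        case False
        then have P0: "P > 0" using P by simp
        have "\<bar>r e + t * r w\<bar> \<le> \<rho> * sqrt (E\<^sup>2 + t\<^sup>2 * P\<^sup>2)" for t
        proof -
          have "nrm (comb e t w) = sqrt (E\<^sup>2 + t\<^sup>2 * P\<^sup>2)"
            using nrm_comb[OF e(1) w, of t] nn[of "comb e t w"] unfolding ipe ew ipw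
            by (metis add.right_neutral mult_zero_right real_sqrt_unique)
          then show ?thesis using r_bound[OF comb[OF e(1) w, of t]] r_comb[OF e(1) w, of t] by simp
        qed
        then have "(r e)\<^sup>2 / E\<^sup>2 + (r w)\<^sup>2 / P\<^sup>2 \<le> \<rho>\<^sup>2"
          using re \<rho> by (intro bessel_two[OF E P0]) auto
        moreover have "(r e)\<^sup>2 / E\<^sup>2 \<ge> ((1 - \<delta>) * \<rho>)\<^sup>2"
        proof -
          have "((1 - \<delta>) * \<rho> * E)\<^sup>2 \<le> \<bar>r e\<bar>\<^sup>2"
            using e(2) \<delta> \<rho> E unfolding E_def by (intro power_mono) auto
          then have "((1 - \<delta>) * \<rho>)\<^sup>2 * E\<^sup>2 \<le> (r e)\<^sup>2" unfolding power_mult_distrib[of _ E] by simp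
          then show ?thesis using E by (simp add: pos_le_divide_eq)
        qed
        ultimately have "(r w)\<^sup>2 / P\<^sup>2 \<le> \<rho>\<^sup>2 - ((1 - \<delta>) * \<rho>)\<^sup>2" by linarith
        also have "\<dots> = \<rho>\<^sup>2 * (2 * \<delta> - \<delta>\<^sup>2)" by (simp add: power2_eq_square algebra_simps)
        also have "\<dots> \<le> \<rho>\<^sup>2 * (2 * \<delta>)" by (intro mult_left_mono) auto
        also have "\<dots> = (\<rho> * (s1 * M))\<^sup>2" by (simp add: \<delta>_def power_mult_distrib)
        finally have "(r w)\<^sup>2 \<le> (\<rho> * (s1 * M) * P)\<^sup>2" using P0 by (simp add: field_simps power_mult_distrib)
        then show ?thesis using s1M0 \<rho> P by (simp add: abs_le_square_iff[symmetric])
      qed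
      have "\<bar>B e w\<bar> \<le> M * (E * P)" using B_bound[OF e(1) w] by (simp add: E_def P_def)
      then have "\<bar>\<sigma> * B e w\<bar> \<le> s / E * (M * (E * P))"
        unfolding abs_mult \<sigma> using s E by (intro mult_left_mono) auto
      also have "\<dots> = \<rho> * (s1 * M) * P" using E by (simp add: s_def)
      finally have r'w: "\<bar>r' w\<bar> \<le> 2 * (\<rho> * (s1 * M)) * P" using rw by (simp add: r'_def)
      have "\<bar>r' \<psi>\<bar> \<le> \<bar>r' w\<bar> + \<bar>c\<bar> * \<bar>r' e\<bar>" unfolding r'\<psi> by (metis abs_mult abs_triangle_ineq)
      also have "\<bar>c\<bar> * \<bar>r' e\<bar> \<le> \<bar>c\<bar> * ((\<rho> - s * \<nu>) * E)" by (intro mult_left_mono r'e) auto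
      finally have "\<bar>r' \<psi>\<bar> \<le> (\<rho> - s * \<nu>) * (\<bar>c\<bar> * E) + 2 * (\<rho> * (s1 * M)) * P"
        using r'w by (simp add: mult_ac)
      also have "\<dots> \<le> sqrt ((\<rho> - s * \<nu>)\<^sup>2 + (2 * (\<rho> * (s1 * M)))\<^sup>2) * sqrt ((\<bar>c\<bar> * E)\<^sup>2 + P\<^sup>2)"
        by (rule two_dim_Cauchy_Schwarz)
      also have "(\<rho> - s * \<nu>)\<^sup>2 + (2 * (\<rho> * (s1 * M)))\<^sup>2 = \<rho>\<^sup>2 * (1 - \<nu>\<^sup>2 / (\<nu>\<^sup>2 + 4 * M\<^sup>2))"
      proof -
        have "(\<rho> - s * \<nu>)\<^sup>2 + (2 * (\<rho> * (s1 * M)))\<^sup>2 = \<rho>\<^sup>2 * (1 - 2 * s1 * \<nu> + s1 * (s1 * (\<nu>\<^sup>2 + 4 * M\<^sup>2)))"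
          by (simp add: s_def power2_eq_square algebra_simps)
        also have "s1 * (\<nu>\<^sup>2 + 4 * M\<^sup>2) = \<nu>" using den by (simp add: s1_def)
        also have "1 - 2 * s1 * \<nu> + s1 * \<nu> = 1 - \<nu>\<^sup>2 / (\<nu>\<^sup>2 + 4 * M\<^sup>2)" by (simp add: s1_def power2_eq_square)
        finally show ?thesis .
      qed
      also have "sqrt ((\<bar>c\<bar> * E)\<^sup>2 + P\<^sup>2) = nrm \<psi>"
        unfolding nrm\<psi>[symmetric] by (simp add: ip_nonneg)
      also have "sqrt (\<rho>\<^sup>2 * (1 - \<nu>\<^sup>2 / (\<nu>\<^sup>2 + 4 * M\<^sup>2))) = sqrt (1 - \<nu>\<^sup>2 / (\<nu>\<^sup>2 + 4 * M\<^sup>2)) * \<rho>"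
        using \<rho> by (simp add: real_sqrt_mult)
      also have "\<dots> * nrm \<psi> \<le> ?q * \<rho> * nrm \<psi>" using \<rho> nn by (intro mult_right_mono) auto
      finally show ?thesis .
    qed
    have "\<bar>lin \<psi> - B (comb \<phi> \<sigma> e) \<psi>\<bar> \<le> ?q * \<rho> * nrm \<psi>" if \<psi>: "\<psi> \<in> V" for \<psi>
      using r'_bound[OF \<psi>] B_left[OF \<phi>(1) e(1) \<psi>, of \<sigma>] by (simp add: r'_def r_def algebra_simps)
    then show ?thesis unfolding attainable_def using comb[OF \<phi>(1) e(1)] by blast
  qed
qed

text \<open>The functional and the form are bounded, so the residual of \<open>v0\<close> has finite dual norm; each contraction
  step reduces it by a fixed factor.\<close>

theorem approximate_solution:
  assumes \<epsilon>: "\<epsilon> > 0" shows "\<exists>\<phi>\<in>V. \<forall>\<psi>\<in>V. \<bar>B \<phi> \<psi> - lin \<psi>\<bar> \<le> \<epsilon> * nrm \<psi>"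
proof -
  obtain q where q: "0 < q" "q < 1" "\<And>\<rho>. attainable \<rho> \<Longrightarrow> \<rho> > 0 \<Longrightarrow> attainable (q * \<rho>)"
  proof
    let ?q = "max (1 - (\<nu> / (\<nu>\<^sup>2 + 4 * M\<^sup>2) * M)\<^sup>2 / 2) (sqrt (1 - \<nu>\<^sup>2 / (\<nu>\<^sup>2 + 4 * M\<^sup>2)))"
    have den: "\<nu>\<^sup>2 + 4 * M\<^sup>2 > 0" using \<nu> by (simp add: add_pos_nonneg)
    have "\<nu>\<^sup>2 / (\<nu>\<^sup>2 + 4 * M\<^sup>2) < 1" using den M by simp
    then show "0 < ?q" by (simp add: less_max_iff_disj)
    have "\<nu>\<^sup>2 / (\<nu>\<^sup>2 + 4 * M\<^sup>2) > 0" "(\<nu> / (\<nu>\<^sup>2 + 4 * M\<^sup>2) * M)\<^sup>2 > 0" using den \<nu> M by auto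
    then show "?q < 1" by simp
    show "attainable (?q * \<rho>)" if "attainable \<rho>" "\<rho> > 0" for \<rho> using residual_contraction[OF that] .
  qed
  define \<rho>0 where "\<rho>0 = \<bar>L\<bar> + M * nrm v0 + 1"
  have \<rho>0: "\<rho>0 > 0" using M ip_nonneg[of v0] by (simp add: \<rho>0_def add_nonneg_pos)
  have "attainable \<rho>0"
    unfolding attainable_def
  proof (intro bexI[OF _ v0] ballI)
    fix \<psi> assume \<psi>: "\<psi> \<in> V"
    have "L * nrm \<psi> \<le> \<bar>L\<bar> * nrm \<psi>" using ip_nonneg[of \<psi>] by (intro mult_right_mono) auto
    then have "\<bar>lin \<psi> - B v0 \<psi>\<bar> \<le> \<bar>L\<bar> * nrm \<psi> + M * (nrm v0 * nrm \<psi>)"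
      using l_bound[OF \<psi>] B_bound[OF v0 \<psi>] abs_triangle_ineq4[of "lin \<psi>" "B v0 \<psi>"] by linarith
    also have "\<dots> \<le> \<rho>0 * nrm \<psi>" using ip_nonneg[of \<psi>] by (simp add: \<rho>0_def algebra_simps)
    finally show "\<bar>lin \<psi> - B v0 \<psi>\<bar> \<le> \<rho>0 * nrm \<psi>" .
  qed
  then have it: "attainable (q ^ k * \<rho>0)" for k
  proof (induction k)
    case (Suc k)
    then show ?case using q(3)[of "q ^ k * \<rho>0"] q(1) \<rho>0 by (simp add: mult.assoc)
  qed simp
  have "(\<lambda>k. q ^ k * \<rho>0) \<longlonglongrightarrow> 0 * \<rho>0" using q(1,2) by (intro tendsto_intros LIMSEQ_realpow_zero) auto
  then have "eventually (\<lambda>k. q ^ k * \<rho>0 < \<epsilon>) sequentially" by (rule order_tendstoD(2)) (simp add: \<epsilon>)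
  then obtain k where k: "q ^ k * \<rho>0 < \<epsilon>" by (auto simp: eventually_sequentially)
  obtain \<phi> where \<phi>: "\<phi> \<in> V" "\<And>\<psi>. \<psi> \<in> V \<Longrightarrow> \<bar>lin \<psi> - B \<phi> \<psi>\<bar> \<le> q ^ k * \<rho>0 * nrm \<psi>"
    using it[of k] unfolding attainable_def by blast
  have "\<bar>B \<phi> \<psi> - lin \<psi>\<bar> \<le> \<epsilon> * nrm \<psi>" if "\<psi> \<in> V" for \<psi>
    using \<phi>(2)[OF that] mult_right_mono[OF less_imp_le[OF k], of "nrm \<psi>"] ip_nonneg[of \<psi>] by (simp add: abs_minus_commute)
  then show ?thesis using \<phi>(1) by blast
qed

end

section \<open>Approximate solvability with a kernel bound\<close>

text \<open>Solvability with zero boundary values by test functions, up to \<open>\<epsilon>\<close> in the dual of the energy norm,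
  together with the weak form of the kernel bound \<open>\<bar>\<phi>(x)\<bar> \<le> K \<integral>\<bar>x - y\<bar>\<^bsup>2-n\<^esup> \<bar>g(y)\<bar> dy\<close>, obtained by
  integrating against \<open>h\<close>. The weak form is symmetric in \<open>g\<close> and \<open>h\<close>, hence preserved under duality.
  The error \<open>\<epsilon> \<parallel>h\<parallel>\<^sub>2\<close> leaves room for replacing an exact solution by an \<open>L\<^sup>2\<close>-close test function.\<close>

definition approx_solvable ::
    "('n::finite, 'm::finite) coeff \<Rightarrow> (real^'n) set \<Rightarrow> real^'n \<Rightarrow> real \<Rightarrow> real \<Rightarrow> bool" where
  "approx_solvable A \<Omega> p r K \<longleftrightarrow>
     (\<forall>g. bounded_supported (\<Omega> \<inter> ball p r) g \<longrightarrow> (\<forall>\<epsilon>>0. \<exists>\<phi>\<in>Cc_inf_vec \<Omega>.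
        (\<forall>\<psi>\<in>Cc_inf_vec \<Omega>. \<bar>bform A UNIV \<phi> \<psi> - (LINT x|lebesgue. g x \<bullet> \<psi> x)\<bar> \<le> \<epsilon> * l2 lebesgue (cjac \<psi>)) \<and>
        (\<forall>h. bounded_supported (\<Omega> \<inter> ball p r) h \<longrightarrow>
           \<bar>LINT x|lebesgue. h x \<bullet> \<phi> x\<bar> \<le> K * riesz_pairing h g + \<epsilon> * l2 lebesgue h)))"

lemma lebesgue_shrink:
  fixes f :: "'a::euclidean_space \<Rightarrow> 'b::euclidean_space"
  assumes "S \<in> sets lebesgue" "\<And>x. x \<notin> S \<Longrightarrow> f x = 0"
  shows "integral\<^sup>L lebesgue f = integral\<^sup>L (lebesgue_on S) f"
    and "integrable lebesgue f \<longleftrightarrow> integrable (lebesgue_on S) f"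
  using lebesgue_on_shrink[of S UNIV f] assms by (simp_all add: lebesgue_on_UNIV_eq)

lemma l2_shrink:
  fixes F :: "'a::euclidean_space \<Rightarrow> 'b::euclidean_space"
  assumes "S \<in> sets lebesgue" "\<And>x. x \<notin> S \<Longrightarrow> F x = 0"
  shows "l2 lebesgue F = l2 (lebesgue_on S) F"
  unfolding l2_def using lebesgue_shrink(1)[OF assms(1), of "\<lambda>x. (norm (F x))\<^sup>2"] assms(2) by simp

lemma Cc_inf_vec_sqint_UNIV:
  fixes \<phi> :: "real^'n \<Rightarrow> real^'m"
  assumes "\<phi> \<in> Cc_inf_vec U"
  shows "sqint lebesgue \<phi>" "sqint lebesgue (cjac \<phi>)"
  using Cc_inf_vec_sqint[OF open_UNIV Cc_inf_vec_mono[OF subset_UNIV assms]] by (simp_all add: lebesgue_on_UNIV_eq)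

lemma bform_UNIV:
  assumes A: "bounded_coercive \<nu> M A" and U: "open U" and \<psi>: "\<psi> \<in> Cc_inf_vec U"
  shows "bform A UNIV \<phi> \<psi> = bform A U \<phi> \<psi>"
proof -
  have "aform A x (cjac \<phi> x) (cjac \<psi> x) = 0" if "x \<notin> U" for x
    using Cc_inf_vec_support(2)[OF \<psi> that] by (simp add: bounded_bilinear.zero_right[OF aform_bilinear[OF A]])
  then show ?thesis unfolding bform_def using U by (simp add: lebesgue_on_UNIV_eq lebesgue_shrink(1)[of U])
qed

lemma bform_bound:
  assumes A: "bounded_coercive \<nu> M A" "\<nu> > 0" and "\<phi> \<in> Cc_inf_vec U" "\<psi> \<in> Cc_inf_vec U"
  shows "\<bar>bform A UNIV \<phi> \<psi>\<bar> \<le> M * (l2 lebesgue (cjac \<phi>) * l2 lebesgue (cjac \<psi>))"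
  using aform_integrable(2)[OF A, of UNIV "cjac \<phi>" "cjac \<psi>"] Cc_inf_vec_sqint_UNIV assms(3,4)
  unfolding bform_def lebesgue_on_UNIV_eq by blast

lemma bform_coercive:
  assumes A: "bounded_coercive \<nu> M A" "\<nu> > 0" and \<phi>: "\<phi> \<in> Cc_inf_vec U"
  shows "\<nu> * (l2 lebesgue (cjac \<phi>))\<^sup>2 \<le> bform A UNIV \<phi> \<phi>"
proof -
  note s = Cc_inf_vec_sqint_UNIV(2)[OF \<phi>]
  have "(LINT x|lebesgue. \<nu> * (norm (cjac \<phi> x))\<^sup>2) \<le> (LINT x|lebesgue. aform A x (cjac \<phi> x) (cjac \<phi> x))"
    using s aform_integrable(1)[OF A, of UNIV "cjac \<phi>" "cjac \<phi>"] bounded_coercive_coercive[OF A(1)]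
    by (intro integral_mono) (auto simp: sqint_def lebesgue_on_UNIV_eq)
  then show ?thesis by (simp add: bform_def l2_square lebesgue_on_UNIV_eq)
qed

lemma cjac_comb:
  assumes "\<phi> \<in> Cc_inf_vec U" "\<psi> \<in> Cc_inf_vec U"
  shows "cjac (\<lambda>x. \<phi> x + c *\<^sub>R \<psi> x) = (\<lambda>x. cjac \<phi> x + c *\<^sub>R cjac \<psi> x)"
  using cjac_add_scale Cc_inf_vec_differentiable[OF assms(1)] Cc_inf_vec_differentiable[OF assms(2)] by blast

text \<open>Each approximate solution \<open>\<phi>\<^sub>h\<close> bounds the functional \<open>\<psi> \<mapsto> \<integral>h \<bullet> \<psi>\<close> in the energy norm.
  The functional is therefore approximately represented by the transposed form, and testing
  the two problems against each other exchanges the roles of \<open>g\<close> and \<open>h\<close>.\<close>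

lemma approx_solvable_adj:
  fixes A :: "('n::finite, 'm::finite) coeff"
  assumes Kc: "riesz_ball_bound TYPE('n) Kc" and r: "r > 0" and A: "bounded_coercive \<nu> M A" "\<nu> > 0" and K: "K \<ge> 0"
    and sol: "approx_solvable A \<Omega> p r K"
  shows "approx_solvable (adj_coeff A) \<Omega> p r K"
  unfolding approx_solvable_def
proof (intro allI impI)
  fix g :: "real^'n \<Rightarrow> real^'m" and \<epsilon> :: real
  assume g: "bounded_supported (\<Omega> \<inter> ball p r) g" and \<epsilon>: "\<epsilon> > 0"
  let ?V = "Cc_inf_vec \<Omega> :: (real^'n \<Rightarrow> real^'m) set"
  let ?D = "\<lambda>\<phi>::real^'n \<Rightarrow> real^'m. l2 lebesgue (cjac \<phi>)"
  let ?B = "ball p r"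
  have M: "M > 0" using bounded_coercive_constants[OF A(1)] A(2) by simp
  have gB: "bounded_supported ?B g" by (rule bounded_supported_mono[OF g]) simp
  have sg: "sqint lebesgue g" by (rule bounded_supported_integrable(2)[OF gB order_refl])
  define \<kappa> where "\<kappa> = K * (Kc * (2 * r)\<^sup>2)"
  have \<kappa>: "\<kappa> \<ge> 0" using K Kc by (simp add: \<kappa>_def riesz_ball_bound_def)
  define C1 where "C1 = 1 + (\<kappa> + 2) / \<nu>"
  have C1: "C1 \<ge> 1" using \<kappa> A(2) by (simp add: C1_def)
  define \<epsilon>1 where "\<epsilon>1 = \<epsilon> / (2 * C1)"
  have \<epsilon>1: "\<epsilon>1 > 0" using \<epsilon> C1 by (simp add: \<epsilon>1_def)
  obtain \<phi>g where \<phi>g: "\<phi>g \<in> ?V" "\<forall>\<psi>\<in>?V. \<bar>bform A UNIV \<phi>g \<psi> - (LINT x|lebesgue. g x \<bullet> \<psi> x)\<bar> \<le> 1 * ?D \<psi>"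
    using sol[unfolded approx_solvable_def, rule_format, OF g zero_less_one] by blast
  have inner_i: "integrable lebesgue (\<lambda>x. g x \<bullet> \<psi> x)" if "\<psi> \<in> ?V" for \<psi>
    by (rule inner_integrable(1)[OF sg Cc_inf_vec_sqint_UNIV(1)[OF that]])
  have D2: "sqrt (LINT x|lebesgue. cjac f x \<bullet> cjac f x) = ?D f" for f :: "real^'n \<Rightarrow> real^'m"
    by (simp add: l2_def power2_norm_eq_inner)
  have aform_i: "integrable lebesgue (\<lambda>x. aform A x (cjac f x) (cjac h x))" if "f \<in> ?V" "h \<in> ?V" for f h
    using aform_integrable(1)[OF A, of UNIV "cjac f" "cjac h"] Cc_inf_vec_sqint_UNIV(2)[OF that(1)] Cc_inf_vec_sqint_UNIV(2)[OF that(2)] by (simp add: lebesgue_on_UNIV_eq)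
  interpret pre_hilbert_form ?V "\<lambda>f c g x. f x + c *\<^sub>R g x" "\<lambda>f g. LINT x|lebesgue. cjac f x \<bullet> cjac g x"
      "bform (adj_coeff A) UNIV" "\<lambda>\<psi>. LINT x|lebesgue. g x \<bullet> \<psi> x" \<nu> M "M * ?D \<phi>g + 1" \<phi>g
  proof
    show "\<phi>g \<in> ?V" by fact
    show "(\<lambda>x. f x + c *\<^sub>R h x) \<in> ?V" if "f \<in> ?V" "h \<in> ?V" for f h c by (rule Cc_inf_vec_add_scale[OF that])
    show "(LINT x|lebesgue. cjac f x \<bullet> cjac h x) = (LINT x|lebesgue. cjac h x \<bullet> cjac f x)" for f h :: "real^'n \<Rightarrow> real^'m"
      by (simp add: inner_commute)
    show "0 \<le> (LINT x|lebesgue. cjac f x \<bullet> cjac f x)" for f :: "real^'n \<Rightarrow> real^'m" by (simp add: integral_nonneg_AE)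
    show "(LINT x|lebesgue. cjac (\<lambda>x. f x + c *\<^sub>R h x) x \<bullet> cjac k x) =
        (LINT x|lebesgue. cjac f x \<bullet> cjac k x) + c * (LINT x|lebesgue. cjac h x \<bullet> cjac k x)"
      if "f \<in> ?V" "h \<in> ?V" "k \<in> ?V" for f h c k
      using inner_integrable(1)[OF Cc_inf_vec_sqint_UNIV(2)[OF that(1)] Cc_inf_vec_sqint_UNIV(2)[OF that(3)]]
        inner_integrable(1)[OF Cc_inf_vec_sqint_UNIV(2)[OF that(2)] Cc_inf_vec_sqint_UNIV(2)[OF that(3)]]
      by (simp add: cjac_comb[OF that(1,2)] inner_add_left)
    show "bform (adj_coeff A) UNIV (\<lambda>x. f x + c *\<^sub>R h x) k = bform (adj_coeff A) UNIV f k + c * bform (adj_coeff A) UNIV h k"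
      if "f \<in> ?V" "h \<in> ?V" "k \<in> ?V" for f h c k
      using aform_i[OF that(3,1)] aform_i[OF that(3,2)]
      by (simp add: aform_adj bform_def lebesgue_on_UNIV_eq cjac_comb[OF that(1,2)] bounded_bilinear.add_right[OF aform_bilinear[OF A(1)]]
          bounded_bilinear.scaleR_right[OF aform_bilinear[OF A(1)]])
    show "bform (adj_coeff A) UNIV k (\<lambda>x. f x + c *\<^sub>R h x) = bform (adj_coeff A) UNIV k f + c * bform (adj_coeff A) UNIV k h"
      if "f \<in> ?V" "h \<in> ?V" "k \<in> ?V" for f h c k
      using aform_i[OF that(1,3)] aform_i[OF that(2,3)]
      by (simp add: aform_adj bform_def lebesgue_on_UNIV_eq cjac_comb[OF that(1,2)] bounded_bilinear.add_left[OF aform_bilinear[OF A(1)]]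
          bounded_bilinear.scaleR_left[OF aform_bilinear[OF A(1)]])
    show "\<bar>bform (adj_coeff A) UNIV f h\<bar> \<le> M * (sqrt (LINT x|lebesgue. cjac f x \<bullet> cjac f x) * sqrt (LINT x|lebesgue. cjac h x \<bullet> cjac h x))"
      if "f \<in> ?V" "h \<in> ?V" for f h
      unfolding D2 using bform_bound[OF A that(2,1)] by (simp add: bform_adj mult.commute)
    show "\<nu> * (LINT x|lebesgue. cjac f x \<bullet> cjac f x) \<le> bform (adj_coeff A) UNIV f f" if "f \<in> ?V" for f
      using bform_coercive[OF A that] by (simp add: bform_adj l2_square power2_norm_eq_inner)
    show "(LINT x|lebesgue. g x \<bullet> (f x + c *\<^sub>R h x)) = (LINT x|lebesgue. g x \<bullet> f x) + c * (LINT x|lebesgue. g x \<bullet> h x)"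
      if "f \<in> ?V" "h \<in> ?V" for f h c
      using inner_i[OF that(1)] inner_i[OF that(2)] by (simp add: inner_add_right)
    show "\<bar>LINT x|lebesgue. g x \<bullet> f x\<bar> \<le> (M * ?D \<phi>g + 1) * sqrt (LINT x|lebesgue. cjac f x \<bullet> cjac f x)" if "f \<in> ?V" for f
      unfolding D2 using \<phi>g(2)[rule_format, OF that] bform_bound[OF A \<phi>g(1) that] by (simp add: algebra_simps)
    show "\<nu> > 0" "M > 0" by fact+
  qed
  obtain \<phi> where \<phi>0: "\<phi> \<in> ?V" "\<forall>\<psi>\<in>?V.
      \<bar>bform (adj_coeff A) UNIV \<phi> \<psi> - (LINT x|lebesgue. g x \<bullet> \<psi> x)\<bar> \<le> \<epsilon>1 * ?D \<psi>"
    using approximate_solution[OF \<epsilon>1] unfolding D2 by blast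
  note \<phi> = \<phi>0(1) \<phi>0(2)[rule_format]
  show "\<exists>\<phi>\<in>?V. (\<forall>\<psi>\<in>?V. \<bar>bform (adj_coeff A) UNIV \<phi> \<psi> - (LINT x|lebesgue. g x \<bullet> \<psi> x)\<bar> \<le> \<epsilon> * ?D \<psi>) \<and>
       (\<forall>h. bounded_supported (\<Omega> \<inter> ?B) h \<longrightarrow> \<bar>LINT x|lebesgue. h x \<bullet> \<phi> x\<bar> \<le> K * riesz_pairing h g + \<epsilon> * l2 lebesgue h)"
  proof (intro bexI[OF _ \<phi>(1)] conjI ballI allI impI)
    fix \<psi> assume \<psi>: "\<psi> \<in> ?V"
    have "\<epsilon>1 \<le> \<epsilon>" using \<epsilon> C1 by (simp add: \<epsilon>1_def field_simps)
    then have "\<epsilon>1 * ?D \<psi> \<le> \<epsilon> * ?D \<psi>" by (rule mult_right_mono) (rule l2_nonneg)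
    then show "\<bar>bform (adj_coeff A) UNIV \<phi> \<psi> - (LINT x|lebesgue. g x \<bullet> \<psi> x)\<bar> \<le> \<epsilon> * ?D \<psi>"
      using \<phi>(2)[OF \<psi>] by linarith
  next
    fix h :: "real^'n \<Rightarrow> real^'m" assume h: "bounded_supported (\<Omega> \<inter> ?B) h"
    have hB: "bounded_supported ?B h" by (rule bounded_supported_mono[OF h]) simp
    have sh: "sqint lebesgue h" by (rule bounded_supported_integrable(2)[OF hB order_refl])
    define H where "H = l2 lebesgue h"
    have kk0: "riesz_pairing h g \<ge> 0" by (rule riesz_pairing_finite(2)[OF Kc r hB gB])
    show "\<bar>LINT x|lebesgue. h x \<bullet> \<phi> x\<bar> \<le> K * riesz_pairing h g + \<epsilon> * l2 lebesgue h"
    proof (cases "H = 0")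
      case True
      then have "\<bar>LINT x|lebesgue. h x \<bullet> \<phi> x\<bar> \<le> 0"
        using inner_integrable(2)[OF sh Cc_inf_vec_sqint_UNIV(1)[OF \<phi>(1)]] by (simp add: H_def)
      then show ?thesis using True K kk0 by (simp add: H_def)
    next
      case False
      then have H: "H > 0" using l2_nonneg[of lebesgue h] by (simp add: H_def)
      define s where "s = ?D \<phi> + l2 lebesgue g + 1"
      have s: "s > 0" using l2_nonneg[of lebesgue "cjac \<phi>"] l2_nonneg[of lebesgue g] by (simp add: s_def)
      define \<epsilon>2 where "\<epsilon>2 = min H (\<epsilon> * H / (2 * s))"
      have \<epsilon>2: "\<epsilon>2 > 0" "\<epsilon>2 \<le> H" "\<epsilon>2 * s \<le> \<epsilon> * H / 2"
      proof -
        show "\<epsilon>2 > 0" "\<epsilon>2 \<le> H" using H \<epsilon> s by (auto simp: \<epsilon>2_def)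
        have "\<epsilon>2 \<le> \<epsilon> * H / (2 * s)" by (simp add: \<epsilon>2_def)
        then show "\<epsilon>2 * s \<le> \<epsilon> * H / 2" using s by (simp add: field_simps)
      qed
      obtain \<phi>h where \<phi>h0: "\<phi>h \<in> ?V"
          "\<forall>\<psi>\<in>?V. \<bar>bform A UNIV \<phi>h \<psi> - (LINT x|lebesgue. h x \<bullet> \<psi> x)\<bar> \<le> \<epsilon>2 * ?D \<psi>"
          "\<forall>k. bounded_supported (\<Omega> \<inter> ?B) k \<longrightarrow> \<bar>LINT x|lebesgue. k x \<bullet> \<phi>h x\<bar> \<le> K * riesz_pairing k h + \<epsilon>2 * l2 lebesgue k"
        using sol[unfolded approx_solvable_def, rule_format, OF h \<epsilon>2(1)] by blast
      note \<phi>h = \<phi>h0(1) \<phi>h0(2)[rule_format] \<phi>h0(3)[rule_format]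
      define E where "E = ?D \<phi>h"
      have E0: "E \<ge> 0" by (simp add: E_def l2_nonneg)
      have "\<nu> * E\<^sup>2 \<le> bform A UNIV \<phi>h \<phi>h" unfolding E_def by (rule bform_coercive[OF A \<phi>h(1)])
      also have "\<dots> \<le> (K * riesz_pairing h h + \<epsilon>2 * H) + \<epsilon>2 * E"
        using \<phi>h(2)[OF \<phi>h(1)] \<phi>h(3)[OF h] unfolding E_def[symmetric] H_def[symmetric] by linarith
      also have "K * riesz_pairing h h \<le> \<kappa> * H\<^sup>2"
        using mult_left_mono[OF riesz_pairing_self[OF Kc r hB] K] by (simp add: \<kappa>_def H_def mult_ac)
      also have "\<epsilon>2 * H \<le> H\<^sup>2" using \<epsilon>2 H by (simp add: power2_eq_square)
      also have "\<epsilon>2 * E \<le> H * E" using \<epsilon>2 E0 by (intro mult_right_mono) auto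
      finally have en: "\<nu> * E\<^sup>2 \<le> (\<kappa> + 1) * H\<^sup>2 + H * E" by (simp add: algebra_simps)
      have EH: "E \<le> C1 * H"
      proof (cases "E \<le> H")
        case True
        then show ?thesis using C1 H mult_right_mono[of 1 C1 H] by linarith
      next
        case False
        then have EE: "E > 0" "H \<le> E" using H by auto
        have "H\<^sup>2 \<le> H * E" using EE H by (simp add: power2_eq_square)
        then have "(\<kappa> + 1) * H\<^sup>2 \<le> (\<kappa> + 1) * (H * E)" using \<kappa> by (intro mult_left_mono) auto
        then have "\<nu> * E\<^sup>2 \<le> (\<kappa> + 2) * H * E" using en by (simp add: algebra_simps)
        then have "\<nu> * E \<le> (\<kappa> + 2) * H" using EE by (simp add: power2_eq_square)
        then have "E \<le> (\<kappa> + 2) / \<nu> * H" using A(2) by (simp add: field_simps)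
        then show ?thesis using H by (simp add: C1_def algebra_simps)
      qed
      have a: "\<bar>LINT x|lebesgue. h x \<bullet> \<phi> x\<bar> \<le> \<bar>bform A UNIV \<phi>h \<phi>\<bar> + \<epsilon>2 * ?D \<phi>"
        using \<phi>h(2)[OF \<phi>(1)] by linarith
      have b: "\<bar>bform A UNIV \<phi>h \<phi>\<bar> \<le> \<bar>LINT x|lebesgue. g x \<bullet> \<phi>h x\<bar> + \<epsilon>1 * E"
        using \<phi>(2)[OF \<phi>h(1)] unfolding bform_adj E_def by linarith
      have c: "\<bar>LINT x|lebesgue. g x \<bullet> \<phi>h x\<bar> \<le> K * riesz_pairing h g + \<epsilon>2 * l2 lebesgue g"
        using \<phi>h(3)[OF g] riesz_pairing_commute[OF h g] by simp
      have "\<epsilon>1 * E \<le> \<epsilon>1 * (C1 * H)" using EH \<epsilon>1 by (intro mult_left_mono) auto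
      also have "\<dots> = \<epsilon> * H / 2" using C1 by (simp add: \<epsilon>1_def)
      finally have d: "\<epsilon>1 * E \<le> \<epsilon> * H / 2" .
      have "\<epsilon>2 * ?D \<phi> + \<epsilon>2 * l2 lebesgue g \<le> \<epsilon> * H / 2"
        using \<epsilon>2(1,3) by (simp add: s_def algebra_simps)
      then show ?thesis using a b c d unfolding H_def by linarith
    qed
  qed
qed

section \<open>The Green's matrix solves the adjoint problem\<close>

text \<open>The pointwise bound refers to the continuous representative if there is one. This representative
  agrees almost everywhere with \<open>G\<close>, and the pole is a null set.\<close>

lemma green_bound_AE:
  assumes \<Omega>: "open \<Omega>" and bd: "green_bound \<Omega> G Rmax C0" and x: "x \<in> \<Omega>"
  shows "AE y in lebesgue_on \<Omega>. ereal (dist y x) < Rmax \<longrightarrow> norm (G y x) \<le> C0 * riesz y x"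
proof -
  have Om: "\<Omega> \<in> sets lebesgue" "\<Omega> - {x} \<in> sets lebesgue" using \<Omega> by auto
  let ?P = "\<lambda>y v. 0 < dist y x \<and> ereal (dist y x) < Rmax \<longrightarrow> norm v \<le> C0 * dist y x powr (2 - real CARD('a))"
  let ?C = "{h. continuous_on (\<Omega> - {x}) h \<and> (AE y in lebesgue_on (\<Omega> - {x}). h y = G y x)}"
  have "holds_repr (\<Omega> - {x}) (\<lambda>y. G y x) ?P" using bd x unfolding green_bound_def by (rule bspec)
  then have R: "if ?C \<noteq> {} then \<forall>h\<in>?C. \<forall>y\<in>\<Omega> - {x}. ?P y (h y) else AE y in lebesgue_on (\<Omega> - {x}). ?P y (G y x)"
    unfolding holds_repr_def Let_def .
  have "AE y in lebesgue_on (\<Omega> - {x}). ?P y (G y x)"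
  proof (cases "?C = {}")
    case True
    then have "\<not> ?C \<noteq> {}" by blast
    from R[unfolded if_not_P[OF this]] show ?thesis .
  next
    case False
    then obtain h where h: "continuous_on (\<Omega> - {x}) h" "AE y in lebesgue_on (\<Omega> - {x}). h y = G y x" by blast
    have "h \<in> ?C" using h by blast
    with R[unfolded if_P[OF False]] have Q: "\<forall>y\<in>\<Omega> - {x}. ?P y (h y)" by (rule bspec)
    show ?thesis
    proof (rule AE_mp[OF h(2)], rule AE_I2, rule impI)
      fix y assume "y \<in> space (lebesgue_on (\<Omega> - {x}))" and eq: "h y = G y x"
      then have "y \<in> \<Omega> - {x}" by simp
      from bspec[OF Q this] show "?P y (G y x)" unfolding eq .
    qed
  qed
  then have "AE y in lebesgue. y \<in> \<Omega> - {x} \<longrightarrow> ?P y (G y x)" using Om by (subst (asm) AE_restrict_space_iff) auto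
  moreover have "AE y in lebesgue. y \<notin> {x}" by (rule AE_not_in) simp
  ultimately have "AE y in lebesgue. y \<in> \<Omega> \<longrightarrow> (ereal (dist y x) < Rmax \<longrightarrow> norm (G y x) \<le> C0 * riesz y x)"
    by eventually_elim (auto simp: riesz_def)
  then show ?thesis using Om by (subst AE_restrict_space_iff) auto
qed

text \<open>The function \<open>W(x) = \<integral>G(y,x)\<^sup>T g(y) dy\<close> solves the adjoint problem exactly and is a limit of test
  functions in \<open>Y\<^sup>1\<^sup>,\<^sup>2\<close>. A late member of the sequence satisfies the equation up to \<open>\<epsilon>\<close>, because the form
  is bounded, and is \<open>L\<^sup>2\<close>-close to \<open>W\<close> on the bounded set \<open>\<Omega> \<inter> ball p r\<close>. The kernel bound for \<open>W\<close> is that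
  of \<open>G\<close>, which is available as points of \<open>ball p r\<close> have distance less than \<open>2r \<le> Rmax\<close>; the
  factor \<open>m\<^sup>2\<close> comes from estimating vectors by the sums of their components.\<close>

lemma approx_solvable_green:
  fixes A :: "('n::finite, 'm::finite) coeff"
  assumes n: "CARD('n) \<ge> 3" and Kc: "riesz_ball_bound TYPE('n) Kc" and r: "r > 0" "ereal (2 * r) \<le> Rmax"
    and \<Omega>: "open \<Omega>" and A: "bounded_coercive \<nu> M A" "\<nu> > 0"
    and G: "is_green_matrix A \<Omega> G" and bd: "green_bound \<Omega> G Rmax C0" and C: "C \<ge> C0" "C \<ge> 0"
  shows "approx_solvable (adj_coeff A) \<Omega> p r ((real CARD('m))\<^sup>2 * C)"
  unfolding approx_solvable_def
proof (intro allI impI)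
  fix g :: "real^'n \<Rightarrow> real^'m" and \<epsilon> :: real
  let ?B = "ball p r" and ?K = "(real CARD('m))\<^sup>2 * C"
  let ?V = "Cc_inf_vec \<Omega> :: (real^'n \<Rightarrow> real^'m) set"
  assume g: "bounded_supported (\<Omega> \<inter> ?B) g" and \<epsilon>: "\<epsilon> > 0"
  define S where "S = \<Omega> \<inter> ?B"
  have Om: "\<Omega> \<in> sets lebesgue" using \<Omega> by auto
  have S: "S \<subseteq> \<Omega>" "S \<in> sets lebesgue" "bounded S"
    unfolding S_def using \<Omega> by (auto intro: bounded_subset[OF bounded_ball])
  then have "S \<in> lmeasurable" by (intro bounded_set_imp_lmeasurable)
  note S = this S
  have A': "bounded_coercive \<nu> M (adj_coeff A)" by (rule bounded_coercive_adj[OF A(1)])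
  have M: "M > 0" using bounded_coercive_constants[OF A(1)] A(2) by simp
  have gB: "bounded_supported ?B g" by (rule bounded_supported_mono[OF g]) simp
  have gm: "g \<in> borel_measurable lebesgue" by (rule bounded_supported_measurable[OF g])
  have g0: "g x = 0" if "x \<notin> S" for x using g that by (simp add: bounded_supported_def S_def)
  define W where "W x = (\<chi> k. LINT y|lebesgue_on \<Omega>. (\<Sum>i\<in>UNIV. G y x $ i $ k * g y $ i))" for x
  have "g \<in> Linf_c \<Omega>"
  proof -
    obtain B where B: "\<And>x. norm (g x) \<le> B" using g by (auto simp: bounded_supported_def)
    have gO: "g \<in> borel_measurable (lebesgue_on \<Omega>)" by (rule measurable_restrict_space1[OF gm])
    have "Linf_norm \<Omega> g \<le> ereal B"
      unfolding Linf_norm_def by (intro esssup_I) (use gO B in \<open>auto intro!: AE_I2\<close>)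
    then have "Linf_norm \<Omega> g < \<infinity>" by (rule le_less_trans) simp
    moreover have "compact (closure S)" "closure S \<subseteq> closure \<Omega>"
      using S(2,4) by (auto intro!: closure_mono)
    moreover have "AE x in lebesgue_on \<Omega>. x \<notin> closure S \<longrightarrow> g x = 0"
      using g0 closure_subset[of S] by (intro AE_I2) blast
    ultimately show ?thesis using gO unfolding Linf_c_def Linf_def by blast
  qed
  moreover have "\<forall>f\<in>Linf_c \<Omega>. let u = (\<lambda>x. \<chi> k. LINT y|lebesgue_on \<Omega>. (\<Sum>i\<in>UNIV. G y x $ i $ k * f y $ i))
        in u \<in> Y12_0_vec \<Omega> \<and> weak_solution (adj_coeff A) \<Omega> u f"
    using G unfolding is_green_matrix_def by (elim conjE)
  ultimately have "let u = W in u \<in> Y12_0_vec \<Omega> \<and> weak_solution (adj_coeff A) \<Omega> u g"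
    unfolding W_def[abs_def] by (rule bspec[rotated])
  then have W: "W \<in> Y12_0_vec \<Omega>" "weak_solution (adj_coeff A) \<Omega> W g" by (simp_all add: Let_def)
  have Wbound: "ennreal (norm (W x)) \<le> ennreal ?K * (\<integral>\<^sup>+y. ennreal (riesz x y * norm (g y)) \<partial>lebesgue)" if x: "x \<in> S" for x
  proof -
    have xO: "x \<in> \<Omega>" "x \<in> ?B" using x by (auto simp: S_def)
    let ?I = "\<integral>\<^sup>+y. ennreal (riesz x y * norm (g y)) \<partial>lebesgue"
    let ?m = "real CARD('m)"
    have comp: "ennreal \<bar>W x $ k\<bar> \<le> ennreal (?m * C) * ?I" for k
    proof -
      let ?f = "\<lambda>y. \<Sum>i\<in>UNIV. G y x $ i $ k * g y $ i"
      have "ennreal \<bar>W x $ k\<bar> \<le> (\<integral>\<^sup>+y. ennreal (norm (?f y)) \<partial>lebesgue_on \<Omega>)"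
      proof (cases "integrable (lebesgue_on \<Omega>) ?f")
        case True
        then show ?thesis using integral_norm_bound_ennreal[OF True] by (simp add: W_def)
      next
        case False
        then show ?thesis by (simp add: W_def not_integrable_integral_eq)
      qed
      also have "\<dots> \<le> (\<integral>\<^sup>+y. ennreal (?m * C * (riesz x y * norm (g y))) \<partial>lebesgue_on \<Omega>)"
      proof (rule nn_integral_mono_AE, rule AE_mp[OF green_bound_AE[OF \<Omega> bd xO(1)]], rule AE_I2, rule impI)
        fix y assume y: "ereal (dist y x) < Rmax \<longrightarrow> norm (G y x) \<le> C0 * riesz y x"
        have "norm (?f y) \<le> ?m * C * (riesz x y * norm (g y))"
        proof (cases "y \<in> S")
          case True
          then have "dist y x < 2 * r"
            using xO(2) dist_triangle[of y x p] unfolding S_def by (simp add: dist_commute)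
          then have "ereal (dist y x) < ereal (2 * r)" by simp
          then have "ereal (dist y x) < Rmax" using r(2) by (rule less_le_trans)
          then have "norm (G y x) \<le> C0 * riesz x y" using y by (simp add: riesz_commute)
          also have "\<dots> \<le> C * riesz x y" using C riesz_nonneg by (intro mult_right_mono) auto
          finally have Gb: "norm (G y x) \<le> C * riesz x y" .
          have "norm (?f y) \<le> (\<Sum>i\<in>UNIV. \<bar>G y x $ i $ k\<bar> * \<bar>g y $ i\<bar>)"
            using sum_abs[of "\<lambda>i. G y x $ i $ k * g y $ i" UNIV] by (simp add: abs_mult)
          also have "\<dots> \<le> (\<Sum>i\<in>(UNIV :: 'm set). C * riesz x y * norm (g y))"
            by (intro sum_mono mult_mono order_trans[OF component_le_norm2 Gb] component_le_norm_cart mult_nonneg_nonneg C riesz_nonneg abs_ge_zero)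
          finally show ?thesis by (simp add: mult_ac)
        next
          case False
          then show ?thesis using g0 by simp
        qed
        then show "ennreal (norm (?f y)) \<le> ennreal (?m * C * (riesz x y * norm (g y)))" by (rule ennreal_leI)
      qed
      also have "\<dots> \<le> (\<integral>\<^sup>+y. ennreal (?m * C * (riesz x y * norm (g y))) \<partial>lebesgue)"
        using Om by (subst nn_integral_restrict_space) (auto intro!: nn_integral_mono simp: indicator_def)
      also have "\<dots> = ennreal (?m * C) * ?I"
      proof -
        have "(\<lambda>y. ennreal (riesz x y * norm (g y))) \<in> borel_measurable lebesgue"
          using gm riesz_measurable by measurable
        then show ?thesis using C by (simp add: ennreal_mult' nn_integral_cmult)
      qed
      finally show ?thesis .
    qed
    have "ennreal (norm (W x)) \<le> ennreal (\<Sum>k\<in>UNIV. \<bar>W x $ k\<bar>)"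
      by (intro ennreal_leI) (rule norm_le_l1_cart)
    also have "\<dots> = (\<Sum>k\<in>UNIV. ennreal \<bar>W x $ k\<bar>)" by (rule sum_ennreal[symmetric]) simp
    also have "\<dots> \<le> (\<Sum>k\<in>(UNIV :: 'm set). ennreal (?m * C) * ?I)" by (intro sum_mono comp)
    also have "\<dots> = ennreal ?K * ?I"
      using C by (simp add: power2_eq_square ennreal_mult' ennreal_of_nat_eq_real_of_nat mult_ac)
    finally show ?thesis .
  qed
  have W0: "(\<lambda>x. W x $ i) \<in> Y12_0 \<Omega>" for i using W(1) by (simp add: Y12_0_vec_def)
  have Y1: "(\<lambda>x. W x $ i) \<in> Y12 \<Omega>" for i using W0[of i] by (simp add: Y12_0_def)
  have Y2: "\<exists>\<phi>\<in>Cc_inf \<Omega>. Y12_norm \<Omega> (\<lambda>x. W x $ i - \<phi> x) < e" if "e > 0" for i e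
    using W0[of i] that by (simp add: Y12_0_def)
  have p: "sobolev_exp TYPE('n) > 0" using sobolev_exp_ge_2[OF n] by simp
  obtain \<psi> where \<psi>: "\<And>k i. (\<lambda>x. \<psi> k x $ i) \<in> Cc_inf \<Omega>"
    "\<And>k. sqint (lebesgue_on \<Omega>) (cjac (\<psi> k))" "\<And>k. sqint (lebesgue_on S) (\<psi> k)"
    "sqint (lebesgue_on \<Omega>) (wjac \<Omega> W)" "sqint (lebesgue_on S) W"
    "(\<lambda>k. l2 (lebesgue_on S) (\<lambda>x. \<psi> k x - W x)) \<longlonglongrightarrow> 0"
    "(\<lambda>k. l2 (lebesgue_on \<Omega>) (\<lambda>x. cjac (\<psi> k) x - wjac \<Omega> W x)) \<longlonglongrightarrow> 0"
    by (rule Y12_approximation[OF n \<Omega> S(1,2) Y1 Cc_inf_class(1)[OF \<Omega> _ p] Cc_inf_class(2)[OF \<Omega> _ p] Cc_inf_class(3)[OF \<Omega> _ p] Y2]) blast+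
  have "eventually (\<lambda>k. l2 (lebesgue_on S) (\<lambda>x. \<psi> k x - W x) < \<epsilon>) sequentially"
    by (rule order_tendstoD(2)[OF \<psi>(6)]) (rule \<epsilon>)
  moreover have "eventually (\<lambda>k. l2 (lebesgue_on \<Omega>) (\<lambda>x. cjac (\<psi> k) x - wjac \<Omega> W x) < \<epsilon> / M) sequentially"
    by (rule order_tendstoD(2)[OF \<psi>(7)]) (use \<epsilon> M in simp)
  ultimately have "eventually (\<lambda>k. l2 (lebesgue_on S) (\<lambda>x. \<psi> k x - W x) < \<epsilon> \<and>
      l2 (lebesgue_on \<Omega>) (\<lambda>x. cjac (\<psi> k) x - wjac \<Omega> W x) < \<epsilon> / M) sequentially" by (rule eventually_conj)
  then obtain k where k: "l2 (lebesgue_on S) (\<lambda>x. \<psi> k x - W x) < \<epsilon>"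
      "l2 (lebesgue_on \<Omega>) (\<lambda>x. cjac (\<psi> k) x - wjac \<Omega> W x) < \<epsilon> / M" by (auto simp: eventually_sequentially)
  have \<phi>: "\<psi> k \<in> ?V" using \<psi>(1) by (simp add: Cc_inf_vec_def)
  show "\<exists>\<phi>\<in>?V. (\<forall>\<psi>\<in>?V. \<bar>bform (adj_coeff A) UNIV \<phi> \<psi> - (LINT x|lebesgue. g x \<bullet> \<psi> x)\<bar> \<le> \<epsilon> * l2 lebesgue (cjac \<psi>)) \<and>
       (\<forall>h. bounded_supported (\<Omega> \<inter> ?B) h \<longrightarrow> \<bar>LINT x|lebesgue. h x \<bullet> \<phi> x\<bar> \<le> ?K * riesz_pairing h g + \<epsilon> * l2 lebesgue h)"
  proof (intro bexI[OF _ \<phi>] conjI ballI allI impI)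
    fix \<xi> assume \<xi>: "\<xi> \<in> ?V"
    note s\<xi> = Cc_inf_vec_sqint(2)[OF \<Omega> \<xi>]
    have "(LINT x|lebesgue. g x \<bullet> \<xi> x) = (LINT x|lebesgue_on \<Omega>. g x \<bullet> \<xi> x)"
      using Cc_inf_vec_support(1)[OF \<xi>] by (intro lebesgue_shrink(1)[OF Om]) simp
    also have "\<dots> = (LINT x|lebesgue_on \<Omega>. aform (adj_coeff A) x (wjac \<Omega> W x) (cjac \<xi> x))"
      using W(2) \<xi> by (simp add: weak_solution_def sys_form_aform)
    finally have "bform (adj_coeff A) UNIV (\<psi> k) \<xi> - (LINT x|lebesgue. g x \<bullet> \<xi> x) =
        (LINT x|lebesgue_on \<Omega>. aform (adj_coeff A) x (cjac (\<psi> k) x - wjac \<Omega> W x) (cjac \<xi> x))"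
      using aform_integrable(1)[OF A' A(2) \<psi>(2) s\<xi>, of k] aform_integrable(1)[OF A' A(2) \<psi>(4) s\<xi>]
      unfolding bform_UNIV[OF A' \<Omega> \<xi>] unfolding bform_def
      by (simp add: bounded_bilinear.diff_left[OF aform_bilinear[OF A']])
    then have "\<bar>bform (adj_coeff A) UNIV (\<psi> k) \<xi> - (LINT x|lebesgue. g x \<bullet> \<xi> x)\<bar> \<le>
        M * (l2 (lebesgue_on \<Omega>) (\<lambda>x. cjac (\<psi> k) x - wjac \<Omega> W x) * l2 (lebesgue_on \<Omega>) (cjac \<xi>))"
      using aform_integrable(2)[OF A' A(2) sqint_diff(1)[OF \<psi>(2,4)] s\<xi>] by simp
    also have "\<dots> \<le> M * (\<epsilon> / M * l2 (lebesgue_on \<Omega>) (cjac \<xi>))"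
      using k(2) M l2_nonneg by (intro mult_left_mono mult_right_mono) auto
    also have "\<dots> = \<epsilon> * l2 lebesgue (cjac \<xi>)"
      using M l2_shrink[OF Om Cc_inf_vec_support(2)[OF \<xi>]] by simp
    finally show "\<bar>bform (adj_coeff A) UNIV (\<psi> k) \<xi> - (LINT x|lebesgue. g x \<bullet> \<xi> x)\<bar> \<le> \<epsilon> * l2 lebesgue (cjac \<xi>)" .
  next
    fix h :: "real^'n \<Rightarrow> real^'m" assume h: "bounded_supported (\<Omega> \<inter> ?B) h"
    have hB: "bounded_supported ?B h" by (rule bounded_supported_mono[OF h]) simp
    have h0: "h x = 0" if "x \<notin> S" for x using h that by (simp add: bounded_supported_def S_def)
    have sh: "sqint (lebesgue_on S) h"
      using sqint_on_subset(1)[OF S(3) _ subset_UNIV, of h] bounded_supported_integrable(2)[OF hB order_refl] by (simp add: lebesgue_on_UNIV_eq)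
    have hm: "h \<in> borel_measurable lebesgue" by (rule bounded_supported_measurable[OF h])
    have "(LINT x|lebesgue. h x \<bullet> \<psi> k x) = (LINT x|lebesgue_on S. h x \<bullet> \<psi> k x)"
      using h0 by (intro lebesgue_shrink(1)[OF S(3)]) simp
    also have "\<dots> = (LINT x|lebesgue_on S. h x \<bullet> W x) + (LINT x|lebesgue_on S. h x \<bullet> (\<psi> k x - W x))"
      using inner_integrable(1)[OF sh \<psi>(3)] inner_integrable(1)[OF sh \<psi>(5)] by (simp add: inner_diff_right)
    finally have split: "\<bar>LINT x|lebesgue. h x \<bullet> \<psi> k x\<bar> \<le> \<bar>LINT x|lebesgue_on S. h x \<bullet> W x\<bar> + \<bar>LINT x|lebesgue_on S. h x \<bullet> (\<psi> k x - W x)\<bar>"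
      by linarith
    have "\<bar>LINT x|lebesgue_on S. h x \<bullet> (\<psi> k x - W x)\<bar> \<le> l2 (lebesgue_on S) h * l2 (lebesgue_on S) (\<lambda>x. \<psi> k x - W x)"
      by (rule inner_integrable(2)[OF sh sqint_diff(1)[OF \<psi>(3,5)]])
    also have "\<dots> \<le> l2 (lebesgue_on S) h * \<epsilon>" using k(1) l2_nonneg by (intro mult_left_mono) auto
    also have "\<dots> = \<epsilon> * l2 lebesgue h" using l2_shrink[OF S(3) h0] by simp
    finally have second: "\<bar>LINT x|lebesgue_on S. h x \<bullet> (\<psi> k x - W x)\<bar> \<le> \<epsilon> * l2 lebesgue h" .
    have "ennreal \<bar>LINT x|lebesgue_on S. h x \<bullet> W x\<bar> \<le> (\<integral>\<^sup>+x. ennreal \<bar>h x \<bullet> W x\<bar> \<partial>lebesgue_on S)"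
      using integral_norm_bound_ennreal[OF inner_integrable(1)[OF sh \<psi>(5)]] by simp
    also have "\<dots> \<le> (\<integral>\<^sup>+x. ennreal ?K * (\<integral>\<^sup>+y. ennreal (norm (h x) * riesz x y * norm (g y)) \<partial>lebesgue) \<partial>lebesgue_on S)"
    proof (rule nn_integral_mono)
      fix x assume "x \<in> space (lebesgue_on S)"
      then have x: "x \<in> S" by simp
      have gr: "(\<lambda>y. ennreal (riesz x y * norm (g y))) \<in> borel_measurable lebesgue"
        using gm riesz_measurable by measurable
      have "ennreal \<bar>h x \<bullet> W x\<bar> \<le> ennreal (norm (h x)) * ennreal (norm (W x))"
        by (simp add: Cauchy_Schwarz_ineq2 ennreal_leI flip: ennreal_mult)
      also have "\<dots> \<le> ennreal (norm (h x)) * (ennreal ?K * (\<integral>\<^sup>+y. ennreal (riesz x y * norm (g y)) \<partial>lebesgue))"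
        by (intro mult_left_mono Wbound[OF x]) simp
      also have "\<dots> = ennreal ?K * (\<integral>\<^sup>+y. ennreal (norm (h x) * riesz x y * norm (g y)) \<partial>lebesgue)"
        using gr by (simp add: nn_integral_cmult ennreal_mult' mult.assoc mult.left_commute)
      finally show "ennreal \<bar>h x \<bullet> W x\<bar> \<le> ennreal ?K * (\<integral>\<^sup>+y. ennreal (norm (h x) * riesz x y * norm (g y)) \<partial>lebesgue)" .
    qed
    also have "\<dots> \<le> (\<integral>\<^sup>+x. ennreal ?K * (\<integral>\<^sup>+y. ennreal (norm (h x) * riesz x y * norm (g y)) \<partial>lebesgue) \<partial>lebesgue)"
      using S(3) by (subst nn_integral_restrict_space) (auto intro!: nn_integral_mono simp: indicator_def)
    also have "\<dots> = ennreal ?K * riesz_energy (\<lambda>x. norm (h x)) (\<lambda>x. norm (g x))"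
    proof -
      interpret sigma_finite_measure "lebesgue :: (real^'n) measure" by (rule sigma_finite_lebesgue)
      have "(\<lambda>(x, y). ennreal (norm (h x) * riesz x y * norm (g y))) \<in> borel_measurable (lebesgue \<Otimes>\<^sub>M lebesgue)"
        using hm gm by (intro riesz_energy_measurable) auto
      from borel_measurable_nn_integral[OF this] show ?thesis unfolding riesz_energy_def by (intro nn_integral_cmult) simp
    qed
    also have "\<dots> = ennreal (?K * riesz_pairing h g)"
      unfolding riesz_pairing_finite(1)[OF Kc r(1) hB gB] using C by (simp add: ennreal_mult')
    finally have "\<bar>LINT x|lebesgue_on S. h x \<bullet> W x\<bar> \<le> ?K * riesz_pairing h g"
      using C riesz_pairing_finite(2)[OF Kc r(1) hB gB] by (subst (asm) ennreal_le_iff) auto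
    then show "\<bar>LINT x|lebesgue. h x \<bullet> \<psi> k x\<bar> \<le> ?K * riesz_pairing h g + \<epsilon> * l2 lebesgue h"
      using split second by linarith
  qed
qed

section \<open>Caccioppoli's inequality\<close>

lemma outer_measurable:
  assumes "v \<in> borel_measurable M" "q \<in> borel_measurable M"
  shows "(\<lambda>x. outer (v x) (q x)) \<in> borel_measurable M"
proof (rule measurable_vec)
  fix i
  have "(\<lambda>x. v x $ i *\<^sub>R q x) \<in> borel_measurable M"
    by (rule borel_measurable_scaleR[OF measurable_vec_nth[OF assms(1)] assms(2)])
  then show "(\<lambda>x. outer (v x) (q x) $ i) \<in> borel_measurable M" by (simp add: outer_def)
qed

lemma outer_sqint:
  assumes v: "sqint M v" and q: "q \<in> borel_measurable M" "\<And>x. x \<in> space M \<Longrightarrow> norm (q x) \<le> c" "c \<ge> 0"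
  shows "sqint M (\<lambda>x. outer (v x) (q x))" "l2 M (\<lambda>x. outer (v x) (q x)) \<le> c * l2 M v"
proof -
  have m: "(\<lambda>x. outer (v x) (q x)) \<in> borel_measurable M" using v q(1) by (intro outer_measurable) (auto simp: sqint_def)
  have le: "AE x in M. norm (outer (v x) (q x)) \<le> c * norm (v x)"
    using q(2) by (intro AE_I2) (simp add: norm_outer mult.commute[of c] mult_left_mono)
  show "sqint M (\<lambda>x. outer (v x) (q x))" "l2 M (\<lambda>x. outer (v x) (q x)) \<le> c * l2 M v"
    using sqint_dominated[OF v m le q(3)] by blast+
qed

text \<open>The derivative of \<open>\<eta>\<^sup>2 v\<close>, for \<open>P = Dv\<close> and \<open>q = \<nabla>\<eta>\<close>, as a test direction; the mixed term is absorbed by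
  Young's inequality.\<close>

lemma caccioppoli_pointwise:
  assumes A: "bounded_coercive \<nu> M A" "\<nu> > 0"
  shows "\<nu> / 2 * (\<eta>\<^sup>2 * (norm P)\<^sup>2) - 2 * M\<^sup>2 / \<nu> * ((norm v)\<^sup>2 * (norm q)\<^sup>2)
    \<le> aform A x P (\<eta>\<^sup>2 *\<^sub>R P + (2 * \<eta>) *\<^sub>R outer v q)"
proof -
  interpret bounded_bilinear "aform A x" by (rule aform_bilinear[OF A(1)])
  define a b where "a = \<bar>\<eta>\<bar> * norm P" and "b = M * (norm v * norm q)"
  have "0 \<le> (\<nu> * a - 2 * b)\<^sup>2" by simp
  then have "4 * \<nu> * (a * b) \<le> \<nu>\<^sup>2 * a\<^sup>2 + 4 * b\<^sup>2" by (simp add: power2_eq_square algebra_simps)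
  then have ab: "2 * (a * b) \<le> \<nu> / 2 * a\<^sup>2 + 2 / \<nu> * b\<^sup>2" using A(2) by (simp add: field_simps power2_eq_square)
  have "\<bar>2 * \<eta> * aform A x P (outer v q)\<bar> \<le> 2 * \<bar>\<eta>\<bar> * (M * (norm P * (norm v * norm q)))"
    using mult_left_mono[OF bounded_coercive_bound[OF A(1), of x P "outer v q"], of "2 * \<bar>\<eta>\<bar>"] by (simp add: abs_mult norm_outer)
  also have "\<dots> = 2 * (a * b)" unfolding a_def b_def by (simp only: mult_ac)
  finally have 1: "2 * \<eta> * aform A x P (outer v q) \<ge> - (2 * (a * b))" by linarith
  have 2: "\<eta>\<^sup>2 * aform A x P P \<ge> \<eta>\<^sup>2 * (\<nu> * (norm P)\<^sup>2)" by (intro mult_left_mono bounded_coercive_coercive[OF A(1)]) simp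
  have "a\<^sup>2 = \<eta>\<^sup>2 * (norm P)\<^sup>2" "b\<^sup>2 = M\<^sup>2 * ((norm v)\<^sup>2 * (norm q)\<^sup>2)"
    by (simp_all add: a_def b_def power_mult_distrib)
  then show ?thesis using ab 1 2 by (simp add: add_right scaleR_right algebra_simps)
qed

text \<open>An integrated form that covers two cases: a test function with its classical derivative, and a Sobolev
  function with its weak derivative. For this reason \<open>F\<close> and \<open>G\<close> stand for the derivatives of \<open>v\<close> and
  \<open>\<eta>\<^sup>2 v\<close>, and the equation enters only through the number \<open>\<delta>\<close>. The function \<open>w\<close> dominates \<open>v \<nabla>\<eta>\<close>; it may
  be \<open>v\<close> restricted to the set where \<open>\<nabla>\<eta>\<close> does not vanish.\<close>

lemma caccioppoli:
  assumes A: "bounded_coercive \<nu> M A" "\<nu> > 0" and F: "sqint (lebesgue_on U) F" and v: "sqint (lebesgue_on U) v"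
    and \<eta>: "\<eta> \<in> borel_measurable (lebesgue_on U)" "\<And>x. \<bar>\<eta> x\<bar> \<le> 1"
    and q: "q \<in> borel_measurable (lebesgue_on U)" and w: "sqint (lebesgue_on U) w" and c: "c \<ge> 0"
    and qv: "\<And>x. x \<in> U \<Longrightarrow> norm (v x) * norm (q x) \<le> c * norm (w x)"
    and G: "\<And>x. x \<in> U \<Longrightarrow> G x = (\<eta> x)\<^sup>2 *\<^sub>R F x + (2 * \<eta> x) *\<^sub>R outer (v x) (q x)"
    and le: "(LINT x|lebesgue_on U. aform A x (F x) (G x)) \<le> \<delta>"
  shows "\<nu> / 2 * (l2 (lebesgue_on U) (\<lambda>x. \<eta> x *\<^sub>R F x))\<^sup>2 \<le> 2 * M\<^sup>2 / \<nu> * (c\<^sup>2 * (l2 (lebesgue_on U) w)\<^sup>2) + \<delta>"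
    "sqint (lebesgue_on U) G" "l2 (lebesgue_on U) G \<le> l2 (lebesgue_on U) F + 2 * c * l2 (lebesgue_on U) w"
proof -
  let ?\<mu> = "lebesgue_on U"
  have sp: "space ?\<mu> = U" by simp
  have \<eta>2: "(\<lambda>x. (\<eta> x)\<^sup>2) \<in> borel_measurable ?\<mu>" "\<And>x. \<bar>(\<eta> x)\<^sup>2\<bar> \<le> 1" using \<eta> by (auto simp: power2_eq_square abs_mult mult_le_one abs_square_le_1[unfolded power2_eq_square])
  have o1: "(\<lambda>x. outer (v x) (q x)) \<in> borel_measurable ?\<mu>" using v q by (intro outer_measurable) (auto simp: sqint_def)
  have "AE x in ?\<mu>. norm (outer (v x) (q x)) \<le> c * norm (w x)" using qv by (intro AE_I2) (simp add: norm_outer)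
  note o = sqint_dominated[OF w o1 this c]
  have o2: "(\<lambda>x. 2 * \<eta> x) \<in> borel_measurable ?\<mu>" using \<eta>(1) by measurable
  have o3: "\<bar>2 * \<eta> x\<bar> \<le> 2" for x using \<eta>(2)[of x] by simp
  note s1 = sqint_mult[OF F \<eta>2(1), of 1, OF \<eta>2(2)]
  note s2 = sqint_mult[OF o(1) o2, of 2, OF o3]
  note s = sqint_add[OF s1(1) s2(1)]
  have cong: "l2 ?\<mu> G = l2 ?\<mu> (\<lambda>x. (\<eta> x)\<^sup>2 *\<^sub>R F x + (2 * \<eta> x) *\<^sub>R outer (v x) (q x))"
    unfolding l2_def using G by (intro arg_cong[where f = sqrt] Bochner_Integration.integral_cong) auto
  have Gm: "G \<in> borel_measurable ?\<mu>"
    using s(1) G measurable_cong[of ?\<mu> G "\<lambda>x. (\<eta> x)\<^sup>2 *\<^sub>R F x + (2 * \<eta> x) *\<^sub>R outer (v x) (q x)" borel] by (simp add: sqint_def)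
  show sG: "sqint ?\<mu> G"
    by (rule sqint_dominated(1)[OF s(1) Gm, of 1]) (auto intro!: AE_I2 simp: G)
  show "l2 ?\<mu> G \<le> l2 ?\<mu> F + 2 * c * l2 ?\<mu> w" using s(2) s1(2) s2(2) o(2) unfolding cong by simp
  have \<eta>F: "sqint ?\<mu> (\<lambda>x. \<eta> x *\<^sub>R F x)" by (rule sqint_mult(1)[OF F \<eta>(1), of 1]) (use \<eta>(2) in auto)
  have i1: "integrable ?\<mu> (\<lambda>x. \<nu> / 2 * (norm (\<eta> x *\<^sub>R F x))\<^sup>2)" using \<eta>F by (simp add: sqint_def)
  have i2: "integrable ?\<mu> (\<lambda>x. 2 * M\<^sup>2 / \<nu> * (c\<^sup>2 * (norm (w x))\<^sup>2))" using w by (simp add: sqint_def)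
  have i3: "integrable ?\<mu> (\<lambda>x. aform A x (F x) (G x))" by (rule aform_integrable(1)[OF A F sG])
  have "(LINT x|?\<mu>. \<nu> / 2 * (norm (\<eta> x *\<^sub>R F x))\<^sup>2 - 2 * M\<^sup>2 / \<nu> * (c\<^sup>2 * (norm (w x))\<^sup>2)) \<le> (LINT x|?\<mu>. aform A x (F x) (G x))"
  proof (rule integral_mono[OF Bochner_Integration.integrable_diff[OF i1 i2] i3])
    fix x assume "x \<in> space ?\<mu>"
    then have x: "x \<in> U" by simp
    have "(norm (v x) * norm (q x))\<^sup>2 \<le> (c * norm (w x))\<^sup>2" using qv[OF x] by (intro power_mono) auto
    then have "2 * M\<^sup>2 / \<nu> * ((norm (v x))\<^sup>2 * (norm (q x))\<^sup>2) \<le> 2 * M\<^sup>2 / \<nu> * (c\<^sup>2 * (norm (w x))\<^sup>2)"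
      using A(2) by (intro mult_left_mono) (auto simp: power_mult_distrib)
    then show "\<nu> / 2 * (norm (\<eta> x *\<^sub>R F x))\<^sup>2 - 2 * M\<^sup>2 / \<nu> * (c\<^sup>2 * (norm (w x))\<^sup>2) \<le> aform A x (F x) (G x)"
      using caccioppoli_pointwise[OF A, of "\<eta> x" "F x" "v x" "q x" x] G[OF x] by (simp add: power_mult_distrib)
  qed
  also have "(LINT x|?\<mu>. \<nu> / 2 * (norm (\<eta> x *\<^sub>R F x))\<^sup>2 - 2 * M\<^sup>2 / \<nu> * (c\<^sup>2 * (norm (w x))\<^sup>2)) =
      \<nu> / 2 * (l2 ?\<mu> (\<lambda>x. \<eta> x *\<^sub>R F x))\<^sup>2 - 2 * M\<^sup>2 / \<nu> * (c\<^sup>2 * (l2 ?\<mu> w)\<^sup>2)"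
    using i1 i2 by (subst Bochner_Integration.integral_diff) (simp_all add: l2_square)
  finally show "\<nu> / 2 * (l2 ?\<mu> (\<lambda>x. \<eta> x *\<^sub>R F x))\<^sup>2 \<le> 2 * M\<^sup>2 / \<nu> * (c\<^sup>2 * (l2 ?\<mu> w)\<^sup>2) + \<delta>"
    using le by linarith
qed

section \<open>Estimates of approximate solutions away from the source\<close>

definition cutoff_grad_bound :: "'n::finite itself \<Rightarrow> real \<Rightarrow> bool" where
  "cutoff_grad_bound _ Cg \<longleftrightarrow> Cg > 0 \<and> (\<forall>(p::real^'n) r x. r > 0 \<longrightarrow> norm (grad (cutoff p r) x) \<le> Cg / r)"

lemma cutoff_differentiable: "cutoff p r differentiable at x"
  by (rule smooth_on_differentiable[OF smooth_cutoff open_UNIV UNIV_I])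

lemma cutoff_grad_zero:
  fixes p :: "real^'n"
  assumes "r > 0" "dist x p < r \<or> dist x p > 2 * r" shows "grad (cutoff p r) x = 0"
proof -
  have c: "grad (\<lambda>x::real^'n. c) x = 0" for c by (simp add: grad_def pderiv_zero vec_eq_iff)
  show ?thesis
  proof (cases "dist x p < r")
    case True
    have 1: "cutoff p r y = 1" if "y \<in> ball p r" for y
      using that assms(1) by (intro cutoff_one) (simp_all add: dist_commute)
    have "x \<in> ball p r" using True by (simp add: dist_commute)
    from grad_cong[OF open_ball this 1] have "grad (cutoff p r) x = grad (\<lambda>x. 1) x" .
    then show ?thesis by (simp add: c)
  next
    case False
    have "open {x. dist x p > 2 * r}" by (intro open_Collect_less continuous_intros)
    moreover have "x \<in> {x. dist x p > 2 * r}" using False assms(2) by simp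
    moreover have "cutoff p r y = 0" if "y \<in> {x. dist x p > 2 * r}" for y
      using that assms(1) by (intro cutoff_zero) simp_all
    ultimately have "grad (cutoff p r) x = grad (\<lambda>x. 0) x" by (rule grad_cong)
    then show ?thesis by (simp add: c)
  qed
qed

lemma smooth_mult_UNIV:
  fixes f g :: "real^'n \<Rightarrow> real"
  assumes "smooth_on UNIV f" "smooth_on UNIV g" shows "smooth_on UNIV (\<lambda>x. f x * g x)"
  by (rule Ck_on_imp_smooth_on[OF open_UNIV Ck_on_mult[OF smooth_on_imp_Ck_on[OF open_UNIV assms(1)] smooth_on_imp_Ck_on[OF open_UNIV assms(2)]]])

text \<open>Zero in the ball of radius \<open>\<rho>\<close>, which contains the source, and one where the gradient of
  \<open>cutoff p (2 * \<rho>)\<close> lives, namely at distances from \<open>2\<rho>\<close> to \<open>4\<rho>\<close>.\<close>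

definition ring_cutoff :: "real^'n::finite \<Rightarrow> real \<Rightarrow> real^'n \<Rightarrow> real" where
  "ring_cutoff p \<rho> x = cutoff p (4 * \<rho>) x * (1 - cutoff p \<rho> x)"

lemma smooth_ring_cutoff:
  fixes p :: "real^'n" shows "smooth_on UNIV (ring_cutoff p \<rho>)"
proof -
  have "smooth_on UNIV (\<lambda>x. 1 - cutoff p \<rho> x)"
    by (rule Ck_on_imp_smooth_on[OF open_UNIV Ck_on_diff[OF Ck_on_const smooth_on_imp_Ck_on[OF open_UNIV smooth_cutoff]]])
  then show ?thesis unfolding ring_cutoff_def[abs_def] by (rule smooth_mult_UNIV[OF smooth_cutoff])
qed

lemma ring_cutoff_bounds: "0 \<le> ring_cutoff p \<rho> x" "ring_cutoff p \<rho> x \<le> 1"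
  unfolding ring_cutoff_def using cutoff_bounds[of p "4 * \<rho>" x] cutoff_bounds[of p \<rho> x]
  by (auto intro: mult_nonneg_nonneg mult_le_one)

lemma grad_ring_cutoff:
  fixes p :: "real^'n"
  assumes Cg: "cutoff_grad_bound TYPE('n) Cg" and \<rho>: "\<rho> > 0"
  shows "norm (grad (ring_cutoff p \<rho>) x) \<le> 2 * Cg / \<rho>"
    "dist x p < \<rho> \<or> dist x p > 8 * \<rho> \<Longrightarrow> grad (ring_cutoff p \<rho>) x = 0"
proof -
  have d: "(\<lambda>x. 1 - cutoff p \<rho> x) differentiable at x" using cutoff_differentiable by (intro derivative_intros)
  have "grad (\<lambda>x. 1 + (- 1) * cutoff p \<rho> x) x = grad (\<lambda>x::real^'n. 1) x + (- 1) *\<^sub>R grad (cutoff p \<rho>) x"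
    by (rule grad_add_scale) (auto intro: cutoff_differentiable)
  then have g: "grad (\<lambda>x. 1 - cutoff p \<rho> x) x = - grad (cutoff p \<rho>) x"
    by (simp add: grad_def pderiv_zero vec_eq_iff)
  have G: "grad (ring_cutoff p \<rho>) x = cutoff p (4 * \<rho>) x *\<^sub>R (- grad (cutoff p \<rho>) x) + (1 - cutoff p \<rho> x) *\<^sub>R grad (cutoff p (4 * \<rho>)) x"
    unfolding ring_cutoff_def[abs_def] using grad_mult[OF cutoff_differentiable d, of p "4 * \<rho>"] g by simp
  have b: "norm (grad (cutoff p \<rho>) x) \<le> Cg / \<rho>" "norm (grad (cutoff p (4 * \<rho>)) x) \<le> Cg / (4 * \<rho>)"
    using Cg \<rho> unfolding cutoff_grad_bound_def by auto
  have "cutoff p (4 * \<rho>) x * norm (grad (cutoff p \<rho>) x) \<le> 1 * (Cg / \<rho>)"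
    by (rule mult_mono[OF cutoff_bounds(2) b(1)]) simp_all
  moreover have "(1 - cutoff p \<rho> x) * norm (grad (cutoff p (4 * \<rho>)) x) \<le> 1 * (Cg / (4 * \<rho>))"
    by (rule mult_mono[OF _ b(2)]) (simp_all add: cutoff_bounds)
  moreover have "norm (grad (ring_cutoff p \<rho>) x) \<le> cutoff p (4 * \<rho>) x * norm (grad (cutoff p \<rho>) x)
      + (1 - cutoff p \<rho> x) * norm (grad (cutoff p (4 * \<rho>)) x)"
    unfolding G using norm_triangle_ineq[of "cutoff p (4 * \<rho>) x *\<^sub>R (- grad (cutoff p \<rho>) x)" "(1 - cutoff p \<rho> x) *\<^sub>R grad (cutoff p (4 * \<rho>)) x"]
    by (simp add: cutoff_bounds)
  ultimately have "norm (grad (ring_cutoff p \<rho>) x) \<le> 1 * (Cg / \<rho>) + 1 * (Cg / (4 * \<rho>))" by linarith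
  also have "\<dots> \<le> 2 * Cg / \<rho>" using Cg \<rho> by (simp add: cutoff_grad_bound_def field_simps)
  finally show "norm (grad (ring_cutoff p \<rho>) x) \<le> 2 * Cg / \<rho>" .
  assume x: "dist x p < \<rho> \<or> dist x p > 8 * \<rho>"
  show "grad (ring_cutoff p \<rho>) x = 0"
  proof (cases "dist x p < \<rho>")
    case True
    then show ?thesis unfolding G using \<rho> cutoff_one[of \<rho> x p] cutoff_grad_zero[of \<rho> x p] by simp
  next
    case False
    then have "dist x p > 8 * \<rho>" using x by simp
    then show ?thesis unfolding G using \<rho> cutoff_grad_zero[of \<rho> x p] cutoff_grad_zero[of "4 * \<rho>" x p] by simp
  qed
qed

lemma square_root_estimate:
  fixes X a \<epsilon> :: real
  assumes "X\<^sup>2 \<le> a * X + \<epsilon> * X" "X \<ge> 0" "a \<ge> 0" "\<epsilon> \<ge> 0" shows "X \<le> a + \<epsilon>"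
proof (cases "X = 0")
  case False
  then have "X > 0" using assms by simp
  moreover have "X * X \<le> (a + \<epsilon>) * X" using assms(1) by (simp add: power2_eq_square algebra_simps)
  ultimately show ?thesis by simp
qed (use assms in simp)

lemma indicator_sqint:
  fixes F :: "'a \<Rightarrow> 'b::euclidean_space"
  assumes F: "sqint M F" and S: "S \<inter> space M \<in> sets M"
  shows "sqint M (\<lambda>x. indicator S x *\<^sub>R F x)" "l2 M (\<lambda>x. indicator S x *\<^sub>R F x) \<le> l2 M F"
proof -
  have m: "(indicator S :: _ \<Rightarrow> real) \<in> borel_measurable M"
    using S by (simp add: borel_measurable_indicator_iff)
  show "sqint M (\<lambda>x. indicator S x *\<^sub>R F x)" "l2 M (\<lambda>x. indicator S x *\<^sub>R F x) \<le> l2 M F"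
    using sqint_mult[OF F m, of 1] by auto
qed

text \<open>The \<open>L\<^sup>2\<close> norm of the indicator function of a ball of radius \<open>10\<rho>\<close>, the factor in the Cauchy-Schwarz
  estimate of \<open>L\<^sup>1\<close> norms.\<close>

definition ball_const :: "'n::finite itself \<Rightarrow> real \<Rightarrow> real" where
  "ball_const _ \<rho> = sqrt (measure lebesgue (ball (0::real^'n) (10 * \<rho>)))"

lemma measure_ball_const: "sqrt (measure lebesgue (ball p (10 * \<rho>))) = ball_const TYPE('n) \<rho>" for p :: "real^'n"
proof (cases "\<rho> \<ge> 0")
  case True
  then show ?thesis
    by (simp add: ball_const_def content_ball_conv_unit_ball[of "10 * \<rho>" p] content_ball_conv_unit_ball[of "10 * \<rho>" "0::real^'n"])
next
  case False
  then have "ball q (10 * \<rho>) = {}" for q :: "real^'n" by simp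
  then show ?thesis unfolding ball_const_def by (simp only:)
qed

lemma L1_le_L2_ball:
  fixes h :: "real^'n \<Rightarrow> real^'m"
  assumes h: "sqint lebesgue h" "\<And>x. x \<notin> ball p (10 * \<rho>) \<Longrightarrow> h x = 0"
  shows "(LINT x|lebesgue. norm (h x)) \<le> ball_const TYPE('n) \<rho> * l2 lebesgue h"
proof -
  let ?B = "ball p (10 * \<rho>)"
  have B: "?B \<in> sets lebesgue" by simp
  have s: "sqint (lebesgue_on ?B) h"
    using sqint_on_subset(1)[OF B _ subset_UNIV, of h] h(1) by (simp add: lebesgue_on_UNIV_eq)
  have "(LINT x|lebesgue. norm (h x)) = (LINT x|lebesgue_on ?B. norm (h x))"
    by (rule lebesgue_shrink(1)[OF B]) (simp add: h(2))
  also have "\<dots> \<le> sqrt (measure (lebesgue_on ?B) (space (lebesgue_on ?B))) * l2 (lebesgue_on ?B) h"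
    by (rule norm_le_l2_finite(2)[OF finite_measure_lebesgue_on[OF lmeasurable_ball] s])
  also have "measure (lebesgue_on ?B) (space (lebesgue_on ?B)) = measure lebesgue ?B"
    by (simp add: measure_restrict_space)
  also have "l2 (lebesgue_on ?B) h = l2 lebesgue h" by (rule l2_shrink[OF B h(2), symmetric])
  finally show ?thesis unfolding measure_ball_const .
qed

definition annulus :: "real^'n::finite \<Rightarrow> real \<Rightarrow> (real^'n) set" where
  "annulus p \<rho> = {x. \<rho> \<le> dist x p \<and> dist x p < 10 * \<rho>}"

lemma annulus_sets: "annulus p \<rho> \<in> sets lebesgue" for p :: "real^'n"
proof -
  have "annulus p \<rho> = ball p (10 * \<rho>) - ball p \<rho>" by (auto simp: annulus_def dist_commute)
  then show ?thesis by simp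
qed

lemma Cc_inf_vec_bounded:
  fixes \<phi> :: "real^'n \<Rightarrow> real^'m"
  assumes "\<phi> \<in> Cc_inf_vec U" shows "\<exists>B. \<forall>x. norm (\<phi> x) \<le> B"
proof -
  have "\<exists>B. \<forall>x. \<bar>\<phi> x $ i\<bar> \<le> B" for i
    by (rule Cc_inf_bounded[OF Cc_inf_vec_component[OF assms, of i]]) blast
  then have "\<forall>i. \<exists>B. \<forall>x. \<bar>\<phi> x $ i\<bar> \<le> B" by blast
  from choice[OF this] obtain B where B: "\<And>i x. \<bar>\<phi> x $ i\<bar> \<le> B i" by blast
  have "norm (\<phi> x) \<le> (\<Sum>i\<in>UNIV. B i)" for x
    using norm_le_l1_cart[of "\<phi> x"] sum_mono[of UNIV "\<lambda>i. \<bar>\<phi> x $ i\<bar>" B] B by (meson order_trans)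
  then show ?thesis by blast
qed

text \<open>The weak kernel bound is turned into three norms of \<open>\<phi>\<close> by the choice of \<open>h\<close>. For \<open>h = \<phi>\<close> on the annulus
  its left-hand side is the square of the \<open>L\<^sup>2\<close> norm there, while the kernel is at most \<open>(\<rho>/2)\<^bsup>2-n\<^esup>\<close> by
  separation from the source. For \<open>h = sgn \<phi>\<close> on the ball it is the \<open>L\<^sup>1\<close> norm. For \<open>h = g\<close> it bounds the energy
  of \<open>\<phi>\<close>; this bound is crude, but multiplied by \<open>\<epsilon>\<close> it disappears in the end. Finally Caccioppoli's inequality
  on the annulus, where the equation is homogeneous up to \<open>\<epsilon>\<close>, estimates \<open>D\<phi>\<close> there.\<close>

lemma approx_solution_estimates:
  fixes A :: "('n::finite, 'm::finite) coeff"
  assumes n: "CARD('n) \<ge> 3" and Kc: "riesz_ball_bound TYPE('n) Kc" and Cg: "cutoff_grad_bound TYPE('n) Cg"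
    and A: "bounded_coercive \<nu> M A" "\<nu> > 0" and K: "K \<ge> 0" and \<rho>: "\<rho> > 0" and \<epsilon>: "0 < \<epsilon>" "\<epsilon> \<le> 1"
    and sol: "approx_solvable A \<Omega> p (10 * \<rho>) K" and g: "bounded_supported (\<Omega> \<inter> ball p (\<rho> / 2)) g"
  defines "a1 \<equiv> K * (\<rho> / 2) powr (2 - real CARD('n)) * ball_const TYPE('n) \<rho> * (LINT x|lebesgue. norm (g x))"
    and "E0 \<equiv> 1 + (K * riesz_pairing g g + l2 lebesgue g + 1) / \<nu>"
  shows "\<exists>\<phi>\<in>Cc_inf_vec \<Omega>.
     (\<forall>\<psi>\<in>Cc_inf_vec \<Omega>. \<bar>bform A UNIV \<phi> \<psi> - (LINT x|lebesgue. g x \<bullet> \<psi> x)\<bar> \<le> \<epsilon> * l2 lebesgue (cjac \<psi>)) \<and>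
     l2 lebesgue (\<lambda>x. indicator (annulus p \<rho>) x *\<^sub>R \<phi> x) \<le> a1 + \<epsilon> \<and>
     (LINT x|lebesgue. indicator (ball p (10 * \<rho>)) x * norm (\<phi> x))
        \<le> K * (Kc * (20 * \<rho>)\<^sup>2 * (LINT x|lebesgue. norm (g x))) + \<epsilon> * ball_const TYPE('n) \<rho> \<and>
     \<nu> / 2 * (l2 lebesgue (\<lambda>x. ring_cutoff p \<rho> x *\<^sub>R cjac \<phi> x))\<^sup>2
        \<le> 2 * M\<^sup>2 / \<nu> * ((2 * Cg / \<rho>)\<^sup>2 * (a1 + \<epsilon>)\<^sup>2) + \<epsilon> * (E0 + 2 * (2 * Cg / \<rho>) * (a1 + \<epsilon>))"
proof -
  let ?B = "ball p (10 * \<rho>)" and ?bc = "ball_const TYPE('n) \<rho>"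
  let ?N = "LINT x|lebesgue. norm (g x)"
  have r10: "10 * \<rho> > 0" using \<rho> by simp
  have bc: "?bc \<ge> 0" by (simp add: ball_const_def)
  have gO: "bounded_supported (\<Omega> \<inter> ?B) g" using \<rho> by (intro bounded_supported_mono[OF g]) auto
  have gB: "bounded_supported ?B g" by (rule bounded_supported_mono[OF gO]) simp
  have N: "?N \<ge> 0" by (simp add: integral_nonneg_AE)
  have a1: "a1 \<ge> 0" unfolding a1_def using K bc N by simp
  have kgg: "riesz_pairing g g \<ge> 0" by (rule riesz_pairing_finite(2)[OF Kc r10 gB gB])
  obtain \<phi> where \<phi>0: "\<phi> \<in> Cc_inf_vec \<Omega>"
      "\<forall>\<psi>\<in>Cc_inf_vec \<Omega>. \<bar>bform A UNIV \<phi> \<psi> - (LINT x|lebesgue. g x \<bullet> \<psi> x)\<bar> \<le> \<epsilon> * l2 lebesgue (cjac \<psi>)"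
      "\<forall>h. bounded_supported (\<Omega> \<inter> ?B) h \<longrightarrow> \<bar>LINT x|lebesgue. h x \<bullet> \<phi> x\<bar> \<le> K * riesz_pairing h g + \<epsilon> * l2 lebesgue h"
    using sol[unfolded approx_solvable_def, rule_format, OF gO \<epsilon>(1)] by blast
  note \<phi> = \<phi>0(1) \<phi>0(2)[rule_format] \<phi>0(3)[rule_format]
  note s\<phi> = Cc_inf_vec_sqint_UNIV[OF \<phi>(1)]
  have \<phi>m: "\<phi> \<in> borel_measurable lebesgue" using s\<phi>(1) by (simp add: sqint_def)
  have out: "\<phi> x = 0" if "x \<notin> \<Omega>" for x by (rule Cc_inf_vec_support(1)[OF \<phi>(1) that])
  obtain b where b: "\<And>x. norm (\<phi> x) \<le> b" using Cc_inf_vec_bounded[OF \<phi>(1)] by blast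

  define h where "h x = indicator (annulus p \<rho>) x *\<^sub>R \<phi> x" for x
  define X where "X = l2 lebesgue h"
  have sh: "sqint lebesgue h" unfolding h_def[abs_def] by (rule indicator_sqint(1)[OF s\<phi>(1)]) (simp add: annulus_sets)
  have hO: "bounded_supported (\<Omega> \<inter> ?B) h" unfolding bounded_supported_def
  proof (intro conjI allI impI)
    show "h \<in> borel_measurable lebesgue" using sh by (simp add: sqint_def)
    show "\<exists>B. \<forall>x. norm (h x) \<le> B" using b order_trans[OF norm_ge_zero b] by (intro exI[of _ b]) (auto simp: h_def indicator_def)
    show "h x = 0" if "x \<notin> \<Omega> \<inter> ?B" for x using that out by (auto simp: h_def annulus_def indicator_def dist_commute)
  qed
  have hB: "bounded_supported ?B h" by (rule bounded_supported_mono[OF hO]) simp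
  have "X\<^sup>2 = (LINT x|lebesgue. h x \<bullet> \<phi> x)"
    unfolding X_def l2_square by (intro Bochner_Integration.integral_cong refl) (auto simp: h_def indicator_def power2_norm_eq_inner)
  also have "\<dots> \<le> K * riesz_pairing h g + \<epsilon> * X" using \<phi>(3)[OF hO] by (simp add: X_def)
  also have "riesz_pairing h g \<le> (\<rho> / 2) powr (2 - real CARD('n)) * ((LINT x|lebesgue. norm (h x)) * ?N)"
  proof (rule riesz_pairing_separated[OF n _ hB gB])
    fix x y assume "h x \<noteq> 0" "g y \<noteq> 0"
    then have "\<rho> \<le> dist x p" "dist y p < \<rho> / 2"
      using g by (auto simp: h_def annulus_def indicator_def bounded_supported_def dist_commute split: if_splits)
    then show "\<rho> / 2 \<le> dist x y" using dist_triangle[of x p y] by linarith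
  qed (use \<rho> in simp)
  also have "(LINT x|lebesgue. norm (h x)) \<le> ?bc * X"
    unfolding X_def by (rule L1_le_L2_ball[OF sh]) (use hB in \<open>auto simp: bounded_supported_def\<close>)
  finally have "X\<^sup>2 \<le> K * ((\<rho> / 2) powr (2 - real CARD('n)) * ((?bc * X) * ?N)) + \<epsilon> * X"
    using K N by (simp add: mult_left_mono mult_right_mono)
  then have "X\<^sup>2 \<le> a1 * X + \<epsilon> * X" by (simp add: a1_def mult_ac)
  moreover have X0: "X \<ge> 0" unfolding X_def by (rule l2_nonneg)
  ultimately have X: "X \<le> a1 + \<epsilon>" using a1 less_imp_le[OF \<epsilon>(1)] by (rule square_root_estimate)

  define k where "k x = indicator ?B x *\<^sub>R sgn (\<phi> x)" for x
  have k1: "norm (k x) \<le> 1" for x by (simp add: k_def norm_sgn indicator_def)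
  have kO: "bounded_supported (\<Omega> \<inter> ?B) k" unfolding bounded_supported_def
  proof (intro conjI allI impI)
    have "(\<lambda>x. sgn (\<phi> x)) \<in> borel_measurable lebesgue" unfolding sgn_div_norm[abs_def] using \<phi>m by measurable
    then show "k \<in> borel_measurable lebesgue" unfolding k_def[abs_def]
      by (intro borel_measurable_scaleR borel_measurable_indicator) auto
    show "\<exists>B. \<forall>x. norm (k x) \<le> B" using k1 by blast
    show "k x = 0" if "x \<notin> \<Omega> \<inter> ?B" for x using that out by (auto simp: k_def)
  qed
  have kB: "bounded_supported ?B k" by (rule bounded_supported_mono[OF kO]) simp
  have "(LINT x|lebesgue. indicator ?B x * norm (\<phi> x)) = (LINT x|lebesgue. k x \<bullet> \<phi> x)"
  proof -
    have "sgn v \<bullet> v = norm v" for v :: "real^'m"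
      by (cases "v = 0") (simp_all add: sgn_div_norm power2_norm_eq_inner[symmetric] power2_eq_square)
    then show ?thesis by (simp add: k_def)
  qed
  also have "\<dots> \<le> K * riesz_pairing k g + \<epsilon> * l2 lebesgue k" using \<phi>(3)[OF kO] by simp
  also have "riesz_pairing k g = riesz_pairing g k" by (rule riesz_pairing_commute[OF kB gB])
  also have "riesz_pairing g k \<le> 1 * Kc * (2 * (10 * \<rho>))\<^sup>2 * ?N" by (rule riesz_pairing_finite(3)[OF Kc r10 gB kB k1])
  also have "l2 lebesgue k \<le> ?bc"
  proof -
    have "(l2 lebesgue k)\<^sup>2 = (LINT x|lebesgue. (norm (k x))\<^sup>2)" by (rule l2_square)
    also have "\<dots> \<le> (LINT x|lebesgue. indicator ?B x)"
    proof (rule integral_mono)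
      show "integrable lebesgue (\<lambda>x. (norm (k x))\<^sup>2)" using bounded_supported_integrable(2)[OF kB order_refl] by (simp add: sqint_def)
      show "integrable lebesgue (indicator ?B :: _ \<Rightarrow> real)"
        using lmeasurable_ball[of p "10 * \<rho>"] by (intro integrable_real_indicator) (auto simp: fmeasurable_def)
      show "(norm (k x))\<^sup>2 \<le> indicator ?B x" for x using k1[of x] by (auto simp: k_def indicator_def power_le_one)
    qed
    also have "\<dots> = measure lebesgue ?B" by simp
    finally show ?thesis using real_le_rsqrt unfolding measure_ball_const[of p, symmetric] by blast
  qed
  finally have Y: "(LINT x|lebesgue. indicator ?B x * norm (\<phi> x)) \<le> K * (Kc * (20 * \<rho>)\<^sup>2 * ?N) + \<epsilon> * ?bc"
    using K \<epsilon> by (simp add: mult_left_mono)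

  define E where "E = l2 lebesgue (cjac \<phi>)"
  have E0: "E \<ge> 0" by (simp add: E_def l2_nonneg)
  have "\<nu> * E\<^sup>2 \<le> bform A UNIV \<phi> \<phi>" unfolding E_def by (rule bform_coercive[OF A \<phi>(1)])
  also have "\<dots> \<le> K * riesz_pairing g g + \<epsilon> * l2 lebesgue g + \<epsilon> * E"
    using \<phi>(2)[OF \<phi>(1)] \<phi>(3)[OF gO] unfolding E_def[symmetric] by linarith
  also have "\<epsilon> * l2 lebesgue g \<le> 1 * l2 lebesgue g" using \<epsilon> l2_nonneg by (intro mult_right_mono) auto
  also have "\<epsilon> * E \<le> 1 * E" using \<epsilon> E0 by (intro mult_right_mono) auto
  finally have en: "\<nu> * E\<^sup>2 \<le> K * riesz_pairing g g + l2 lebesgue g + E" by simp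
  have E: "E \<le> E0"
  proof (cases "E \<le> 1")
    case True
    have "(K * riesz_pairing g g + l2 lebesgue g + 1) / \<nu> \<ge> 0" using K kgg l2_nonneg[of lebesgue g] A(2) by simp
    then show ?thesis using True unfolding E0_def by linarith
  next
    case False
    then have "(K * riesz_pairing g g + l2 lebesgue g) * 1 \<le> (K * riesz_pairing g g + l2 lebesgue g) * E"
      using K kgg l2_nonneg[of lebesgue g] by (intro mult_left_mono) auto
    then have "\<nu> * E * E \<le> (K * riesz_pairing g g + l2 lebesgue g + 1) * E" using en by (simp add: power2_eq_square algebra_simps)
    then have "\<nu> * E \<le> K * riesz_pairing g g + l2 lebesgue g + 1" using False by simp
    then have "E \<le> (K * riesz_pairing g g + l2 lebesgue g + 1) / \<nu>" using A(2) by (simp add: field_simps)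
    then show ?thesis unfolding E0_def by simp
  qed

  let ?\<eta> = "ring_cutoff p \<rho>"
  define \<psi> where "\<psi> x = (?\<eta> x * ?\<eta> x) *\<^sub>R \<phi> x" for x
  have \<psi>: "\<psi> \<in> Cc_inf_vec \<Omega>" unfolding \<psi>_def[abs_def]
    by (rule Cc_inf_vec_mult[OF \<phi>(1) smooth_mult_UNIV[OF smooth_ring_cutoff smooth_ring_cutoff]])
  have \<eta>d: "?\<eta> differentiable at x" for x by (rule smooth_on_differentiable[OF smooth_ring_cutoff]) auto
  have G: "cjac \<psi> x = (?\<eta> x)\<^sup>2 *\<^sub>R cjac \<phi> x + (2 * ?\<eta> x) *\<^sub>R outer (\<phi> x) (grad ?\<eta> x)" for x
  proof -
    have "cjac \<psi> x = (?\<eta> x * ?\<eta> x) *\<^sub>R cjac \<phi> x + outer (\<phi> x) (grad (\<lambda>x. ?\<eta> x * ?\<eta> x) x)"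
      unfolding \<psi>_def[abs_def]
      by (rule cjac_mult[OF differentiable_mult[OF \<eta>d \<eta>d] Cc_inf_vec_differentiable[OF \<phi>(1)]])
    also have "grad (\<lambda>x. ?\<eta> x * ?\<eta> x) x = (2 * ?\<eta> x) *\<^sub>R grad ?\<eta> x"
      using grad_mult[OF \<eta>d \<eta>d, of x] by (simp add: scaleR_add_left[symmetric])
    finally show ?thesis by (simp add: power2_eq_square outer_scale)
  qed
  have \<eta>m: "?\<eta> \<in> borel_measurable (lebesgue_on UNIV)"
    by (rule continuous_on_open_measurable[OF open_UNIV smooth_on_continuous[OF smooth_ring_cutoff]])
  have qm: "grad ?\<eta> \<in> borel_measurable (lebesgue_on UNIV)"
    by (rule continuous_on_open_measurable[OF open_UNIV grad_continuous_on[OF smooth_ring_cutoff]])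
  have qv: "norm (\<phi> x) * norm (grad ?\<eta> x) \<le> 2 * Cg / \<rho> * norm (h x)" for x
  proof (cases "x \<in> annulus p \<rho>")
    case True
    then show ?thesis using mult_left_mono[OF grad_ring_cutoff(1)[OF Cg \<rho>, of p x], of "norm (\<phi> x)"]
      by (simp add: h_def mult.commute)
  next
    case False
    then have "dist x p < \<rho> \<or> dist x p > 8 * \<rho>" using \<rho> by (auto simp: annulus_def)
    then show ?thesis using grad_ring_cutoff(2)[OF Cg \<rho>] Cg \<rho> by (simp add: cutoff_grad_bound_def)
  qed
  have cg: "2 * Cg / \<rho> \<ge> 0" using Cg \<rho> by (simp add: cutoff_grad_bound_def)
  have zero: "(LINT x|lebesgue. g x \<bullet> \<psi> x) = 0"
  proof -
    have "g x \<bullet> \<psi> x = 0" for x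
    proof (cases "g x = 0")
      case False
      then have "x \<in> ball p (\<rho> / 2)" using g unfolding bounded_supported_def by blast
      then have "dist x p < \<rho>" using \<rho> by (simp add: dist_commute)
      then show ?thesis using cutoff_one[of \<rho> x p] \<rho> by (simp add: \<psi>_def ring_cutoff_def)
    qed simp
    then show ?thesis by simp
  qed
  have \<eta>1: "\<bar>?\<eta> x\<bar> \<le> 1" for x using ring_cutoff_bounds[of p \<rho> x] by simp
  have U: "sqint (lebesgue_on UNIV) \<phi>" "sqint (lebesgue_on UNIV) (cjac \<phi>)" "sqint (lebesgue_on UNIV) h"
    unfolding lebesgue_on_UNIV_eq by (rule s\<phi>, rule s\<phi>, rule sh)
  have test: "(LINT x|lebesgue_on UNIV. aform A x (cjac \<phi> x) (cjac \<psi> x)) \<le> \<epsilon> * l2 lebesgue (cjac \<psi>)"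
    using \<phi>(2)[OF \<psi>] zero by (simp add: bform_def)
  note cac = caccioppoli[OF A U(2) U(1) \<eta>m \<eta>1 qm U(3) cg qv G test, unfolded lebesgue_on_UNIV_eq X_def[symmetric] E_def[symmetric]]
  have "\<epsilon> * l2 lebesgue (cjac \<psi>) \<le> \<epsilon> * (E0 + 2 * (2 * Cg / \<rho>) * (a1 + \<epsilon>))"
    using cac(3) E X cg \<epsilon> by (intro mult_left_mono order_trans[OF cac(3)] add_mono) auto
  moreover have "2 * M\<^sup>2 / \<nu> * ((2 * Cg / \<rho>)\<^sup>2 * X\<^sup>2) \<le> 2 * M\<^sup>2 / \<nu> * ((2 * Cg / \<rho>)\<^sup>2 * (a1 + \<epsilon>)\<^sup>2)"
    using X X0 A(2) by (intro mult_left_mono power_mono) auto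
  ultimately have V: "\<nu> / 2 * (l2 lebesgue (\<lambda>x. ?\<eta> x *\<^sub>R cjac \<phi> x))\<^sup>2
      \<le> 2 * M\<^sup>2 / \<nu> * ((2 * Cg / \<rho>)\<^sup>2 * (a1 + \<epsilon>)\<^sup>2) + \<epsilon> * (E0 + 2 * (2 * Cg / \<rho>) * (a1 + \<epsilon>))"
    using cac(1) by linarith
  show ?thesis
    by (intro bexI[OF _ \<phi>(1)] conjI \<phi>0(2) Y V X[unfolded X_def h_def[abs_def]])
qed

section \<open>Test functions built from a solution that vanishes on the boundary\<close>

text \<open>Why \<open>\<xi> u\<close> may be used as a test function. The approximating functions vanish near the boundary part
  \<open>frontier \<Omega> \<inter> ball x R\<close>, and \<open>\<xi>\<close> vanishes near the rest of the boundary of \<open>\<Omega> \<inter> ball x R\<close>, which is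
  contained in the sphere. Their products therefore have compact support in the open set.\<close>

lemma cutoff_test_sequence:
  fixes u :: "real^'n \<Rightarrow> real^'m"
  assumes n: "CARD('n) \<ge> 3" and \<Omega>: "open \<Omega>" and ball: "cball p s \<subseteq> ball x R"
    and van: "vanishes_on_vec (\<Omega> \<inter> ball x R) (frontier \<Omega> \<inter> ball x R) u"
    and \<chi>: "smooth_on UNIV \<xi>" "\<And>y. y \<notin> cball p s \<Longrightarrow> \<xi> y = 0" "\<And>y. \<bar>\<xi> y\<bar> \<le> 1"
    and c: "\<And>y. norm (grad \<xi> y) \<le> c"
  defines "U \<equiv> \<Omega> \<inter> ball x R"
  defines "H \<equiv> \<lambda>y. \<xi> y *\<^sub>R wjac U u y + outer (u y) (grad \<xi> y)"
  shows "sqint (lebesgue_on U) u" "sqint (lebesgue_on U) (wjac U u)" "sqint (lebesgue_on U) H"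
    "sqint (lebesgue_on U) (\<lambda>y. \<xi> y *\<^sub>R u y)"
    "\<exists>T. (\<forall>k. T k \<in> Cc_inf_vec U) \<and>
         (\<lambda>k. l2 (lebesgue_on U) (\<lambda>y. T k y - \<xi> y *\<^sub>R u y)) \<longlonglongrightarrow> 0 \<and>
         (\<lambda>k. l2 (lebesgue_on U) (\<lambda>y. cjac (T k) y - H y)) \<longlonglongrightarrow> 0"
proof -
  let ?\<mu> = "lebesgue_on U" and ?\<Sigma> = "frontier \<Omega> \<inter> ball x R"
  have U: "open U" "bounded U" unfolding U_def using \<Omega> by (auto intro: bounded_subset[OF bounded_ball])
  have S: "U \<in> lmeasurable" using U by (simp add: bounded_set_imp_lmeasurable)
  have c0: "c \<ge> 0" using c[of p] norm_ge_zero order_trans by blast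
  have v: "vanishes_on U ?\<Sigma> (\<lambda>x. u x $ i)" for i using van by (simp add: vanishes_on_vec_def U_def)
  have Y1: "(\<lambda>x. u x $ i) \<in> Y12 U" for i using v[of i] by (simp add: vanishes_on_def)
  have Y2: "\<exists>\<phi>\<in>Cc_inf_closure U ?\<Sigma>. Y12_norm U (\<lambda>x. u x $ i - \<phi> x) < e" if e: "e > 0" for i e
  proof -
    obtain \<phi> where \<phi>: "\<forall>k::nat. \<phi> k \<in> Cc_inf_closure U ?\<Sigma>" "(\<lambda>k. Y12_norm U (\<lambda>x. u x $ i - \<phi> k x)) \<longlonglongrightarrow> 0"
      using v[of i] unfolding vanishes_on_def by blast
    have "eventually (\<lambda>k. Y12_norm U (\<lambda>x. u x $ i - \<phi> k x) < e) sequentially"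
      by (rule order_tendstoD(2)[OF \<phi>(2) e])
    then obtain k where "Y12_norm U (\<lambda>x. u x $ i - \<phi> k x) < e" by (auto simp: eventually_sequentially)
    then show ?thesis using \<phi>(1) by blast
  qed
  have p0: "sobolev_exp TYPE('n) > 0" using sobolev_exp_ge_2[OF n] by simp
  obtain \<psi> where \<psi>: "\<And>k i. (\<lambda>x. \<psi> k x $ i) \<in> Cc_inf_closure U ?\<Sigma>"
    "\<And>k. sqint ?\<mu> (cjac (\<psi> k))" "\<And>k. sqint ?\<mu> (\<psi> k)"
    "sqint ?\<mu> (wjac U u)" "sqint ?\<mu> u"
    "(\<lambda>k. l2 ?\<mu> (\<lambda>x. \<psi> k x - u x)) \<longlonglongrightarrow> 0"
    "(\<lambda>k. l2 ?\<mu> (\<lambda>x. cjac (\<psi> k) x - wjac U u x)) \<longlonglongrightarrow> 0"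
    by (rule Y12_approximation[OF n U(1) S order_refl Y1 Cc_inf_closure_class(1)[OF U _ p0] Cc_inf_closure_class(2)[OF U _ p0] Cc_inf_closure_class(3)[OF U _ p0] Y2]) blast+
  have xm: "\<xi> \<in> borel_measurable ?\<mu>"
    by (rule continuous_on_open_measurable[OF U(1) continuous_on_subset[OF smooth_on_continuous[OF \<chi>(1)] subset_UNIV]])
  have qm: "grad \<xi> \<in> borel_measurable ?\<mu>"
    by (rule continuous_on_open_measurable[OF U(1) continuous_on_subset[OF grad_continuous_on[OF \<chi>(1)] subset_UNIV]])
  have mult: "sqint ?\<mu> (\<lambda>y. \<xi> y *\<^sub>R F y)" "l2 ?\<mu> (\<lambda>y. \<xi> y *\<^sub>R F y) \<le> l2 ?\<mu> F"
    if "sqint ?\<mu> F" for F :: "real^'n \<Rightarrow> 'z::euclidean_space"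
    using sqint_mult[OF that xm, of 1] \<chi>(3) by auto
  have out: "sqint ?\<mu> (\<lambda>y. outer (F y) (grad \<xi> y))" "l2 ?\<mu> (\<lambda>y. outer (F y) (grad \<xi> y)) \<le> c * l2 ?\<mu> F"
    if "sqint ?\<mu> F" for F :: "real^'n \<Rightarrow> real^'m"
    using outer_sqint[OF that qm c c0] by auto
  show "sqint ?\<mu> u" "sqint ?\<mu> (wjac U u)" by (rule \<psi>(5), rule \<psi>(4))
  show sH: "sqint ?\<mu> H" unfolding H_def by (rule sqint_add(1)[OF mult(1)[OF \<psi>(4)] out(1)[OF \<psi>(5)]])
  show "sqint ?\<mu> (\<lambda>y. \<xi> y *\<^sub>R u y)" by (rule mult(1)[OF \<psi>(5)])
  define T where "T k y = (if y \<in> U then \<xi> y *\<^sub>R \<psi> k y else 0)" for k y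
  have sm: "smooth_on U (\<lambda>y. \<psi> k y $ i)" for k i using \<psi>(1) by (simp add: Cc_inf_closure_def)
  have T: "T k \<in> Cc_inf_vec U" for k
  proof -
    have "(\<lambda>y. T k y $ i) \<in> Cc_inf U" for i
    proof -
      define K where "K = closure {y\<in>U. \<psi> k y $ i \<noteq> 0} \<inter> cball p s"
      have cl: "compact (closure {y\<in>U. \<psi> k y $ i \<noteq> 0})" "closure {y\<in>U. \<psi> k y $ i \<noteq> 0} \<inter> ?\<Sigma> = {}"
        using \<psi>(1)[of k i] by (simp_all add: Cc_inf_closure_def)
      have K: "compact K" unfolding K_def by (rule compact_Int_closed[OF cl(1) closed_cball])
      have KU: "K \<subseteq> U"
      proof
        fix y assume y: "y \<in> K"
        then have yR: "y \<in> ball x R" using ball by (auto simp: K_def)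
        have "y \<in> closure \<Omega>"
          using y closure_mono[of "{y\<in>U. \<psi> k y $ i \<noteq> 0}" \<Omega>] unfolding K_def U_def by blast
        moreover have "y \<notin> frontier \<Omega>" using y yR cl(2) unfolding K_def by blast
        ultimately have "y \<in> \<Omega>" using \<Omega> by (simp add: frontier_def interior_open)
        then show "y \<in> U" using yR by (simp add: U_def)
      qed
      have z: "\<xi> y * \<psi> k y $ i = 0" if "y \<in> U" "y \<notin> K" for y
      proof (cases "y \<in> cball p s")
        case True
        then have "y \<notin> closure {y\<in>U. \<psi> k y $ i \<noteq> 0}" using that(2) by (simp add: K_def)
        then have "y \<notin> {y\<in>U. \<psi> k y $ i \<noteq> 0}" by (rule contra_subsetD[OF closure_subset])
        then show ?thesis using that(1) by simp
      next
        case False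
        then show ?thesis using \<chi>(2) by simp
      qed
      have "(\<lambda>y. if y \<in> U then \<xi> y * \<psi> k y $ i else 0) \<in> Cc_inf U"
        by (rule Cc_inf_cutoff[OF U(1) sm smooth_on_subset[OF \<chi>(1) subset_UNIV] K KU z])
      moreover have "(\<lambda>y. T k y $ i) = (\<lambda>y. if y \<in> U then \<xi> y * \<psi> k y $ i else 0)" by (auto simp: T_def)
      ultimately show ?thesis by simp
    qed
    then show ?thesis by (simp add: Cc_inf_vec_def)
  qed
  have DT: "cjac (T k) y - H y = \<xi> y *\<^sub>R (cjac (\<psi> k) y - wjac U u y) + outer (\<psi> k y - u y) (grad \<xi> y)" if y: "y \<in> U" for k y
  proof -
    have "cjac (T k) y = cjac (\<lambda>y. \<xi> y *\<^sub>R \<psi> k y) y"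
      by (rule cjac_cong[OF U(1) y]) (simp add: T_def)
    also have "\<dots> = \<xi> y *\<^sub>R cjac (\<psi> k) y + outer (\<psi> k y) (grad \<xi> y)"
      by (rule cjac_mult[OF smooth_on_differentiable[OF \<chi>(1) open_UNIV UNIV_I] smooth_on_differentiable[OF sm U(1) y]])
    finally show ?thesis by (simp add: H_def outer_diff algebra_simps)
  qed
  have "(\<lambda>k. l2 ?\<mu> (\<lambda>y. T k y - \<xi> y *\<^sub>R u y)) \<longlonglongrightarrow> 0"
  proof (rule tendsto_if_abs_diff_le[OF _ \<psi>(6)])
    fix k
    have "l2 ?\<mu> (\<lambda>y. T k y - \<xi> y *\<^sub>R u y) = l2 ?\<mu> (\<lambda>y. \<xi> y *\<^sub>R (\<psi> k y - u y))"
      unfolding l2_def by (intro arg_cong[where f = sqrt] Bochner_Integration.integral_cong) (auto simp: T_def scaleR_diff_right)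
    then show "\<bar>l2 ?\<mu> (\<lambda>y. T k y - \<xi> y *\<^sub>R u y) - 0\<bar> \<le> l2 ?\<mu> (\<lambda>x. \<psi> k x - u x)"
      using mult(2)[OF sqint_diff(1)[OF \<psi>(3,5)], of k] l2_nonneg[of ?\<mu> "\<lambda>y. \<xi> y *\<^sub>R (\<psi> k y - u y)"] by simp
  qed
  moreover have "(\<lambda>k. l2 ?\<mu> (\<lambda>y. cjac (T k) y - H y)) \<longlonglongrightarrow> 0"
  proof (rule tendsto_if_abs_diff_le)
    fix k
    note d1 = sqint_diff(1)[OF \<psi>(2)[of k] \<psi>(4)] and d2 = sqint_diff(1)[OF \<psi>(3)[of k] \<psi>(5)]
    have "l2 ?\<mu> (\<lambda>y. cjac (T k) y - H y) =
        l2 ?\<mu> (\<lambda>y. \<xi> y *\<^sub>R (cjac (\<psi> k) y - wjac U u y) + outer (\<psi> k y - u y) (grad \<xi> y))"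
      unfolding l2_def by (intro arg_cong[where f = sqrt] Bochner_Integration.integral_cong) (auto simp: DT)
    also have "\<dots> \<le> l2 ?\<mu> (\<lambda>x. cjac (\<psi> k) x - wjac U u x) + c * l2 ?\<mu> (\<lambda>x. \<psi> k x - u x)"
      using sqint_add(2)[OF mult(1)[OF d1] out(1)[OF d2]] mult(2)[OF d1] out(2)[OF d2] by linarith
    finally show "\<bar>l2 ?\<mu> (\<lambda>y. cjac (T k) y - H y) - 0\<bar> \<le> l2 ?\<mu> (\<lambda>x. cjac (\<psi> k) x - wjac U u x) + c * l2 ?\<mu> (\<lambda>x. \<psi> k x - u x)"
      using l2_nonneg[of ?\<mu> "\<lambda>y. cjac (T k) y - H y"] by simp
  next
    show "(\<lambda>k. l2 ?\<mu> (\<lambda>x. cjac (\<psi> k) x - wjac U u x) + c * l2 ?\<mu> (\<lambda>x. \<psi> k x - u x)) \<longlonglongrightarrow> 0"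
      using tendsto_add[OF \<psi>(7) tendsto_mult_right_zero[OF \<psi>(6), of c]] by simp
  qed
  ultimately show "\<exists>T. (\<forall>k. T k \<in> Cc_inf_vec U) \<and>
         (\<lambda>k. l2 ?\<mu> (\<lambda>y. T k y - \<xi> y *\<^sub>R u y)) \<longlonglongrightarrow> 0 \<and>
         (\<lambda>k. l2 ?\<mu> (\<lambda>y. cjac (T k) y - H y)) \<longlonglongrightarrow> 0" using T by blast
qed

lemma bounded_source_sqint:
  fixes f :: "real^'n \<Rightarrow> real^'m"
  assumes U: "U \<in> lmeasurable" and f: "f \<in> borel_measurable (lebesgue_on U)"
    and Fb: "AE y in lebesgue_on U. norm (f y) \<le> Fb" "Fb \<ge> 0"
  shows "sqint (lebesgue_on U) f"
    "sqint (lebesgue_on U) (\<lambda>y. indicator (ball p (10 * \<rho>)) y *\<^sub>R f y)"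
    "l2 (lebesgue_on U) (\<lambda>y. indicator (ball p (10 * \<rho>)) y *\<^sub>R f y) \<le> Fb * ball_const TYPE('n) \<rho>"
proof -
  let ?\<mu> = "lebesgue_on U" and ?B = "ball p (10 * \<rho>)"
  have Um: "U \<in> sets lebesgue" using U by auto
  interpret finite_measure ?\<mu> by (rule finite_measure_lebesgue_on[OF U])
  have "sqint ?\<mu> (\<lambda>_. 1::real)" by (simp add: sqint_def)
  then show f2: "sqint ?\<mu> f" by (rule sqint_dominated(1)[OF _ f _ Fb(2)]) (use Fb(1) in simp)
  have BU: "?B \<inter> space ?\<mu> \<in> sets ?\<mu>" using Um by (auto simp: sets_restrict_space)
  show "sqint ?\<mu> (\<lambda>y. indicator ?B y *\<^sub>R f y)" by (rule indicator_sqint(1)[OF f2 BU])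
  have iB: "integrable lebesgue (indicator ?B :: _ \<Rightarrow> real)"
    using lmeasurable_ball[of p "10 * \<rho>"] by (intro integrable_real_indicator) (auto simp: fmeasurable_def)
  have sq: "(norm (indicator ?B y :: real))\<^sup>2 = indicator ?B y" for y by (simp add: indicator_def)
  have sB: "sqint (lebesgue_on UNIV) (indicator ?B :: _ \<Rightarrow> real)"
    using iB unfolding sqint_def sq lebesgue_on_UNIV_eq by auto
  have lB: "l2 (lebesgue_on UNIV) (indicator ?B :: _ \<Rightarrow> real) = ball_const TYPE('n) \<rho>"
    unfolding l2_def sq lebesgue_on_UNIV_eq measure_ball_const[of p, symmetric] by simp
  note sU = sqint_on_subset[OF Um _ subset_UNIV sB]
  have sU1: "sqint ?\<mu> (indicator ?B :: _ \<Rightarrow> real)" using sU(1) by simp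
  have "l2 ?\<mu> (\<lambda>y. indicator ?B y *\<^sub>R f y) \<le> Fb * l2 ?\<mu> (indicator ?B :: _ \<Rightarrow> real)"
  proof (rule sqint_dominated(2)[OF sU1 _ _ Fb(2)])
    show "(\<lambda>y. indicator ?B y *\<^sub>R f y) \<in> borel_measurable ?\<mu>" using indicator_sqint(1)[OF f2 BU] by (simp add: sqint_def)
    show "AE y in ?\<mu>. norm (indicator ?B y *\<^sub>R f y) \<le> Fb * norm (indicator ?B y :: real)"
      using Fb(1) by eventually_elim (auto simp: indicator_def)
  qed
  also have "\<dots> \<le> Fb * ball_const TYPE('n) \<rho>" using sU(2) Fb(2) unfolding lB by (intro mult_left_mono) auto
  finally show "l2 ?\<mu> (\<lambda>y. indicator ?B y *\<^sub>R f y) \<le> Fb * ball_const TYPE('n) \<rho>" .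
qed

text \<open>Caccioppoli's inequality for \<open>u\<close>, that is the equation tested with \<open>\<eta>\<^sup>2 u\<close> for \<open>\<eta> = cutoff p (4 * \<rho>)\<close>. Since
  \<open>\<eta>\<close> is supported in the ball of radius \<open>8\<rho>\<close>, the right-hand side \<open>f\<close> may be truncated to the ball of
  radius \<open>10\<rho>\<close>, on which \<open>ball_const\<close> measures it.\<close>

lemma solution_energy:
  fixes A :: "('n::finite, 'm::finite) coeff" and u f :: "real^'n \<Rightarrow> real^'m"
  assumes n: "CARD('n) \<ge> 3" and Cg: "cutoff_grad_bound TYPE('n) Cg" and \<Omega>: "open \<Omega>" and \<rho>: "\<rho> > 0"
    and ball: "ball p (10 * \<rho>) \<subseteq> ball x R" and A: "bounded_coercive \<nu> M A" "\<nu> > 0"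
    and van: "vanishes_on_vec (\<Omega> \<inter> ball x R) (frontier \<Omega> \<inter> ball x R) u"
    and sol: "weak_solution A (\<Omega> \<inter> ball x R) u f"
    and f: "f \<in> borel_measurable (lebesgue_on (\<Omega> \<inter> ball x R))"
    and Fb: "AE y in lebesgue_on (\<Omega> \<inter> ball x R). norm (f y) \<le> Fb" "Fb \<ge> 0"
  defines "\<mu> \<equiv> lebesgue_on (\<Omega> \<inter> ball x R)"
  shows "\<nu> / 2 * (l2 \<mu> (\<lambda>y. cutoff p (4 * \<rho>) y *\<^sub>R wjac (\<Omega> \<inter> ball x R) u y))\<^sup>2
     \<le> 2 * M\<^sup>2 / \<nu> * ((Cg / (4 * \<rho>))\<^sup>2 * (l2 \<mu> u)\<^sup>2) + Fb * ball_const TYPE('n) \<rho> * l2 \<mu> u"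
proof -
  define U where "U = \<Omega> \<inter> ball x R"
  have \<mu>: "\<mu> = lebesgue_on U" by (simp add: \<mu>_def U_def)
  have U: "open U" "bounded U" unfolding U_def using \<Omega> by (auto intro: bounded_subset[OF bounded_ball])
  have Ul: "U \<in> lmeasurable" using U by (simp add: bounded_set_imp_lmeasurable)
  let ?\<eta> = "cutoff p (4 * \<rho>)" and ?c = "Cg / (4 * \<rho>)" and ?F = "wjac U u" and ?B = "ball p (10 * \<rho>)"
  define \<xi> where "\<xi> y = ?\<eta> y * ?\<eta> y" for y
  have r4: "4 * \<rho> > 0" using \<rho> by simp
  have gb: "norm (grad ?\<eta> y) \<le> ?c" for y using Cg r4 unfolding cutoff_grad_bound_def by blast
  have c0: "?c \<ge> 0" using Cg \<rho> by (simp add: cutoff_grad_bound_def)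
  have \<xi>s: "smooth_on UNIV \<xi>" unfolding \<xi>_def[abs_def] by (rule smooth_mult_UNIV[OF smooth_cutoff smooth_cutoff])
  have \<xi>0: "\<xi> y = 0" if "y \<notin> cball p (8 * \<rho>)" for y
    using cutoff_zero[OF r4, of y p] that by (simp add: \<xi>_def dist_commute)
  have \<xi>1: "\<bar>\<xi> y\<bar> \<le> 1" for y using cutoff_bounds[of p "4 * \<rho>" y] by (simp add: \<xi>_def abs_mult mult_le_one)
  have \<xi>g: "grad \<xi> y = (2 * ?\<eta> y) *\<^sub>R grad ?\<eta> y" for y
    unfolding \<xi>_def[abs_def] using grad_mult[OF cutoff_differentiable cutoff_differentiable, of p "4 * \<rho>" p "4 * \<rho>" y]
    by (simp add: scaleR_add_left[symmetric])
  have \<xi>gb: "norm (grad \<xi> y) \<le> 2 * ?c" for y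
  proof -
    have "norm (grad \<xi> y) = 2 * ?\<eta> y * norm (grad ?\<eta> y)" using cutoff_bounds[of p "4 * \<rho>" y] by (simp add: \<xi>g)
    also have "\<dots> \<le> 2 * 1 * ?c" using cutoff_bounds[of p "4 * \<rho>" y] gb[of y] by (intro mult_mono) auto
    finally show ?thesis by simp
  qed
  have cb: "cball p (8 * \<rho>) \<subseteq> ball x R"
  proof -
    have "cball p (8 * \<rho>) \<subseteq> ?B" using \<rho> by auto
    then show ?thesis using ball by blast
  qed
  note seq = cutoff_test_sequence[OF n \<Omega> cb van \<xi>s \<xi>0 \<xi>1 \<xi>gb, folded U_def]
  define H where "H y = \<xi> y *\<^sub>R ?F y + outer (u y) (grad \<xi> y)" for y
  obtain T where T: "\<forall>k. T k \<in> Cc_inf_vec U" "(\<lambda>k. l2 (lebesgue_on U) (\<lambda>y. T k y - \<xi> y *\<^sub>R u y)) \<longlonglongrightarrow> 0"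
      "(\<lambda>k. l2 (lebesgue_on U) (\<lambda>y. cjac (T k) y - H y)) \<longlonglongrightarrow> 0"
    using seq(5) unfolding H_def by blast
  have sH: "sqint (lebesgue_on U) H" using seq(3) unfolding H_def[abs_def] .
  have sT: "sqint (lebesgue_on U) (T k)" "sqint (lebesgue_on U) (cjac (T k))" for k
    using Cc_inf_vec_sqint[OF U(1)] T(1) by blast+
  note bf = bounded_source_sqint[OF Ul f[folded U_def] Fb(1)[folded U_def] Fb(2)]
  have "(\<lambda>k. LINT y|lebesgue_on U. aform A y (?F y) (cjac (T k) y)) \<longlonglongrightarrow> (LINT y|lebesgue_on U. aform A y (?F y) (H y))"
    by (rule aform_tendsto[OF A seq(2) sH sT(2) T(3)])
  moreover have "(LINT y|lebesgue_on U. aform A y (?F y) (cjac (T k) y)) = (LINT y|lebesgue_on U. f y \<bullet> T k y)" for k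
    using sol T(1) unfolding weak_solution_def sys_form_aform U_def[symmetric] by blast
  moreover have "(\<lambda>k. LINT y|lebesgue_on U. f y \<bullet> T k y) \<longlonglongrightarrow> (LINT y|lebesgue_on U. f y \<bullet> (\<xi> y *\<^sub>R u y))"
    by (rule inner_tendsto[OF bf(1) seq(4) sT(1) T(2)])
  ultimately have eq: "(LINT y|lebesgue_on U. aform A y (?F y) (H y)) = (LINT y|lebesgue_on U. f y \<bullet> (\<xi> y *\<^sub>R u y))"
    using LIMSEQ_unique by simp
  have "(LINT y|lebesgue_on U. f y \<bullet> (\<xi> y *\<^sub>R u y)) = (LINT y|lebesgue_on U. (indicator ?B y *\<^sub>R f y) \<bullet> (\<xi> y *\<^sub>R u y))"
  proof (intro Bochner_Integration.integral_cong refl)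
    fix y
    have "\<xi> y = 0" if "y \<notin> ?B" using that \<rho> by (intro \<xi>0) auto
    then show "f y \<bullet> (\<xi> y *\<^sub>R u y) = (indicator ?B y *\<^sub>R f y) \<bullet> (\<xi> y *\<^sub>R u y)" by (cases "y \<in> ?B") auto
  qed
  also have "\<dots> \<le> l2 (lebesgue_on U) (\<lambda>y. indicator ?B y *\<^sub>R f y) * l2 (lebesgue_on U) (\<lambda>y. \<xi> y *\<^sub>R u y)"
    using inner_integrable(2)[OF bf(2) seq(4)] by (rule order_trans[OF abs_ge_self])
  also have "\<dots> \<le> (Fb * ball_const TYPE('n) \<rho>) * l2 (lebesgue_on U) u"
  proof (rule mult_mono[OF bf(3)])
    have xm: "\<xi> \<in> borel_measurable (lebesgue_on U)"
      by (rule continuous_on_open_measurable[OF U(1) continuous_on_subset[OF smooth_on_continuous[OF \<xi>s] subset_UNIV]])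
    show "l2 (lebesgue_on U) (\<lambda>y. \<xi> y *\<^sub>R u y) \<le> l2 (lebesgue_on U) u"
      using sqint_mult(2)[OF seq(1) xm, of 1] \<xi>1 by simp
    show "0 \<le> Fb * ball_const TYPE('n) \<rho>" using Fb(2) by (simp add: ball_const_def)
  qed (rule l2_nonneg)
  finally have le: "(LINT y|lebesgue_on U. aform A y (?F y) (H y)) \<le> Fb * ball_const TYPE('n) \<rho> * l2 (lebesgue_on U) u"
    unfolding eq .
  have \<eta>m: "?\<eta> \<in> borel_measurable (lebesgue_on U)"
    by (rule continuous_on_open_measurable[OF U(1) continuous_on_subset[OF smooth_on_continuous[OF smooth_cutoff] subset_UNIV]])
  have qm: "grad ?\<eta> \<in> borel_measurable (lebesgue_on U)"
    by (rule continuous_on_open_measurable[OF U(1) continuous_on_subset[OF grad_continuous_on[OF smooth_cutoff] subset_UNIV]])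
  have \<eta>1: "\<bar>?\<eta> y\<bar> \<le> 1" for y using cutoff_bounds[of p "4 * \<rho>" y] by simp
  have qv: "norm (u y) * norm (grad ?\<eta> y) \<le> ?c * norm (u y)" for y
    using mult_left_mono[OF gb, of "norm (u y)"] by (simp add: mult.commute)
  have G: "H y = (?\<eta> y)\<^sup>2 *\<^sub>R ?F y + (2 * ?\<eta> y) *\<^sub>R outer (u y) (grad ?\<eta> y)" for y
    unfolding H_def \<xi>g by (simp add: \<xi>_def power2_eq_square outer_scale)
  show ?thesis
    unfolding \<mu> U_def[symmetric]
    by (rule caccioppoli(1)[OF A seq(2) seq(1) \<eta>m \<eta>1 qm seq(1) c0 qv G le])
qed

section \<open>The local bound in duality form\<close>

lemma Cc_inf_vec_localize:
  fixes \<phi> :: "real^'n \<Rightarrow> real^'m"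
  assumes \<phi>: "\<phi> \<in> Cc_inf_vec \<Omega>" and \<zeta>: "smooth_on UNIV \<zeta>" "\<And>y. y \<notin> cball p s \<Longrightarrow> \<zeta> y = 0" and ball: "cball p s \<subseteq> B"
  shows "(\<lambda>y. \<zeta> y *\<^sub>R \<phi> y) \<in> Cc_inf_vec (\<Omega> \<inter> B)"
proof -
  have "(\<lambda>y. \<zeta> y * \<phi> y $ i) \<in> Cc_inf (\<Omega> \<inter> B)" for i
  proof -
    have c: "(\<lambda>y. \<phi> y $ i) \<in> Cc_inf \<Omega>" by (rule Cc_inf_vec_component[OF \<phi>])
    obtain K where K: "compact K" "K \<subseteq> \<Omega>" "\<And>y. y \<notin> K \<Longrightarrow> \<phi> y $ i = 0" by (rule Cc_infE[OF c]) blast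
    show ?thesis
    proof (rule Cc_infI)
      show "smooth_on UNIV (\<lambda>y. \<zeta> y * \<phi> y $ i)" by (rule smooth_mult_UNIV[OF \<zeta>(1) Cc_inf_smooth[OF c]])
      show "compact (K \<inter> cball p s)" by (rule compact_Int_closed[OF K(1) closed_cball])
      show "K \<inter> cball p s \<subseteq> \<Omega> \<inter> B" using K(2) ball by blast
      show "\<zeta> y * \<phi> y $ i = 0" if "y \<notin> K \<inter> cball p s" for y
        using that K(3)[of y] \<zeta>(2)[of y] by (cases "y \<in> K") auto
    qed
  qed
  then show ?thesis by (simp add: Cc_inf_vec_def)
qed

text \<open>The identity behind the theorem, with \<open>\<zeta> = cutoff p (2 * \<rho>)\<close> equal to one on the support of \<open>g\<close>:
  \<open>\<integral>g \<bullet> u\<close> equals, up to the residual of \<open>\<phi>\<close>, the form evaluated at \<open>\<phi>\<close> and \<open>\<zeta> u\<close>; this differs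
  from the form at \<open>\<zeta> \<phi>\<close> and \<open>u\<close>, known from the equation of \<open>u\<close>, by two terms with \<open>\<nabla>\<zeta>\<close>. The
  numbers \<open>Q\<close> and \<open>E0\<close> depend on \<open>u\<close> and \<open>g\<close> but not on \<open>\<epsilon>\<close>, so that they drop out as \<open>\<epsilon> \<rightarrow> 0\<close>.\<close>

lemma duality_estimate_eps:
  fixes A :: "('n::finite, 'm::finite) coeff" and u f g :: "real^'n \<Rightarrow> real^'m"
  assumes n: "CARD('n) \<ge> 3" and Kc: "riesz_ball_bound TYPE('n) Kc" and Cg: "cutoff_grad_bound TYPE('n) Cg"
    and \<Omega>: "open \<Omega>" and \<rho>: "\<rho> > 0" and ball: "ball p (10 * \<rho>) \<subseteq> ball x R" and A: "bounded_coercive \<nu> M A" "\<nu> > 0" and K: "K \<ge> 0"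
    and van: "vanishes_on_vec (\<Omega> \<inter> ball x R) (frontier \<Omega> \<inter> ball x R) u"
    and sol: "weak_solution (adj_coeff A) (\<Omega> \<inter> ball x R) u f"
    and f: "f \<in> borel_measurable (lebesgue_on (\<Omega> \<inter> ball x R))"
    and Fb: "AE y in lebesgue_on (\<Omega> \<inter> ball x R). norm (f y) \<le> Fb" "Fb \<ge> 0"
    and appr: "approx_solvable A \<Omega> p (10 * \<rho>) K" and g: "bounded_supported (\<Omega> \<inter> ball p (\<rho> / 2)) g"
  defines "\<mu> \<equiv> lebesgue_on (\<Omega> \<inter> ball x R)"
    and "N \<equiv> LINT x|lebesgue. norm (g x)"
    and "c2 \<equiv> Cg / (2 * \<rho>)"
  defines "a1 \<equiv> K * (\<rho> / 2) powr (2 - real CARD('n)) * ball_const TYPE('n) \<rho> * N"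
    and "Z \<equiv> l2 \<mu> (\<lambda>y. cutoff p (4 * \<rho>) y *\<^sub>R wjac (\<Omega> \<inter> ball x R) u y)"
  shows "\<exists>Q E0. \<forall>\<epsilon>. 0 < \<epsilon> \<and> \<epsilon> \<le> 1 \<longrightarrow>
    \<bar>LINT y|\<mu>. g y \<bullet> u y\<bar> \<le> Fb * (K * (Kc * (20 * \<rho>)\<^sup>2 * N) + \<epsilon> * ball_const TYPE('n) \<rho>)
      + M * c2 * (a1 + \<epsilon>) * Z
      + M * c2 * sqrt (2 / \<nu> * (2 * M\<^sup>2 / \<nu> * ((2 * Cg / \<rho>)\<^sup>2 * (a1 + \<epsilon>)\<^sup>2) + \<epsilon> * (E0 + 2 * (2 * Cg / \<rho>) * (a1 + \<epsilon>)))) * l2 \<mu> u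
      + \<epsilon> * Q"
proof -
  define U where "U = \<Omega> \<inter> ball x R"
  have \<mu>: "\<mu> = lebesgue_on U" by (simp add: \<mu>_def U_def)
  have U: "open U" "bounded U" unfolding U_def using \<Omega> by (auto intro: bounded_subset[OF bounded_ball])
  have Ul: "U \<in> lmeasurable" "U \<in> sets lebesgue" using U by (auto simp: bounded_set_imp_lmeasurable)
  have UO: "U \<subseteq> \<Omega>" by (simp add: U_def)
  have M: "M > 0" using bounded_coercive_constants[OF A(1)] A(2) by simp
  let ?B = "ball p (10 * \<rho>)" and ?F = "wjac U u" and ?h = "\<lambda>\<phi> y. indicator (annulus p \<rho>) y *\<^sub>R (\<phi> y :: real^'m)"
  let ?\<zeta> = "cutoff p (2 * \<rho>)" and ?\<eta> = "cutoff p (4 * \<rho>)" and ?r = "ring_cutoff p \<rho>"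
  have r2: "2 * \<rho> > 0" and r4: "4 * \<rho> > 0" using \<rho> by simp_all
  have c2: "c2 \<ge> 0" using Cg \<rho> by (simp add: c2_def cutoff_grad_bound_def)
  have gb: "norm (grad ?\<zeta> y) \<le> c2" for y using Cg r2 unfolding cutoff_grad_bound_def c2_def by blast
  have \<zeta>0: "?\<zeta> y = 0" if "y \<notin> cball p (4 * \<rho>)" for y
    using cutoff_zero[OF r2, of y p] that by (simp add: dist_commute)
  have \<zeta>1: "\<bar>?\<zeta> y\<bar> \<le> 1" for y using cutoff_bounds[of p "2 * \<rho>" y] by simp
  have cb: "cball p (4 * \<rho>) \<subseteq> ball x R"
  proof -
    have "cball p (4 * \<rho>) \<subseteq> ?B" using \<rho> by auto
    then show ?thesis using ball by blast
  qed
  \<comment> \<open>The gradient of the cutoff function lives where the other cutoff functions are one.\<close>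
  have grad_supp: "\<rho> \<le> dist y p \<and> dist y p < 10 * \<rho> \<and> ?\<eta> y = 1 \<and> ?r y = 1" if "grad ?\<zeta> y \<noteq> 0" for y
  proof -
    have "\<not> (dist y p < 2 * \<rho> \<or> dist y p > 2 * (2 * \<rho>))" using cutoff_grad_zero[OF r2, of y p] that by blast
    then have d: "2 * \<rho> \<le> dist y p" "dist y p \<le> 4 * \<rho>" by linarith+
    then show ?thesis using \<rho> cutoff_one[OF r4 d(2)] cutoff_zero[OF \<rho> d(1)] by (simp add: ring_cutoff_def)
  qed
  note seq = cutoff_test_sequence[OF n \<Omega> cb van smooth_cutoff \<zeta>0 \<zeta>1 gb, folded U_def]
  define H where "H y = ?\<zeta> y *\<^sub>R ?F y + outer (u y) (grad ?\<zeta> y)" for y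
  obtain T where T: "\<forall>k. T k \<in> Cc_inf_vec U" "(\<lambda>k. l2 \<mu> (\<lambda>y. T k y - ?\<zeta> y *\<^sub>R u y)) \<longlonglongrightarrow> 0"
      "(\<lambda>k. l2 \<mu> (\<lambda>y. cjac (T k) y - H y)) \<longlonglongrightarrow> 0"
    using seq(5) unfolding H_def \<mu> by blast
  have su: "sqint \<mu> u" "sqint \<mu> ?F" "sqint \<mu> H" "sqint \<mu> (\<lambda>y. ?\<zeta> y *\<^sub>R u y)"
    using seq(1-4) unfolding H_def[abs_def] \<mu> by blast+
  have sT: "sqint \<mu> (T k)" "sqint \<mu> (cjac (T k))" for k
    using Cc_inf_vec_sqint[OF U(1), of "T k"] T(1) unfolding \<mu> by blast+
  have TO: "T k \<in> Cc_inf_vec \<Omega>" for k by (rule Cc_inf_vec_mono[OF UO]) (use T(1) in blast)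
  have \<zeta>m: "?\<zeta> \<in> borel_measurable \<mu>" unfolding \<mu>
    by (rule continuous_on_open_measurable[OF U(1) continuous_on_subset[OF smooth_on_continuous[OF smooth_cutoff] subset_UNIV]])
  have qm: "grad ?\<zeta> \<in> borel_measurable \<mu>" unfolding \<mu>
    by (rule continuous_on_open_measurable[OF U(1) continuous_on_subset[OF grad_continuous_on[OF smooth_cutoff] subset_UNIV]])
  have \<eta>m: "?\<eta> \<in> borel_measurable \<mu>" unfolding \<mu>
    by (rule continuous_on_open_measurable[OF U(1) continuous_on_subset[OF smooth_on_continuous[OF smooth_cutoff] subset_UNIV]])
  have rm: "?r \<in> borel_measurable \<mu>" unfolding \<mu>
    by (rule continuous_on_open_measurable[OF U(1) continuous_on_subset[OF smooth_on_continuous[OF smooth_ring_cutoff] subset_UNIV]])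
  have gm: "g \<in> borel_measurable lebesgue" by (rule bounded_supported_measurable[OF g])
  have gB: "bounded_supported (ball p (\<rho> / 2)) g" by (rule bounded_supported_mono[OF g]) simp
  have sg: "sqint lebesgue g" by (rule bounded_supported_integrable(2)[OF gB order_refl])
  have on_U: "sqint \<mu> F" "l2 \<mu> F \<le> l2 lebesgue F" if "sqint lebesgue F" for F :: "real^'n \<Rightarrow> 'z::euclidean_space"
    using sqint_on_subset[OF Ul(2) _ subset_UNIV, of F] that unfolding \<mu> lebesgue_on_UNIV_eq by simp_all
  have sgU: "sqint \<mu> g" by (rule on_U(1)[OF sg])
  have g\<zeta>: "g y \<bullet> (?\<zeta> y *\<^sub>R u y) = g y \<bullet> u y" for y
  proof (cases "g y = 0")
    case False
    then have "y \<in> ball p (\<rho> / 2)" using g unfolding bounded_supported_def by blast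
    then have "dist y p \<le> 2 * \<rho>" using \<rho> by (simp add: dist_commute)
    then show ?thesis using cutoff_one[OF r2, of y p] by simp
  qed simp
  have A': "bounded_coercive \<nu> M (adj_coeff A)" by (rule bounded_coercive_adj[OF A(1)])
  note bf = bounded_source_sqint[OF Ul(1) f[folded U_def] Fb(1)[folded U_def] Fb(2), folded \<mu>]
  define I where "I = (LINT y|\<mu>. g y \<bullet> u y)"
  define Q where "Q = l2 \<mu> H"
  define E0 where "E0 = 1 + (K * riesz_pairing g g + l2 lebesgue g + 1) / \<nu>"
  have main: "\<bar>I\<bar> \<le> Fb * (K * (Kc * (20 * \<rho>)\<^sup>2 * N) + \<epsilon> * ball_const TYPE('n) \<rho>)
      + M * c2 * (a1 + \<epsilon>) * Z
      + M * c2 * sqrt (2 / \<nu> * (2 * M\<^sup>2 / \<nu> * ((2 * Cg / \<rho>)\<^sup>2 * (a1 + \<epsilon>)\<^sup>2) + \<epsilon> * (E0 + 2 * (2 * Cg / \<rho>) * (a1 + \<epsilon>)))) * l2 \<mu> u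
      + \<epsilon> * Q" if \<epsilon>: "0 < \<epsilon>" "\<epsilon> \<le> 1" for \<epsilon>
  proof -
    obtain \<phi> where \<phi>: "\<phi> \<in> Cc_inf_vec \<Omega>"
        "\<forall>\<psi>\<in>Cc_inf_vec \<Omega>. \<bar>bform A UNIV \<phi> \<psi> - (LINT x|lebesgue. g x \<bullet> \<psi> x)\<bar> \<le> \<epsilon> * l2 lebesgue (cjac \<psi>)"
        "l2 lebesgue (?h \<phi>) \<le> a1 + \<epsilon>"
        "(LINT x|lebesgue. indicator ?B x * norm (\<phi> x)) \<le> K * (Kc * (20 * \<rho>)\<^sup>2 * N) + \<epsilon> * ball_const TYPE('n) \<rho>"
        "\<nu> / 2 * (l2 lebesgue (\<lambda>x. ?r x *\<^sub>R cjac \<phi> x))\<^sup>2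
          \<le> 2 * M\<^sup>2 / \<nu> * ((2 * Cg / \<rho>)\<^sup>2 * (a1 + \<epsilon>)\<^sup>2) + \<epsilon> * (E0 + 2 * (2 * Cg / \<rho>) * (a1 + \<epsilon>))"
      using approx_solution_estimates[OF n Kc Cg A K \<rho> \<epsilon> appr g, folded N_def a1_def E0_def, folded a1_def] by blast
    let ?J = "LINT y|\<mu>. aform A y (cjac \<phi> y) (H y)"
    have s\<phi>: "sqint lebesgue \<phi>" "sqint lebesgue (cjac \<phi>)" by (rule Cc_inf_vec_sqint_UNIV[OF \<phi>(1)])+
    have sD: "sqint \<mu> (cjac \<phi>)" by (rule on_U(1)[OF s\<phi>(2)])
    \<comment> \<open>Pass to the limit in the equation for \<open>\<phi>\<close>, tested with the approximations of \<open>\<zeta> u\<close>.\<close>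
    have "\<bar>?J - I\<bar> \<le> \<epsilon> * Q"
    proof (rule tendsto_le[OF sequentially_bot])
      have "(\<lambda>k. LINT y|\<mu>. aform A y (cjac \<phi> y) (cjac (T k) y)) \<longlonglongrightarrow> ?J"
        using aform_tendsto[OF A, of U "cjac \<phi>" H "\<lambda>k. cjac (T k)"] sD su(3) sT(2) T(3) unfolding \<mu> by blast
      moreover have "(\<lambda>k. LINT y|\<mu>. g y \<bullet> T k y) \<longlonglongrightarrow> (LINT y|\<mu>. g y \<bullet> (?\<zeta> y *\<^sub>R u y))"
        by (rule inner_tendsto[OF sgU su(4) sT(1) T(2)])
      ultimately show "(\<lambda>k. \<bar>(LINT y|\<mu>. aform A y (cjac \<phi> y) (cjac (T k) y)) - (LINT y|\<mu>. g y \<bullet> T k y)\<bar>) \<longlonglongrightarrow> \<bar>?J - I\<bar>"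
        unfolding I_def g\<zeta> by (intro tendsto_intros)
      have "(\<lambda>k. l2 \<mu> (cjac (T k))) \<longlonglongrightarrow> Q" unfolding Q_def
        by (rule tendsto_if_abs_diff_le[OF l2_diff_abs_le[OF sT(2) su(3)] T(3)])
      then show "(\<lambda>k. \<epsilon> * l2 \<mu> (cjac (T k))) \<longlonglongrightarrow> \<epsilon> * Q" by (rule tendsto_mult_left)
      show "eventually (\<lambda>k. \<bar>(LINT y|\<mu>. aform A y (cjac \<phi> y) (cjac (T k) y)) - (LINT y|\<mu>. g y \<bullet> T k y)\<bar> \<le> \<epsilon> * l2 \<mu> (cjac (T k))) sequentially"
      proof (rule always_eventually, rule allI)
        fix k
        have TU: "T k \<in> Cc_inf_vec U" using T(1) by blast
        have 1: "bform A UNIV \<phi> (T k) = (LINT y|\<mu>. aform A y (cjac \<phi> y) (cjac (T k) y))"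
          unfolding bform_UNIV[OF A(1) U(1) TU] unfolding bform_def \<mu> ..
        have 2: "(LINT y|lebesgue. g y \<bullet> T k y) = (LINT y|\<mu>. g y \<bullet> T k y)"
          unfolding \<mu> by (rule lebesgue_shrink(1)[OF Ul(2)]) (simp add: Cc_inf_vec_support(1)[OF TU])
        have 3: "l2 lebesgue (cjac (T k)) = l2 \<mu> (cjac (T k))"
          unfolding \<mu> by (rule l2_shrink[OF Ul(2)]) (rule Cc_inf_vec_support(2)[OF TU])
        show "\<bar>(LINT y|\<mu>. aform A y (cjac \<phi> y) (cjac (T k) y)) - (LINT y|\<mu>. g y \<bullet> T k y)\<bar> \<le> \<epsilon> * l2 \<mu> (cjac (T k))"
          using bspec[OF \<phi>(2) TO[of k]] unfolding 1 2 3 .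
      qed
    qed
    then have IJ: "\<bar>I\<bar> \<le> \<bar>?J\<bar> + \<epsilon> * Q" by linarith
    \<comment> \<open>Moving the cutoff function from one factor to the other leaves the equation for \<open>u\<close> tested with
      \<open>\<zeta> \<phi>\<close> and two commutator terms.\<close>
    define w where "w y = ?\<zeta> y *\<^sub>R \<phi> y" for y
    have wU: "w \<in> Cc_inf_vec U" unfolding w_def[abs_def] U_def by (rule Cc_inf_vec_localize[OF \<phi>(1) smooth_cutoff \<zeta>0 cb])
    have Dw: "cjac w y = ?\<zeta> y *\<^sub>R cjac \<phi> y + outer (\<phi> y) (grad ?\<zeta> y)" for y
      unfolding w_def[abs_def] by (rule cjac_mult[OF cutoff_differentiable Cc_inf_vec_differentiable[OF \<phi>(1)]])
    have sw: "sqint \<mu> w" "sqint \<mu> (cjac w)" using Cc_inf_vec_sqint[OF U(1) wU] unfolding \<mu> by blast+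
    have so: "sqint \<mu> (\<lambda>y. outer (\<phi> y) (grad ?\<zeta> y))"
      by (rule outer_sqint(1)[OF on_U(1)[OF s\<phi>(1)] qm gb c2])
    have so': "sqint \<mu> (\<lambda>y. outer (u y) (grad ?\<zeta> y))"
      by (rule outer_sqint(1)[OF su(1) qm gb c2])
    note ai = aform_integrable(1)[OF A, of U, folded \<mu>]
    have pw: "aform A y (cjac \<phi> y) (H y) = aform A y (cjac w y) (?F y) - aform A y (outer (\<phi> y) (grad ?\<zeta> y)) (?F y)
        + aform A y (cjac \<phi> y) (outer (u y) (grad ?\<zeta> y))" for y
    proof -
      interpret bounded_bilinear "aform A y" by (rule aform_bilinear[OF A(1)])
      show ?thesis unfolding H_def Dw by (simp add: add_right add_left scaleR_left scaleR_right)
    qed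
    have J: "?J = (LINT y|\<mu>. aform A y (cjac w y) (?F y)) - (LINT y|\<mu>. aform A y (outer (\<phi> y) (grad ?\<zeta> y)) (?F y))
        + (LINT y|\<mu>. aform A y (cjac \<phi> y) (outer (u y) (grad ?\<zeta> y)))"
      unfolding pw using ai[OF sw(2) su(2)] ai[OF so su(2)] ai[OF sD so'] by simp
    have "(LINT y|\<mu>. aform A y (cjac w y) (?F y)) = (LINT y|\<mu>. f y \<bullet> w y)"
      using sol wU unfolding weak_solution_def sys_form_aform U_def[symmetric] \<mu> aform_adj by blast
    moreover have "\<bar>LINT y|\<mu>. f y \<bullet> w y\<bar> \<le> Fb * (LINT x|lebesgue. indicator ?B x * norm (\<phi> x))"
    proof -
      have iB: "integrable lebesgue (\<lambda>x. indicator ?B x * norm (\<phi> x))"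
      proof -
        obtain b where b: "\<And>x. norm (\<phi> x) \<le> b" using Cc_inf_vec_bounded[OF \<phi>(1)] by blast
        have m: "(\<lambda>x. indicator ?B x *\<^sub>R \<phi> x) \<in> borel_measurable lebesgue"
          using s\<phi>(1) by (intro borel_measurable_scaleR borel_measurable_indicator) (auto simp: sqint_def)
        have "norm (indicator ?B x *\<^sub>R \<phi> x) \<le> b" for x
          using b[of x] order_trans[OF norm_ge_zero b[of x]] by (simp add: indicator_def)
        then have "bounded_supported ?B (\<lambda>x. indicator ?B x *\<^sub>R \<phi> x)"
          unfolding bounded_supported_def using m by (intro conjI exI[of _ b]) simp_all
        from bounded_supported_integrable(1)[OF this order_refl] show ?thesis by simp
      qed
      have iBU: "integrable \<mu> (\<lambda>x. indicator ?B x * norm (\<phi> x))" unfolding \<mu>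
        by (rule integrable_lebesgue_imp_on[OF Ul(2) iB])
      have "\<bar>LINT y|\<mu>. f y \<bullet> w y\<bar> \<le> (LINT y|\<mu>. \<bar>f y \<bullet> w y\<bar>)" by (rule integral_abs_bound)
      also have "\<dots> \<le> (LINT y|\<mu>. Fb * (indicator ?B y * norm (\<phi> y)))"
      proof (rule integral_mono_AE)
        show "integrable \<mu> (\<lambda>y. \<bar>f y \<bullet> w y\<bar>)" using inner_integrable(1)[OF bf(1) sw(1)] by (rule integrable_abs)
        show "integrable \<mu> (\<lambda>y. Fb * (indicator ?B y * norm (\<phi> y)))" using iBU by simp
        have "\<bar>f y \<bullet> w y\<bar> \<le> Fb * (indicator ?B y * norm (\<phi> y))" if "norm (f y) \<le> Fb" for y
        proof (cases "y \<in> ?B")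
          case True
          have "\<bar>f y \<bullet> w y\<bar> \<le> norm (f y) * norm (w y)" by (rule Cauchy_Schwarz_ineq2)
          also have "norm (w y) \<le> 1 * norm (\<phi> y)" unfolding w_def norm_scaleR using \<zeta>1 by (intro mult_right_mono) auto
          finally have "\<bar>f y \<bullet> w y\<bar> \<le> norm (f y) * norm (\<phi> y)" by (simp add: mult_left_mono)
          also have "\<dots> \<le> Fb * norm (\<phi> y)" using that by (intro mult_right_mono) auto
          finally show ?thesis using True by simp
        next
          case False
          then have "?\<zeta> y = 0" using \<rho> by (intro \<zeta>0) auto
          then show ?thesis using Fb(2) by (simp add: w_def)
        qed
        then show "AE y in \<mu>. \<bar>f y \<bullet> w y\<bar> \<le> Fb * (indicator ?B y * norm (\<phi> y))"
          using Fb(1) unfolding \<mu>_def[symmetric] by (rule AE_mp[rotated, OF AE_I2[OF impI]])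
      qed
      also have "\<dots> = Fb * (LINT y|\<mu>. indicator ?B y * norm (\<phi> y))" by simp
      also have "\<dots> \<le> Fb * (LINT x|lebesgue. indicator ?B x * norm (\<phi> x))"
        using integral_on_subset_le[OF Ul(2) _ subset_UNIV, of "\<lambda>x. indicator ?B x * norm (\<phi> x)"] iB Fb(2)
        unfolding \<mu> lebesgue_on_UNIV_eq by (intro mult_left_mono) auto
      finally show ?thesis .
    qed
    ultimately have J1: "\<bar>LINT y|\<mu>. aform A y (cjac w y) (?F y)\<bar> \<le> Fb * (K * (Kc * (20 * \<rho>)\<^sup>2 * N) + \<epsilon> * ball_const TYPE('n) \<rho>)"
      using mult_left_mono[OF \<phi>(4) Fb(2)] by linarith
    have Mc: "M * c2 \<ge> 0" using M c2 by simp
    have J2: "\<bar>LINT y|\<mu>. aform A y (outer (\<phi> y) (grad ?\<zeta> y)) (?F y)\<bar> \<le> M * c2 * (a1 + \<epsilon>) * Z"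
    proof -
      have sh: "sqint lebesgue (?h \<phi>)" by (rule indicator_sqint(1)[OF s\<phi>(1)]) (simp add: annulus_sets)
      have sF: "sqint \<mu> (\<lambda>y. ?\<eta> y *\<^sub>R ?F y)"
        by (rule sqint_mult(1)[OF su(2) \<eta>m, of 1]) (use cutoff_bounds[of p "4 * \<rho>"] in auto)
      have m: "(\<lambda>y. aform A y (outer (\<phi> y) (grad ?\<zeta> y)) (?F y)) \<in> borel_measurable \<mu>"
        using ai[OF so su(2)] by simp
      have le: "\<bar>aform A y (outer (\<phi> y) (grad ?\<zeta> y)) (?F y)\<bar> \<le> M * c2 * (norm (?h \<phi> y) * norm (?\<eta> y *\<^sub>R ?F y))" for y
      proof (cases "grad ?\<zeta> y = 0")
        case True
        then have "outer (\<phi> y) (grad ?\<zeta> y) = 0" by (simp add: outer_def vec_eq_iff)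
        then show ?thesis using Mc by (simp add: bounded_bilinear.zero_left[OF aform_bilinear[OF A(1)]])
      next
        case False
        then have eq: "?h \<phi> y = \<phi> y" "?\<eta> y = 1" using grad_supp by (auto simp: annulus_def)
        have "\<bar>aform A y (outer (\<phi> y) (grad ?\<zeta> y)) (?F y)\<bar> \<le> M * (norm (\<phi> y) * norm (grad ?\<zeta> y) * norm (?F y))"
          using bounded_coercive_bound[OF A(1)] by (metis norm_outer)
        also have "\<dots> \<le> M * (norm (\<phi> y) * c2 * norm (?F y))"
          using M gb by (intro mult_left_mono mult_right_mono) auto
        finally show ?thesis unfolding eq by (simp add: mult_ac)
      qed
      have "\<bar>LINT y|\<mu>. aform A y (outer (\<phi> y) (grad ?\<zeta> y)) (?F y)\<bar> \<le> M * c2 * (l2 \<mu> (?h \<phi>) * l2 \<mu> (\<lambda>y. ?\<eta> y *\<^sub>R ?F y))"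
        by (rule bilinear_integrable(2)[OF on_U(1)[OF sh] sF m AE_I2[OF le] Mc])
      also have "\<dots> \<le> M * c2 * ((a1 + \<epsilon>) * Z)"
        using order_trans[OF on_U(2)[OF sh] \<phi>(3)] Mc unfolding Z_def U_def[symmetric]
        by (intro mult_left_mono mult_right_mono l2_nonneg)
      finally show ?thesis by (simp add: mult_ac)
    qed
    let ?R = "2 / \<nu> * (2 * M\<^sup>2 / \<nu> * ((2 * Cg / \<rho>)\<^sup>2 * (a1 + \<epsilon>)\<^sup>2) + \<epsilon> * (E0 + 2 * (2 * Cg / \<rho>) * (a1 + \<epsilon>)))"
    have J3: "\<bar>LINT y|\<mu>. aform A y (cjac \<phi> y) (outer (u y) (grad ?\<zeta> y))\<bar> \<le> M * c2 * sqrt ?R * l2 \<mu> u"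
    proof -
      have sr: "sqint lebesgue (\<lambda>y. ?r y *\<^sub>R cjac \<phi> y)"
      proof (rule sqint_mult(1)[OF s\<phi>(2), of _ 1])
        show "?r \<in> borel_measurable lebesgue"
          using continuous_on_open_measurable[OF open_UNIV smooth_on_continuous[OF smooth_ring_cutoff[of p \<rho>]]] by (simp add: lebesgue_on_UNIV_eq)
      qed (use ring_cutoff_bounds[of p \<rho>] in auto)
      have m: "(\<lambda>y. aform A y (cjac \<phi> y) (outer (u y) (grad ?\<zeta> y))) \<in> borel_measurable \<mu>"
        using ai[OF sD so'] by simp
      have le: "\<bar>aform A y (cjac \<phi> y) (outer (u y) (grad ?\<zeta> y))\<bar> \<le> M * c2 * (norm (?r y *\<^sub>R cjac \<phi> y) * norm (u y))" for y
      proof (cases "grad ?\<zeta> y = 0")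
        case True
        then have "outer (u y) (grad ?\<zeta> y) = 0" by (simp add: outer_def vec_eq_iff)
        then show ?thesis using Mc by (simp add: bounded_bilinear.zero_right[OF aform_bilinear[OF A(1)]])
      next
        case False
        then have eq: "?r y = 1" using grad_supp by blast
        have "\<bar>aform A y (cjac \<phi> y) (outer (u y) (grad ?\<zeta> y))\<bar> \<le> M * (norm (cjac \<phi> y) * (norm (u y) * norm (grad ?\<zeta> y)))"
          using bounded_coercive_bound[OF A(1)] by (metis norm_outer)
        also have "\<dots> \<le> M * (norm (cjac \<phi> y) * (norm (u y) * c2))"
          using M gb by (intro mult_left_mono) auto
        finally show ?thesis unfolding eq by (simp add: mult_ac)
      qed
      have V: "l2 lebesgue (\<lambda>y. ?r y *\<^sub>R cjac \<phi> y) \<le> sqrt ?R"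
      proof (rule real_le_rsqrt)
        have "2 / \<nu> * (\<nu> / 2 * (l2 lebesgue (\<lambda>x. ?r x *\<^sub>R cjac \<phi> x))\<^sup>2) \<le> ?R"
          using A(2) by (intro mult_left_mono[OF \<phi>(5)]) simp
        then show "(l2 lebesgue (\<lambda>y. ?r y *\<^sub>R cjac \<phi> y))\<^sup>2 \<le> ?R" using A(2) by simp
      qed
      have "\<bar>LINT y|\<mu>. aform A y (cjac \<phi> y) (outer (u y) (grad ?\<zeta> y))\<bar> \<le> M * c2 * (l2 \<mu> (\<lambda>y. ?r y *\<^sub>R cjac \<phi> y) * l2 \<mu> u)"
        by (rule bilinear_integrable(2)[OF on_U(1)[OF sr] su(1) m AE_I2[OF le] Mc])
      also have "\<dots> \<le> M * c2 * (sqrt ?R * l2 \<mu> u)"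
        using order_trans[OF on_U(2)[OF sr] V] Mc by (intro mult_left_mono mult_right_mono l2_nonneg)
      finally show ?thesis by (simp add: mult_ac)
    qed
    show ?thesis using IJ J J1 J2 J3 by linarith
  qed
  then show ?thesis unfolding I_def by blast
qed

text \<open>The limit \<open>\<epsilon> \<rightarrow> 0\<close>; the square root becomes explicit.\<close>

lemma duality_estimate:
  fixes A :: "('n::finite, 'm::finite) coeff" and u f g :: "real^'n \<Rightarrow> real^'m"
  assumes n: "CARD('n) \<ge> 3" and Kc: "riesz_ball_bound TYPE('n) Kc" and Cg: "cutoff_grad_bound TYPE('n) Cg"
    and \<Omega>: "open \<Omega>" and \<rho>: "\<rho> > 0" and ball: "ball p (10 * \<rho>) \<subseteq> ball x R" and A: "bounded_coercive \<nu> M A" "\<nu> > 0" and K: "K \<ge> 0"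
    and van: "vanishes_on_vec (\<Omega> \<inter> ball x R) (frontier \<Omega> \<inter> ball x R) u"
    and sol: "weak_solution (adj_coeff A) (\<Omega> \<inter> ball x R) u f"
    and f: "f \<in> borel_measurable (lebesgue_on (\<Omega> \<inter> ball x R))"
    and Fb: "AE y in lebesgue_on (\<Omega> \<inter> ball x R). norm (f y) \<le> Fb" "Fb \<ge> 0"
    and appr: "approx_solvable A \<Omega> p (10 * \<rho>) K" and g: "bounded_supported (\<Omega> \<inter> ball p (\<rho> / 2)) g"
  defines "\<mu> \<equiv> lebesgue_on (\<Omega> \<inter> ball x R)"
    and "N \<equiv> LINT x|lebesgue. norm (g x)"
    and "c2 \<equiv> Cg / (2 * \<rho>)"
  defines "a1 \<equiv> K * (\<rho> / 2) powr (2 - real CARD('n)) * ball_const TYPE('n) \<rho> * N"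
    and "Z \<equiv> l2 \<mu> (\<lambda>y. cutoff p (4 * \<rho>) y *\<^sub>R wjac (\<Omega> \<inter> ball x R) u y)"
  shows "\<bar>LINT y|\<mu>. g y \<bullet> u y\<bar> \<le> Fb * (K * (Kc * (20 * \<rho>)\<^sup>2 * N)) + M * c2 * a1 * Z
      + M * c2 * (2 * M / \<nu> * (2 * Cg / \<rho>) * a1) * l2 \<mu> u"
proof -
  have M: "M > 0" using bounded_coercive_constants[OF A(1)] A(2) by simp
  have a1: "a1 \<ge> 0" unfolding a1_def N_def using K by (simp add: ball_const_def integral_nonneg_AE)
  let ?rhs = "\<lambda>Q E0 \<epsilon>. Fb * (K * (Kc * (20 * \<rho>)\<^sup>2 * N) + \<epsilon> * ball_const TYPE('n) \<rho>)
      + M * c2 * (a1 + \<epsilon>) * Z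
      + M * c2 * sqrt (2 / \<nu> * (2 * M\<^sup>2 / \<nu> * ((2 * Cg / \<rho>)\<^sup>2 * (a1 + \<epsilon>)\<^sup>2) + \<epsilon> * (E0 + 2 * (2 * Cg / \<rho>) * (a1 + \<epsilon>)))) * l2 \<mu> u
      + \<epsilon> * Q"
  have "\<exists>Q E0. \<forall>\<epsilon>. 0 < \<epsilon> \<and> \<epsilon> \<le> 1 \<longrightarrow> \<bar>LINT y|\<mu>. g y \<bullet> u y\<bar> \<le> ?rhs Q E0 \<epsilon>"
    unfolding \<mu>_def N_def c2_def a1_def Z_def
    by (rule duality_estimate_eps[OF n Kc Cg \<Omega> \<rho> ball A K van sol f Fb appr g])
  then obtain Q E0 where Q: "\<And>\<epsilon>. 0 < \<epsilon> \<Longrightarrow> \<epsilon> \<le> 1 \<Longrightarrow> \<bar>LINT y|\<mu>. g y \<bullet> u y\<bar> \<le> ?rhs Q E0 \<epsilon>" by blast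
  define e where "e k = inverse (real (Suc k))" for k
  have e: "e k > 0" "e k \<le> 1" for k by (auto simp: e_def field_simps)
  have e0: "e \<longlonglongrightarrow> 0" unfolding e_def[abs_def] by (rule LIMSEQ_inverse_real_of_nat)
  have "(\<lambda>k. ?rhs Q E0 (e k)) \<longlonglongrightarrow> ?rhs Q E0 0" by (intro tendsto_intros e0)
  then have "\<bar>LINT y|\<mu>. g y \<bullet> u y\<bar> \<le> ?rhs Q E0 0"
    by (rule LIMSEQ_le_const) (use Q[OF e] in blast)
  also have "sqrt (2 / \<nu> * (2 * M\<^sup>2 / \<nu> * ((2 * Cg / \<rho>)\<^sup>2 * (a1 + 0)\<^sup>2) + 0 * (E0 + 2 * (2 * Cg / \<rho>) * (a1 + 0))))
      = 2 * M / \<nu> * (2 * Cg / \<rho>) * a1"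
  proof (rule real_sqrt_unique)
    show "(2 * M / \<nu> * (2 * Cg / \<rho>) * a1)\<^sup>2 = 2 / \<nu> * (2 * M\<^sup>2 / \<nu> * ((2 * Cg / \<rho>)\<^sup>2 * (a1 + 0)\<^sup>2) + 0 * (E0 + 2 * (2 * Cg / \<rho>) * (a1 + 0)))"
      by (simp add: power2_eq_square mult_ac)
    show "0 \<le> 2 * M / \<nu> * (2 * Cg / \<rho>) * a1" using M A(2) Cg \<rho> a1 by (simp add: cutoff_grad_bound_def)
  qed
  finally show ?thesis by simp
qed

section \<open>From duality to the essential supremum\<close>

text \<open>Use \<open>g = sgn u\<close> on the set \<open>E\<close> of points in \<open>S\<close> where \<open>\<bar>u\<bar> > C\<close>: then \<open>\<integral>\<^sub>E (\<bar>u\<bar> - C) \<le> 0\<close>, so \<open>E\<close> is a null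
  set. The inclusion in a ball makes \<open>g\<close> integrable.\<close>

lemma AE_bound_by_duality:
  fixes u :: "real^'n \<Rightarrow> real^'m"
  assumes U: "U \<in> sets lebesgue" and S: "S \<in> sets lebesgue" "S \<subseteq> U" "S \<subseteq> ball p r" and u: "sqint (lebesgue_on U) u" and C: "C \<ge> 0"
    and dual: "\<And>g. bounded_supported S g \<Longrightarrow> \<bar>LINT y|lebesgue_on U. g y \<bullet> u y\<bar> \<le> C * (LINT y|lebesgue. norm (g y))"
  shows "AE y in lebesgue_on U. y \<in> S \<longrightarrow> norm (u y) \<le> C"
proof -
  define v where "v y = (if y \<in> U then u y else 0)" for y
  have um: "u \<in> borel_measurable (lebesgue_on U)" using u by (simp add: sqint_def)
  have v: "v \<in> borel_measurable lebesgue"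
    using borel_measurable_if_lebesgue_on[OF U _ subset_UNIV, of u] um unfolding v_def[abs_def] lebesgue_on_UNIV_eq by simp
  define E where "E = {y\<in>S. norm (u y) > C}"
  have "E = S \<inter> {y \<in> space lebesgue. norm (v y) > C}" using S(2) by (auto simp: E_def v_def)
  also have "\<dots> \<in> sets lebesgue"
  proof (rule sets.Int[OF S(1)])
    have "(\<lambda>y. norm (v y)) \<in> borel_measurable lebesgue" using v by measurable
    then show "{y \<in> space lebesgue. norm (v y) > C} \<in> sets lebesgue" unfolding borel_measurable_iff_greater by blast
  qed
  finally have E: "E \<in> sets lebesgue" .
  have EU: "E \<subseteq> U" "E \<subseteq> S" using S(2) by (auto simp: E_def)
  define g where "g y = indicator E y *\<^sub>R sgn (v y)" for y
  have ng: "norm (g y) = indicator E y" for y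
    using C EU(1) by (auto simp: g_def norm_sgn indicator_def E_def v_def)
  have gS: "bounded_supported S g" unfolding bounded_supported_def
  proof (intro conjI allI impI)
    have "(\<lambda>y. sgn (v y)) \<in> borel_measurable lebesgue" unfolding sgn_div_norm[abs_def] using v by measurable
    then show "g \<in> borel_measurable lebesgue" unfolding g_def[abs_def]
      using E by (intro borel_measurable_scaleR borel_measurable_indicator)
    show "\<exists>B. \<forall>y. norm (g y) \<le> B" unfolding ng by (intro exI[of _ 1]) (simp add: indicator_def)
    show "g y = 0" if "y \<notin> S" for y using that EU(2) by (auto simp: g_def indicator_def)
  qed
  have sg: "sqint (lebesgue_on U) g"
    using sqint_on_subset(1)[OF U _ subset_UNIV, of g] bounded_supported_integrable(2)[OF gS S(3)] by (simp add: lebesgue_on_UNIV_eq)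
  have gu: "g y \<bullet> u y = indicator E y * norm (u y)" for y
  proof -
    have "sgn w \<bullet> w = norm w" for w :: "real^'m"
      by (cases "w = 0") (simp_all add: sgn_div_norm power2_norm_eq_inner[symmetric] power2_eq_square)
    then show ?thesis using EU(1) by (auto simp: g_def v_def indicator_def)
  qed
  have i1: "integrable (lebesgue_on U) (\<lambda>y. indicator E y * norm (u y))"
    using inner_integrable(1)[OF sg u] unfolding gu .
  have iE: "integrable lebesgue (indicator E :: _ \<Rightarrow> real)" using bounded_supported_integrable(1)[OF gS S(3)] unfolding ng .
  have i2: "integrable (lebesgue_on U) (indicator E :: _ \<Rightarrow> real)" by (rule integrable_lebesgue_imp_on[OF U iE])
  have eqE: "(LINT y|lebesgue. indicator E y :: real) = (LINT y|lebesgue_on U. indicator E y)"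
    using EU(1) by (intro lebesgue_shrink(1)[OF U]) (auto simp: indicator_def)
  have "(LINT y|lebesgue_on U. indicator E y * norm (u y)) \<le> C * (LINT y|lebesgue_on U. indicator E y)"
    using dual[OF gS] unfolding gu ng eqE by linarith
  then have le: "(LINT y|lebesgue_on U. indicator E y * norm (u y) - C * indicator E y) \<le> 0" using i1 i2 by simp
  have i3: "integrable (lebesgue_on U) (\<lambda>y. indicator E y * norm (u y) - C * indicator E y)" using i1 i2 by simp
  have nn: "AE y in lebesgue_on U. 0 \<le> indicator E y * norm (u y) - C * indicator E y"
    by (intro AE_I2) (auto simp: indicator_def E_def)
  have "(LINT y|lebesgue_on U. indicator E y * norm (u y) - C * indicator E y) = 0"
    using le integral_nonneg_AE[OF nn] by linarith
  then have "AE y in lebesgue_on U. indicator E y * norm (u y) - C * indicator E y = 0"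
    using integral_nonneg_eq_0_iff_AE[OF i3 nn] by blast
  then show ?thesis by eventually_elim (auto simp: E_def indicator_def split: if_splits)
qed

section \<open>The essential bound in the half ball\<close>

lemma ball_const_scale: "\<rho> > 0 \<Longrightarrow> ball_const TYPE('n::finite) \<rho> = ball_const TYPE('n) 1 * \<rho> powr (real CARD('n) / 2)"
proof -
  assume \<rho>: "\<rho> > 0"
  have "measure lborel (ball (0::real^'n) (10 * \<rho>)) = \<rho> ^ CARD('n) * measure lborel (ball (0::real^'n) 10)"
    using \<rho> content_ball_conv_unit_ball[of "10 * \<rho>" "0::real^'n"] content_ball_conv_unit_ball[of 10 "0::real^'n"]
    by (simp add: power_mult_distrib)
  moreover have "sqrt (\<rho> ^ CARD('n)) = \<rho> powr (real CARD('n) / 2)"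
    using \<rho> by (simp add: powr_half_sqrt[symmetric] powr_realpow[symmetric] powr_powr)
  ultimately show ?thesis by (simp add: ball_const_def real_sqrt_mult mult.commute)
qed

text \<open>The three summands collect the constants of the three terms of \<open>duality_estimate\<close> when \<open>\<rho> = 1\<close>: the
  source term, the term with \<open>Du\<close> and the term with \<open>D\<phi>\<close>.\<close>

definition bound_const :: "'n::finite itself \<Rightarrow> real \<Rightarrow> real \<Rightarrow> real \<Rightarrow> real \<Rightarrow> real \<Rightarrow> real" where
  "bound_const _ Kc Cg \<nu> M K =
     400 * K * Kc + M * Cg / 2 * (K * 2 powr (real CARD('n) - 2) * ball_const TYPE('n) 1) *
       (sqrt (2 / \<nu> * (M\<^sup>2 * Cg\<^sup>2 / (8 * \<nu>) + ball_const TYPE('n) 1)) + 4 * M * Cg / \<nu>)"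

lemma bound_const_nonneg:
  assumes "riesz_ball_bound TYPE('n::finite) Kc" "cutoff_grad_bound TYPE('n) Cg" "\<nu> > 0" "M > 0" "K \<ge> 0"
  shows "bound_const TYPE('n) Kc Cg \<nu> M K \<ge> 0"
  unfolding bound_const_def using assms
  by (intro add_nonneg_nonneg mult_nonneg_nonneg divide_nonneg_pos) (auto simp: riesz_ball_bound_def cutoff_grad_bound_def ball_const_def)

text \<open>Only the powers of \<open>\<rho>\<close> have to be counted. With \<open>\<tau> = \<rho>\<^bsup>n/2\<^esup>\<close>, the kernel \<open>\<rho>\<^bsup>2-n\<^esup>\<close> is \<open>\<rho>\<^sup>2/\<tau>\<^sup>2\<close> and
  \<open>ball_const\<close> is of order \<open>\<tau>\<close>, so the \<open>L\<^sup>2\<close> norm of \<open>\<phi>\<close> on the annulus is of order \<open>\<rho>\<^sup>2/\<tau>\<close>, and \<open>Du\<close> is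
  of order \<open>\<parallel>u\<parallel>\<^sub>2/\<rho> + \<rho> \<tau> Fb\<close>. Each gradient of a cutoff function contributes a factor \<open>1/\<rho>\<close>.\<close>

lemma duality_estimate_scaled:
  fixes A :: "('n::finite, 'm::finite) coeff" and u f g :: "real^'n \<Rightarrow> real^'m"
  assumes n: "CARD('n) \<ge> 3" and Kc: "riesz_ball_bound TYPE('n) Kc" and Cg: "cutoff_grad_bound TYPE('n) Cg"
    and \<Omega>: "open \<Omega>" and \<rho>: "\<rho> > 0" and ball: "ball p (10 * \<rho>) \<subseteq> ball x R" and A: "bounded_coercive \<nu> M A" "\<nu> > 0" and K: "K \<ge> 0"
    and van: "vanishes_on_vec (\<Omega> \<inter> ball x R) (frontier \<Omega> \<inter> ball x R) u"
    and sol: "weak_solution (adj_coeff A) (\<Omega> \<inter> ball x R) u f"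
    and f: "f \<in> borel_measurable (lebesgue_on (\<Omega> \<inter> ball x R))"
    and Fb: "AE y in lebesgue_on (\<Omega> \<inter> ball x R). norm (f y) \<le> Fb" "Fb \<ge> 0"
    and appr: "approx_solvable A \<Omega> p (10 * \<rho>) K" and g: "bounded_supported (\<Omega> \<inter> ball p (\<rho> / 2)) g"
  shows "\<bar>LINT y|lebesgue_on (\<Omega> \<inter> ball x R). g y \<bullet> u y\<bar> \<le>
     bound_const TYPE('n) Kc Cg \<nu> M K *
       (\<rho> powr (- real CARD('n) / 2) * l2 (lebesgue_on (\<Omega> \<inter> ball x R)) u + \<rho>\<^sup>2 * Fb) * (LINT y|lebesgue. norm (g y))"
proof -
  define \<mu> where "\<mu> = lebesgue_on (\<Omega> \<inter> ball x R)"
  define N where "N = (LINT y|lebesgue. norm (g y))"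
  define \<tau> where "\<tau> = \<rho> powr (real CARD('n) / 2)"
  define s where "s = ball_const TYPE('n) 1"
  define k2 where "k2 = 2 powr (real CARD('n) - 2)"
  define L where "L = l2 \<mu> u"
  define Z where "Z = l2 \<mu> (\<lambda>y. cutoff p (4 * \<rho>) y *\<^sub>R wjac (\<Omega> \<inter> ball x R) u y)"
  define CZ where "CZ = 2 / \<nu> * (M\<^sup>2 * Cg\<^sup>2 / (8 * \<nu>) + s)"
  have M: "M > 0" using bounded_coercive_constants[OF A(1)] A(2) by simp
  have Cg0: "Cg > 0" using Cg by (simp add: cutoff_grad_bound_def)
  have \<tau>: "\<tau> > 0" using \<rho> by (simp add: \<tau>_def)
  have s: "s \<ge> 0" by (simp add: s_def ball_const_def)
  have L: "L \<ge> 0" by (simp add: L_def l2_nonneg)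
  have N: "N \<ge> 0" by (simp add: N_def integral_nonneg_AE)
  have bc: "ball_const TYPE('n) \<rho> = s * \<tau>" unfolding s_def \<tau>_def by (rule ball_const_scale[OF \<rho>])
  have pw: "(\<rho> / 2) powr (2 - real CARD('n)) = k2 * (\<rho>\<^sup>2 / \<tau>\<^sup>2)"
  proof -
    have "(\<rho> / 2) powr (2 - real CARD('n)) = \<rho> powr (2 - real CARD('n)) / 2 powr (2 - real CARD('n))"
      using \<rho> by (simp add: powr_divide)
    also have "\<rho> powr (2 - real CARD('n)) = \<rho>\<^sup>2 / \<tau>\<^sup>2"
      using \<rho> by (simp add: powr_diff \<tau>_def power2_eq_square flip: powr_add)
    also have "\<rho>\<^sup>2 / \<tau>\<^sup>2 / 2 powr (2 - real CARD('n)) = k2 * (\<rho>\<^sup>2 / \<tau>\<^sup>2)"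
      using powr_minus_divide[of 2 "2 - real CARD('n)"] by (simp add: k2_def)
    finally show ?thesis .
  qed
  define a1 where "a1 = K * (\<rho> / 2) powr (2 - real CARD('n)) * ball_const TYPE('n) \<rho> * N"
  have a1: "a1 = K * k2 * s * (\<rho>\<^sup>2 / \<tau>) * N" unfolding a1_def pw bc using \<tau> by (simp add: power2_eq_square)
  have a10: "a1 \<ge> 0" unfolding a1 using K s \<tau> N by (simp add: k2_def)
  have CZ: "CZ \<ge> 0" unfolding CZ_def using A(2) s by simp
  have Zle: "Z \<le> sqrt CZ * (L / \<rho> + \<rho> * \<tau> * Fb)"
  proof (rule power2_le_imp_le)
    let ?a = "L / \<rho>" and ?b = "\<rho> * \<tau> * Fb"
    have ab: "?a \<ge> 0" "?b \<ge> 0" using L \<rho> \<tau> Fb by auto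
    have en: "\<nu> / 2 * Z\<^sup>2 \<le> 2 * M\<^sup>2 / \<nu> * ((Cg / (4 * \<rho>))\<^sup>2 * L\<^sup>2) + Fb * (s * \<tau>) * L"
      unfolding Z_def L_def \<mu>_def bc[symmetric]
      by (rule solution_energy[OF n Cg \<Omega> \<rho> ball bounded_coercive_adj[OF A(1)] A(2) van sol f Fb])
    have "Z\<^sup>2 = 2 / \<nu> * (\<nu> / 2 * Z\<^sup>2)" using A(2) by simp
    also have "\<dots> \<le> 2 / \<nu> * (2 * M\<^sup>2 / \<nu> * ((Cg / (4 * \<rho>))\<^sup>2 * L\<^sup>2) + Fb * (s * \<tau>) * L)"
      using A(2) by (intro mult_left_mono[OF en]) simp
    also have "2 * M\<^sup>2 / \<nu> * ((Cg / (4 * \<rho>))\<^sup>2 * L\<^sup>2) = M\<^sup>2 * Cg\<^sup>2 / (8 * \<nu>) * ?a\<^sup>2"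
      by (simp add: power_divide power_mult_distrib mult_ac)
    also have "Fb * (s * \<tau>) * L = s * (?a * ?b)" using \<rho> by simp
    also have "2 / \<nu> * (M\<^sup>2 * Cg\<^sup>2 / (8 * \<nu>) * ?a\<^sup>2 + s * (?a * ?b)) \<le> 2 / \<nu> * (M\<^sup>2 * Cg\<^sup>2 / (8 * \<nu>) * (?a + ?b)\<^sup>2 + s * (?a + ?b)\<^sup>2)"
    proof -
      have "?a\<^sup>2 \<le> (?a + ?b)\<^sup>2" using ab by (intro power_mono) auto
      moreover have "?a * ?b \<le> (?a + ?b) * (?a + ?b)" using ab by (intro mult_mono) auto
      ultimately show ?thesis using A(2) s by (intro mult_left_mono add_mono) (auto simp: power2_eq_square)
    qed
    also have "\<dots> = CZ * (?a + ?b)\<^sup>2" unfolding CZ_def by (simp only: distrib_right mult.assoc)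
    also have "\<dots> = (sqrt CZ * (?a + ?b))\<^sup>2" by (simp only: power_mult_distrib real_sqrt_pow2[OF CZ])
    finally show "Z\<^sup>2 \<le> (sqrt CZ * (?a + ?b))\<^sup>2" .
    show "0 \<le> sqrt CZ * (?a + ?b)" using ab CZ by simp
  qed
  let ?X = "L / \<tau> + \<rho>\<^sup>2 * Fb"
  have "\<bar>LINT y|\<mu>. g y \<bullet> u y\<bar> \<le> Fb * (K * (Kc * (20 * \<rho>)\<^sup>2 * N)) + M * (Cg / (2 * \<rho>)) * a1 * Z
      + M * (Cg / (2 * \<rho>)) * (2 * M / \<nu> * (2 * Cg / \<rho>) * a1) * L"
    unfolding \<mu>_def N_def a1_def Z_def L_def
    by (rule duality_estimate[OF n Kc Cg \<Omega> \<rho> ball A K van sol f Fb appr g])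
  also have "Fb * (K * (Kc * (20 * \<rho>)\<^sup>2 * N)) \<le> 400 * K * Kc * (?X * N)"
  proof -
    have "Fb * (K * (Kc * (20 * \<rho>)\<^sup>2 * N)) = 400 * K * Kc * ((\<rho>\<^sup>2 * Fb) * N)" by (simp add: power_mult_distrib)
    also have "\<dots> \<le> 400 * K * Kc * (?X * N)"
      using K Kc L \<tau> N by (intro mult_left_mono mult_right_mono) (auto simp: riesz_ball_bound_def)
    finally show ?thesis .
  qed
  also have "M * (Cg / (2 * \<rho>)) * a1 * Z \<le> M * Cg / 2 * (K * k2 * s) * (sqrt CZ * (?X * N))"
  proof -
    have "M * (Cg / (2 * \<rho>)) * a1 * Z \<le> M * (Cg / (2 * \<rho>)) * a1 * (sqrt CZ * (L / \<rho> + \<rho> * \<tau> * Fb))"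
      using M Cg0 \<rho> a10 by (intro mult_left_mono[OF Zle]) simp
    also have "\<dots> = M * Cg / 2 * (K * k2 * s) * (sqrt CZ * ((\<rho> / \<tau> * (L / \<rho> + \<rho> * \<tau> * Fb)) * N))"
      unfolding a1 using \<rho> \<tau> by (simp add: power2_eq_square)
    also have "\<rho> / \<tau> * (L / \<rho> + \<rho> * \<tau> * Fb) = ?X" using \<rho> \<tau> by (simp add: distrib_left power2_eq_square)
    finally show ?thesis .
  qed
  also have "M * (Cg / (2 * \<rho>)) * (2 * M / \<nu> * (2 * Cg / \<rho>) * a1) * L \<le> M * Cg / 2 * (K * k2 * s) * (4 * M * Cg / \<nu> * (?X * N))"
  proof -
    have "M * (Cg / (2 * \<rho>)) * (2 * M / \<nu> * (2 * Cg / \<rho>) * a1) * L = M * Cg / 2 * (K * k2 * s) * (4 * M * Cg / \<nu> * (L / \<tau> * N))"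
      unfolding a1 using \<rho> by (simp add: power2_eq_square field_simps)
    also have "\<dots> \<le> M * Cg / 2 * (K * k2 * s) * (4 * M * Cg / \<nu> * (?X * N))"
      using M Cg0 K s A(2) Fb(2) N by (intro mult_left_mono mult_right_mono) (auto simp: k2_def)
    finally show ?thesis .
  qed
  also have "400 * K * Kc * (?X * N) + M * Cg / 2 * (K * k2 * s) * (sqrt CZ * (?X * N))
      + M * Cg / 2 * (K * k2 * s) * (4 * M * Cg / \<nu> * (?X * N)) = bound_const TYPE('n) Kc Cg \<nu> M K * (?X * N)"
  proof -
    have "a * y + w * (b * y) + w * (c * y) = (a + w * (b + c)) * y" for a b c w y :: real by (simp add: algebra_simps)
    then show ?thesis unfolding bound_const_def s_def[symmetric] k2_def[symmetric] CZ_def[symmetric] .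
  qed
  finally have "\<bar>LINT y|\<mu>. g y \<bullet> u y\<bar> \<le> bound_const TYPE('n) Kc Cg \<nu> M K * (?X * N)"
    by simp
  moreover have "\<rho> powr (- real CARD('n) / 2) * L = L / \<tau>"
    using powr_minus_divide[of \<rho> "real CARD('n) / 2"] by (simp add: \<tau>_def)
  ultimately show ?thesis unfolding \<mu>_def N_def L_def by (simp add: mult.assoc)
qed

text \<open>With \<open>\<rho> = R/20\<close> the balls of radius \<open>10\<rho>\<close> about points of the half ball stay in \<open>ball x R\<close>, as the
  duality estimate requires. It bounds \<open>u\<close> almost everywhere in the small ball \<open>ball q (\<rho>/2)\<close>;
  the exceptional sets of countably many centres \<open>q\<close>, dense in the half ball, are collected.\<close>

lemma local_bound:
  fixes A :: "('n::finite, 'm::finite) coeff" and u f :: "real^'n \<Rightarrow> real^'m"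
  assumes n: "CARD('n) \<ge> 3" and Kc: "riesz_ball_bound TYPE('n) Kc" and Cg: "cutoff_grad_bound TYPE('n) Cg"
    and \<Omega>: "open \<Omega>" and x: "x \<in> \<Omega>" and R: "R > 0" and A: "bounded_coercive \<nu> M A" "\<nu> > 0" and K: "K \<ge> 0"
    and appr: "\<And>p. approx_solvable A \<Omega> p (R / 2) K"
    and f: "f \<in> Linf (\<Omega> \<inter> ball x R)"
    and sol: "weak_solution (adj_coeff A) (\<Omega> \<inter> ball x R) u f"
    and van: "vanishes_on_vec (\<Omega> \<inter> ball x R) (frontier \<Omega> \<inter> ball x R) u"
    and N0: "N0 = bound_const TYPE('n) Kc Cg \<nu> M K * 20 powr (real CARD('n) / 2) + 1"
  shows "Linf_norm (\<Omega> \<inter> ball x (R / 2)) u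
            \<le> ereal N0 * (ereal (R powr (- real CARD('n) / 2) * Lp_norm 2 (\<Omega> \<inter> ball x R) u)
                          + ereal (R\<^sup>2) * Linf_norm (\<Omega> \<inter> ball x R) f)"
proof -
  define U where "U = \<Omega> \<inter> ball x R"
  define S where "S = \<Omega> \<inter> ball x (R / 2)"
  define \<rho> where "\<rho> = R / 20"
  have \<rho>: "\<rho> > 0" "R / 2 = 10 * \<rho>" using R by (simp_all add: \<rho>_def)
  have U: "open U" "x \<in> U" "U \<in> sets lebesgue" unfolding U_def using \<Omega> x R by auto
  have S: "S \<in> sets lebesgue" "S \<subseteq> U" unfolding S_def U_def using \<Omega> R by auto
  have M: "M > 0" using bounded_coercive_constants[OF A(1)] A(2) by simp
  let ?\<mu> = "lebesgue_on U" and ?b = "bound_const TYPE('n) Kc Cg \<nu> M K"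
  have b: "?b \<ge> 0" by (rule bound_const_nonneg[OF Kc Cg A(2) M K])
  have fm: "f \<in> borel_measurable ?\<mu>" and fin: "Linf_norm U f < \<infinity>" using f by (auto simp: Linf_def U_def)
  have AEf: "AE y in ?\<mu>. ereal (norm (f y)) \<le> Linf_norm U f"
    unfolding Linf_norm_def using fm by (intro esssup_AE)
  \<comment> \<open>The essential supremum over a null set is \<open>-\<infinity>\<close>; the open set \<open>U\<close> contains \<open>x\<close>, hence is not null.\<close>
  have "\<not> Linf_norm U f < 0"
  proof
    assume "Linf_norm U f < 0"
    then have "AE y in ?\<mu>. False" using AEf
      by (auto elim!: eventually_mono) (metis ereal_less_eq(5) leD norm_ge_zero order_trans)
    then have "AE y in lebesgue. y \<notin> U" using U(3) by (subst (asm) AE_restrict_space_iff) auto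
    then have "U \<in> null_sets lebesgue" using U(3) by (subst (asm) AE_iff_null_sets[symmetric]) auto
    then have "negligible U" by (simp add: negligible_iff_null_sets)
    then show False using open_not_negligible[OF U(1)] U(2) by blast
  qed
  then obtain Fb where Fb: "Linf_norm U f = ereal Fb" "Fb \<ge> 0" using fin by (cases "Linf_norm U f") auto
  have AEf': "AE y in ?\<mu>. norm (f y) \<le> Fb" using AEf unfolding Fb(1) by simp
  have cb: "cball x 0 \<subseteq> ball x R" using R by auto
  \<comment> \<open>Square integrability of \<open>u\<close> is a by-product of approximability, here read off with the cutoff
    function zero.\<close>
  have su: "sqint ?\<mu> u"
    using cutoff_test_sequence(1)[OF n \<Omega> cb van, of "\<lambda>_. 0" 0] unfolding U_def
    by (simp add: smooth_on_const grad_def pderiv_zero zero_vec_def[symmetric])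
  define L where "L = l2 ?\<mu> u"
  have L: "L \<ge> 0" by (simp add: L_def l2_nonneg)
  define B where "B = ?b * (\<rho> powr (- real CARD('n) / 2) * L + \<rho>\<^sup>2 * Fb)"
  have B: "B \<ge> 0" unfolding B_def using b L Fb(2) by simp
  have loc: "AE y in ?\<mu>. y \<in> \<Omega> \<inter> ball q (\<rho> / 2) \<longrightarrow> norm (u y) \<le> B" if q: "q \<in> ball x (R / 2)" for q
  proof (rule AE_bound_by_duality[OF U(3) _ _ _ su B])
    have sub: "ball q (10 * \<rho>) \<subseteq> ball x R"
    proof
      fix y assume "y \<in> ball q (10 * \<rho>)"
      then have "dist q y < R / 2" "dist x q < R / 2" using q \<rho> by auto
      then show "y \<in> ball x R" using dist_triangle[of x y q] by simp
    qed
    show "\<Omega> \<inter> ball q (\<rho> / 2) \<in> sets lebesgue" using \<Omega> by auto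
    have "ball q (\<rho> / 2) \<subseteq> ball q (10 * \<rho>)" using \<rho> by auto
    then show "\<Omega> \<inter> ball q (\<rho> / 2) \<subseteq> U" using sub unfolding U_def by blast
    show "\<Omega> \<inter> ball q (\<rho> / 2) \<subseteq> ball q (\<rho> / 2)" by simp
    fix g :: "real^'n \<Rightarrow> real^'m" assume g: "bounded_supported (\<Omega> \<inter> ball q (\<rho> / 2)) g"
    show "\<bar>LINT y|?\<mu>. g y \<bullet> u y\<bar> \<le> B * (LINT y|lebesgue. norm (g y))"
      unfolding B_def L_def U_def
      by (rule duality_estimate_scaled[OF n Kc Cg \<Omega> \<rho>(1) sub A K van sol fm[unfolded U_def] AEf'[unfolded U_def] Fb(2) appr[of q, unfolded \<rho>(2)] g])
  qed
  obtain D :: "(real^'n) set" where D: "countable D" "\<And>X. open X \<Longrightarrow> X \<noteq> {} \<Longrightarrow> \<exists>d\<in>D. d \<in> X"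
    using countable_dense_exists[where 'a = "real^'n"] by (metis ex_in_conv)
  have "AE y in ?\<mu>. \<forall>q\<in>D \<inter> ball x (R / 2). y \<in> \<Omega> \<inter> ball q (\<rho> / 2) \<longrightarrow> norm (u y) \<le> B"
    using loc D(1) by (subst AE_ball_countable) auto
  then have "AE y in lebesgue. y \<in> U \<longrightarrow> (\<forall>q\<in>D \<inter> ball x (R / 2). y \<in> \<Omega> \<inter> ball q (\<rho> / 2) \<longrightarrow> norm (u y) \<le> B)"
    using U(3) by (subst (asm) AE_restrict_space_iff) auto
  then have "AE y in lebesgue. y \<in> S \<longrightarrow> ereal (norm (u y)) \<le> ereal B"
  proof eventually_elim
    case (elim y)
    show ?case
    proof
      assume y: "y \<in> S"
      have "y \<in> ball x (R / 2) \<inter> ball y (\<rho> / 2)" using y \<rho>(1) by (simp add: S_def)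
      then have "ball x (R / 2) \<inter> ball y (\<rho> / 2) \<noteq> {}" by blast
      from D(2)[OF open_Int[OF open_ball open_ball] this]
      obtain q where q: "q \<in> D" "q \<in> ball x (R / 2) \<inter> ball y (\<rho> / 2)" by blast
      have "y \<in> \<Omega> \<inter> ball q (\<rho> / 2)" using q(2) y by (simp add: S_def dist_commute)
      moreover have "y \<in> U" "q \<in> D \<inter> ball x (R / 2)" using y S(2) q by blast+
      ultimately have "norm (u y) \<le> B" using elim by blast
      then show "ereal (norm (u y)) \<le> ereal B" by simp
    qed
  qed
  then have AEu: "AE y in lebesgue_on S. ereal (norm (u y)) \<le> ereal B"
    using S(1) by (subst AE_restrict_space_iff) auto
  have "u \<in> borel_measurable (lebesgue_on S)" using su S(2) measurable_restrict_mono by (auto simp: sqint_def)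
  then have "Linf_norm S u \<le> ereal B" unfolding Linf_norm_def using AEu by (intro esssup_I) auto
  also have "B \<le> N0 * (R powr (- real CARD('n) / 2) * L + R\<^sup>2 * Fb)"
  proof -
    let ?k = "20 powr (real CARD('n) / 2)" and ?r = "R powr (- real CARD('n) / 2)"
    have k: "?k \<ge> 1" by (intro ge_one_powr_ge_zero) auto
    have "\<rho> powr (- real CARD('n) / 2) = ?r / 20 powr (- real CARD('n) / 2)"
      unfolding \<rho>_def using R by (simp add: powr_divide)
    also have "\<dots> = ?k * ?r" using powr_minus_divide[of 20 "real CARD('n) / 2"] by simp
    finally have 1: "\<rho> powr (- real CARD('n) / 2) * L = ?k * (?r * L)" by simp
    have "\<rho>\<^sup>2 \<le> R\<^sup>2" using R unfolding \<rho>_def by (intro power_mono) auto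
    then have "\<rho>\<^sup>2 * Fb \<le> 1 * (R\<^sup>2 * Fb)" using Fb(2) by (simp add: mult_right_mono)
    also have "\<dots> \<le> ?k * (R\<^sup>2 * Fb)" using k Fb(2) by (intro mult_right_mono) auto
    finally have "B \<le> ?b * (?k * (?r * L + R\<^sup>2 * Fb))"
      unfolding B_def 1 using b by (intro mult_left_mono) (auto simp: distrib_left)
    also have "\<dots> \<le> N0 * (?r * L + R\<^sup>2 * Fb)"
      unfolding N0 using L Fb(2) by (simp add: algebra_simps)
    finally show ?thesis .
  qed
  finally have "Linf_norm S u \<le> ereal (N0 * (R powr (- real CARD('n) / 2) * L + R\<^sup>2 * Fb))" by simp
  then show ?thesis
    unfolding S_def[symmetric] U_def[symmetric] Fb(1) Lp_norm_2 L_def by simp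
qed

theorem theorem3p9:
  fixes \<nu> C0 :: real
  assumes "CARD('n::finite) \<ge> 3" and "0 < \<nu>" and "\<nu> \<le> 1"
  shows "\<exists>N0>0. \<forall>(A :: ('n, 'm::finite) coeff) \<Omega> \<mu>0 Rc N1 G Rmax.
           open \<Omega> \<longrightarrow> connected \<Omega> \<longrightarrow> \<Omega> \<noteq> {} \<longrightarrow>
           elliptic_coeff \<nu> A \<longrightarrow>
           0 < \<mu>0 \<longrightarrow> \<mu>0 \<le> 1 \<longrightarrow> 0 < Rc \<longrightarrow> 0 < N1 \<longrightarrow>
           interior_hoelder A \<Omega> \<mu>0 Rc N1 \<longrightarrow>
           is_green_matrix A \<Omega> G \<longrightarrow>
           0 < Rmax \<longrightarrow> green_bound \<Omega> G Rmax C0 \<longrightarrow>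
           local_boundedness A \<Omega> Rmax N0"
proof -
  obtain Kc where "Kc > 0" "\<And>(x::real^'n) r. CARD('n) \<ge> 3 \<Longrightarrow> r > 0 \<Longrightarrow>
       (\<integral>\<^sup>+y. ennreal (riesz x y * indicator (ball x r) y) \<partial>lebesgue) \<le> ennreal (Kc * r\<^sup>2)"
    by (rule riesz_ball_integral) blast
  then have Kc: "riesz_ball_bound TYPE('n) Kc" using assms(1) by (simp add: riesz_ball_bound_def)
  obtain Cg where "Cg > 0" "\<And>(p::real^'n) r x. r > 0 \<Longrightarrow> norm (grad (cutoff p r) x) \<le> Cg / r"
    by (rule cutoff_gradient_bound) blast
  then have Cg: "cutoff_grad_bound TYPE('n) Cg" by (simp add: cutoff_grad_bound_def)
  define M where "M = (real CARD('n))\<^sup>2 * (real CARD('m))\<^sup>2 / \<nu>"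
  \<comment> \<open>\<open>C0\<close> may be negative.\<close>
  define C where "C = max C0 0"
  define K where "K = (real CARD('m))\<^sup>2 * C"
  have C: "C \<ge> C0" "C \<ge> 0" and K: "K \<ge> 0" by (auto simp: C_def K_def)
  have M: "M > 0" using assms(2) by (simp add: M_def)
  define N0 where "N0 = bound_const TYPE('n) Kc Cg \<nu> M K * 20 powr (real CARD('n) / 2) + 1"
  have "N0 > 0" using bound_const_nonneg[OF Kc Cg assms(2) M K] by (simp add: N0_def add_nonneg_pos)
  moreover have "local_boundedness A \<Omega> Rmax N0"
    if \<Omega>: "open \<Omega>" and ell0: "elliptic_coeff \<nu> A" and G: "is_green_matrix A \<Omega> G" and bd: "green_bound \<Omega> G Rmax C0"
    for A :: "('n, 'm) coeff" and \<Omega> G Rmax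
  proof -
    have A: "bounded_coercive \<nu> M A" unfolding M_def by (rule elliptic_imp_bounded_coercive[OF ell0 assms(2)])
    note A' = bounded_coercive_adj[OF A]
    show ?thesis unfolding local_boundedness_def
    proof (intro ballI allI impI)
      fix x R f u
      assume x: "x \<in> \<Omega>" and R: "0 < R \<and> ereal R < Rmax" and f: "f \<in> Linf (\<Omega> \<inter> ball x R)"
        and u: "(weak_solution A (\<Omega> \<inter> ball x R) u f \<or> weak_solution (adj_coeff A) (\<Omega> \<inter> ball x R) u f) \<and>
          vanishes_on_vec (\<Omega> \<inter> ball x R) (frontier \<Omega> \<inter> ball x R) u"
      have R2: "R / 2 > 0" "ereal (2 * (R / 2)) \<le> Rmax" using R by (auto intro: less_imp_le)
      have s1: "approx_solvable (adj_coeff A) \<Omega> p (R / 2) K" for p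
        unfolding K_def by (rule approx_solvable_green[OF assms(1) Kc R2 \<Omega> A assms(2) G bd C])
      have s2: "approx_solvable A \<Omega> p (R / 2) K" for p
        using approx_solvable_adj[OF Kc R2(1) A' assms(2) K s1] unfolding adj_adj .
      show "Linf_norm (\<Omega> \<inter> ball x (R / 2)) u
            \<le> ereal N0 * (ereal (R powr (- real CARD('n) / 2) * Lp_norm 2 (\<Omega> \<inter> ball x R) u)
                          + ereal (R\<^sup>2) * Linf_norm (\<Omega> \<inter> ball x R) f)"
      proof (cases "weak_solution (adj_coeff A) (\<Omega> \<inter> ball x R) u f")
        case True
        show ?thesis
          by (rule local_bound[OF assms(1) Kc Cg \<Omega> x _ A assms(2) K s2 f True _ N0_def]) (use R u in auto)
      next
        case False
        then have w: "weak_solution (adj_coeff (adj_coeff A)) (\<Omega> \<inter> ball x R) u f" using u by (simp add: adj_adj)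
        show ?thesis
          by (rule local_bound[OF assms(1) Kc Cg \<Omega> x _ A' assms(2) K s1 f w _ N0_def]) (use R u in auto)
      qed
    qed
  qed
  ultimately show ?thesis by blast
qed

end
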